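(* Let $n\geq 2$ be an integer and let $\mathbb S^n\subset\mathbb R^{n+1}$ be the unit sphere. There exist a compact set $Y\subset\mathbb R^{n+1}$ and a point $p\in Y\cap\mathbb S^n$ such that: (i) $Y$ is homeomorphic to $\mathbb S^n$; (ii) $Y\setminus\{p\}$ is a smooth manifold diffeomorphic to $\mathbb S^n\setminus\{p\}$; in fact there is a Lipschitz continuous homeomorphism $\Phi:Y\to\mathbb S^n$ whose restriction $\Phi:Y\setminus\{p\}\to\mathbb S^n\setminus\{p\}$ is a smooth diffeomorphism; (iii) $\pi_k^{\mathrm{Lip}}(Y,y_0)=0$ for all $k\geq 1$ and every choice of base point $y_0\in Y$; (iv) the Lipschitz mappings $\mathrm{Lip}(\mathbb S^n,Y)$ are not dense in $W^{1,n}(\mathbb S^n,Y)$.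
   Context: For a pointed metric space $(Y,y_0)$, the Lipschitz homotopy group $\pi_k^{\mathrm{Lip}}(Y,y_0)$ is defined exactly as the classical homotopy group $\pi_k(Y,y_0)$ (homotopy classes of maps $(Q^k,\partial Q^k)\to(Y,y_0)$, $Q^k=[0,1]^k$), except that both the maps and the homotopies are required to be Lipschitz (no bound on the Lipschitz constant of the homotopy in terms of those of the maps is required). For a compact set $Y\subset\mathbb R^{n+1}$, $W^{1,n}(\mathbb S^n,Y)=\{u\in W^{1,n}(\mathbb S^n,\mathbb R^{n+1}): u(x)\in Y \text{ for a.e. } x\}$ with the metric induced by the $W^{1,n}(\mathbb S^n,\mathbb R^{n+1})$ norm; density is with respect to this metric. *)

theory Defs
  imports "HOL-Analysis.Analysis"
begin

fun iter_dd :: "'a::real_normed_vector list \<Rightarrow> ('a \<Rightarrow> 'b::real_normed_vector) \<Rightarrow> 'a \<Rightarrow> 'b" where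
  "iter_dd [] f = f"
| "iter_dd (v # vs) f = (\<lambda>x. frechet_derivative (iter_dd vs f) (at x) v)"

definition smooth_open :: "'a::real_normed_vector set \<Rightarrow> ('a \<Rightarrow> 'b::real_normed_vector) \<Rightarrow> bool" where
  "smooth_open U f \<longleftrightarrow> open U \<and> (\<forall>vs. iter_dd vs f differentiable_on U)"

definition smooth_on_set :: "'a::real_normed_vector set \<Rightarrow> ('a \<Rightarrow> 'b::real_normed_vector) \<Rightarrow> bool" where
  "smooth_on_set S f \<longleftrightarrow> (\<forall>x\<in>S. \<exists>U g. x \<in> U \<and> smooth_open U g \<and> (\<forall>y\<in>U \<inter> S. g y = f y))"

definition diffeomorphism_sets :: "'a::real_normed_vector set \<Rightarrow> 'b::real_normed_vector set \<Rightarrow> ('a \<Rightarrow> 'b) \<Rightarrow> bool" where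
  "diffeomorphism_sets S T f \<longleftrightarrow>
     (\<exists>g. homeomorphism S T f g \<and> smooth_on_set S f \<and> smooth_on_set T g)"

definition test_fun :: "'a::euclidean_space set \<Rightarrow> ('a \<Rightarrow> real) \<Rightarrow> bool" where
  "test_fun \<Omega> \<phi> \<longleftrightarrow> smooth_open UNIV \<phi> \<and> compact (closure {x. \<phi> x \<noteq> 0})
      \<and> closure {x. \<phi> x \<noteq> 0} \<subseteq> \<Omega>"

definition Lp_space :: "'a::euclidean_space set \<Rightarrow> real \<Rightarrow> ('a \<Rightarrow> 'b::euclidean_space) set" where
  "Lp_space \<Omega> p = {u. set_borel_measurable lebesgue \<Omega> u
      \<and> set_integrable lebesgue \<Omega> (\<lambda>x. norm (u x) powr p)}"

definition Lp_norm :: "'a::euclidean_space set \<Rightarrow> real \<Rightarrow> ('a \<Rightarrow> 'b::euclidean_space) \<Rightarrow> real" where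
  "Lp_norm \<Omega> p u = (LINT x:\<Omega>|lebesgue. norm (u x) powr p) powr (1 / p)"

definition weak_partial :: "'a::euclidean_space set \<Rightarrow> 'a \<Rightarrow> ('a \<Rightarrow> 'b::euclidean_space) \<Rightarrow> ('a \<Rightarrow> 'b) \<Rightarrow> bool" where
  "weak_partial \<Omega> i u g \<longleftrightarrow> (\<forall>\<phi>. test_fun \<Omega> \<phi> \<longrightarrow>
      set_lebesgue_integral lebesgue \<Omega> (\<lambda>x. frechet_derivative \<phi> (at x) i *\<^sub>R u x)
      = - set_lebesgue_integral lebesgue \<Omega> (\<lambda>x. \<phi> x *\<^sub>R g x))"

definition W1p :: "'a::euclidean_space set \<Rightarrow> real \<Rightarrow> ('a \<Rightarrow> 'b::euclidean_space) set" where
  "W1p \<Omega> p = {u. u \<in> Lp_space \<Omega> p \<and>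
      (\<forall>i\<in>Basis. \<exists>g. g \<in> Lp_space \<Omega> p \<and> weak_partial \<Omega> i u g)}"

definition W1p_norm :: "'a::euclidean_space set \<Rightarrow> real \<Rightarrow> ('a \<Rightarrow> 'b::euclidean_space) \<Rightarrow> real" where
  "W1p_norm \<Omega> p u = Lp_norm \<Omega> p u +
      (\<Sum>i\<in>Basis. Lp_norm \<Omega> p (SOME g. g \<in> Lp_space \<Omega> p \<and> weak_partial \<Omega> i u g))"

definition annulus :: "'a::euclidean_space set" where
  "annulus = {x. 1/2 < norm x \<and> norm x < 2}"

definition radial_ext :: "('a::euclidean_space \<Rightarrow> 'b) \<Rightarrow> 'a \<Rightarrow> 'b" where
  "radial_ext u x = u (x /\<^sub>R norm x)"

definition sph_dim :: "'a::euclidean_space itself \<Rightarrow> nat" where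
  "sph_dim _ = DIM('a) - 1"

definition W1n_sphere :: "('a::euclidean_space \<Rightarrow> 'a) set" where
  "W1n_sphere = {u. radial_ext u \<in> W1p (annulus::'a set) (real (sph_dim TYPE('a)))}"

definition W1n_sphere_dist :: "('a::euclidean_space \<Rightarrow> 'a) \<Rightarrow> ('a \<Rightarrow> 'a) \<Rightarrow> real" where
  "W1n_sphere_dist u v = W1p_norm (annulus::'a set) (real (sph_dim TYPE('a)))
       (\<lambda>x. radial_ext u x - radial_ext v x)"

text \<open>W^{1,n}(S^n, Y): Sobolev maps with values in Y almost everywhere on the sphere
  (equivalently, the radial extension takes values in Y a.e. on the annulus).\<close>
definition W1n_sphere_into :: "'a::euclidean_space set \<Rightarrow> ('a \<Rightarrow> 'a) set" where
  "W1n_sphere_into Y = {u. u \<in> W1n_sphere \<and>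
       (AE x in lebesgue. x \<in> (annulus::'a set) \<longrightarrow> radial_ext u x \<in> Y)}"

definition cube :: "nat \<Rightarrow> (nat \<Rightarrow> real) set" where
  "cube k = {x. (\<forall>i<k. 0 \<le> x i \<and> x i \<le> 1) \<and> (\<forall>i\<ge>k. x i = 0)}"

definition cube_boundary :: "nat \<Rightarrow> (nat \<Rightarrow> real) set" where
  "cube_boundary k = {x \<in> cube k. \<exists>i<k. x i = 0 \<or> x i = 1}"

definition edist :: "nat \<Rightarrow> (nat \<Rightarrow> real) \<Rightarrow> (nat \<Rightarrow> real) \<Rightarrow> real" where
  "edist k x y = sqrt (\<Sum>i<k. (x i - y i)\<^sup>2)"

definition lip_cube :: "nat \<Rightarrow> 'a::metric_space set \<Rightarrow> ((nat \<Rightarrow> real) \<Rightarrow> 'a) \<Rightarrow> bool" where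
  "lip_cube k Y f \<longleftrightarrow> (\<forall>x\<in>cube k. f x \<in> Y) \<and>
     (\<exists>L. \<forall>x\<in>cube k. \<forall>y\<in>cube k. dist (f x) (f y) \<le> L * edist k x y)"

text \<open>pi_k^Lip(Y,y0) = 0: every Lipschitz map (Q^k, dQ^k) \<rightarrow> (Y,y0) is Lipschitz homotopic,
  relative to dQ^k, to the constant map. The homotopy is a Lipschitz map on
  Q^(k+1) = Q^k \<times> [0,1], the coordinate k being the time.\<close>
definition lip_pi_trivial :: "nat \<Rightarrow> 'a::metric_space set \<Rightarrow> 'a \<Rightarrow> bool" where
  "lip_pi_trivial k Y y0 \<longleftrightarrow>
     (\<forall>f. lip_cube k Y f \<and> (\<forall>x\<in>cube_boundary k. f x = y0) \<longrightarrow>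
        (\<exists>H. lip_cube (Suc k) Y H \<and>
             (\<forall>x\<in>cube k. H x = f x) \<and>
             (\<forall>x\<in>cube k. H (x(k := 1)) = y0) \<and>
             (\<forall>x\<in>cube_boundary k. \<forall>t\<in>{0..1}. H (x(k := t)) = y0)))"

end

theory Submission
  imports Defs
begin

text \<open>Let \<open>Y\<close> be the unit sphere radially perturbed by the factor \<open>1 + sin L / L\<close>, where
  \<open>L = - ln ((1 - cos \<theta>) / 8)\<close> and \<open>\<theta>\<close> is the angle to \<open>p\<close>. The sum of the oscillations of
  \<open>sin L / L\<close> diverges as \<open>L\<close> tends to infinity, so no rectifiable curve in \<open>Y\<close> reaches \<open>p\<close> from
  outside. A nonconstant Lipschitz map from a cube or a sphere into \<open>Y\<close> thus avoids \<open>p\<close> by a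
  definite distance, and is contracted within the contractible manifold \<open>Y - {p}\<close> through
  stereographic coordinates. On the other hand the radial projection of the sphere onto \<open>Y\<close> has
  derivative of order \<open>1 / (\<theta> L)\<close>, whose \<open>n\<close>-th power is integrable for \<open>n \<ge> 2\<close>. It has nonzero
  degree against an \<open>n\<close>-form supported away from \<open>p\<close>, while a Lipschitz map into \<open>Y\<close>, not being
  surjective, has degree zero; the degree integral is continuous in the \<open>W\<^sup>1\<^sup>,\<^sup>n\<close> topology.\<close>

section \<open>The integral of the Jacobian of a compactly supported map\<close>

text \<open>The logarithm is the scale on which two requirements just fit. Passing the extrema of
  \<open>sin L / L\<close> costs length of order 1/L for L spaced by pi, a harmonic series, whereas
  the energy density (1/(theta L))^n theta^(n-1) d theta is comparable to dL/L^n, whose integral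
  converges once n > 1. The obstacle on the other side is that a Lipschitz map into Y need not be
  smooth and that its mollifications leave Y. The n-form is therefore taken on the whole complement
  of the ray from the origin through p, where it is exact and does not see radial changes; a
  mollification only has to keep off that ray. Sobolev maps on the sphere are handled through radial
  extensions to an annulus, so the form is wedged with the differential of a radial step. The degree
  becomes the integral of a Jacobian determinant over space, which vanishes for compactly supported
  maps. The scale of mollification depends on the map, so derivatives are compared only through
  integrals of n-th powers, which is what a form of degree n in the derivative can bear.\<close>

typedef (overloaded) ('a::euclidean_space) bidx = "{..<DIM('a)}"
  by (metis DIM_positive lessThan_iff mem_Collect_eq)

instance bidx :: (euclidean_space) finite
proof
  have "finite (Rep_bidx ` (UNIV::'a bidx set))"
    by (metis finite_lessThan type_definition.Rep_range type_definition_bidx)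
  then show "finite (UNIV::'a bidx set)"
    by (metis Rep_bidx_inject finite_imageD injI)
qed

text \<open>The change of variables \<open>has_measure_differentiable_image\<close> is applied on
  \<open>real ^ 'n\<close> with \<open>'n\<close> finite and well-ordered; the order inherited from
  the natural numbers makes \<open>'a bidx\<close> such an index type.\<close>

instantiation bidx :: (euclidean_space) wellorder
begin
definition less_eq_bidx :: "'a bidx \<Rightarrow> 'a bidx \<Rightarrow> bool" where
  "less_eq_bidx i j \<longleftrightarrow> Rep_bidx i \<le> Rep_bidx j"
definition less_bidx :: "'a bidx \<Rightarrow> 'a bidx \<Rightarrow> bool" where
  "less_bidx i j \<longleftrightarrow> Rep_bidx i < Rep_bidx j"
instance
proof
  fix P :: "'a bidx \<Rightarrow> bool" and a
  assume *: "\<And>x. (\<And>y. y < x \<Longrightarrow> P y) \<Longrightarrow> P x"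
  show "P a"
    by (induction a rule: measure_induct[of Rep_bidx]) (use * in \<open>auto simp: less_bidx_def\<close>)
qed (auto simp: less_eq_bidx_def less_bidx_def Rep_bidx_inject)
end

lemma card_bidx: "CARD('a::euclidean_space bidx) = DIM('a)"
  using type_definition.card[OF type_definition_bidx] by simp

section \<open>Orthonormal coordinates on a Euclidean space\<close>

definition bvec :: "'a::euclidean_space bidx \<Rightarrow> 'a" where
  "bvec = (SOME f. bij_betw f UNIV Basis)"

lemma bij_bvec: "bij_betw (bvec :: 'a::euclidean_space bidx \<Rightarrow> 'a) UNIV Basis"
proof -
  have "\<exists>f :: 'a bidx \<Rightarrow> 'a. bij_betw f UNIV Basis"
    by (rule finite_same_card_bij) (auto simp: card_bidx)
  then show ?thesis unfolding bvec_def by (rule someI_ex)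
qed

lemma bvec_in_Basis [simp]: "bvec i \<in> Basis"
  using bij_bvec by (auto simp: bij_betw_def)

lemma ball_Basis_bvec: "(\<forall>b\<in>Basis. P b) \<longleftrightarrow> (\<forall>i. P (bvec i))"
  using bij_betw_imp_surj_on[OF bij_bvec] by (metis bvec_in_Basis imageE)

lemma bvec_inject [simp]: "bvec i = bvec j \<longleftrightarrow> i = j"
  using bij_bvec by (auto simp: bij_betw_def inj_def)

lemma inner_bvec: "bvec i \<bullet> bvec j = (if i = j then 1 else 0)"
  by (simp add: inner_Basis)

lemma sum_bvec: "(\<Sum>i\<in>UNIV. f (bvec i)) = sum f Basis"
  by (rule sum.reindex_bij_betw[OF bij_bvec])

lemma prod_bvec: "(\<Prod>i\<in>UNIV. f (bvec i)) = prod f Basis"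
  by (rule prod.reindex_bij_betw[OF bij_bvec])

definition coordv :: "'a::euclidean_space \<Rightarrow> real ^ 'a bidx" where
  "coordv x = (\<chi> i. x \<bullet> bvec i)"

definition uncoordv :: "real ^ 'a bidx \<Rightarrow> 'a::euclidean_space" where
  "uncoordv v = (\<Sum>i\<in>UNIV. v $ i *\<^sub>R bvec i)"

lemma uncoordv_inner: "uncoordv v \<bullet> bvec i = v $ i"
proof -
  have "uncoordv v \<bullet> bvec i = (\<Sum>j\<in>UNIV. v $ j * (if j = i then 1 else 0))"
    by (simp add: uncoordv_def inner_sum_left inner_bvec)
  also have "\<dots> = (\<Sum>j\<in>UNIV. if j = i then v $ j else 0)"
    by (intro sum.cong) auto
  finally show ?thesis by simp
qed

lemma coordv_uncoordv [simp]: "coordv (uncoordv v) = v"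
  by (simp add: coordv_def uncoordv_inner vec_eq_iff)

lemma uncoordv_coordv [simp]: "uncoordv (coordv x) = x"
  by (simp add: uncoordv_def coordv_def sum_bvec[of "\<lambda>b. (x \<bullet> b) *\<^sub>R b"] euclidean_representation)

lemma linear_coordv: "linear coordv"
  by (auto intro!: linearI simp: coordv_def vec_eq_iff inner_add_left)

lemma linear_uncoordv: "linear uncoordv"
  by (auto intro!: linearI simp: uncoordv_def sum.distrib scaleR_add_left scaleR_sum_right)

lemma norm_coordv [simp]: "norm (coordv x) = norm x"
proof -
  have "(norm (coordv x))\<^sup>2 = (\<Sum>i\<in>UNIV. (x \<bullet> bvec i)\<^sup>2)"
    by (simp add: norm_vec_def L2_set_def sum_nonneg coordv_def)
  also have "\<dots> = (norm x)\<^sup>2"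
    using sum_bvec[of "\<lambda>b. (x \<bullet> b)\<^sup>2"] by (simp add: power2_norm_eq_inner euclidean_inner[of x x]) (simp add: power2_eq_square)
  finally show ?thesis by simp
qed

lemma norm_uncoordv [simp]: "norm (uncoordv v) = norm v"
  by (metis coordv_uncoordv norm_coordv)

text \<open>Boxes pull back to boxes with the same side lengths, and the measure of boxes determines
  Lebesgue measure.\<close>

lemma lborel_distr_coordv: "distr lborel borel coordv = (lborel :: (real ^ 'a::euclidean_space bidx) measure)"
proof (rule lborel_eqI[symmetric])
  have m: "coordv \<in> borel_measurable borel"
    by (intro borel_measurable_continuous_onI linear_continuous_on linear_coordv linear_conv_bounded_linear[THEN iffD1])
  fix l u :: "real ^ 'a bidx"
  assume le: "\<And>b. b \<in> Basis \<Longrightarrow> l \<bullet> b \<le> u \<bullet> b"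
  have ax: "l $ i \<le> u $ i" for i using le[of "axis i 1"] by (simp add: inner_axis)
  have v: "coordv -` box l u = box (uncoordv l) (uncoordv u :: 'a)" (is "?A = ?B")
  proof (rule set_eqI)
    fix x :: 'a
    have "x \<in> ?B \<longleftrightarrow> (\<forall>i. uncoordv l \<bullet> bvec i < x \<bullet> bvec i \<and> x \<bullet> bvec i < uncoordv u \<bullet> bvec i)"
      by (simp add: mem_box ball_Basis_bvec)
    then show "x \<in> ?A \<longleftrightarrow> x \<in> ?B"
      by (simp add: uncoordv_inner mem_box_cart coordv_def)
  qed
  have "emeasure (distr lborel borel coordv) (box l u) = emeasure lborel ?A"
    using m by (subst emeasure_distr) auto
  also have "\<dots> = (\<Prod>b\<in>Basis. (uncoordv u - uncoordv l :: 'a) \<bullet> b)"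
    unfolding v
  proof (subst emeasure_lborel_box)
    fix b :: 'a assume "b \<in> Basis"
    then obtain i where "b = bvec i" using bij_bvec[where 'a='a] by (auto simp: bij_betw_def)
    then show "uncoordv l \<bullet> b \<le> uncoordv u \<bullet> b" by (simp add: uncoordv_inner ax)
  qed simp
  also have "(\<Prod>b\<in>Basis. (uncoordv u - uncoordv l :: 'a) \<bullet> b) = (\<Prod>i\<in>UNIV. u $ i - l $ i)"
    by (subst prod_bvec[symmetric]) (simp add: inner_diff_left uncoordv_inner)
  also have "\<dots> = (\<Prod>b\<in>Basis. (u - l) \<bullet> b)"
  proof -
    have "(\<Prod>b\<in>Basis. (u - l) \<bullet> b) = (\<Prod>b\<in>(\<lambda>i. axis i 1) ` UNIV. (u - l) \<bullet> b)"
      by (rule prod.cong) (auto simp: Basis_vec_def)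
    also have "\<dots> = (\<Prod>i\<in>UNIV. (u - l) \<bullet> axis i 1)"
      by (subst prod.reindex) (auto simp: inj_on_def axis_eq_axis)
    finally show ?thesis by (simp add: inner_axis)
  qed
  finally show "emeasure (distr lborel borel coordv) (box l u) = (\<Prod>b\<in>Basis. (u - l) \<bullet> b)" .
qed simp

text \<open>Rows and columns use the same enumeration of the basis, so the value does not depend on
  the arbitrary choice in \<open>bvec\<close>.\<close>

definition detf :: "('a::euclidean_space \<Rightarrow> 'a) \<Rightarrow> real" where
  "detf c = det (\<chi> i j. c (bvec j) \<bullet> bvec i)"

lemma detf_leibniz:
  "detf c = (\<Sum>\<sigma>\<in>{\<sigma>. \<sigma> permutes UNIV}. of_int (sign \<sigma>) * (\<Prod>i\<in>UNIV. c (bvec (\<sigma> i)) \<bullet> bvec i))"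
  by (simp add: detf_def det_def)

text \<open>Multilinearity in the rows, sorted by the set \<open>S\<close> of rows taken from
  \<open>M\<close>. The right side exhibits a polynomial in \<open>s\<close> whose term for
  \<open>S = UNIV\<close> has coefficient \<open>det M\<close>.\<close>

lemma det_perturbation_expansion:
  fixes M :: "real^'n^'n"
  shows "det (mat 1 + s *\<^sub>R M) = (\<Sum>S\<in>Pow UNIV. s ^ card S *
     (\<Sum>\<sigma>\<in>{\<sigma>. \<sigma> permutes UNIV}. of_int (sign \<sigma>) *
        ((\<Prod>i\<in>S. M $ i $ \<sigma> i) * (\<Prod>i\<in>UNIV - S. (mat 1 :: real^'n^'n) $ i $ \<sigma> i))))"
proof -
  have "det (mat 1 + s *\<^sub>R M) = (\<Sum>\<sigma>\<in>{\<sigma>. \<sigma> permutes UNIV}. of_int (sign \<sigma>) *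
      (\<Prod>i\<in>UNIV. s * M $ i $ \<sigma> i + (mat 1 :: real^'n^'n) $ i $ \<sigma> i))"
    by (simp add: det_def add.commute)
  also have "\<dots> = (\<Sum>\<sigma>\<in>{\<sigma>. \<sigma> permutes UNIV}. of_int (sign \<sigma>) *
      (\<Sum>S\<in>Pow UNIV. s ^ card S * ((\<Prod>i\<in>S. M $ i $ \<sigma> i) * (\<Prod>i\<in>UNIV - S. (mat 1 :: real^'n^'n) $ i $ \<sigma> i))))"
    by (simp add: prod_add prod.distrib mult.assoc)
  also have "\<dots> = (\<Sum>\<sigma>\<in>{\<sigma>. \<sigma> permutes UNIV}. \<Sum>S\<in>Pow UNIV. s ^ card S * (of_int (sign \<sigma>) *
      ((\<Prod>i\<in>S. M $ i $ \<sigma> i) * (\<Prod>i\<in>UNIV - S. (mat 1 :: real^'n^'n) $ i $ \<sigma> i))))"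
    by (simp add: sum_distrib_left mult_ac)
  finally show ?thesis by (subst (asm) sum.swap) (simp add: sum_distrib_left)
qed

text \<open>Subtracting \<open>v\<close> from the constant coefficient gives a polynomial with
  infinitely many roots. The condition \<open>N \<ge> 1\<close> ensures that the top coefficient is
  not the one changed.\<close>

lemma polynomial_const_imp_coeff_zero:
  fixes a :: "nat \<Rightarrow> real"
  assumes "infinite A" and const: "\<And>s. s \<in> A \<Longrightarrow> (\<Sum>k\<le>N. a k * s ^ k) = v" and "N \<ge> 1"
  shows "a N = 0"
proof (rule ccontr)
  assume "a N \<noteq> 0"
  define c where "c = (\<lambda>k. if k = 0 then a 0 - v else a k)"
  have "finite {z. (\<Sum>i\<le>N. c i * z ^ i) = 0}"
    by (rule polyfun_roots_finite[of c N]) (use \<open>a N \<noteq> 0\<close> \<open>N \<ge> 1\<close> in \<open>auto simp: c_def\<close>)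
  moreover have "A \<subseteq> {z. (\<Sum>i\<le>N. c i * z ^ i) = 0}"
  proof
    fix s assume "s \<in> A"
    have "(\<Sum>i\<le>N. c i * s ^ i) = (\<Sum>i\<le>N. a i * s ^ i - (if i = 0 then v else 0))"
      by (intro sum.cong) (auto simp: c_def)
    also have "\<dots> = 0" using const[OF \<open>s \<in> A\<close>] by (simp add: sum_subtractf)
    finally show "s \<in> {z. (\<Sum>i\<le>N. c i * z ^ i) = 0}" by simp
  qed
  ultimately show False using \<open>infinite A\<close> finite_subset by blast
qed

text \<open>Off the ball \<open>W\<close> is locally zero, so its derivative vanishes there; on the
  ball compactness bounds the derivative on each basis vector. The mean value inequality then turns
  the bound into a Lipschitz constant.\<close>

lemma compact_support_C1_bounded:
  fixes W :: "'a::euclidean_space \<Rightarrow> 'b::euclidean_space"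
  assumes der: "\<And>x. (W has_derivative W' x) (at x)"
    and cont: "\<And>v. continuous_on UNIV (\<lambda>x. W' x v)"
    and supp: "\<And>x. norm x > r \<Longrightarrow> W x = 0"
  obtains B where "B > 0" "\<And>x v. norm (W' x v) \<le> B * norm v" "B-lipschitz_on UNIV W"
    "\<And>x v. norm x > r \<Longrightarrow> W' x v = 0"
proof -
  have zero: "W' x v = 0" if "norm x > r" for x v
  proof -
    have "open (- cball 0 r :: 'a set)" by (simp add: open_Compl)
    then have "((\<lambda>_. 0) has_derivative W' x) (at x)"
      using that by (intro has_derivative_transform_within_open[OF der]) (auto simp: supp)
    then have "W' x = (\<lambda>_. 0)" using has_derivative_unique[OF _ has_derivative_const] by blast
    then show ?thesis by simp
  qed
  have lin: "linear (W' x)" for x using der[of x] has_derivative_linear by blast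
  have "\<exists>B. \<forall>x\<in>cball 0 r. norm (W' x b) \<le> B" for b
    using compact_imp_bounded[OF compact_continuous_image[OF continuous_on_subset[OF cont[of b] subset_UNIV] compact_cball]]
    by (auto simp: bounded_iff)
  then obtain B where B: "\<And>b x. x \<in> cball 0 r \<Longrightarrow> norm (W' x b) \<le> B b" by metis
  define C where "C = (\<Sum>b\<in>Basis. \<bar>B b\<bar>) + 1"
  have C: "norm (W' x v) \<le> C * norm v" for x v
  proof (cases "norm x \<le> r")
    case True
    have "W' x v = W' x (\<Sum>b\<in>Basis. (v \<bullet> b) *\<^sub>R b)" by (simp add: euclidean_representation)
    also have "\<dots> = (\<Sum>b\<in>Basis. (v \<bullet> b) *\<^sub>R W' x b)" by (simp add: linear_sum[OF lin] linear_cmul[OF lin])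
    also have "norm \<dots> \<le> (\<Sum>b\<in>Basis. norm v * \<bar>B b\<bar>)"
    proof (rule sum_norm_le)
      fix b :: 'a assume "b \<in> Basis"
      then have "\<bar>v \<bullet> b\<bar> \<le> norm v" by (simp add: Basis_le_norm)
      moreover have "norm (W' x b) \<le> \<bar>B b\<bar>" using B[of x b] True by auto
      ultimately show "norm ((v \<bullet> b) *\<^sub>R W' x b) \<le> norm v * \<bar>B b\<bar>" by (simp add: mult_mono)
    qed
    also have "\<dots> = norm v * (\<Sum>b\<in>Basis. \<bar>B b\<bar>)" by (simp add: sum_distrib_left)
    also have "\<dots> \<le> C * norm v" by (simp add: C_def algebra_simps)
    finally show ?thesis .
  next
    case False
    have "C \<ge> 0" by (simp add: C_def add_nonneg_nonneg sum_nonneg)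
    then show ?thesis using zero[of x v] False by simp
  qed
  have "C > 0" by (simp add: C_def add_nonneg_pos sum_nonneg)
  moreover have "C-lipschitz_on UNIV W"
  proof (rule lipschitz_onI)
    fix x y
    show "dist (W x) (W y) \<le> C * dist x y"
      unfolding dist_norm
    proof (rule differentiable_bound[of UNIV])
      show "onorm (W' x) \<le> C" for x by (rule onorm_le) (rule C)
    qed (use der in auto)
  qed (use \<open>C > 0\<close> in simp)
  ultimately show thesis using that C zero by blast
qed

text \<open>For small \<open>s\<close> the map \<open>x + s W x\<close> is a diffeomorphism of the ball, so the polynomial
  \<open>s \<mapsto> \<integral> det (1 + s DW)\<close> is constant, and its leading coefficient is \<open>\<integral> det DW\<close>.\<close>

lemma integral_det_compact_support_cart:
  fixes W :: "(real,'n::{finite,wellorder}) vec \<Rightarrow> (real,'n) vec"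
  assumes der: "\<And>x. (W has_derivative W' x) (at x)"
    and cont: "\<And>v. continuous_on UNIV (\<lambda>x. W' x v)"
    and supp: "\<And>x. norm x > r \<Longrightarrow> W x = 0"
  shows "integral (cball 0 r) (\<lambda>x. det (matrix (W' x))) = 0"
proof -
  obtain B where B: "B > 0" "\<And>x v. norm (W' x v) \<le> B * norm v" "B-lipschitz_on UNIV W"
    "\<And>x v. norm x > r \<Longrightarrow> W' x v = 0"
    using compact_support_C1_bounded[OF assms] by metis
  define N where "N = CARD('n)"
  have lin: "linear (W' x)" for x using der[of x] has_derivative_linear by blast
  define c where "c = (\<lambda>S x. \<Sum>\<sigma>\<in>{\<sigma>. \<sigma> permutes (UNIV::'n set)}. of_int (sign \<sigma>) *
        ((\<Prod>i\<in>S. matrix (W' x) $ i $ \<sigma> i) * (\<Prod>i\<in>UNIV - S. (mat 1 :: ((real,'n) vec,'n) vec) $ i $ \<sigma> i)))"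
  have cont_c: "continuous_on (cball 0 r) (c S)" for S
    unfolding c_def matrix_def
    by (auto intro!: continuous_intros continuous_on_subset[OF cont])
  have int_c: "c S integrable_on cball 0 r" for S
    by (intro set_borel_integral_eq_integral(1)) (unfold set_integrable_def, rule borel_integrable_compact[OF compact_cball cont_c])
  have expand: "det (matrix (\<lambda>v. v + s *\<^sub>R W' x v)) = (\<Sum>S\<in>Pow UNIV. s ^ card S * c S x)" for s x
  proof -
    have "matrix (\<lambda>v. v + s *\<^sub>R W' x v) = mat 1 + s *\<^sub>R matrix (W' x)"
      by (simp add: matrix_def mat_def vec_eq_iff axis_def)
    then show ?thesis using det_perturbation_expansion[of s "matrix (W' x)"] by (simp add: c_def)
  qed
  define a where "a = (\<lambda>k. \<Sum>S\<in>{S \<in> Pow UNIV. card S = k}. integral (cball 0 r) (c S))"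
  \<comment> \<open>For these \<open>s\<close> one has \<open>s * B \<le> 1/2\<close>, so
    \<open>x + s W x\<close> perturbs the identity by a contraction. The interval is infinite, which
    is all the polynomial argument needs.\<close>
  have main: "(\<Sum>k\<le>N. a k * s ^ k) = measure lebesgue (cball 0 r :: ((real,'n) vec) set)" if s: "s \<in> {0..1/(2*B)}" for s
  proof -
    define G where "G = (\<lambda>x. x + s *\<^sub>R W x)"
    have sB: "s * B < 1" "0 \<le> s" using s B(1) by (auto simp: field_simps)
    have inj0: "v = 0" if "v + u *\<^sub>R W' x v = 0" "u \<in> {0..s}" for v x u
    proof (rule ccontr)
      assume "v \<noteq> 0"
      have "norm v = norm (u *\<^sub>R W' x v)" using that(1) by (metis add_eq_0_iff norm_minus_cancel)
      also have "\<dots> \<le> s * (B * norm v)" using that(2) B(2)[of x v] by (auto intro!: mult_mono)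
      also have "\<dots> < 1 * norm v" using sB \<open>v \<noteq> 0\<close> by (simp only: mult.assoc[symmetric]) (simp)
      finally show False by simp
    qed
    have det0: "det (matrix (\<lambda>v. v + u *\<^sub>R W' x v)) \<noteq> 0" if "u \<in> {0..s}" for u x
    proof -
      have l: "linear (\<lambda>v. v + u *\<^sub>R W' x v)"
        by (auto intro!: linearI simp: linear_add[OF lin] linear_cmul[OF lin] algebra_simps)
      have "inj (\<lambda>v. v + u *\<^sub>R W' x v)"
        using linear_injective_0[OF l] inj0[OF _ that] by blast
      then show ?thesis using l
        by (metis det_nz_iff_inj)
    qed
    have pos: "det (matrix (\<lambda>v. v + s *\<^sub>R W' x v)) > 0" for x
    proof (rule ccontr)
      assume n: "\<not> ?thesis"
      let ?d = "\<lambda>u. det (matrix (\<lambda>v. v + u *\<^sub>R W' x v))"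
      have "?d 0 = 1" by (simp add: matrix_id_mat_1[unfolded id_def])
      have "continuous_on {0..s} ?d" unfolding expand by (intro continuous_intros)
      then obtain u where "0 \<le> u" "u \<le> s" "?d u = 0"
        using IVT2'[of ?d s 0 0] n \<open>?d 0 = 1\<close> sB by auto
      then show False using det0 by auto
    qed
    have Lip: "norm (W x - W y) \<le> B * norm (x - y)" for x y
      using lipschitz_onD[OF B(3)] by (simp add: dist_norm)
    have inj: "inj G"
    proof (rule injI)
      fix x y assume "G x = G y"
      then have "x - y = s *\<^sub>R (W y - W x)" by (simp add: G_def algebra_simps)
      then have "norm (x - y) \<le> s * (B * norm (x - y))"
        using Lip[of y x] sB by (simp add: mult_left_mono norm_minus_commute)
      then have "(1 - s * B) * norm (x - y) \<le> 0" by (simp add: algebra_simps)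
      then show "x = y" using sB by (simp add: mult_le_0_iff)
    qed
    \<comment> \<open>A preimage of \<open>y\<close> is a fixed point of the contraction that sends
      \<open>x\<close> to \<open>y - s W x\<close>.\<close>
    have surj: "\<exists>x. G x = y" for y
    proof -
      have "\<exists>!x. (\<lambda>x. y - s *\<^sub>R W x) x = x"
      proof (rule banach_fix_type[of "s * B"])
        have "dist (y - s *\<^sub>R W u) (y - s *\<^sub>R W v) \<le> s * B * dist u v" for u v
        proof -
          have "dist (y - s *\<^sub>R W u) (y - s *\<^sub>R W v) = s * norm (W u - W v)"
            using sB by (simp add: dist_norm norm_minus_commute flip: scaleR_diff_right)
          also have "\<dots> \<le> s * (B * norm (u - v))" using Lip sB by (intro mult_left_mono) auto
          finally show ?thesis by (simp add: dist_norm mult.assoc)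
        qed
        then show "\<forall>u v. dist (y - s *\<^sub>R W u) (y - s *\<^sub>R W v) \<le> s * B * dist u v" by blast
      qed (use sB B(1) in auto)
      then obtain x where "y - s *\<^sub>R W x = x" by blast
      then have "G x = y" by (metis G_def diff_add_cancel)
      then show ?thesis by blast
    qed
    have fixout: "G x = x" if "norm x > r" for x using supp[OF that] by (simp add: G_def)
    \<comment> \<open>\<open>G\<close> fixes every point outside the ball, so an injective
      \<open>G\<close> cannot send a point of the ball there, and a preimage of a point of the ball
      cannot lie outside.\<close>
    have img: "G ` cball 0 r = cball 0 r"
    proof (intro equalityI subsetI)
      fix y assume "y \<in> G ` cball 0 r"
      then obtain x where x: "x \<in> cball 0 r" "y = G x" by blast
      show "y \<in> cball 0 r"
      proof (rule ccontr)
        assume "y \<notin> cball 0 r"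
        then have "G y = G x" using fixout[of y] x(2) by auto
        then have "y = x" using inj by (simp add: inj_eq)
        then show False using x(1) \<open>y \<notin> cball 0 r\<close> by simp
      qed
    next
      fix y :: "(real,'n) vec" assume y: "y \<in> cball 0 r"
      obtain x where x: "G x = y" using surj by blast
      have "x \<in> cball 0 r" using fixout[of x] x y by force
      then show "y \<in> G ` cball 0 r" using x by blast
    qed
    have derG: "(G has_derivative (\<lambda>v. v + s *\<^sub>R W' x v)) (at x within cball 0 r)" for x
      unfolding G_def
      by (auto intro!: derivative_eq_intros has_derivative_at_withinI[OF der])
    have "((\<lambda>x. \<bar>det (matrix (\<lambda>v. v + s *\<^sub>R W' x v))\<bar>) has_integral measure lebesgue (G ` cball 0 r)) (cball 0 r)"
      using has_measure_differentiable_image[of "cball 0 r" G "\<lambda>x v. v + s *\<^sub>R W' x v" "measure lebesgue (G ` cball 0 r)"]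
        derG inj img by (auto simp: inj_on_def inj_def)
    then have "((\<lambda>x. \<Sum>S\<in>Pow UNIV. s ^ card S * c S x) has_integral measure lebesgue (cball 0 r :: ((real,'n) vec) set)) (cball 0 r)"
      by (simp only: expand[symmetric] abs_of_pos[OF pos] img)
    then have "measure lebesgue (cball 0 r :: ((real,'n) vec) set) = integral (cball 0 r) (\<lambda>x. \<Sum>S\<in>Pow UNIV. s ^ card S * c S x)"
      by (simp add: has_integral_iff)
    also have "\<dots> = (\<Sum>S\<in>Pow UNIV. s ^ card S * integral (cball 0 r) (c S))"
      using int_c by (subst integral_sum) (auto intro!: integrable_on_mult_right)
    also have "\<dots> = (\<Sum>k\<le>N. \<Sum>S\<in>{S \<in> Pow UNIV. card S = k}. s ^ card S * integral (cball 0 r) (c S))"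
      by (rule sum.group[symmetric]) (auto simp: N_def card_mono)
    also have "\<dots> = (\<Sum>k\<le>N. a k * s ^ k)"
      by (simp add: a_def sum_distrib_left mult.commute)
    finally show ?thesis by simp
  qed
  have "a N = 0"
  proof (rule polynomial_const_imp_coeff_zero[OF _ main])
    show "infinite {0..1 / (2 * B)}" using B(1) by (simp add: infinite_Icc)
    show "1 \<le> N" using zero_less_card_finite[where 'a='n] unfolding N_def by linarith
  qed
  \<comment> \<open>The coefficient of degree \<open>N\<close> collects only
    \<open>S = UNIV\<close>, and that term is the integral of
    \<open>det (matrix (W' x))\<close>.\<close>
  moreover have "{S \<in> Pow (UNIV::'n set). card S = N} = {UNIV}"
    unfolding N_def using card_eq_UNIV_imp_eq_UNIV[where 'a='n] by auto
  moreover have "c UNIV = (\<lambda>x. det (matrix (W' x)))"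
    by (simp add: c_def det_def)
  ultimately show ?thesis by (simp add: a_def)
qed

text \<open>This takes the place of Stokes' theorem in the degree argument. The isometry
  \<open>coordv\<close> preserves Lebesgue measure and turns \<open>detf\<close> into a matrix
  determinant.\<close>

proposition integral_detf_compact_support:
  fixes W :: "'a::euclidean_space \<Rightarrow> 'a"
  assumes der: "\<And>x. (W has_derivative W' x) (at x)"
    and cont: "\<And>v. continuous_on UNIV (\<lambda>x. W' x v)"
    and supp: "\<And>x. norm x > r \<Longrightarrow> W x = 0"
  shows "(LBINT x. detf (W' x)) = 0"
proof -
  have bc: "bounded_linear (coordv :: 'a \<Rightarrow> _)" and bu: "bounded_linear (uncoordv :: _ \<Rightarrow> 'a)"
    using linear_coordv linear_uncoordv linear_conv_bounded_linear by blast+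
  define V where "V = (\<lambda>x. coordv (W (uncoordv x)))"
  define V' where "V' = (\<lambda>x v. coordv (W' (uncoordv x) (uncoordv v)))"
  have derV: "(V has_derivative V' x) (at x)" for x
    unfolding V_def V'_def
    by (rule bounded_linear.has_derivative[OF bc])
       (rule has_derivative_compose[OF bounded_linear_imp_has_derivative[OF bu] der])
  have contV: "continuous_on UNIV (\<lambda>x. V' x v)" for v
    unfolding V'_def
    by (rule linear_continuous_on_compose[OF _ linear_coordv],
        rule continuous_on_compose2[OF cont linear_continuous_on[OF bu]]) auto
  have suppV: "V x = 0" if "norm x > r" for x
    using supp[of "uncoordv x"] that by (simp add: V_def linear_0[OF linear_coordv])
  have dV: "det (matrix (V' (coordv x))) = detf (W' x)" for x
  proof -
    have "uncoordv (axis j 1) = bvec j" for j :: "'a bidx"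
      by (subst euclidean_eq_iff) (simp add: ball_Basis_bvec uncoordv_inner axis_def inner_bvec)
    then show ?thesis
      by (simp add: matrix_def detf_def V'_def) (simp add: coordv_def)
  qed
  have zero: "det (matrix (V' x)) = 0" if "norm x > r" for x
  proof -
    obtain B where "\<And>x v. norm x > r \<Longrightarrow> V' x v = 0"
      using compact_support_C1_bounded[OF derV contV suppV] by metis
    then have "matrix (V' x) = 0" using that by (simp add: matrix_def vec_eq_iff)
    \<comment> \<open>The whole matrix is zero, so an arbitrary row, here the one with index
      \<open>undefined\<close>, witnesses that the determinant vanishes.\<close>
    then show ?thesis by (simp add: det_zero_row(1)[of undefined] row_def zero_vec_def)
  qed
  have cd: "continuous_on UNIV (\<lambda>x. det (matrix (V' x)))"
    unfolding matrix_def det_def by (auto intro!: continuous_intros contV)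
  have ind: "(\<lambda>x. indicator (cball 0 r) x *\<^sub>R det (matrix (V' x))) = (\<lambda>x. det (matrix (V' x)))"
    by (rule ext) (use zero in \<open>auto simp: indicator_def\<close>)
  have si: "set_integrable lborel (cball 0 r) (\<lambda>x. det (matrix (V' x)))"
    unfolding set_integrable_def
    by (rule borel_integrable_compact) (auto intro: continuous_on_subset[OF cd])
  have "(LBINT x. detf (W' x)) = (LBINT x. det (matrix (V' (coordv x))))"
    by (simp add: dV)
  also have "\<dots> = integral\<^sup>L (distr lborel borel coordv) (\<lambda>x. det (matrix (V' x)))"
    by (rule integral_distr[symmetric])
       (auto intro!: borel_measurable_continuous_onI cd linear_continuous_on bc)
  also have "\<dots> = set_lebesgue_integral lborel (cball 0 r) (\<lambda>x. det (matrix (V' x)))"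
    by (simp only: lborel_distr_coordv set_lebesgue_integral_def ind)
  also have "\<dots> = integral (cball 0 r) (\<lambda>x. det (matrix (V' x)))"
    using set_borel_integral_eq_integral(2)[OF si] by simp
  also have "\<dots> = 0" by (rule integral_det_compact_support_cart[OF derV contV suppV])
  finally show ?thesis .
qed

section \<open>Smooth functions and mollifiers\<close>

text \<open>\<open>iter_dd\<close> adds its new derivative last; here the recursion takes the first
  derivative off, so that the product and chain rules can be proved by induction. The index is
  shifted: \<open>Ck_on k\<close> means differentiable \<open>k + 1\<close> times.\<close>

primrec Ck_on :: "nat \<Rightarrow> 'a::real_normed_vector set \<Rightarrow> ('a \<Rightarrow> 'b::real_normed_vector) \<Rightarrow> bool" where
  "Ck_on 0 U f \<longleftrightarrow> f differentiable_on U"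
| "Ck_on (Suc k) U f \<longleftrightarrow> f differentiable_on U \<and> (\<forall>v. Ck_on k U (\<lambda>x. frechet_derivative f (at x) v))"

lemma iter_dd_snoc: "iter_dd (vs @ [v]) f = iter_dd vs (\<lambda>x. frechet_derivative f (at x) v)"
  by (induction vs) auto

lemma Ck_on_iff_iter_dd:
  fixes f :: "'a::real_normed_vector \<Rightarrow> 'b::real_normed_vector"
  shows "Ck_on k U f \<longleftrightarrow> (\<forall>vs. length vs \<le> k \<longrightarrow> iter_dd vs f differentiable_on U)"
proof (induction k arbitrary: f)
  case (Suc k)
  have "(\<forall>vs. length vs \<le> Suc k \<longrightarrow> iter_dd vs f differentiable_on U) \<longleftrightarrow>
      f differentiable_on U \<and> (\<forall>v vs. length vs \<le> k \<longrightarrow> iter_dd (vs @ [v]) f differentiable_on U)"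
  proof (intro iffI conjI allI impI)
    fix vs :: "'a list" assume *: "f differentiable_on U \<and> (\<forall>v vs. length vs \<le> k \<longrightarrow> iter_dd (vs @ [v]) f differentiable_on U)"
      "length vs \<le> Suc k"
    then show "iter_dd vs f differentiable_on U" by (cases vs rule: rev_cases) auto
  next
    assume "\<forall>vs. length vs \<le> Suc k \<longrightarrow> iter_dd vs f differentiable_on U"
    from this[rule_format, of "[]"] show "f differentiable_on U" by simp
  qed auto
  then show ?case unfolding iter_dd_snoc using Suc by auto
qed auto

lemma smooth_open_iff_Ck: "smooth_open U f \<longleftrightarrow> open U \<and> (\<forall>k. Ck_on k U f)"
  by (auto simp: smooth_open_def Ck_on_iff_iter_dd)

lemma frechet_derivative_cong_open:
  assumes "open U" "x \<in> U" "\<And>y. y \<in> U \<Longrightarrow> f y = g y"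
  shows "frechet_derivative f (at x) = frechet_derivative g (at x)"
proof -
  have "(f has_derivative f') (at x) \<longleftrightarrow> (g has_derivative f') (at x)" for f'
    using has_derivative_transform_within_open[of f f' x UNIV U g]
      has_derivative_transform_within_open[of g f' x UNIV U f] assms by auto
  then show ?thesis by (simp add: frechet_derivative_def)
qed

lemma differentiable_on_eq:
  assumes "f differentiable_on U" "\<And>x. x \<in> U \<Longrightarrow> f x = g x"
  shows "g differentiable_on U"
  unfolding differentiable_on_def
proof
  fix x assume "x \<in> U"
  then show "g differentiable (at x within U)"
    using assms by (intro differentiable_transform_within[of f x U 1 g]) (auto simp: differentiable_on_def)
qed

lemma Ck_on_cong:
  assumes "open U" "\<And>x. x \<in> U \<Longrightarrow> f x = g x" "Ck_on k U f"
  shows "Ck_on k U g"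
  using assms(2,3)
proof (induction k arbitrary: f g)
  case 0
  then show ?case by (auto intro: differentiable_on_eq)
next
  case (Suc k)
  have "Ck_on k U (\<lambda>x. frechet_derivative g (at x) v)" for v
  proof (rule Suc.IH)
    show "frechet_derivative f (at x) v = frechet_derivative g (at x) v" if "x \<in> U" for x
      using frechet_derivative_cong_open[OF assms(1) that Suc.prems(1)] by simp
  qed (use Suc.prems in simp)
  moreover have "g differentiable_on U" using Suc.prems differentiable_on_eq[of f U g] by auto
  ultimately show ?case by simp
qed

lemma Ck_on_SucI:
  assumes "open U" "\<And>x. x \<in> U \<Longrightarrow> (f has_derivative f' x) (at x)" "\<And>v. Ck_on k U (\<lambda>x. f' x v)"
  shows "Ck_on (Suc k) U f"
proof -
  have "f differentiable_on U"
    using assms(2) by (meson differentiable_at_imp_differentiable_on differentiable_def)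
  moreover have "Ck_on k U (\<lambda>x. frechet_derivative f (at x) v)" for v
    by (rule Ck_on_cong[OF assms(1) _ assms(3)[of v]]) (use frechet_derivative_at[OF assms(2)] in simp)
  ultimately show ?thesis by simp
qed

lemma Ck_on_0I:
  assumes "\<And>x. x \<in> U \<Longrightarrow> (f has_derivative f' x) (at x)"
  shows "Ck_on 0 U f"
  using assms by (auto simp: differentiable_on_def differentiable_def intro: has_derivative_at_withinI)

lemma Ck_on_SucD: "Ck_on (Suc k) U f \<Longrightarrow> Ck_on k U f"
  by (induction k arbitrary: f) auto

lemma Ck_on_has_derivative:
  assumes "Ck_on k U f" "open U" "x \<in> U"
  shows "(f has_derivative frechet_derivative f (at x)) (at x)"
proof -
  have "f differentiable_on U" using assms(1) by (cases k) auto
  then have "f differentiable at x" using assms(2,3) differentiable_on_eq_differentiable_at by blast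
  then show ?thesis by (rule frechet_derivative_works[THEN iffD1])
qed

lemma Ck_on_const: "open U \<Longrightarrow> Ck_on k U (\<lambda>x. c)"
proof (induction k arbitrary: c)
  case (Suc k)
  show ?case by (rule Ck_on_SucI[where f' = "\<lambda>x v. 0"]) (use Suc in auto)
qed (auto simp: differentiable_on_def)

lemma Ck_on_bounded_linear:
  assumes "open U" "bounded_linear f"
  shows "Ck_on k U f"
proof (cases k)
  case 0
  then show ?thesis using assms by (auto intro!: Ck_on_0I[where f'="\<lambda>x. f"] bounded_linear_imp_has_derivative simp del: Ck_on.simps)
next
  case (Suc j)
  show ?thesis unfolding Suc
    by (rule Ck_on_SucI[where f' = "\<lambda>x. f"]) (use assms in \<open>auto intro!: Ck_on_const bounded_linear_imp_has_derivative\<close>)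
qed

lemma Ck_on_add:
  assumes "open U" "Ck_on k U f" "Ck_on k U g"
  shows "Ck_on k U (\<lambda>x. f x + g x)"
  using assms(2,3)
proof (induction k arbitrary: f g)
  case (Suc k)
  show ?case
    by (rule Ck_on_SucI[OF assms(1) has_derivative_add[OF Ck_on_has_derivative[OF Suc.prems(1) assms(1)] Ck_on_has_derivative[OF Suc.prems(2) assms(1)]]])
       (use Suc in auto)
qed auto

lemma Ck_on_bilinear:
  fixes prd :: "'b::real_normed_vector \<Rightarrow> 'c::real_normed_vector \<Rightarrow> 'd::real_normed_vector"
  assumes "bounded_bilinear prd" "open U" "Ck_on k U f" "Ck_on k U g"
  shows "Ck_on k U (\<lambda>x. prd (f x) (g x))"
  using assms(3,4)
proof (induction k arbitrary: f g)
  case 0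
  show ?case
    by (rule Ck_on_0I[OF bounded_bilinear.FDERIV[OF assms(1) Ck_on_has_derivative[OF 0(1) assms(2)] Ck_on_has_derivative[OF 0(2) assms(2)]]])
next
  case (Suc k)
  show ?case
    by (rule Ck_on_SucI[OF assms(2) bounded_bilinear.FDERIV[OF assms(1) Ck_on_has_derivative[OF Suc.prems(1) assms(2)] Ck_on_has_derivative[OF Suc.prems(2) assms(2)]]])
       (use Suc Ck_on_SucD[OF Suc.prems(1)] Ck_on_SucD[OF Suc.prems(2)] in \<open>auto intro!: Ck_on_add assms(2) Suc.IH\<close>)
qed

lemma Ck_on_sum:
  assumes "open U" "\<And>i. i \<in> I \<Longrightarrow> Ck_on k U (f i)"
  shows "Ck_on k U (\<lambda>x. \<Sum>i\<in>I. f i x)"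
  using assms(2) by (induction I rule: infinite_finite_induct) (auto intro!: Ck_on_add Ck_on_const assms(1))

lemma Ck_on_compose:
  fixes f :: "'b::euclidean_space \<Rightarrow> 'c::real_normed_vector" and g :: "'a::real_normed_vector \<Rightarrow> 'b"
  assumes "open U" "open V" "\<And>x. x \<in> U \<Longrightarrow> g x \<in> V" "Ck_on k V f" "Ck_on k U g"
  shows "Ck_on k U (\<lambda>x. f (g x))"
  using assms(4,5)
proof (induction k arbitrary: f)
  case 0
  show ?case
    by (rule Ck_on_0I, rule has_derivative_compose[OF Ck_on_has_derivative[OF 0(2) assms(1)] Ck_on_has_derivative[OF 0(1) assms(2,3)]])
next
  case (Suc k)
  let ?f' = "\<lambda>y. frechet_derivative f (at y)" and ?g' = "\<lambda>x. frechet_derivative g (at x)"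
  have df: "(f has_derivative ?f' (g x)) (at (g x))" if "x \<in> U" for x
    using Ck_on_has_derivative[OF Suc.prems(1) assms(2)] assms(3) that by blast
  \<comment> \<open>In \<open>f' (g x) (g' x v)\<close> the direction fed to \<open>f'\<close> moves
    with \<open>x\<close>. Expanding it in the basis leaves only fixed directions \<open>b\<close>,
    so every summand is a product covered by the induction hypothesis.\<close>
  have d: "((\<lambda>x. f (g x)) has_derivative (\<lambda>v. \<Sum>b\<in>Basis. (?g' x v \<bullet> b) *\<^sub>R ?f' (g x) b)) (at x)" if x: "x \<in> U" for x
  proof -
    have lin: "linear (?f' (g x))" using df[OF x] has_derivative_linear by blast
    have rep: "?f' (g x) w = (\<Sum>b\<in>Basis. (w \<bullet> b) *\<^sub>R ?f' (g x) b)" for w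
    proof -
      have "?f' (g x) (\<Sum>b\<in>Basis. (w \<bullet> b) *\<^sub>R b) = (\<Sum>b\<in>Basis. (w \<bullet> b) *\<^sub>R ?f' (g x) b)"
        by (simp add: linear_sum[OF lin] linear_cmul[OF lin])
      then show ?thesis by (simp add: euclidean_representation)
    qed
    have "(\<lambda>v. \<Sum>b\<in>Basis. (?g' x v \<bullet> b) *\<^sub>R ?f' (g x) b) = (\<lambda>v. ?f' (g x) (?g' x v))"
      by (simp only: rep[symmetric])
    then show ?thesis
      using has_derivative_compose[OF Ck_on_has_derivative[OF Suc.prems(2) assms(1) x] df[OF x]] by simp
  qed
  show ?case
  proof (rule Ck_on_SucI[OF assms(1) d])
    fix v
    show "Ck_on k U (\<lambda>x. \<Sum>b\<in>Basis. (?g' x v \<bullet> b) *\<^sub>R ?f' (g x) b)"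
    proof (rule Ck_on_sum[OF assms(1)])
      fix b :: 'b assume "b \<in> Basis"
      have "Ck_on k U (\<lambda>x. ?g' x v \<bullet> b)"
        by (rule Ck_on_bilinear[OF bounded_bilinear_inner assms(1)])
           (use Suc.prems(2) in \<open>auto intro: Ck_on_const assms(1)\<close>)
      moreover have "Ck_on k U (\<lambda>x. ?f' (g x) b)"
        using Suc.IH[of "\<lambda>y. ?f' y b"] Suc.prems Ck_on_SucD by auto
      ultimately show "Ck_on k U (\<lambda>x. (?g' x v \<bullet> b) *\<^sub>R ?f' (g x) b)"
        by (rule Ck_on_bilinear[OF bounded_bilinear_scaleR assms(1)])
    qed
  qed
qed

lemma Ck_on_Suc_realI:
  fixes f :: "real \<Rightarrow> real"
  assumes "open U" "\<And>x. x \<in> U \<Longrightarrow> (f has_real_derivative f' x) (at x)" "Ck_on k U f'"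
  shows "Ck_on (Suc k) U f"
  by (rule Ck_on_SucI[OF assms(1), where f' = "\<lambda>x v. f' x * v"])
     (use assms in \<open>auto simp: has_field_derivative_def intro!: Ck_on_bilinear[OF bounded_bilinear_mult] Ck_on_const\<close>)

lemma Ck_on_0_realI:
  fixes f :: "real \<Rightarrow> real"
  assumes "\<And>x. x \<in> U \<Longrightarrow> (f has_real_derivative f' x) (at x)"
  shows "Ck_on 0 U f"
  by (rule Ck_on_0I[where f' = "\<lambda>x v. f' x * v"]) (use assms in \<open>auto simp: has_field_derivative_def\<close>)

section \<open>Smooth functions: algebra, composition and elementary examples\<close>

lemma smooth_open_const: "open U \<Longrightarrow> smooth_open U (\<lambda>x. c)"
  by (simp add: smooth_open_iff_Ck Ck_on_const del: Ck_on.simps)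

lemma smooth_open_linear: "open U \<Longrightarrow> bounded_linear f \<Longrightarrow> smooth_open U f"
  by (simp add: smooth_open_iff_Ck Ck_on_bounded_linear del: Ck_on.simps)

lemma smooth_open_add: "smooth_open U f \<Longrightarrow> smooth_open U g \<Longrightarrow> smooth_open U (\<lambda>x. f x + g x)"
  by (simp add: smooth_open_iff_Ck Ck_on_add del: Ck_on.simps)

lemma smooth_open_scaleR: "smooth_open U f \<Longrightarrow> smooth_open U g \<Longrightarrow> smooth_open U (\<lambda>x. f x *\<^sub>R g x)"
  by (simp add: smooth_open_iff_Ck Ck_on_bilinear[OF bounded_bilinear_scaleR] del: Ck_on.simps)

lemma smooth_open_inner: "smooth_open U f \<Longrightarrow> smooth_open U g \<Longrightarrow> smooth_open U (\<lambda>x. f x \<bullet> g x)"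
  by (simp add: smooth_open_iff_Ck Ck_on_bilinear[OF bounded_bilinear_inner] del: Ck_on.simps)

lemma smooth_open_mult:
  fixes f g :: "'a::real_normed_vector \<Rightarrow> real"
  shows "smooth_open U f \<Longrightarrow> smooth_open U g \<Longrightarrow> smooth_open U (\<lambda>x. f x * g x)"
  by (simp add: smooth_open_iff_Ck Ck_on_bilinear[OF bounded_bilinear_mult] del: Ck_on.simps)

lemma smooth_open_minus: "smooth_open U f \<Longrightarrow> smooth_open U (\<lambda>x. - f x)"
  using smooth_open_scaleR[OF smooth_open_const[of U "-1"], of f] by (simp add: smooth_open_def)

lemma smooth_open_diff: "smooth_open U f \<Longrightarrow> smooth_open U g \<Longrightarrow> smooth_open U (\<lambda>x. f x - g x)"
  using smooth_open_add[OF _ smooth_open_minus, of U f g] by simp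

lemma smooth_open_compose:
  fixes f :: "'b::euclidean_space \<Rightarrow> 'c::real_normed_vector"
  assumes "smooth_open V f" "smooth_open U g" "\<And>x. x \<in> U \<Longrightarrow> g x \<in> V"
  shows "smooth_open U (\<lambda>x. f (g x))"
proof -
  have "Ck_on k U (\<lambda>x. f (g x))" for k
    by (rule Ck_on_compose[of U V]) (use assms in \<open>simp_all add: smooth_open_iff_Ck del: Ck_on.simps\<close>)
  then show ?thesis using assms(2) by (simp add: smooth_open_iff_Ck del: Ck_on.simps)
qed

lemma smooth_open_id: "open U \<Longrightarrow> smooth_open U (\<lambda>x. x)"
  by (rule smooth_open_linear) (auto intro: bounded_linear_ident)

lemma smooth_open_sin: "smooth_open UNIV (sin :: real \<Rightarrow> real)"
proof -
  have "Ck_on k UNIV (sin :: real \<Rightarrow> real) \<and> Ck_on k UNIV (\<lambda>x::real. cos x) \<and> Ck_on k UNIV (\<lambda>x::real. - sin x)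
      \<and> Ck_on k UNIV (\<lambda>x::real. - cos x)" for k
  proof (induction k)
    case 0
    show ?case
      by (intro conjI; rule Ck_on_0_realI) (auto intro!: derivative_eq_intros)
  next
    case (Suc k)
    show ?case
      by (intro conjI; rule Ck_on_Suc_realI)
         (use Suc in \<open>auto intro!: derivative_eq_intros simp del: Ck_on.simps\<close>)
  qed
  then show ?thesis by (auto simp: smooth_open_iff_Ck simp del: Ck_on.simps)
qed

lemma smooth_open_inverse:
  assumes "open U" "0 \<notin> U"
  shows "smooth_open U (\<lambda>x::real. inverse x)"
proof -
  have "Ck_on k U (\<lambda>x::real. inverse x)" for k
  proof (induction k)
    case 0
    show ?case by (rule Ck_on_0_realI) (use assms in \<open>auto intro!: derivative_eq_intros\<close>)
  next
    case (Suc k)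
    show ?case
    proof (rule Ck_on_Suc_realI[OF assms(1)])
      show "((\<lambda>x. inverse x) has_real_derivative (- 1) * (inverse x * inverse x)) (at x)" if "x \<in> U" for x
        using assms that by (auto intro!: derivative_eq_intros simp: power2_eq_square)
    qed (intro Ck_on_bilinear[OF bounded_bilinear_mult assms(1)] Suc Ck_on_const assms(1))
  qed
  then show ?thesis using assms by (auto simp: smooth_open_iff_Ck simp del: Ck_on.simps)
qed

lemma smooth_open_ln: "smooth_open {0<..} (ln :: real \<Rightarrow> real)"
proof -
  have "Ck_on k {0<..} (ln :: real \<Rightarrow> real)" for k
  proof (cases k)
    case 0
    have "Ck_on 0 {0<..} (ln :: real \<Rightarrow> real)"
      by (rule Ck_on_0_realI[where f' = inverse]) (auto intro!: derivative_eq_intros simp: divide_simps)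
    then show ?thesis by (simp only: 0)
  next
    case (Suc j)
    have "smooth_open {0<..} (\<lambda>x::real. inverse x)" by (rule smooth_open_inverse) auto
    then have "Ck_on j {0<..} (\<lambda>x::real. inverse x)" by (simp add: smooth_open_iff_Ck del: Ck_on.simps)
    then show ?thesis unfolding Suc
      by (rule Ck_on_Suc_realI[rotated 2]) (auto intro!: derivative_eq_intros simp: divide_simps)
  qed
  then show ?thesis by (auto simp: smooth_open_iff_Ck simp del: Ck_on.simps)
qed

lemma smooth_open_sqrt: "smooth_open {0<..} sqrt"
proof -
  have "Ck_on k {0<..} sqrt" for k
  proof (induction k)
    case 0
    show ?case by (rule Ck_on_0_realI) (auto intro!: derivative_eq_intros)
  next
    case (Suc k)
    have "smooth_open {0<..} (\<lambda>x::real. inverse x)" by (rule smooth_open_inverse) auto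
    then have "Ck_on k {0<..} (\<lambda>x::real. inverse x)" by (simp add: smooth_open_iff_Ck del: Ck_on.simps)
    then have "Ck_on k {0<..} (\<lambda>x. inverse (sqrt x))"
      by (rule Ck_on_compose[OF _ _ _ _ Suc, rotated 3]) auto
    then have "Ck_on k {0<..} (\<lambda>x. inverse (sqrt x) * (1 / 2))"
      by (intro Ck_on_bilinear[OF bounded_bilinear_mult] Ck_on_const) auto
    then show ?case
      by (rule Ck_on_Suc_realI[rotated 2]) (auto intro!: derivative_eq_intros simp: field_simps)
  qed
  then show ?thesis by (auto simp: smooth_open_iff_Ck simp del: Ck_on.simps)
qed

lemma smooth_open_norm:
  assumes "open U" "0 \<notin> U"
  shows "smooth_open U (norm :: 'a::euclidean_space \<Rightarrow> real)"
  unfolding norm_eq_sqrt_inner[abs_def]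
  by (rule smooth_open_compose[OF smooth_open_sqrt])
     (use assms in \<open>auto intro!: smooth_open_inner smooth_open_id\<close>)

lemma smooth_open_has_derivative:
  assumes "smooth_open U f" "x \<in> U"
  shows "(f has_derivative frechet_derivative f (at x)) (at x)"
proof -
  have "Ck_on 0 U f" "open U" using assms by (auto simp: smooth_open_iff_Ck simp del: Ck_on.simps)
  then show ?thesis using assms(2) by (rule Ck_on_has_derivative)
qed

lemma smooth_open_continuous_derivative:
  assumes "smooth_open U f"
  shows "continuous_on U (\<lambda>x. frechet_derivative f (at x) v)"
proof -
  have "Ck_on 1 U f" using assms by (simp add: smooth_open_iff_Ck del: Ck_on.simps)
  then show ?thesis by (auto intro: differentiable_imp_continuous_on)
qed

lemma smooth_open_continuous: "smooth_open U f \<Longrightarrow> continuous_on U f"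
proof -
  assume "smooth_open U f"
  then have "Ck_on 0 U f" by (simp add: smooth_open_iff_Ck del: Ck_on.simps)
  then show ?thesis by (auto intro: differentiable_imp_continuous_on)
qed

lemma smooth_open_subset: "smooth_open U f \<Longrightarrow> V \<subseteq> U \<Longrightarrow> open V \<Longrightarrow> smooth_open V f"
  by (auto simp: smooth_open_def intro: differentiable_on_subset)

lemma smooth_open_cong: "smooth_open U f \<Longrightarrow> (\<And>x. x \<in> U \<Longrightarrow> f x = g x) \<Longrightarrow> smooth_open U g"
  unfolding smooth_open_iff_Ck by (metis Ck_on_cong)

text \<open>The family \<open>exp (-1/t) / t ^ j\<close>, extended by \<open>0\<close>, is closed under differentiation up to
  linear combinations.\<close>

definition flat_exp :: "nat \<Rightarrow> real \<Rightarrow> real" where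
  "flat_exp j t = (if t \<le> 0 then 0 else exp (- 1 / t) / t ^ j)"

lemma flat_exp_tendsto_0: "((\<lambda>t. flat_exp j t) \<longlongrightarrow> 0) (at_right 0)"
proof -
  have "((\<lambda>t::real. inverse t ^ j / exp (inverse t)) \<longlongrightarrow> 0) (at_right 0)"
    by (rule filterlim_compose[OF tendsto_power_div_exp_0 filterlim_inverse_at_top_right])
  moreover have "eventually (\<lambda>t. inverse t ^ j / exp (inverse t) = flat_exp j t) (at_right (0::real))"
    by (auto simp: eventually_at_right_field flat_exp_def exp_minus divide_simps intro!: exI[of _ 1])
  ultimately show ?thesis by (rule Lim_transform_eventually)
qed

lemma flat_exp_has_derivative:
  "(flat_exp j has_real_derivative flat_exp (j + 2) t - real j * flat_exp (j + 1) t) (at t)"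
proof -
  consider "t < 0" | "t = 0" | "t > 0" by linarith
  then show ?thesis
  proof cases
    case 1
    have "((\<lambda>_. 0) has_real_derivative 0) (at t)" by simp
    then have "(flat_exp j has_real_derivative 0) (at t)"
      by (rule DERIV_cong_ev[THEN iffD1, rotated 3])
         (use 1 eventually_nhds_in_open[of "{..<0}" t] in \<open>auto simp: flat_exp_def elim!: eventually_mono\<close>)
    then show ?thesis using 1 by (simp add: flat_exp_def)
  next
    case 3
    have "((\<lambda>t. exp (- 1 / t) / t ^ j) has_real_derivative flat_exp (j + 2) t - real j * flat_exp (j + 1) t) (at t)"
    proof -
      have "((\<lambda>t. exp (- 1 / t) / t ^ j) has_real_derivative
          (exp (- 1 / t) * (1 / t\<^sup>2) * t ^ j - exp (- 1 / t) * (real j * t ^ (j - 1))) / (t ^ j)\<^sup>2) (at t)"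
        using 3 by (auto intro!: derivative_eq_intros simp: power2_eq_square)
      moreover have "(exp (- 1 / t) * (1 / t\<^sup>2) * t ^ j - exp (- 1 / t) * (real j * t ^ (j - 1))) / (t ^ j)\<^sup>2
          = flat_exp (j + 2) t - real j * flat_exp (j + 1) t"
        using 3 by (cases j) (auto simp: flat_exp_def divide_simps power2_eq_square algebra_simps)
      ultimately show ?thesis by simp
    qed
    then show ?thesis
      by (rule DERIV_cong_ev[THEN iffD1, rotated 3])
         (use 3 eventually_nhds_in_open[of "{0<..}" t] in \<open>auto simp: flat_exp_def elim!: eventually_mono\<close>)
  next
    case 2
    have "((\<lambda>h. flat_exp j h / h) \<longlongrightarrow> 0) (at 0)"
      unfolding filterlim_at_split
    proof
      show "((\<lambda>h. flat_exp j h / h) \<longlongrightarrow> 0) (at_right 0)"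
        by (rule Lim_transform_eventually[OF flat_exp_tendsto_0[of "Suc j"]])
           (auto simp: eventually_at_right_field flat_exp_def intro!: exI[of _ 1])
      show "((\<lambda>h. flat_exp j h / h) \<longlongrightarrow> 0) (at_left 0)"
        by (rule tendsto_eventually) (auto simp: eventually_at_left_field flat_exp_def intro!: exI[of _ "-1"])
    qed
    then show ?thesis using 2 by (simp add: DERIV_def flat_exp_def)
  qed
qed

lemma smooth_open_flat_exp: "smooth_open UNIV (flat_exp j)"
proof -
  have "Ck_on k UNIV (flat_exp j)" for k
  proof (induction k arbitrary: j)
    case 0
    show ?case by (rule Ck_on_0_realI[OF flat_exp_has_derivative])
  next
    case (Suc k)
    have "Ck_on k UNIV (\<lambda>t. flat_exp (j + 2) t + (- real j) * flat_exp (j + 1) t)"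
      by (intro Ck_on_add Ck_on_bilinear[OF bounded_bilinear_mult] Ck_on_const Suc) auto
    then have "Ck_on k UNIV (\<lambda>t. flat_exp (j + 2) t - real j * flat_exp (j + 1) t)" by simp
    then show ?case by (intro Ck_on_Suc_realI[OF _ flat_exp_has_derivative]) auto
  qed
  then show ?thesis by (auto simp: smooth_open_iff_Ck simp del: Ck_on.simps)
qed

text \<open>The flatness of \<open>flat_exp\<close> at 0 makes
  \<open>flat_exp 0 (\<epsilon>\<^sup>2 - x \<bullet> x)\<close> smooth across the sphere of radius
  \<open>\<epsilon>\<close>; it is positive inside, so it can be normalized.\<close>

lemma mollifier_exists:
  assumes "\<epsilon> > 0"
  obtains \<rho> :: "'a::euclidean_space \<Rightarrow> real" where "smooth_open UNIV \<rho>" "\<And>x. \<rho> x \<ge> 0"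
    "\<And>x. norm x \<ge> \<epsilon> \<Longrightarrow> \<rho> x = 0" "integrable lborel \<rho>" "integral\<^sup>L lborel \<rho> = 1"
proof -
  define f where "f = (\<lambda>x::'a. flat_exp 0 (\<epsilon>\<^sup>2 - x \<bullet> x))"
  have sm: "smooth_open UNIV f"
    unfolding f_def
    by (rule smooth_open_compose[OF smooth_open_flat_exp])
       (auto intro!: smooth_open_diff smooth_open_const smooth_open_inner smooth_open_id)
  have zero: "f x = 0" if "norm x \<ge> \<epsilon>" for x
    using that assms power_mono[OF that, of 2] by (auto simp: f_def flat_exp_def simp flip: power2_norm_eq_inner)
  have nn: "f x \<ge> 0" for x by (simp add: f_def flat_exp_def)
  have cont: "continuous_on UNIV f" by (rule smooth_open_continuous[OF sm])
  have ind: "(\<lambda>x. indicator (cball 0 \<epsilon>) x *\<^sub>R f x) = f"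
    by (rule ext) (use zero in \<open>auto simp: indicator_def\<close>)
  have int: "integrable lborel f"
    using borel_integrable_compact[OF compact_cball continuous_on_subset[OF cont subset_UNIV], of 0 \<epsilon>] by (simp only: ind)
  have "integral\<^sup>L lborel f \<noteq> 0"
  proof
    assume "integral\<^sup>L lborel f = 0"
    then have "AE x in lborel. f x = 0" using integral_nonneg_eq_0_iff_AE[OF int] nn by simp
    moreover have "AE x in lborel. x \<in> ball 0 \<epsilon> \<longrightarrow> f x \<noteq> 0"
      by (rule AE_I2) (use assms in \<open>auto simp: f_def flat_exp_def power2_norm_eq_inner[symmetric] power2_le_iff_abs_le not_le abs_square_less_1 power_strict_mono\<close>)
    ultimately have "AE x in lborel. x \<notin> ball (0::'a) \<epsilon>" by eventually_elim auto
    then have "ball (0::'a) \<epsilon> \<in> null_sets lborel" by (simp add: AE_iff_null_sets)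
    then have "negligible (ball (0::'a) \<epsilon>)" by (simp add: negligible_iff_null_sets null_sets_completionI)
    then show False using open_not_negligible[of "ball (0::'a) \<epsilon>"] assms by auto
  qed
  then have pos: "integral\<^sup>L lborel f > 0"
    using Bochner_Integration.integral_nonneg[of lborel f] nn by (simp add: order_less_le)
  show thesis
  proof (rule that[of "\<lambda>x. (1 / integral\<^sup>L lborel f) * f x"])
    show "smooth_open UNIV (\<lambda>x. 1 / integral\<^sup>L lborel f * f x)"
      by (intro smooth_open_mult smooth_open_const sm) auto
  qed (use zero nn pos int in auto)
qed

section \<open>Weak partial derivatives\<close>

lemma integral_translate_lborel:
  fixes f :: "'a::euclidean_space \<Rightarrow> 'b::{banach, second_countable_topology}"
  assumes [measurable]: "f \<in> borel_measurable borel"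
  shows "(LBINT x. f (x + c)) = integral\<^sup>L lborel f"
proof -
  have "integral\<^sup>L (distr lborel borel ((+) c)) f = (LBINT x. f (c + x))"
    by (rule integral_distr) auto
  then show ?thesis by (simp add: lborel_distr_plus add.commute)
qed

lemma integrable_translate_lborel:
  fixes f :: "'a::euclidean_space \<Rightarrow> 'b::{banach, second_countable_topology}"
  assumes "integrable lborel f"
  shows "integrable lborel (\<lambda>x. f (x + c))"
proof -
  have [measurable]: "f \<in> borel_measurable borel" using assms by (simp add: borel_measurable_integrable)
  have "integrable (distr lborel borel ((+) c)) f \<longleftrightarrow> integrable lborel (\<lambda>x. f (c + x))"
    by (rule integrable_distr_eq) auto
  then show ?thesis using assms by (simp add: lborel_distr_plus add.commute)
qed

lemma integrable_bounded_support:
  fixes f :: "'a::euclidean_space \<Rightarrow> 'b::euclidean_space"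
  assumes [measurable]: "f \<in> borel_measurable borel" and "\<And>x. norm (f x) \<le> B" "\<And>x. norm x > r \<Longrightarrow> f x = 0"
  shows "integrable lborel f"
proof (rule Bochner_Integration.integrable_bound)
  show "integrable lborel (\<lambda>x::'a. B * indicator (cball 0 r) x :: real)" by (auto intro!: integrable_real_indicator emeasure_lborel_cball_finite)
  show "AE x in lborel. norm (f x) \<le> norm (B * indicator (cball 0 r) x)"
    using assms(2,3) by (auto simp: indicator_def intro: order_trans[OF _ abs_ge_self])
qed simp

lemma has_derivative_difference_quotient:
  assumes "(f has_derivative f') (at x)"
  shows "(\<lambda>k. real (Suc k) *\<^sub>R (f (x + (1 / real (Suc k)) *\<^sub>R v) - f x)) \<longlonglongrightarrow> f' v"
proof (cases "v = 0")
  case True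
  then show ?thesis using has_derivative_bounded_linear[OF assms] by (simp add: linear_simps)
next
  case False
  define h where "h = (\<lambda>k. (1 / real (Suc k)) *\<^sub>R v)"
  define d where "d = (\<lambda>k. norm (f (x + h k) - f x - f' (h k)) / norm (h k))"
  have lin: "linear f'" using assms by (rule has_derivative_linear)
  have "(\<lambda>k. 1 / real (Suc k)) \<longlonglongrightarrow> 0"
    using LIMSEQ_inverse_real_of_nat by (simp add: inverse_eq_divide)
  then have "h \<longlonglongrightarrow> 0 *\<^sub>R v" unfolding h_def by (rule tendsto_scaleR) simp
  then have "filterlim h (at 0) sequentially"
    using False by (intro filterlim_atI) (auto simp: h_def)
  moreover have "((\<lambda>h. norm (f (x + h) - f x - f' h) / norm h) \<longlongrightarrow> 0) (at 0)"
    using assms by (simp add: has_derivative_at)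
  ultimately have "d \<longlonglongrightarrow> 0" unfolding d_def by (rule filterlim_compose[rotated])
  then have "(\<lambda>k. norm v * d k) \<longlonglongrightarrow> norm v * 0" by (intro tendsto_intros)
  moreover have "norm (real (Suc k) *\<^sub>R (f (x + h k) - f x) - f' v) = norm v * d k" for k
  proof -
    have "f' v = real (Suc k) *\<^sub>R f' (h k)"
      unfolding h_def linear_cmul[OF lin] by simp
    then have "norm (real (Suc k) *\<^sub>R (f (x + h k) - f x) - f' v) = real (Suc k) * norm (f (x + h k) - f x - f' (h k))"
      by (simp only: scaleR_diff_right[symmetric] norm_scaleR abs_of_nat)
    also have "\<dots> = norm v * d k" using False by (simp add: d_def h_def)
    finally show ?thesis .
  qed
  ultimately show ?thesis
    by (subst Lim_null, subst tendsto_norm_zero_iff[symmetric]) (simp add: h_def)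
qed

lemma compact_image_bound:
  fixes f :: "'a::topological_space \<Rightarrow> 'b::real_normed_vector"
  assumes "compact K" "continuous_on K f"
  obtains C where "C \<ge> 0" "\<And>x. x \<in> K \<Longrightarrow> norm (f x) \<le> C"
proof -
  have "bounded (f ` K)" by (intro compact_imp_bounded compact_continuous_image assms)
  then obtain C where C: "\<And>x. x \<in> K \<Longrightarrow> norm (f x) \<le> C" by (auto simp: bounded_iff)
  have "norm (f x) \<le> \<bar>C\<bar>" if "x \<in> K" for x using C[OF that] by linarith
  then show thesis using that[of "\<bar>C\<bar>"] by simp
qed

text \<open>Every difference quotient of \<open>f\<close> has integral 0 by translation invariance.
  The quotients are bounded by the Lipschitz constant and supported in a slightly larger ball, so
  dominated convergence passes to the derivative.\<close>

lemma integral_derivative_compact_support: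
  fixes f :: "'a::euclidean_space \<Rightarrow> 'b::euclidean_space"
  assumes der: "\<And>x. (f has_derivative f' x) (at x)"
    and cont: "\<And>v. continuous_on UNIV (\<lambda>x. f' x v)"
    and supp: "\<And>x. norm x > r \<Longrightarrow> f x = 0"
  shows "(LBINT x. f' x v) = 0"
proof -
  obtain B where B: "B > 0" "B-lipschitz_on UNIV f"
    using compact_support_C1_bounded[OF assms] by metis
  have cf: "continuous_on UNIV f" using lipschitz_on_continuous_on[OF B(2)] .
  have [measurable]: "f \<in> borel_measurable borel" by (rule borel_measurable_continuous_onI[OF cf])
  have [measurable]: "(\<lambda>x. f' x v) \<in> borel_measurable borel" by (rule borel_measurable_continuous_onI[OF cont])
  define q where "q = (\<lambda>k x. real (Suc k) *\<^sub>R (f (x + (1 / real (Suc k)) *\<^sub>R v) - f x))"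
  have q_bound: "norm (q k x) \<le> B * norm v" for k x
  proof -
    have "norm (f (x + (1 / real (Suc k)) *\<^sub>R v) - f x) \<le> B * norm ((1 / real (Suc k)) *\<^sub>R v)"
      using lipschitz_onD[OF B(2), of "x + (1 / real (Suc k)) *\<^sub>R v" x] by (simp add: dist_norm)
    then have "real (Suc k) * norm (f (x + (1 / real (Suc k)) *\<^sub>R v) - f x) \<le> real (Suc k) * (B * norm ((1 / real (Suc k)) *\<^sub>R v))"
      by (rule mult_left_mono) simp
    also have "\<dots> = B * norm v" by simp
    finally show ?thesis by (simp add: q_def)
  qed
  have q_supp: "q k x = 0" if "norm x > r + norm v" for k x
  proof -
    have "norm ((1 / real (Suc k)) *\<^sub>R v) \<le> norm v"
      using mult_right_mono[of "1 / real (Suc k)" 1 "norm v"] by (simp add: divide_simps)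
    moreover have "norm x \<le> norm (x + (1 / real (Suc k)) *\<^sub>R v) + norm ((1 / real (Suc k)) *\<^sub>R v)"
      using norm_triangle_ineq4[of "x + (1 / real (Suc k)) *\<^sub>R v" "(1 / real (Suc k)) *\<^sub>R v"] by simp
    ultimately have "norm (x + (1 / real (Suc k)) *\<^sub>R v) > r" "norm x > r" using that norm_ge_zero[of v] by linarith+
    then show ?thesis by (simp add: q_def supp)
  qed
  obtain C where C: "C \<ge> 0" "\<And>x. x \<in> cball 0 r \<Longrightarrow> norm (f x) \<le> C"
    using compact_image_bound[OF compact_cball continuous_on_subset[OF cf subset_UNIV]] by metis
  have intf: "integrable lborel f"
  proof (rule integrable_bounded_support[where r=r])
    show "norm (f x) \<le> C" for x
      using C(1) C(2)[of x] supp[of x] by (cases "norm x \<le> r") auto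
  qed (use supp in auto)
  have "integral\<^sup>L lborel (q k) = 0" for k
    unfolding q_def using integral_translate_lborel[of f "(1 / real (Suc k)) *\<^sub>R v"] integrable_translate_lborel[OF intf] intf
    by simp
  moreover have "(\<lambda>k. integral\<^sup>L lborel (q k)) \<longlonglongrightarrow> (LBINT x. f' x v)"
  proof (rule integral_dominated_convergence)
    show "integrable lborel (\<lambda>x::'a. B * norm v * indicator (cball 0 (r + norm v)) x :: real)"
      by (auto intro!: integrable_real_indicator emeasure_lborel_cball_finite)
    show "AE x in lborel. (\<lambda>k. q k x) \<longlonglongrightarrow> f' x v"
      unfolding q_def by (intro AE_I2 has_derivative_difference_quotient der)
    show "AE x in lborel. norm (q k x) \<le> B * norm v * indicator (cball 0 (r + norm v)) x" for k
      using q_bound[of k] q_supp[of _ k] by (intro AE_I2) (auto simp: indicator_def not_le)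
  qed (auto simp: q_def)
  ultimately show ?thesis by (simp add: LIMSEQ_const_iff)
qed

lemma test_funD:
  fixes A :: "'a::euclidean_space set"
  assumes "test_fun A \<phi>"
  shows "(\<phi> has_derivative frechet_derivative \<phi> (at x)) (at x)"
    "continuous_on UNIV (\<lambda>x. frechet_derivative \<phi> (at x) v)"
    "continuous_on UNIV \<phi>"
    "x \<notin> closure {x. \<phi> x \<noteq> 0} \<Longrightarrow> \<phi> x = 0"
    "x \<notin> closure {x. \<phi> x \<noteq> 0} \<Longrightarrow> frechet_derivative \<phi> (at x) v = 0"
    "x \<notin> A \<Longrightarrow> \<phi> x = 0" "x \<notin> A \<Longrightarrow> frechet_derivative \<phi> (at x) v = 0"
proof -
  have sm: "smooth_open UNIV \<phi>" using assms by (simp add: test_fun_def)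
  show "(\<phi> has_derivative frechet_derivative \<phi> (at x)) (at x)" for x
    by (rule smooth_open_has_derivative[OF sm]) simp
  show "continuous_on UNIV (\<lambda>x. frechet_derivative \<phi> (at x) v)" for v
    by (rule smooth_open_continuous_derivative[OF sm])
  show "continuous_on UNIV \<phi>" by (rule smooth_open_continuous[OF sm])
  show z: "\<phi> x = 0" if "x \<notin> closure {x. \<phi> x \<noteq> 0}" for x
    using that closure_subset[of "{x. \<phi> x \<noteq> 0}"] by auto
  show z': "frechet_derivative \<phi> (at x) v = 0" if "x \<notin> closure {x. \<phi> x \<noteq> 0}" for x v
  proof -
    have "frechet_derivative \<phi> (at x) = frechet_derivative (\<lambda>x. 0) (at x)"
    proof (rule frechet_derivative_cong_open[of "- closure {x. \<phi> x \<noteq> 0}"])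
      fix y assume "y \<in> - closure {x. \<phi> x \<noteq> 0}"
      then have "y \<notin> closure {x. \<phi> x \<noteq> 0}" by blast
      then show "\<phi> y = 0" by (rule z)
    qed (use that in blast)+
    then show ?thesis by simp
  qed
  have "closure {x. \<phi> x \<noteq> 0} \<subseteq> A" using assms by (simp add: test_fun_def)
  then have nA: "x \<notin> closure {x. \<phi> x \<noteq> 0}" if "x \<notin> A" for x using that by blast
  show "\<phi> x = 0" if "x \<notin> A" for x by (rule z[OF nA[OF that]])
  show "frechet_derivative \<phi> (at x) v = 0" if "x \<notin> A" for x v by (rule z'[OF nA[OF that]])
qed

lemma test_fun_bounds:
  fixes A :: "'a::euclidean_space set"
  assumes "test_fun A \<phi>"
  obtains B r where "B > 0" "\<And>x v. norm (frechet_derivative \<phi> (at x) v) \<le> B * norm v" "B-lipschitz_on UNIV \<phi>"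
    "\<And>x. norm x > r \<Longrightarrow> \<phi> x = 0" "\<And>x v. norm x > r \<Longrightarrow> frechet_derivative \<phi> (at x) v = 0" "\<And>x. \<bar>\<phi> x\<bar> \<le> B"
proof -
  have "compact (closure {x. \<phi> x \<noteq> 0})" using assms by (simp add: test_fun_def)
  then obtain r where r: "\<And>x. x \<in> closure {x. \<phi> x \<noteq> 0} \<Longrightarrow> norm x \<le> r"
    using compact_imp_bounded bounded_iff by metis
  have z: "\<phi> x = 0" if "norm x > r" for x using test_funD(4)[OF assms, of x] r[of x] that by force
  obtain B where B: "B > 0" "\<And>x v. norm (frechet_derivative \<phi> (at x) v) \<le> B * norm v" "B-lipschitz_on UNIV \<phi>"
    "\<And>x v. norm x > r \<Longrightarrow> frechet_derivative \<phi> (at x) v = 0"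
    using compact_support_C1_bounded[OF test_funD(1)[OF assms] test_funD(2)[OF assms] z] by metis
  obtain C where C: "C \<ge> 0" "\<And>x. x \<in> cball 0 r \<Longrightarrow> norm (\<phi> x) \<le> C"
    using compact_image_bound[OF compact_cball continuous_on_subset[OF test_funD(3)[OF assms] subset_UNIV]] by metis
  have C': "\<bar>\<phi> x\<bar> \<le> \<bar>C\<bar>" for x using C(1) C(2)[of x] z[of x] by (cases "norm x \<le> r") auto
  show thesis
  proof (rule that[of "max B \<bar>C\<bar>" r])
    show "norm (frechet_derivative \<phi> (at x) v) \<le> max B \<bar>C\<bar> * norm v" for x v
      by (rule order_trans[OF B(2)]) (simp add: mult_right_mono)
    show "(max B \<bar>C\<bar>)-lipschitz_on UNIV \<phi>" by (rule lipschitz_on_mono[OF B(3)]) auto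
    show "\<bar>\<phi> x\<bar> \<le> max B \<bar>C\<bar>" for x using C'[of x] by simp
  qed (use B z in auto)
qed

lemma test_fun_measurable:
  fixes A :: "'a::euclidean_space set"
  assumes "test_fun A \<phi>"
  shows "\<phi> \<in> borel_measurable borel" "(\<lambda>x. frechet_derivative \<phi> (at x) v) \<in> borel_measurable borel"
  using test_funD(2,3)[OF assms] by (auto intro: borel_measurable_continuous_onI)

text \<open>For Borel functions the completed measure and \<open>lborel\<close> give the same
  integrals, and the indicator of \<open>A\<close> is absorbed by the test function, which vanishes
  off \<open>A\<close> together with its derivative.\<close>

lemma weak_partial_lborel_iff:
  fixes u g :: "'a::euclidean_space \<Rightarrow> 'b::euclidean_space"
  assumes [measurable]: "u \<in> borel_measurable borel" "g \<in> borel_measurable borel"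
  shows "weak_partial A i u g \<longleftrightarrow> (\<forall>\<phi>. test_fun A \<phi> \<longrightarrow>
     (LBINT x. frechet_derivative \<phi> (at x) i *\<^sub>R u x) = - (LBINT x. \<phi> x *\<^sub>R g x))"
proof -
  have "set_lebesgue_integral lebesgue A (\<lambda>x. frechet_derivative \<phi> (at x) i *\<^sub>R u x) = (LBINT x. frechet_derivative \<phi> (at x) i *\<^sub>R u x)
     \<and> set_lebesgue_integral lebesgue A (\<lambda>x. \<phi> x *\<^sub>R g x) = (LBINT x. \<phi> x *\<^sub>R g x)" if t: "test_fun A \<phi>" for \<phi>
  proof -
    note [measurable] = test_fun_measurable[OF t]
    have "(\<lambda>x. indicator A x *\<^sub>R (frechet_derivative \<phi> (at x) i *\<^sub>R u x)) = (\<lambda>x. frechet_derivative \<phi> (at x) i *\<^sub>R u x)"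
      "(\<lambda>x. indicator A x *\<^sub>R (\<phi> x *\<^sub>R g x)) = (\<lambda>x. \<phi> x *\<^sub>R g x)"
      by (rule ext, use test_funD(6,7)[OF t] in \<open>auto simp: indicator_def\<close>)+
    then show ?thesis
      unfolding set_lebesgue_integral_def by (simp add: integral_completion)
  qed
  then show ?thesis unfolding weak_partial_def by (metis (no_types, lifting))
qed

text \<open>The product of \<open>u\<close> with a test function is C1 on the whole space after
  extension by zero, and the integral of its derivative is 0.\<close>

lemma weak_partial_C1:
  fixes u :: "'a::euclidean_space \<Rightarrow> 'b::euclidean_space"
  assumes A: "open A" and [measurable]: "u \<in> borel_measurable borel" "(\<lambda>x. u' x i) \<in> borel_measurable borel"
    and der: "\<And>x. x \<in> A \<Longrightarrow> (u has_derivative u' x) (at x)"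
    and cont: "\<And>v. continuous_on A (\<lambda>x. u' x v)"
    and int: "\<And>\<phi>. test_fun A \<phi> \<Longrightarrow> integrable lborel (\<lambda>x. \<phi> x *\<^sub>R u' x i)"
     "\<And>\<phi>. test_fun A \<phi> \<Longrightarrow> integrable lborel (\<lambda>x. frechet_derivative \<phi> (at x) i *\<^sub>R u x)"
  shows "weak_partial A i u (\<lambda>x. u' x i)"
  unfolding weak_partial_lborel_iff[OF assms(2,3)]
proof (intro allI impI)
  fix \<phi> assume t: "test_fun A \<phi>"
  obtain B r where r: "\<And>x. norm x > r \<Longrightarrow> \<phi> x = 0" using test_fun_bounds[OF t] by metis
  define K where "K = closure {x. \<phi> x \<noteq> 0}"
  have K: "K \<subseteq> A" "closed K" using t by (auto simp: K_def test_fun_def)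
  have zK: "\<phi> x = 0" "frechet_derivative \<phi> (at x) v = 0" if "x \<in> - K" for x v
  proof -
    have "x \<notin> closure {x. \<phi> x \<noteq> 0}" using that unfolding K_def by blast
    then show "\<phi> x = 0" "frechet_derivative \<phi> (at x) v = 0" by (rule test_funD[OF t])+
  qed
  have AK: "A \<union> - K = UNIV" "open (- K)" using K by (auto simp: open_Compl)
  define f where "f = (\<lambda>x. \<phi> x *\<^sub>R u x)"
  define f' where "f' = (\<lambda>x v. frechet_derivative \<phi> (at x) v *\<^sub>R u x + \<phi> x *\<^sub>R u' x v)"
  have f'K: "f' x v = 0" if "x \<in> - K" for x v using zK[OF that] by (simp add: f'_def)
  have cu: "continuous_on A u"
    using der by (meson continuous_at_imp_continuous_on has_derivative_continuous)
  have "(f has_derivative f' x) (at x)" for x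
  proof (cases "x \<in> A")
    case True
    show ?thesis unfolding f_def f'_def
      by (auto intro!: derivative_eq_intros der[OF True] test_funD(1)[OF t])
  next
    case False
    then have "x \<in> - K" using K by auto
    then have "f' x = (\<lambda>v. 0)" using f'K by auto
    moreover have "(f has_derivative (\<lambda>v. 0)) (at x)"
      by (rule has_derivative_transform_within_open[of "\<lambda>_. 0" _ _ _ "- K"]) (use \<open>x \<in> - K\<close> AK zK in \<open>auto simp: f_def\<close>)
    ultimately show ?thesis by simp
  qed
  moreover have "continuous_on UNIV (\<lambda>x. f' x v)" for v
  proof -
    have "continuous_on A (\<lambda>x. f' x v)" unfolding f'_def
      by (intro continuous_intros continuous_on_subset[OF test_funD(2)[OF t]] continuous_on_subset[OF test_funD(3)[OF t]] cu cont) auto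
    moreover have "continuous_on (- K) (\<lambda>x. f' x v)"
      using continuous_on_cong[of "-K" "-K" "\<lambda>x. f' x v" "\<lambda>x. 0"] f'K by simp
    ultimately show ?thesis using continuous_on_open_Un[OF A AK(2)] AK(1) by metis
  qed
  moreover have "f x = 0" if "norm x > r" for x using r[OF that] by (simp add: f_def)
  ultimately have "(LBINT x. f' x i) = 0" by (rule integral_derivative_compact_support)
  then show "(LBINT x. frechet_derivative \<phi> (at x) i *\<^sub>R u x) = - (LBINT x. \<phi> x *\<^sub>R u' x i)"
    using int[OF t] by (simp add: f'_def eq_neg_iff_add_eq_0)
qed

text \<open>Dominated convergence in both sides of the defining identity. It serves to remove the
  truncation of the oscillation near the singular ray.\<close>

lemma weak_partial_limit:
  fixes u :: "nat \<Rightarrow> 'a::euclidean_space \<Rightarrow> 'b::euclidean_space"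
  assumes [measurable]: "\<And>m. u m \<in> borel_measurable borel" "\<And>m. g m \<in> borel_measurable borel"
      "u' \<in> borel_measurable borel" "g' \<in> borel_measurable borel" "A \<in> sets borel"
    and w: "\<And>m. weak_partial A i (u m) (g m)"
    and lim: "AE x in lborel. x \<in> A \<longrightarrow> (\<lambda>m. u m x) \<longlonglongrightarrow> u' x"
       "AE x in lborel. x \<in> A \<longrightarrow> (\<lambda>m. g m x) \<longlonglongrightarrow> g' x"
    and dom: "integrable lborel (\<lambda>x. indicator A x * M x)"
       "\<And>m. AE x in lborel. x \<in> A \<longrightarrow> norm (u m x) \<le> M x"
       "\<And>m. AE x in lborel. x \<in> A \<longrightarrow> norm (g m x) \<le> M x"
  shows "weak_partial A i u' g'"
  unfolding weak_partial_lborel_iff[OF assms(3,4)]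
proof (intro allI impI)
  fix \<phi> assume t: "test_fun A \<phi>"
  note [measurable] = test_fun_measurable[OF t]
  obtain B where B: "B > 0" "\<And>x v. norm (frechet_derivative \<phi> (at x) v) \<le> B * norm v" "\<And>x. \<bar>\<phi> x\<bar> \<le> B"
    using test_fun_bounds[OF t] by metis
  have general: "(\<lambda>m. (LBINT x. \<psi> x *\<^sub>R h m x)) \<longlonglongrightarrow> (LBINT x. \<psi> x *\<^sub>R h' x)"
    if [measurable]: "\<psi> \<in> borel_measurable borel" "\<And>m. h m \<in> borel_measurable borel" "h' \<in> borel_measurable borel"
      and "\<And>x. x \<notin> A \<Longrightarrow> \<psi> x = 0" "\<And>x. \<bar>\<psi> x\<bar> \<le> C" "AE x in lborel. x \<in> A \<longrightarrow> (\<lambda>m. h m x) \<longlonglongrightarrow> h' x"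
       "\<And>m. AE x in lborel. x \<in> A \<longrightarrow> norm (h m x) \<le> M x" for \<psi> and h :: "nat \<Rightarrow> 'a \<Rightarrow> 'b" and h' C
  proof (rule integral_dominated_convergence)
    show "integrable lborel (\<lambda>x. C * (indicator A x * M x))" using dom(1) by simp
    show "AE x in lborel. (\<lambda>m. \<psi> x *\<^sub>R h m x) \<longlonglongrightarrow> \<psi> x *\<^sub>R h' x"
      using that(6)
    proof eventually_elim
      case (elim x)
      then show ?case using that(4)[of x] by (cases "x \<in> A") (auto intro: tendsto_scaleR)
    qed
    show "AE x in lborel. norm (\<psi> x *\<^sub>R h m x) \<le> C * (indicator A x * M x)" for m
      using that(7)[of m]
    proof eventually_elim
      case (elim x)
      then show ?case using that(4,5)[of x] by (cases "x \<in> A") (auto intro!: mult_mono)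
    qed
  qed auto
  have 1: "(\<lambda>m. (LBINT x. frechet_derivative \<phi> (at x) i *\<^sub>R u m x)) \<longlonglongrightarrow> (LBINT x. frechet_derivative \<phi> (at x) i *\<^sub>R u' x)"
    by (rule general[where C="B * norm i"]) (use B(2) test_funD(7)[OF t] lim dom in auto)
  have 2: "(\<lambda>m. (LBINT x. \<phi> x *\<^sub>R g m x)) \<longlonglongrightarrow> (LBINT x. \<phi> x *\<^sub>R g' x)"
    by (rule general[where C=B]) (use B(3) test_funD(6)[OF t] lim dom in auto)
  have "(LBINT x. frechet_derivative \<phi> (at x) i *\<^sub>R u m x) = - (LBINT x. \<phi> x *\<^sub>R g m x)" for m
    using w[of m, unfolded weak_partial_lborel_iff[OF assms(1,2)]] t by blast
  then show "(LBINT x. frechet_derivative \<phi> (at x) i *\<^sub>R u' x) = - (LBINT x. \<phi> x *\<^sub>R g' x)"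
    using LIMSEQ_unique[OF 1] tendsto_minus[OF 2] by simp
qed

text \<open>Midpoints, rather than all convex combinations, are enough for the parallelogram law,
  and bounds and measurability pass through them by a plain induction.\<close>

inductive_set midpoint_closure :: "('a \<Rightarrow> 'b::real_vector) set \<Rightarrow> ('a \<Rightarrow> 'b) set" for E where
  base: "h \<in> E \<Longrightarrow> h \<in> midpoint_closure E"
| mid: "h \<in> midpoint_closure E \<Longrightarrow> k \<in> midpoint_closure E \<Longrightarrow> (\<lambda>x. (1/2) *\<^sub>R (h x + k x)) \<in> midpoint_closure E"

lemma midpoint_closure_mono: "E \<subseteq> F \<Longrightarrow> midpoint_closure E \<subseteq> midpoint_closure F"
proof
  fix h assume "h \<in> midpoint_closure E" "E \<subseteq> F"
  then show "h \<in> midpoint_closure F"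
    by (induction rule: midpoint_closure.induct) (auto intro: midpoint_closure.intros)
qed

lemma norm_midpoint_le:
  fixes a b :: "'b::real_normed_vector"
  assumes "norm a \<le> r" "norm b \<le> r"
  shows "norm ((1/2) *\<^sub>R (a + b)) \<le> r"
  using norm_triangle_ineq[of a b] assms by simp

text \<open>A Mazur-type lemma: nearly norm-minimal elements of the midpoint hulls of the tails are
  Cauchy by the parallelogram law, which replaces weak compactness in \<open>L\<^sup>2\<close>.\<close>

lemma bounded_sequence_midpoints_converge:
  fixes E :: "nat \<Rightarrow> 'a::euclidean_space \<Rightarrow> 'b::euclidean_space"
  assumes [measurable]: "\<And>k. E k \<in> borel_measurable borel" and A[measurable]: "A \<in> sets borel" "emeasure lborel A < \<infinity>"
    and bound: "\<And>k x. norm (E k x) \<le> L" and supp: "\<And>k x. x \<notin> A \<Longrightarrow> E k x = 0"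
  obtains h g m where "\<And>j. h j \<in> midpoint_closure (E ` {m j..})" "\<And>j. m j \<ge> (j::nat)"
     "g \<in> borel_measurable borel" "AE x in lborel. (\<lambda>j. h j x) \<longlonglongrightarrow> g x"
proof -
  define X where "X = (\<lambda>m. midpoint_closure (E ` {m..}))"
  have X_mono: "X m \<subseteq> X l" if "l \<le> m" for l m
    unfolding X_def using that by (intro midpoint_closure_mono) auto
  have X_props: "h \<in> borel_measurable borel \<and> (\<forall>x. norm (h x) \<le> L) \<and> (\<forall>x. x \<notin> A \<longrightarrow> h x = 0)" if "h \<in> X m" for h m
    using that unfolding X_def
  proof (induction rule: midpoint_closure.induct)
    case (base h)
    then show ?case using bound supp by auto
  next
    case (mid h k)
    then have "norm ((1/2) *\<^sub>R (h x + k x)) \<le> L" for x by (intro norm_midpoint_le) auto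
    moreover have "(\<lambda>x. (1/2) *\<^sub>R (h x + k x)) \<in> borel_measurable borel" using mid by (intro borel_measurable_scaleR borel_measurable_add borel_measurable_const) auto
    ultimately show ?case using mid by (simp del: scaleR_add_right)
  qed
  have L0: "L \<ge> 0" using bound[of 0 0] norm_ge_zero order_trans by blast
  have int2: "integrable lborel (\<lambda>x. (norm (h x))\<^sup>2)" "integrable lborel h" if "h \<in> X m" for h m
  proof -
    note p = X_props[OF that]
    have [measurable]: "h \<in> borel_measurable borel" using p by simp
    have "integrable lborel (\<lambda>x. L * indicator A x :: real)" "integrable lborel (\<lambda>x. L\<^sup>2 * indicator A x :: real)"
      using A by (auto intro!: integrable_real_indicator)
    note i = this
    show "integrable lborel (\<lambda>x. (norm (h x))\<^sup>2)"
      by (rule Bochner_Integration.integrable_bound[OF i(2)]) (use p L0 in \<open>auto simp: indicator_def power_mono\<close>)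
    show "integrable lborel h"
      by (rule Bochner_Integration.integrable_bound[OF i(1)]) (use p L0 in \<open>auto simp: indicator_def\<close>)
  qed
  define N where "N = (\<lambda>h::'a \<Rightarrow> 'b. (LBINT x. (norm (h x))\<^sup>2))"
  have N0: "N h \<ge> 0" for h by (simp add: N_def)
  have E_X: "E m \<in> X m" for m by (auto simp: X_def intro: midpoint_closure.base)
  \<comment> \<open>The least energy over the hull of the m-th tail. It increases with
    \<open>m\<close> and is bounded, so for late tails it comes close to its supremum
    \<open>D\<close>.\<close>
  define d where "d = (\<lambda>m. Inf (N ` X m))"
  have bb: "bdd_below (N ` X m)" for m using N0 by (auto intro: bdd_belowI[of _ 0])
  have d_le: "d m \<le> N h" if "h \<in> X m" for h m unfolding d_def using that bb by (auto intro: cInf_lower)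
  have d_mono: "d l \<le> d m" if "l \<le> m" for l m
    unfolding d_def using X_mono[OF that] bb[of l] E_X[of m] by (intro cInf_superset_mono) auto
  have d_bd: "d m \<le> L\<^sup>2 * measure lborel A" for m
  proof -
    have "N (E m) \<le> (LBINT x. L\<^sup>2 * indicator A x)" unfolding N_def
    proof (rule integral_mono)
      show "integrable lborel (\<lambda>x. L\<^sup>2 * indicator A x :: real)" using A by (auto intro!: integrable_real_indicator)
      show "(norm (E m x))\<^sup>2 \<le> L\<^sup>2 * indicator A x" for x
        using bound[of m x] supp[of x m] L0 by (auto simp: indicator_def power_mono)
    qed (use int2 E_X in blast)
    then show ?thesis using d_le[OF E_X[of m]] A by simp
  qed
  define D where "D = Sup (range d)"
  have bd: "bdd_above (range d)" using d_bd by (intro bdd_aboveI) auto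
  have d_D: "d m \<le> D" for m unfolding D_def using bd by (auto intro: cSup_upper)
  have "\<exists>m\<ge>j. d m \<ge> D - 1 / real (Suc j)" for j
  proof -
    have "D - 1 / real (Suc j) < D" by simp
    then obtain m where "d m > D - 1 / real (Suc j)" unfolding D_def using less_cSup_iff[OF _ bd] by auto
    then show ?thesis using d_mono[of m "max m j"] by (intro exI[of _ "max m j"]) auto
  qed
  then obtain m where m: "\<And>j. m j \<ge> j" "\<And>j. d (m j) \<ge> D - 1 / real (Suc j)" by metis
  have "\<exists>h\<in>X (m j). N h < D + 1 / real (Suc j)" for j
  proof -
    have "d (m j) < D + 1 / real (Suc j)" using d_D[of "m j"] by (simp add: add_strict_increasing2 add.commute order_le_less_trans)
    then have "\<exists>y\<in>N ` X (m j). y < D + 1 / real (Suc j)"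
      unfolding d_def using E_X[of "m j"] by (intro cInf_lessD) auto
    then show ?thesis by blast
  qed
  then obtain h where h: "\<And>j. h j \<in> X (m j)" "\<And>j. N (h j) < D + 1 / real (Suc j)" by metis
  \<comment> \<open>The midpoint of \<open>h i\<close> and \<open>h j\<close> still lies in an
    admissible hull, so its energy is at least \<open>D - 1/(n+1)\<close>, while both energies are
    at most \<open>D + 1/(n+1)\<close>. The parallelogram law leaves 8/(n+1).\<close>
  have cauchy2: "(LBINT x. (norm (h i x - h j x))\<^sup>2) \<le> 8 / real (Suc n) \<and> integrable lborel (\<lambda>x. (norm (h i x - h j x))\<^sup>2)"
    if "n \<le> i" "n \<le> j" for i j n
  proof -
    define l where "l = min (m i) (m j)"
    have hl: "h i \<in> X l" "h j \<in> X l" using h(1)[of i] h(1)[of j] X_mono[of l "m i"] X_mono[of l "m j"] by (auto simp: l_def)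
    have mem: "(\<lambda>x. (1/2) *\<^sub>R (h i x + h j x)) \<in> X l"
      using hl unfolding X_def by (rule midpoint_closure.mid)
    have par: "(norm (h i x - h j x))\<^sup>2 = 2 * (norm (h i x))\<^sup>2 + 2 * (norm (h j x))\<^sup>2 - 4 * (norm ((1/2) *\<^sub>R (h i x + h j x)))\<^sup>2" for x
      by (simp only: power2_norm_eq_inner) (simp add: algebra_simps inner_commute)
    have "(LBINT x. (norm (h i x - h j x))\<^sup>2) = 2 * N (h i) + 2 * N (h j) - 4 * N (\<lambda>x. (1/2) *\<^sub>R (h i x + h j x))"
      unfolding par N_def using int2(1)[OF hl(1)] int2(1)[OF hl(2)] int2(1)[OF mem]
      by (simp del: norm_scaleR)
    moreover have "N (\<lambda>x. (1/2) *\<^sub>R (h i x + h j x)) \<ge> D - 1 / real (Suc n)"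
    proof -
      have "1 / real (Suc i) \<le> 1 / real (Suc n)" "1 / real (Suc j) \<le> 1 / real (Suc n)" using that by (auto simp: frac_le)
      then have "d l \<ge> D - 1 / real (Suc n)" using m(2)[of i] m(2)[of j] by (auto simp: l_def min_def)
      then show ?thesis using d_le[OF mem] by linarith
    qed
    moreover have "N (h i) \<le> D + 1 / real (Suc n)" "N (h j) \<le> D + 1 / real (Suc n)"
    proof -
      have "1 / real (Suc i) \<le> 1 / real (Suc n)" "1 / real (Suc j) \<le> 1 / real (Suc n)" using that by (auto simp: frac_le)
      then show "N (h i) \<le> D + 1 / real (Suc n)" "N (h j) \<le> D + 1 / real (Suc n)" using h(2)[of i] h(2)[of j] by linarith+
    qed
    moreover have "integrable lborel (\<lambda>x. (norm (h i x - h j x))\<^sup>2)"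
      unfolding par using int2(1)[OF hl(1)] int2(1)[OF hl(2)] int2(1)[OF mem]
      by (simp del: norm_scaleR)
    moreover have "8 / real (Suc n) = 8 * (1 / real (Suc n))" by simp
    ultimately show ?thesis by linarith
  qed
  \<comment> \<open>From mean square to mean: \<open>t \<le> \<eta> + t\<^sup>2 / \<eta>\<close> on
    the set \<open>A\<close> of finite measure, with \<open>\<eta>\<close> chosen so that the first
    part integrates to less than \<open>e / 2\<close>. An L1-Cauchy sequence has an almost
    everywhere Cauchy subsequence.\<close>
  have "\<exists>n. \<forall>i\<ge>n. \<forall>j\<ge>n. (LBINT x. norm (h i x - h j x)) < e" if "e > 0" for e
  proof -
    define \<eta> where "\<eta> = (e / 2) / (measure lborel A + 1)"
    have mA: "measure lborel A + 1 > 0" by (simp add: add_nonneg_pos)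
    then have "\<eta> > 0" using that by (simp add: \<eta>_def)
    moreover have "\<eta> * (measure lborel A + 1) = e / 2"
      by (rule nonzero_eq_divide_eq[THEN iffD1]) (use mA in \<open>auto simp: \<eta>_def\<close>)
    ultimately have \<eta>: "\<eta> > 0" "\<eta> * measure lborel A < e / 2" by (auto simp: algebra_simps)
    obtain n where n: "real n > 16 / (\<eta> * e)" using reals_Archimedean2 by blast
    show ?thesis
    proof (intro exI[of _ n] allI impI)
      fix i j assume ij: "i \<ge> n" "j \<ge> n"
      note c = cauchy2[OF ij]
      have pi: "h i \<in> borel_measurable borel" "h j \<in> borel_measurable borel" "x \<notin> A \<Longrightarrow> h i x = 0 \<and> h j x = 0" for x
        using X_props[OF h(1)] by auto
      have "(LBINT x. norm (h i x - h j x)) \<le> (LBINT x. \<eta> * indicator A x + (1/\<eta>) * (norm (h i x - h j x))\<^sup>2)"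
      proof (rule integral_mono)
        show "integrable lborel (\<lambda>x. norm (h i x - h j x))" using int2(2)[OF h(1)] by auto
        show "integrable lborel (\<lambda>x. \<eta> * indicator A x + 1 / \<eta> * (norm (h i x - h j x))\<^sup>2)"
          using c A by (auto intro!: integrable_real_indicator)
        show "norm (h i x - h j x) \<le> \<eta> * indicator A x + 1 / \<eta> * (norm (h i x - h j x))\<^sup>2" for x
        proof (cases "x \<in> A")
          case True
          let ?t = "norm (h i x - h j x)"
          have "?t \<le> \<eta> + ?t\<^sup>2 / \<eta>"
          proof (cases "?t \<le> \<eta>")
            case False
            then have "?t * \<eta> \<le> ?t * ?t" using \<eta> by (intro mult_left_mono) auto
            then have "?t \<le> ?t\<^sup>2 / \<eta>" using \<eta> by (simp add: field_simps power2_eq_square)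
            then show ?thesis using \<eta> by linarith
          qed (use \<eta> in \<open>simp add: add_increasing2\<close>)
          then show ?thesis using True by simp
        qed (use pi in simp)
      qed
      also have "\<dots> = \<eta> * measure lborel A + (1/\<eta>) * (LBINT x. (norm (h i x - h j x))\<^sup>2)"
        using c A by (simp add: integrable_real_indicator)
      also have "\<dots> \<le> \<eta> * measure lborel A + (1/\<eta>) * (8 / real (Suc n))"
        using c \<eta> by (intro add_left_mono mult_left_mono) auto
      also have "(1/\<eta>) * (8 / real (Suc n)) < e / 2"
      proof -
        have "16 / (\<eta> * e) < real (Suc n)" using n by simp
        then have "16 < real (Suc n) * (\<eta> * e)" using \<eta> that by (simp add: pos_divide_less_eq del: of_nat_Suc)
        then show ?thesis using \<eta> that by (simp add: field_simps del: of_nat_Suc)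
      qed
      finally show "(LBINT x. norm (h i x - h j x)) < e" using \<eta> by simp
    qed
  qed
  then obtain r where r: "strict_mono r" "AE x in lborel. Cauchy (\<lambda>i. h (r i) x)"
    using cauchy_L1_AE_cauchy_subseq[of lborel h] int2(2)[OF h(1)] by metis
  show thesis
  proof (rule that[of "\<lambda>j. h (r j)" "\<lambda>j. m (r j)" "\<lambda>x. lim (\<lambda>j. h (r j) x)"])
    show "h (r j) \<in> midpoint_closure (E ` {m (r j)..})" for j using h(1) by (simp add: X_def)
    show "j \<le> m (r j)" for j using m(1)[of "r j"] seq_suble[OF r(1), of j] by linarith
    have [measurable]: "h j \<in> borel_measurable borel" for j using X_props[OF h(1)] by simp
    show "(\<lambda>x. lim (\<lambda>j. h (r j) x)) \<in> borel_measurable borel" by measurable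
    show "AE x in lborel. (\<lambda>j. h (r j) x) \<longlonglongrightarrow> lim (\<lambda>j. h (r j) x)"
      using r(2) by eventually_elim (simp add: Cauchy_convergent_iff convergent_LIMSEQ_iff)
  qed
qed

text \<open>The difference quotients are uniformly bounded, so midpoint averages of their tails
  converge almost everywhere to some \<open>g\<close>. Tested against a smooth function the
  quotients converge to the weak derivative by discrete integration by parts, and so do the
  averages.\<close>

lemma lipschitz_weak_partial:
  fixes w :: "'a::euclidean_space \<Rightarrow> 'b::euclidean_space"
  assumes A: "open A" "bounded A" and w[measurable]: "w \<in> borel_measurable borel" and M: "\<And>x. norm (w x) \<le> M"
    and lip: "\<delta> > 0" "\<And>x h. x \<in> A \<Longrightarrow> norm h < \<delta> \<Longrightarrow> norm (w (x + h) - w x) \<le> L * norm h"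
  obtains g where "g \<in> borel_measurable borel" "AE x in lborel. norm (g x) \<le> \<bar>L\<bar> * norm i" "weak_partial A i w g"
proof -
  \<comment> \<open>The shift by \<open>k0\<close> keeps every step \<open>s k *\<^sub>R i\<close>
    shorter than \<open>\<delta>\<close>, so the local Lipschitz estimate holds from the first index
    on.\<close>
  obtain k0 :: nat where k0: "real k0 > norm i / \<delta>" using reals_Archimedean2 by blast
  define s where "s = (\<lambda>k. 1 / real (Suc (k + k0)))"
  have s: "s k > 0" "norm (s k *\<^sub>R i) < \<delta>" for k
  proof -
    have "norm i < real (Suc (k + k0)) * \<delta>"
    proof -
      have "norm i < real k0 * \<delta>" using k0 lip(1) by (simp add: pos_divide_less_eq)
      also have "\<dots> \<le> real (Suc (k + k0)) * \<delta>" using lip(1) by (intro mult_right_mono) auto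
      finally show ?thesis .
    qed
    then show "norm (s k *\<^sub>R i) < \<delta>" by (simp add: s_def field_simps)
  qed (simp add: s_def)
  have [measurable]: "A \<in> sets borel" using A by auto
  obtain R where "\<forall>x\<in>A. norm x \<le> R" using A(2) bounded_iff by blast
  then have R: "A \<subseteq> cball 0 R" by auto
  have "emeasure lborel A \<le> emeasure lborel (cball 0 R :: 'a set)" using R by (intro emeasure_mono) auto
  also have "\<dots> < \<infinity>" by (rule emeasure_lborel_cball_finite)
  finally have fin: "emeasure lborel A < \<infinity>" .
  define E where "E = (\<lambda>k x. indicator A x *\<^sub>R ((1 / s k) *\<^sub>R (w (x + s k *\<^sub>R i) - w x)))"
  have [measurable]: "E k \<in> borel_measurable borel" for k unfolding E_def by measurable
  have E_bound: "norm (E k x) \<le> \<bar>L\<bar> * norm i" for k x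
  proof (cases "x \<in> A")
    case True
    have "norm (w (x + s k *\<^sub>R i) - w x) \<le> L * norm (s k *\<^sub>R i)" using lip(2)[OF True s(2)] .
    also have "\<dots> \<le> \<bar>L\<bar> * norm (s k *\<^sub>R i)" by (intro mult_right_mono) auto
    also have "\<dots> = s k * (\<bar>L\<bar> * norm i)" using s(1)[of k] by simp
    finally show ?thesis using True s(1)[of k] by (simp add: E_def divide_simps mult.commute)
  qed (simp add: E_def)
  obtain h g m where h: "\<And>j. h j \<in> midpoint_closure (E ` {m j..})" "\<And>j. m j \<ge> (j::nat)"
     "g \<in> borel_measurable borel" "AE x in lborel. (\<lambda>j. h j x) \<longlonglongrightarrow> g x"
    by (rule bounded_sequence_midpoints_converge[of E A "\<bar>L\<bar> * norm i"]) (use fin E_bound in \<open>auto simp: E_def\<close>)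
  note [measurable] = h(3)
  have props: "h \<in> borel_measurable borel \<and> (\<forall>x. norm (h x) \<le> \<bar>L\<bar> * norm i)" if "h \<in> midpoint_closure (E ` F)" for h F
    using that
  proof (induction rule: midpoint_closure.induct)
    case (base h)
    then show ?case using E_bound by auto
  next
    case (mid h k)
    then have "norm ((1/2) *\<^sub>R (h x + k x)) \<le> \<bar>L\<bar> * norm i" for x by (intro norm_midpoint_le) auto
    moreover have "(\<lambda>x. (1/2) *\<^sub>R (h x + k x)) \<in> borel_measurable borel"
      using mid by (intro borel_measurable_scaleR borel_measurable_add borel_measurable_const) auto
    ultimately show ?case by (simp del: scaleR_add_right)
  qed
  have g_bound: "AE x in lborel. norm (g x) \<le> \<bar>L\<bar> * norm i"
    using h(4)
  proof eventually_elim
    case (elim x)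
    then show ?case by (rule Lim_bounded[OF tendsto_norm]) (use props[OF h(1)] in auto)
  qed
  have "weak_partial A i w g"
    unfolding weak_partial_lborel_iff[OF w h(3)]
  proof (intro allI impI)
    fix \<phi> assume t: "test_fun A \<phi>"
    note [measurable] = test_fun_measurable[OF t]
    obtain B r where B: "B > 0" "\<And>x v. norm (frechet_derivative \<phi> (at x) v) \<le> B * norm v" "B-lipschitz_on UNIV \<phi>"
      "\<And>x. norm x > r \<Longrightarrow> \<phi> x = 0" "\<And>x. \<bar>\<phi> x\<bar> \<le> B"
      using test_fun_bounds[OF t] by metis
    have M0: "M \<ge> 0" using M[of 0] norm_ge_zero order_trans by blast
    define T where "T = - (LBINT x. frechet_derivative \<phi> (at x) i *\<^sub>R w x)"
    have int_phi: "integrable lborel (\<lambda>x. \<phi> x *\<^sub>R f x)" if "f \<in> borel_measurable borel" "\<And>x. norm (f x) \<le> C" for f :: "'a \<Rightarrow> 'b" and C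
    proof (rule integrable_bounded_support[where B = "B * \<bar>C\<bar>" and r = r])
      show "norm (\<phi> x *\<^sub>R f x) \<le> B * \<bar>C\<bar>" for x
        using B(5)[of x] that(2)[of x] B(1) by (auto intro!: mult_mono)
      show "\<phi> x *\<^sub>R f x = 0" if "norm x > r" for x using B(4)[OF that] by simp
    qed (use that(1) in measurable)
    \<comment> \<open>Discrete integration by parts: a translation of the variable moves the
      difference quotient from \<open>w\<close> to the test function.\<close>
    have E_eq: "(LBINT x. \<phi> x *\<^sub>R E k x) = - (LBINT x. ((1 / s k) * (\<phi> x - \<phi> (x - s k *\<^sub>R i))) *\<^sub>R w x)" for k
    proof -
      have i1: "integrable lborel (\<lambda>x. \<phi> x *\<^sub>R w (x + s k *\<^sub>R i))" by (rule int_phi) (use M in auto)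
      have i2: "integrable lborel (\<lambda>x. \<phi> x *\<^sub>R w x)" by (rule int_phi) (use M in auto)
      have i3: "integrable lborel (\<lambda>x. \<phi> (x - s k *\<^sub>R i) *\<^sub>R w x)"
        using integrable_translate_lborel[OF i1, of "- s k *\<^sub>R i"] by simp
      have e3: "(LBINT x. \<phi> x *\<^sub>R w (x + s k *\<^sub>R i)) = (LBINT x. \<phi> (x - s k *\<^sub>R i) *\<^sub>R w x)"
        using integral_translate_lborel[of "\<lambda>x. \<phi> x *\<^sub>R w (x + s k *\<^sub>R i)" "- s k *\<^sub>R i"] by simp
      have "(\<lambda>x. \<phi> x *\<^sub>R E k x) = (\<lambda>x. (1 / s k) *\<^sub>R (\<phi> x *\<^sub>R w (x + s k *\<^sub>R i) - \<phi> x *\<^sub>R w x))"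
        using test_funD(6)[OF t] by (auto simp: E_def fun_eq_iff indicator_def scaleR_diff_right mult.commute)
      then have "(LBINT x. \<phi> x *\<^sub>R E k x) = (1 / s k) *\<^sub>R ((LBINT x. \<phi> x *\<^sub>R w (x + s k *\<^sub>R i)) - (LBINT x. \<phi> x *\<^sub>R w x))"
        using i1 i2 by (simp del: scaleR_diff_right)
      also have "\<dots> = - ((1 / s k) *\<^sub>R ((LBINT x. \<phi> x *\<^sub>R w x) - (LBINT x. \<phi> (x - s k *\<^sub>R i) *\<^sub>R w x)))"
        unfolding e3 by (simp add: algebra_simps)
      also have "\<dots> = - (LBINT x. (1 / s k) *\<^sub>R (\<phi> x *\<^sub>R w x - \<phi> (x - s k *\<^sub>R i) *\<^sub>R w x))"
        using i2 i3 by (simp del: scaleR_diff_right)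
      also have "(\<lambda>x. (1 / s k) *\<^sub>R (\<phi> x *\<^sub>R w x - \<phi> (x - s k *\<^sub>R i) *\<^sub>R w x)) = (\<lambda>x. ((1 / s k) * (\<phi> x - \<phi> (x - s k *\<^sub>R i))) *\<^sub>R w x)"
        by (auto simp: fun_eq_iff algebra_simps)
      finally show ?thesis .
    qed
    have "(\<lambda>k. (LBINT x. ((1 / s k) * (\<phi> x - \<phi> (x - s k *\<^sub>R i))) *\<^sub>R w x)) \<longlonglongrightarrow> (LBINT x. frechet_derivative \<phi> (at x) i *\<^sub>R w x)"
    proof (rule integral_dominated_convergence)
      show "integrable lborel (\<lambda>x::'a. B * norm i * M * indicator (cball 0 (r + norm i)) x :: real)"
        by (auto intro!: integrable_real_indicator emeasure_lborel_cball_finite)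
      have q: "(1 / s k) * (\<phi> x - \<phi> (x - s k *\<^sub>R i)) = - (real (Suc (k + k0)) *\<^sub>R (\<phi> (x + (1 / real (Suc (k + k0))) *\<^sub>R (- i)) - \<phi> x))" for k x
        by (simp add: s_def algebra_simps)
      show "AE x in lborel. (\<lambda>k. ((1 / s k) * (\<phi> x - \<phi> (x - s k *\<^sub>R i))) *\<^sub>R w x) \<longlonglongrightarrow> frechet_derivative \<phi> (at x) i *\<^sub>R w x"
      proof (intro AE_I2 tendsto_scaleR tendsto_const)
        fix x
        have "(\<lambda>k. - (real (Suc (k + k0)) *\<^sub>R (\<phi> (x + (1 / real (Suc (k + k0))) *\<^sub>R (- i)) - \<phi> x))) \<longlonglongrightarrow> - frechet_derivative \<phi> (at x) (- i)"
          by (intro tendsto_minus LIMSEQ_ignore_initial_segment[OF has_derivative_difference_quotient[OF test_funD(1)[OF t]]])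
        moreover have "frechet_derivative \<phi> (at x) (- i) = - frechet_derivative \<phi> (at x) i"
          using linear_neg[OF has_derivative_linear[OF test_funD(1)[OF t]]] .
        ultimately show "(\<lambda>k. (1 / s k) * (\<phi> x - \<phi> (x - s k *\<^sub>R i))) \<longlonglongrightarrow> frechet_derivative \<phi> (at x) i"
          unfolding q by simp
      qed
      fix k
      show "AE x in lborel. norm (((1 / s k) * (\<phi> x - \<phi> (x - s k *\<^sub>R i))) *\<^sub>R w x) \<le> B * norm i * M * indicator (cball 0 (r + norm i)) x"
      proof (rule AE_I2)
        fix x
        have "\<bar>\<phi> x - \<phi> (x - s k *\<^sub>R i)\<bar> \<le> B * (s k * norm i)"
          using lipschitz_onD[OF B(3), of x "x - s k *\<^sub>R i"] s(1)[of k] by (simp add: dist_norm)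
        then have b: "\<bar>(1 / s k) * (\<phi> x - \<phi> (x - s k *\<^sub>R i))\<bar> \<le> B * norm i"
          using s(1)[of k] by (simp add: abs_mult field_simps)
        show "norm (((1 / s k) * (\<phi> x - \<phi> (x - s k *\<^sub>R i))) *\<^sub>R w x) \<le> B * norm i * M * indicator (cball 0 (r + norm i)) x"
        proof (cases "norm x \<le> r + norm i")
          case True
          have "norm (((1 / s k) * (\<phi> x - \<phi> (x - s k *\<^sub>R i))) *\<^sub>R w x) \<le> (B * norm i) * M"
            unfolding norm_scaleR by (rule mult_mono[OF b M]) (use B(1) in auto)
          then show ?thesis using True by simp
        next
          case False
          have "s k \<le> 1" by (simp add: s_def)
          then have "norm (s k *\<^sub>R i) \<le> norm i" using s(1)[of k] mult_right_mono[of "s k" 1 "norm i"] by simp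
          then have "norm x > r" "norm (x - s k *\<^sub>R i) > r"
            using False norm_triangle_sub[of x "s k *\<^sub>R i"] norm_ge_zero[of i] by linarith+
          then show ?thesis using B(4) False by simp
        qed
      qed
    qed (auto)
    then have lim: "(\<lambda>k. (LBINT x. \<phi> x *\<^sub>R E k x)) \<longlonglongrightarrow> T"
      unfolding E_eq T_def by (rule tendsto_minus)
    \<comment> \<open>The pairing with \<open>\<phi>\<close> is linear, so a bound on its distance
      from \<open>T\<close> over a tail persists on the midpoint hull of that tail.\<close>
    have hull: "norm ((LBINT x. \<phi> x *\<^sub>R f x) - T) \<le> e"
      if "f \<in> midpoint_closure (E ` {l..})" "\<And>k. k \<ge> l \<Longrightarrow> norm ((LBINT x. \<phi> x *\<^sub>R E k x) - T) \<le> e" for f l e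
      using that(1)
    proof (induction rule: midpoint_closure.induct)
      case (base f)
      then show ?case using that(2) by auto
    next
      case (mid f f')
      have "integrable lborel (\<lambda>x. \<phi> x *\<^sub>R f x)" "integrable lborel (\<lambda>x. \<phi> x *\<^sub>R f' x)"
        using props[OF mid(1)] props[OF mid(2)] by (auto intro!: int_phi)
      then have "(LBINT x. (1/2) *\<^sub>R (\<phi> x *\<^sub>R f x + \<phi> x *\<^sub>R f' x)) =
        (1/2) *\<^sub>R ((LBINT x. \<phi> x *\<^sub>R f x) + (LBINT x. \<phi> x *\<^sub>R f' x))"
        by (simp del: scaleR_add_right)
      moreover have "(\<lambda>x. \<phi> x *\<^sub>R ((1/2) *\<^sub>R (f x + f' x))) = (\<lambda>x. (1/2) *\<^sub>R (\<phi> x *\<^sub>R f x + \<phi> x *\<^sub>R f' x))"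
        by (auto simp: fun_eq_iff scaleR_add_right)
      ultimately have "(LBINT x. \<phi> x *\<^sub>R ((1/2) *\<^sub>R (f x + f' x))) - T =
        (1/2) *\<^sub>R (((LBINT x. \<phi> x *\<^sub>R f x) - T) + ((LBINT x. \<phi> x *\<^sub>R f' x) - T))"
        by (simp add: algebra_simps flip: scaleR_add_left)
      then show ?case using norm_midpoint_le[OF mid(3,4)] by simp
    qed
    have limh: "(\<lambda>j. (LBINT x. \<phi> x *\<^sub>R h j x)) \<longlonglongrightarrow> T"
    proof (rule LIMSEQ_I)
      fix e :: real assume "e > 0"
      then obtain l where l: "\<And>k. k \<ge> l \<Longrightarrow> norm ((LBINT x. \<phi> x *\<^sub>R E k x) - T) < e / 2"
        using LIMSEQ_D[OF lim, of "e/2"] by auto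
      have "norm ((LBINT x. \<phi> x *\<^sub>R h j x) - T) \<le> e / 2" if "j \<ge> l" for j
      proof (rule hull[OF h(1)])
        fix k assume "k \<ge> m j"
        then have "k \<ge> l" using h(2)[of j] that by linarith
        then show "norm ((LBINT x. \<phi> x *\<^sub>R E k x) - T) \<le> e / 2" using l by (simp add: less_imp_le)
      qed
      then show "\<exists>no. \<forall>n\<ge>no. norm ((LBINT x. \<phi> x *\<^sub>R h n x) - T) < e"
        using \<open>e > 0\<close> by (intro exI[of _ l]) (metis field_sum_of_halves less_add_same_cancel1 half_gt_zero order_le_less_trans)
    qed
    have "(\<lambda>j. (LBINT x. \<phi> x *\<^sub>R h j x)) \<longlonglongrightarrow> (LBINT x. \<phi> x *\<^sub>R g x)"
    proof (rule integral_dominated_convergence)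
      have [measurable]: "h j \<in> borel_measurable borel" for j using props[OF h(1)] by simp
      show "(\<lambda>x. \<phi> x *\<^sub>R h j x) \<in> borel_measurable lborel" for j by measurable
      show "integrable lborel (\<lambda>x. \<bar>\<phi> x\<bar> * (\<bar>L\<bar> * norm i))"
        by (intro integrable_mult_left integrable_abs integrable_bounded_support[where B=B and r=r]) (use B in auto)
      show "AE x in lborel. (\<lambda>j. \<phi> x *\<^sub>R h j x) \<longlonglongrightarrow> \<phi> x *\<^sub>R g x"
        using h(4) by eventually_elim (intro tendsto_intros)
      show "AE x in lborel. norm (\<phi> x *\<^sub>R h j x) \<le> \<bar>\<phi> x\<bar> * (\<bar>L\<bar> * norm i)" for j
        using props[OF h(1)[of j]] by (intro AE_I2) (auto intro!: mult_left_mono)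
    qed measurable
    then show "(LBINT x. frechet_derivative \<phi> (at x) i *\<^sub>R w x) = - (LBINT x. \<phi> x *\<^sub>R g x)"
      using arg_cong[OF LIMSEQ_unique[OF limh], of _ uminus] by (simp add: T_def)
  qed
  with that h(3) g_bound show thesis by blast
qed

section \<open>Mollification\<close>

definition convol :: "('a::euclidean_space \<Rightarrow> real) \<Rightarrow> ('a \<Rightarrow> 'b::euclidean_space) \<Rightarrow> 'a \<Rightarrow> 'b" where
  "convol \<rho> G x = (LBINT y. \<rho> (x - y) *\<^sub>R G y)"

lemma integrable_convol:
  fixes G :: "'a::euclidean_space \<Rightarrow> 'b::euclidean_space"
  assumes c: "continuous_on UNIV \<kappa>" and b: "\<And>z. \<bar>\<kappa> z\<bar> \<le> C" and G: "integrable lborel G"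
  shows "integrable lborel (\<lambda>y. \<kappa> (x - y) *\<^sub>R G y)"
proof (rule Bochner_Integration.integrable_bound)
  show "integrable lborel (\<lambda>y. C *\<^sub>R G y)" using G by simp
  have [measurable]: "\<kappa> \<in> borel_measurable borel" by (rule borel_measurable_continuous_onI[OF c])
  have [measurable]: "G \<in> borel_measurable borel" using borel_measurable_integrable[OF G] by simp
  show "(\<lambda>y. \<kappa> (x - y) *\<^sub>R G y) \<in> borel_measurable lborel" by measurable
  show "AE y in lborel. norm (\<kappa> (x - y) *\<^sub>R G y) \<le> norm (C *\<^sub>R G y)"
    using b by (intro AE_I2) (auto intro!: mult_right_mono intro: order_trans[OF b])
qed

lemma continuous_on_convol:
  fixes G :: "'a::euclidean_space \<Rightarrow> 'b::euclidean_space"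
  assumes c: "continuous_on UNIV \<kappa>" and b: "\<And>z. \<bar>\<kappa> z\<bar> \<le> C" and G: "integrable lborel G"
  shows "continuous_on UNIV (convol \<kappa> G)"
proof (rule continuous_on_sequentiallyI)
  fix u :: "nat \<Rightarrow> 'a" and a assume u: "u \<longlonglongrightarrow> a"
  have [measurable]: "\<kappa> \<in> borel_measurable borel" by (rule borel_measurable_continuous_onI[OF c])
  have [measurable]: "G \<in> borel_measurable borel" using borel_measurable_integrable[OF G] by simp
  show "(\<lambda>n. convol \<kappa> G (u n)) \<longlonglongrightarrow> convol \<kappa> G a"
    unfolding convol_def
  proof (rule integral_dominated_convergence)
    show "integrable lborel (\<lambda>y. C * norm (G y))" using G by simp
    have "isCont \<kappa> z" for z using c by (simp add: continuous_on_eq_continuous_at)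
    then show "AE y in lborel. (\<lambda>n. \<kappa> (u n - y) *\<^sub>R G y) \<longlonglongrightarrow> \<kappa> (a - y) *\<^sub>R G y"
      by (intro AE_I2 tendsto_scaleR tendsto_const isCont_tendsto_compose[of _ \<kappa>] tendsto_diff u)
    show "AE y in lborel. norm (\<kappa> (u n - y) *\<^sub>R G y) \<le> C * norm (G y)" for n
      using b by (intro AE_I2) (auto intro!: mult_right_mono)
  qed measurable
qed

text \<open>The remainder quotient of \<open>\<rho>\<close> is bounded by \<open>2 * B\<close> and
  tends to 0 pointwise, so its integral against \<open>G\<close> tends to 0 by dominated
  convergence.\<close>

lemma convol_has_derivative:
  fixes G :: "'a::euclidean_space \<Rightarrow> 'b::euclidean_space"
  assumes t: "test_fun UNIV \<rho>" and G: "integrable lborel G"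
  shows "(convol \<rho> G has_derivative (\<lambda>v. convol (\<lambda>z. frechet_derivative \<rho> (at z) v) G x)) (at x)"
proof -
  let ?D = "\<lambda>z v. frechet_derivative \<rho> (at z) v"
  obtain B where B: "B > 0" "\<And>x v. norm (?D x v) \<le> B * norm v" "B-lipschitz_on UNIV \<rho>" "\<And>x. \<bar>\<rho> x\<bar> \<le> B"
    using test_fun_bounds[OF t] by metis
  note [measurable] = test_fun_measurable[OF t]
  have [measurable]: "G \<in> borel_measurable borel" using borel_measurable_integrable[OF G] by simp
  have lin: "linear (?D z)" for z using has_derivative_linear[OF test_funD(1)[OF t]] .
  have i: "integrable lborel (\<lambda>y. ?D (x - y) v *\<^sub>R G y)" for x v
    by (rule integrable_convol[OF test_funD(2)[OF t] _ G, of v "B * norm v"]) (use B(2) in auto)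
  have i0: "integrable lborel (\<lambda>y. \<rho> (x - y) *\<^sub>R G y)" for x
    by (rule integrable_convol[OF test_funD(3)[OF t] B(4) G])
  let ?L = "\<lambda>v. convol (\<lambda>z. ?D z v) G x"
  have bl: "bounded_linear ?L"
  proof (rule bounded_linear_intro)
    show "?L (v + w) = ?L v + ?L w" for v w
      unfolding convol_def linear_add[OF lin] scaleR_add_left using i by simp
    show "?L (r *\<^sub>R v) = r *\<^sub>R ?L v" for r v
      unfolding convol_def linear_cmul[OF lin] using i by (simp flip: scaleR_scaleR)
    show "norm (?L v) \<le> norm v * (B * (LBINT y. norm (G y)))" for v
    proof -
      have "norm (?L v) \<le> (LBINT y. norm (?D (x - y) v *\<^sub>R G y))" unfolding convol_def by (rule integral_norm_bound)
      also have "\<dots> \<le> (LBINT y. (B * norm v) * norm (G y))"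
      proof (rule integral_mono)
        show "norm (?D (x - y) v *\<^sub>R G y) \<le> (B * norm v) * norm (G y)" for y
          using mult_right_mono[OF B(2)[of "x - y" v], of "norm (G y)"] by simp
      qed (use integrable_norm[OF i[of x v]] G in auto)
      finally show ?thesis by (simp add: mult_ac)
    qed
  qed
  have "(\<lambda>h. norm (convol \<rho> G (x + h) - convol \<rho> G x - ?L h) / norm h) \<midarrow>0\<rightarrow> 0"
    unfolding tendsto_at_iff_sequentially o_def
  proof (intro allI impI)
    fix h :: "nat \<Rightarrow> 'a" assume h: "\<forall>j. h j \<in> UNIV - {0}" "h \<longlonglongrightarrow> 0"
    define R where "R = (\<lambda>j y. (\<rho> (x + h j - y) - \<rho> (x - y) - ?D (x - y) (h j)) / norm (h j))"
    have R_bound: "\<bar>R j y\<bar> \<le> 2 * B" for j y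
    proof -
      have "\<bar>\<rho> (x + h j - y) - \<rho> (x - y)\<bar> \<le> B * norm (h j)"
        using lipschitz_onD[OF B(3), of "x + h j - y" "x - y"] by (simp add: dist_norm)
      moreover have "\<bar>?D (x - y) (h j)\<bar> \<le> B * norm (h j)" using B(2)[of "x - y" "h j"] by simp
      ultimately have "\<bar>\<rho> (x + h j - y) - \<rho> (x - y) - ?D (x - y) (h j)\<bar> \<le> 2 * B * norm (h j)" by linarith
      then show ?thesis using h(1) by (simp add: R_def divide_le_eq)
    qed
    have eq: "norm (convol \<rho> G (x + h j) - convol \<rho> G x - ?L (h j)) / norm (h j) = norm ((LBINT y. R j y *\<^sub>R G y))" for j
    proof -
      have "(\<lambda>y. R j y *\<^sub>R G y) = (\<lambda>y. (1 / norm (h j)) *\<^sub>R (\<rho> (x + h j - y) *\<^sub>R G y - \<rho> (x - y) *\<^sub>R G y - ?D (x - y) (h j) *\<^sub>R G y))"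
        by (auto simp: R_def fun_eq_iff divide_inverse algebra_simps)
      then have "(LBINT y. R j y *\<^sub>R G y) = (1 / norm (h j)) *\<^sub>R (convol \<rho> G (x + h j) - convol \<rho> G x - ?L (h j))"
        unfolding convol_def using i[of x "h j"] i0[of x] i0[of "x + h j"] by (simp del: scaleR_diff_right)
      then show ?thesis by simp
    qed
    have "(\<lambda>j. (LBINT y. R j y *\<^sub>R G y)) \<longlonglongrightarrow> integral\<^sup>L lborel (\<lambda>y::'a. 0 :: 'b)"
    proof (rule integral_dominated_convergence)
      show "integrable lborel (\<lambda>y. 2 * B * norm (G y))" using G by simp
      show "(\<lambda>y. R j y *\<^sub>R G y) \<in> borel_measurable lborel" for j
        unfolding R_def by measurable
      show "AE y in lborel. norm (R j y *\<^sub>R G y) \<le> 2 * B * norm (G y)" for j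
        using R_bound by (intro AE_I2) (auto intro!: mult_right_mono)
      have "(\<lambda>j. R j y) \<longlonglongrightarrow> 0" for y
      proof -
        have "(\<lambda>h. norm (\<rho> (x - y + h) - \<rho> (x - y) - ?D (x - y) h) / norm h) \<midarrow>0\<rightarrow> 0"
          using test_funD(1)[OF t, of "x - y"] by (simp add: has_derivative_at)
        then have "(\<lambda>j. norm (R j y)) \<longlonglongrightarrow> 0"
          using h unfolding tendsto_at_iff_sequentially o_def R_def by (simp add: algebra_simps)
        then show ?thesis by (rule tendsto_norm_zero_cancel)
      qed
      then have "(\<lambda>j. R j y *\<^sub>R G y) \<longlonglongrightarrow> 0 *\<^sub>R G y" for y by (intro tendsto_scaleR tendsto_const)
      then show "AE y in lborel. (\<lambda>j. R j y *\<^sub>R G y) \<longlonglongrightarrow> 0" by simp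
    qed simp
    then show "(\<lambda>j. norm (convol \<rho> G (x + h j) - convol \<rho> G x - ?L (h j)) / norm (h j)) \<longlonglongrightarrow> 0"
      unfolding eq using tendsto_norm_zero by fastforce
  qed
  with bl show ?thesis by (simp add: has_derivative_at)
qed

text \<open>The graph of a convex power lies above its tangent at \<open>s\<close>. Integrated
  against a probability density this yields Jensen's inequality.\<close>

lemma power_tangent_le:
  fixes s t :: real
  assumes "s \<ge> 0" "t \<ge> 0" "n \<ge> 1"
  shows "s ^ n + real n * s ^ (n - 1) * (t - s) \<le> t ^ n"
  using assms(3)
proof (induction n rule: dec_induct)
  case (step k)
  have "s ^ Suc k + real (Suc k) * s ^ k * (t - s) = s * (s ^ k + real k * s ^ (k - 1) * (t - s)) + s ^ k * (t - s)"
    using step(1) by (cases k) (auto simp: algebra_simps)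
  also have "\<dots> \<le> s * t ^ k + s ^ k * (t - s)"
    using step.IH assms by (intro add_right_mono mult_left_mono) auto
  also have "\<dots> \<le> s * t ^ k + t ^ k * (t - s)"
  proof -
    have "0 \<le> (t ^ k - s ^ k) * (t - s)"
      by (cases "s \<le> t") (use assms power_mono[of s t k] power_mono[of t s k] in \<open>auto intro: mult_nonpos_nonpos mult_nonneg_nonneg\<close>)
    then show ?thesis by (simp add: algebra_simps)
  qed
  finally show ?case by (simp add: algebra_simps)
qed simp

text \<open>Young's inequality for a probability density: Jensen's inequality at each point, then
  Fubini's theorem.\<close>

lemma convol_power_integral_le:
  fixes G :: "'a::euclidean_space \<Rightarrow> 'b::euclidean_space"
  assumes c: "continuous_on UNIV \<rho>" and nn: "\<And>z. \<rho> z \<ge> 0" and b: "\<And>z. \<bar>\<rho> z\<bar> \<le> C"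
    and \<rho>: "integrable lborel \<rho>" "integral\<^sup>L lborel \<rho> = 1"
    and G: "integrable lborel G" "integrable lborel (\<lambda>x. norm (G x) ^ n)" and n: "n \<ge> 1"
  shows "integrable lborel (\<lambda>x. norm (convol \<rho> G x) ^ n)"
    "(LBINT x. norm (convol \<rho> G x) ^ n) \<le> (LBINT x. norm (G x) ^ n)"
proof -
  have m1[measurable]: "\<rho> \<in> borel_measurable borel" by (rule borel_measurable_continuous_onI[OF c])
  have m2[measurable]: "G \<in> borel_measurable borel" using borel_measurable_integrable[OF G(1)] by simp
  have [measurable]: "convol \<rho> G \<in> borel_measurable borel" by (rule borel_measurable_continuous_onI[OF continuous_on_convol[OF c b G(1)]])
  have refl: "(LBINT y. \<rho> (x - y)) = 1 \<and> integrable lborel (\<lambda>y. \<rho> (x - y))" for x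
  proof -
    have "distr lborel borel (\<lambda>y. x - y) = lborel"
      using lborel_affine[of "-1" x] by (simp add: density_1)
    then have "integrable (distr lborel borel (\<lambda>y. x - y)) \<rho>" "integral\<^sup>L (distr lborel borel (\<lambda>y. x - y)) \<rho> = 1"
      using \<rho> by simp_all
    then show ?thesis by (simp add: integrable_distr_eq integral_distr)
  qed
  have pointwise: "norm (convol \<rho> G x) ^ n \<le> (LBINT y. \<rho> (x - y) * norm (G y) ^ n)" for x
  proof -
    define s where "s = (LBINT y. \<rho> (x - y) * norm (G y))"
    have i1: "integrable lborel (\<lambda>y. \<rho> (x - y) * norm (G y))"
      using integrable_norm[OF integrable_convol[OF c b G(1), of x]] nn by simp
    have i2: "integrable lborel (\<lambda>y. \<rho> (x - y) * norm (G y) ^ n)"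
      using integrable_convol[OF c b G(2), of x] by simp
    have s0: "s \<ge> 0" unfolding s_def using nn by (intro Bochner_Integration.integral_nonneg) auto
    have "norm (convol \<rho> G x) \<le> s" unfolding convol_def s_def
      using integral_norm_bound[of lborel "\<lambda>y. \<rho> (x - y) *\<^sub>R G y"] nn by simp
    then have "norm (convol \<rho> G x) ^ n \<le> s ^ n" by (intro power_mono) auto
    \<comment> \<open>\<open>s\<close> is the mean of \<open>norm (G y)\<close> under the density,
      so the added linear term has integral 0.\<close>
    also have "s ^ n = (LBINT y. \<rho> (x - y) * s ^ n + real n * s ^ (n - 1) * (\<rho> (x - y) * norm (G y) - s * \<rho> (x - y)))"
      using refl[of x] i1 by (simp add: s_def[symmetric])
    also have "\<dots> \<le> (LBINT y. \<rho> (x - y) * norm (G y) ^ n)"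
    proof (rule integral_mono)
      show "integrable lborel (\<lambda>y. \<rho> (x - y) * s ^ n + real n * s ^ (n - 1) * (\<rho> (x - y) * norm (G y) - s * \<rho> (x - y)))"
        using refl[of x] i1 by simp
      fix y
      have "\<rho> (x - y) * (s ^ n + real n * s ^ (n - 1) * (norm (G y) - s)) \<le> \<rho> (x - y) * norm (G y) ^ n"
        using power_tangent_le[OF s0 _ n, of "norm (G y)"] nn by (intro mult_left_mono) auto
      then show "\<rho> (x - y) * s ^ n + real n * s ^ (n - 1) * (\<rho> (x - y) * norm (G y) - s * \<rho> (x - y)) \<le> \<rho> (x - y) * norm (G y) ^ n"
        by (simp add: algebra_simps)
    qed (rule i2)
    finally show ?thesis .
  qed
  have i2: "integrable lborel (\<lambda>y. \<rho> (x - y) * norm (G y) ^ n)" for x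
    using integrable_convol[OF c b G(2), of x] by simp
  have "(\<integral>\<^sup>+x. ennreal (norm (convol \<rho> G x) ^ n) \<partial>lborel) \<le> (\<integral>\<^sup>+x. (\<integral>\<^sup>+y. ennreal (\<rho> (x - y) * norm (G y) ^ n) \<partial>lborel) \<partial>lborel)"
  proof (rule nn_integral_mono)
    fix x
    have "(\<integral>\<^sup>+y. ennreal (\<rho> (x - y) * norm (G y) ^ n) \<partial>lborel) = ennreal ((LBINT y. \<rho> (x - y) * norm (G y) ^ n))"
      by (rule nn_integral_eq_integral[OF i2]) (use nn in auto)
    then show "ennreal (norm (convol \<rho> G x) ^ n) \<le> (\<integral>\<^sup>+y. ennreal (\<rho> (x - y) * norm (G y) ^ n) \<partial>lborel)"
      using pointwise[of x] by (simp add: ennreal_leI)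
  qed
  also have "\<dots> = (\<integral>\<^sup>+y. (\<integral>\<^sup>+x. ennreal (\<rho> (x - y) * norm (G y) ^ n) \<partial>lborel) \<partial>lborel)"
    by (rule lborel_pair.Fubini'[symmetric]) measurable
  also have "\<dots> = (\<integral>\<^sup>+y. ennreal (norm (G y) ^ n) \<partial>lborel)"
  proof (rule nn_integral_cong)
    fix y
    have i: "integrable lborel (\<lambda>x. \<rho> (x - y))" using integrable_translate_lborel[OF \<rho>(1), of "- y"] by simp
    have "(\<integral>\<^sup>+x. ennreal (\<rho> (x - y) * norm (G y) ^ n) \<partial>lborel) = ennreal ((LBINT x. \<rho> (x - y) * norm (G y) ^ n))"
      by (rule nn_integral_eq_integral) (use i nn in auto)
    also have "(LBINT x. \<rho> (x - y) * norm (G y) ^ n) = norm (G y) ^ n"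
      using i integral_translate_lborel[OF m1, of "- y"] \<rho>(2) by simp
    finally show "(\<integral>\<^sup>+x. ennreal (\<rho> (x - y) * norm (G y) ^ n) \<partial>lborel) = ennreal (norm (G y) ^ n)" .
  qed
  also have "\<dots> = ennreal ((LBINT y. norm (G y) ^ n))"
    by (rule nn_integral_eq_integral[OF G(2)]) auto
  finally have fin: "(\<integral>\<^sup>+x. ennreal (norm (convol \<rho> G x) ^ n) \<partial>lborel) \<le> ennreal ((LBINT y. norm (G y) ^ n))" .
  show int: "integrable lborel (\<lambda>x. norm (convol \<rho> G x) ^ n)"
    by (rule integrableI_bounded) (use fin in \<open>auto simp: le_less_trans\<close>)
  then have "(\<integral>\<^sup>+x. ennreal (norm (convol \<rho> G x) ^ n) \<partial>lborel) = ennreal ((LBINT x. norm (convol \<rho> G x) ^ n))"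
    by (intro nn_integral_eq_integral) auto
  then show "(LBINT x. norm (convol \<rho> G x) ^ n) \<le> (LBINT x. norm (G x) ^ n)"
    using fin by (simp add: ennreal_le_iff Bochner_Integration.integral_nonneg)
qed

lemma convol_near:
  fixes F :: "'a::euclidean_space \<Rightarrow> 'b::euclidean_space"
  assumes c: "continuous_on UNIV \<rho>" and nn: "\<And>z. \<rho> z \<ge> 0" and b: "\<And>z. \<bar>\<rho> z\<bar> \<le> C"
    and \<rho>: "integrable lborel (\<lambda>y. \<rho> (x - y))" "(LBINT y. \<rho> (x - y)) = 1" and supp: "\<And>z. norm z \<ge> \<epsilon> \<Longrightarrow> \<rho> z = 0"
    and F: "integrable lborel F" and near: "\<And>y. norm (x - y) < \<epsilon> \<Longrightarrow> norm (F y - a) \<le> \<eta>"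
  shows "norm (convol \<rho> F x - a) \<le> \<eta>"
proof -
  have i: "integrable lborel (\<lambda>y. \<rho> (x - y) *\<^sub>R F y)" by (rule integrable_convol[OF c b F])
  have ia: "integrable lborel (\<lambda>y. \<rho> (x - y) *\<^sub>R a)" using \<rho>(1) by auto
  have "convol \<rho> F x - a = (LBINT y. \<rho> (x - y) *\<^sub>R F y) - (LBINT y. \<rho> (x - y) *\<^sub>R a)"
    using \<rho> by (simp add: convol_def)
  also have "\<dots> = (LBINT y. \<rho> (x - y) *\<^sub>R (F y - a))"
    using i ia by (simp add: scaleR_diff_right)
  finally have "norm (convol \<rho> F x - a) \<le> (LBINT y. norm (\<rho> (x - y) *\<^sub>R (F y - a)))"
    by (simp only: integral_norm_bound)
  also have "\<dots> \<le> (LBINT y. \<rho> (x - y) * \<eta>)"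
  proof (rule integral_mono)
    show "integrable lborel (\<lambda>y. norm (\<rho> (x - y) *\<^sub>R (F y - a)))"
      using integrable_norm[OF Bochner_Integration.integrable_diff[OF i ia]] by (simp add: scaleR_diff_right[symmetric] del: norm_scaleR)
    show "norm (\<rho> (x - y) *\<^sub>R (F y - a)) \<le> \<rho> (x - y) * \<eta>" for y
      using nn[of "x - y"] near[of y] supp[of "x - y"] by (cases "norm (x - y) < \<epsilon>") (auto intro!: mult_left_mono)
  qed (use \<rho> in auto)
  also have "\<dots> = \<eta>" using \<rho> by simp
  finally show ?thesis .
qed

lemma test_fun_reflect_translate:
  fixes \<rho> :: "'a::euclidean_space \<Rightarrow> real"
  assumes sm: "smooth_open UNIV \<rho>" and supp: "\<And>z. norm z \<ge> \<epsilon> \<Longrightarrow> \<rho> z = 0" and A: "cball x \<epsilon> \<subseteq> A"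
  shows "test_fun A (\<lambda>y. \<rho> (x - y))"
    "frechet_derivative (\<lambda>y. \<rho> (x - y)) (at y) i = - frechet_derivative \<rho> (at (x - y)) i"
proof -
  have "{y. \<rho> (x - y) \<noteq> 0} \<subseteq> cball x \<epsilon>" using supp by (force simp: dist_norm)
  then have cl: "closure {y. \<rho> (x - y) \<noteq> 0} \<subseteq> cball x \<epsilon>" by (simp add: closure_minimal)
  have "bounded {y. \<rho> (x - y) \<noteq> 0}"
    by (rule bounded_subset[OF bounded_cball[of x \<epsilon>]]) (rule order_trans[OF closure_subset cl])
  then have cp: "compact (closure {y. \<rho> (x - y) \<noteq> 0})" by (simp only: compact_closure)
  have sm2: "smooth_open UNIV (\<lambda>y. \<rho> (x - y))"
    by (rule smooth_open_compose[OF sm]) (auto intro!: smooth_open_diff smooth_open_const smooth_open_id)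
  show "test_fun A (\<lambda>y. \<rho> (x - y))"
    unfolding test_fun_def using sm2 cp order_trans[OF cl A] by (intro conjI)
  have d: "(\<rho> has_derivative frechet_derivative \<rho> (at (x - y))) (at (x - y))" using smooth_open_has_derivative[OF sm] by simp
  have "((\<lambda>y. \<rho> (x - y)) has_derivative (\<lambda>v. frechet_derivative \<rho> (at (x - y)) (- v))) (at y)"
    by (rule has_derivative_compose[of "\<lambda>y. x - y" "\<lambda>v. - v", OF _ d]) (auto intro!: derivative_eq_intros)
  then have "frechet_derivative (\<lambda>y. \<rho> (x - y)) (at y) = (\<lambda>v. frechet_derivative \<rho> (at (x - y)) (- v))"
    by (rule frechet_derivative_at[symmetric])
  then show "frechet_derivative (\<lambda>y. \<rho> (x - y)) (at y) i = - frechet_derivative \<rho> (at (x - y)) i"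
    using linear_neg[OF has_derivative_linear[OF d]] by simp
qed

text \<open>With \<open>\<rho> (x - y)\<close> as test function the definition of the weak
  derivative says that mollification commutes with differentiation. The ball around \<open>x\<close>
  lies in \<open>A\<close>, so the cutoff by the indicator contributes nothing at the
  boundary.\<close>

lemma convol_weak_partial:
  fixes w g :: "'a::euclidean_space \<Rightarrow> 'b::euclidean_space"
  assumes sm: "smooth_open UNIV \<rho>" and supp: "\<And>z. norm z \<ge> \<epsilon> \<Longrightarrow> \<rho> z = 0" and x: "cball x \<epsilon> \<subseteq> A"
    and [measurable]: "w \<in> borel_measurable borel" "g \<in> borel_measurable borel"
    and w: "weak_partial A i w g"
  shows "convol (\<lambda>z. frechet_derivative \<rho> (at z) i) (\<lambda>y. indicator A y *\<^sub>R w y) x = convol \<rho> (\<lambda>y. indicator A y *\<^sub>R g y) x"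
proof -
  have t: "test_fun A (\<lambda>y. \<rho> (x - y))"
     "\<And>y i. frechet_derivative (\<lambda>y. \<rho> (x - y)) (at y) i = - frechet_derivative \<rho> (at (x - y)) i"
    using test_fun_reflect_translate[OF sm _ x] supp by blast+
  have z: "\<rho> (x - y) = 0" "frechet_derivative \<rho> (at (x - y)) i = 0" if "y \<notin> A" for y
    using test_funD(6,7)[OF t(1) that] t(2)[of y i] by auto
  have 1: "(\<lambda>y. frechet_derivative \<rho> (at (x - y)) i *\<^sub>R (indicator A y *\<^sub>R w y)) = (\<lambda>y. - (frechet_derivative (\<lambda>y. \<rho> (x - y)) (at y) i *\<^sub>R w y))"
    unfolding t(2) using z by (auto simp: fun_eq_iff indicator_def)
  have 2: "(\<lambda>y. \<rho> (x - y) *\<^sub>R (indicator A y *\<^sub>R g y)) = (\<lambda>y. \<rho> (x - y) *\<^sub>R g y)"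
    using z by (auto simp: fun_eq_iff indicator_def)
  have "(LBINT y. frechet_derivative (\<lambda>y. \<rho> (x - y)) (at y) i *\<^sub>R w y) = - (LBINT y. \<rho> (x - y) *\<^sub>R g y)"
    using w t(1) unfolding weak_partial_lborel_iff[OF assms(4,5)] by blast
  then show ?thesis unfolding convol_def 1 2 by simp
qed

section \<open>Norms of Sobolev functions\<close>

lemma borel_representative:
  fixes g :: "'a::euclidean_space \<Rightarrow> 'b::euclidean_space"
  assumes "set_borel_measurable lebesgue A g" and A[measurable]: "A \<in> sets borel"
  obtains g' where "g' \<in> borel_measurable borel" "AE x in lebesgue. indicator A x *\<^sub>R g x = g' x" "\<And>x. x \<notin> A \<Longrightarrow> g' x = 0"
proof -
  let ?f = "\<lambda>x. indicator A x *\<^sub>R g x"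
  have m: "?f \<in> borel_measurable lebesgue" using assms(1) by (simp add: set_borel_measurable_def)
  have "\<exists>h\<in>borel_measurable lborel. AE x in lborel. ?f x \<bullet> b = h x" for b
    by (rule completion_ex_borel_measurable_real) (use m in measurable)
  then obtain h where h: "\<And>b. h b \<in> borel_measurable lborel" "\<And>b. AE x in lborel. ?f x \<bullet> b = h b x" by metis
  have [measurable]: "h b \<in> borel_measurable borel" for b using h(1)[of b] by simp
  define g' where "g' = (\<lambda>x. indicator A x *\<^sub>R (\<Sum>b\<in>Basis. h b x *\<^sub>R b))"
  have "AE x in lborel. \<forall>b\<in>Basis. ?f x \<bullet> b = h b x"
    by (rule AE_finite_allI) (use h(2) in auto)
  then have "AE x in lborel. ?f x = g' x"
  proof eventually_elim
    case (elim x)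
    have "?f x = (\<Sum>b\<in>Basis. (?f x \<bullet> b) *\<^sub>R b)" by (simp only: euclidean_representation)
    also have "\<dots> = (\<Sum>b\<in>Basis. h b x *\<^sub>R b)" using elim by (intro sum.cong) auto
    finally show ?case by (cases "x \<in> A") (auto simp: g'_def)
  qed
  then have "AE x in lebesgue. ?f x = g' x" by (rule AE_completion)
  moreover have "g' \<in> borel_measurable borel" unfolding g'_def by measurable
  moreover have "g' x = 0" if "x \<notin> A" for x using that by (simp add: g'_def)
  ultimately show thesis using that by blast
qed

lemma set_borel_measurable_lebesgueI:
  fixes g :: "'a::euclidean_space \<Rightarrow> 'b::euclidean_space"
  assumes "g \<in> borel_measurable borel" "A \<in> sets borel"
  shows "set_borel_measurable lebesgue A g"
proof -
  note [measurable] = assms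
  have "(\<lambda>x. indicator A x *\<^sub>R g x) \<in> borel_measurable lborel" by measurable
  then show ?thesis unfolding set_borel_measurable_def by (rule measurable_completion)
qed

lemma norm_powr_nat: "n \<ge> 1 \<Longrightarrow> norm (x::'b::real_normed_vector) powr real n = norm x ^ n"
  by (cases "x = 0") (auto simp: powr_realpow)

lemma Lp_space_nat_iff:
  fixes g :: "'a::euclidean_space \<Rightarrow> 'b::euclidean_space"
  assumes [measurable]: "g \<in> borel_measurable borel" "A \<in> sets borel" and n: "n \<ge> 1"
  shows "g \<in> Lp_space A (real n) \<longleftrightarrow> integrable lborel (\<lambda>x. indicator A x * norm (g x) ^ n)"
    "Lp_norm A (real n) g = ((LBINT x. indicator A x * norm (g x) ^ n)) powr (1 / real n)"
proof -
  have [measurable]: "(\<lambda>x. indicator A x * norm (g x) ^ n) \<in> borel_measurable lborel" by measurable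
  have "integrable lebesgue (\<lambda>x. indicator A x * norm (g x) ^ n) \<longleftrightarrow> integrable lborel (\<lambda>x. indicator A x * norm (g x) ^ n)"
    by (rule integrable_completion) measurable
  then show "g \<in> Lp_space A (real n) \<longleftrightarrow> integrable lborel (\<lambda>x. indicator A x * norm (g x) ^ n)"
    using set_borel_measurable_lebesgueI[of g A] by (simp add: Lp_space_def set_integrable_def norm_powr_nat[OF n])
  show "Lp_norm A (real n) g = ((LBINT x. indicator A x * norm (g x) ^ n)) powr (1 / real n)"
    by (simp add: Lp_norm_def set_lebesgue_integral_def norm_powr_nat[OF n] integral_completion)
qed

lemma power_less_of_powr_inverse_less:
  fixes I \<epsilon> :: real
  assumes "I powr (1 / real n) < \<epsilon>" "I \<ge> 0" "n \<ge> 1"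
  shows "I < \<epsilon> ^ n"
proof (cases "I = 0")
  case True
  then show ?thesis using assms by simp
next
  case False
  then have "I = (I powr (1 / real n)) ^ n" using assms by (simp add: powr_powr flip: powr_realpow)
  also have "\<dots> < \<epsilon> ^ n" using assms by (intro power_strict_mono) auto
  finally show ?thesis .
qed

text \<open>The norm picks its weak derivatives by \<open>SOME\<close>. Membership in
  \<open>W1p\<close> makes any such choice a genuine weak derivative, which is then replaced by a
  Borel representative that vanishes off \<open>A\<close>.\<close>

lemma W1p_norm_lessD:
  fixes w :: "'a::euclidean_space \<Rightarrow> 'b::euclidean_space"
  assumes A[measurable]: "A \<in> sets borel" and n: "n \<ge> 1" and w: "w \<in> W1p A (real n)" and m[measurable]: "w \<in> borel_measurable borel"
    and less: "W1p_norm A (real n) w < \<epsilon>"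
  obtains G where "\<And>i. i \<in> Basis \<Longrightarrow> G i \<in> borel_measurable borel" "\<And>i x. x \<notin> A \<Longrightarrow> G i x = 0"
     "\<And>i. i \<in> Basis \<Longrightarrow> weak_partial A i w (G i)"
     "\<And>i. i \<in> Basis \<Longrightarrow> integrable lborel (\<lambda>x. norm (G i x) ^ n)"
     "\<And>i. i \<in> Basis \<Longrightarrow> (LBINT x. norm (G i x) ^ n) < \<epsilon> ^ n"
     "(LBINT x. indicator A x * norm (w x) ^ n) < \<epsilon> ^ n"
proof -
  define S where "S = (\<lambda>i. SOME g. g \<in> Lp_space A (real n) \<and> weak_partial A i w g)"
  have S: "S i \<in> Lp_space A (real n)" "weak_partial A i w (S i)" if "i \<in> Basis" for i
    using w that someI_ex[of "\<lambda>g. g \<in> Lp_space A (real n) \<and> weak_partial A i w g"] by (auto simp: W1p_def S_def)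
  have Lp0: "Lp_norm A (real n) u \<ge> 0" for u :: "'a \<Rightarrow> 'b" by (simp add: Lp_norm_def)
  have sum: "Lp_norm A (real n) w + (\<Sum>i\<in>Basis. Lp_norm A (real n) (S i)) < \<epsilon>"
    using less by (simp add: W1p_norm_def S_def)
  then have lw: "Lp_norm A (real n) w < \<epsilon>" using Lp0 by (smt (verit) sum_nonneg)
  have lS: "Lp_norm A (real n) (S i) < \<epsilon>" if "i \<in> Basis" for i
  proof -
    have "Lp_norm A (real n) (S i) \<le> (\<Sum>i\<in>Basis. Lp_norm A (real n) (S i))"
      by (rule member_le_sum[OF that]) (use Lp0 in auto)
    then show ?thesis using Lp0[of w] sum by linarith
  qed
  have "\<exists>g. (i \<in> Basis \<longrightarrow> g \<in> borel_measurable borel \<and> (AE x in lebesgue. indicator A x *\<^sub>R S i x = g x)) \<and> (\<forall>x. x \<notin> A \<longrightarrow> g x = 0)" for i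
  proof (cases "i \<in> Basis")
    case True
    then have "set_borel_measurable lebesgue A (S i)" using S(1) by (simp add: Lp_space_def)
    then show ?thesis using borel_representative[OF _ A] by metis
  next
    case False
    then show ?thesis by (intro exI[of _ "\<lambda>_. 0"]) simp
  qed
  then obtain G where G: "\<And>i. i \<in> Basis \<Longrightarrow> G i \<in> borel_measurable borel"
     "\<And>i. i \<in> Basis \<Longrightarrow> AE x in lebesgue. indicator A x *\<^sub>R S i x = G i x" "\<And>i x. x \<notin> A \<Longrightarrow> G i x = 0"
    by metis
  show thesis
  proof (rule that)
    fix i :: 'a assume i: "i \<in> Basis"
    note [measurable] = G(1)[OF i]
    have mS: "(\<lambda>x. indicator A x *\<^sub>R S i x) \<in> borel_measurable lebesgue"
      using S(1)[OF i] by (simp add: Lp_space_def set_borel_measurable_def)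
    have mG: "G i \<in> borel_measurable lebesgue" by (rule measurable_completion) simp
    show "weak_partial A i w (G i)"
      unfolding weak_partial_def
    proof (intro allI impI)
      fix \<phi> assume t: "test_fun A \<phi>"
      have m\<phi>: "\<phi> \<in> borel_measurable lebesgue" by (rule measurable_completion) (use test_fun_measurable(1)[OF t] in simp)
      have "integral\<^sup>L lebesgue (\<lambda>x. \<phi> x *\<^sub>R (indicator A x *\<^sub>R S i x)) = integral\<^sup>L lebesgue (\<lambda>x. \<phi> x *\<^sub>R G i x)"
      proof (rule integral_cong_AE)
        show "AE x in lebesgue. \<phi> x *\<^sub>R (indicator A x *\<^sub>R S i x) = \<phi> x *\<^sub>R G i x"
          using G(2)[OF i] by eventually_elim simp
      qed (rule borel_measurable_scaleR[OF m\<phi> mS], rule borel_measurable_scaleR[OF m\<phi> mG])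
      moreover have "(\<lambda>x. indicator A x *\<^sub>R (\<phi> x *\<^sub>R S i x)) = (\<lambda>x. \<phi> x *\<^sub>R (indicator A x *\<^sub>R S i x))"
        "(\<lambda>x. indicator A x *\<^sub>R (\<phi> x *\<^sub>R G i x)) = (\<lambda>x. \<phi> x *\<^sub>R G i x)"
        using G(3) by (auto simp: fun_eq_iff indicator_def)
      ultimately have "set_lebesgue_integral lebesgue A (\<lambda>x. \<phi> x *\<^sub>R S i x) = set_lebesgue_integral lebesgue A (\<lambda>x. \<phi> x *\<^sub>R G i x)"
        by (simp only: set_lebesgue_integral_def)
      then show "set_lebesgue_integral lebesgue A (\<lambda>x. frechet_derivative \<phi> (at x) i *\<^sub>R w x) = - set_lebesgue_integral lebesgue A (\<lambda>x. \<phi> x *\<^sub>R G i x)"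
        using S(2)[OF i] t by (simp add: weak_partial_def)
    qed
    have ae: "AE x in lebesgue. indicator A x *\<^sub>R (norm (S i x) powr real n) = norm (G i x) ^ n"
      using G(2)[OF i]
    proof eventually_elim
      case (elim x)
      then show ?case using n G(3)[of x i] by (cases "x \<in> A") (auto simp: norm_powr_nat[OF n])
    qed
    have mm: "(\<lambda>x. norm (G i x) ^ n) \<in> borel_measurable lebesgue" by (rule measurable_completion) measurable
    have iS: "integrable lebesgue (\<lambda>x. indicator A x *\<^sub>R (norm (S i x) powr real n))"
      using S(1)[OF i] by (simp add: Lp_space_def set_integrable_def)
    have iG: "integrable lebesgue (\<lambda>x. norm (G i x) ^ n)"
      using integrable_cong_AE[OF borel_measurable_integrable[OF iS] mm ae] iS by blast
    then show "integrable lborel (\<lambda>x. norm (G i x) ^ n)"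
      by (subst (asm) integrable_completion) auto
    have "integral\<^sup>L lebesgue (\<lambda>x. indicator A x *\<^sub>R (norm (S i x) powr real n)) = integral\<^sup>L lebesgue (\<lambda>x. norm (G i x) ^ n)"
      by (rule integral_cong_AE[OF borel_measurable_integrable[OF iS] mm ae])
    also have "\<dots> = (LBINT x. norm (G i x) ^ n)" by (rule integral_completion) measurable
    finally have "Lp_norm A (real n) (S i) = ((LBINT x. norm (G i x) ^ n)) powr (1 / real n)"
      by (simp add: Lp_norm_def set_lebesgue_integral_def)
    then show "(LBINT x. norm (G i x) ^ n) < \<epsilon> ^ n"
      using lS[OF i] n by (intro power_less_of_powr_inverse_less) auto
  next
    show "(LBINT x. indicator A x * norm (w x) ^ n) < \<epsilon> ^ n"
      using lw n unfolding Lp_space_nat_iff(2)[OF m A n] by (intro power_less_of_powr_inverse_less) auto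
  qed (use G in auto)
qed

lemma bounded_emeasure_finite:
  assumes "bounded (A::'a::euclidean_space set)" "A \<in> sets borel"
  shows "emeasure lborel A < \<infinity>"
proof -
  obtain R where "\<forall>x\<in>A. norm x \<le> R" using assms(1) bounded_iff by blast
  then have "A \<subseteq> cball 0 R" by auto
  then have "emeasure lborel A \<le> emeasure lborel (cball 0 R :: 'a set)" by (intro emeasure_mono) auto
  also have "\<dots> < \<infinity>" by (rule emeasure_lborel_cball_finite)
  finally show ?thesis .
qed

lemma integrable_of_power_integrable:
  fixes G :: "'a::euclidean_space \<Rightarrow> 'b::euclidean_space"
  assumes [measurable]: "G \<in> borel_measurable borel" "A \<in> sets borel" and A: "emeasure lborel A < \<infinity>" and z: "\<And>x. x \<notin> A \<Longrightarrow> G x = 0"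
    and i: "integrable lborel (\<lambda>x. norm (G x) ^ n)" and n: "n \<ge> 1"
  shows "integrable lborel G"
proof (rule Bochner_Integration.integrable_bound)
  show "integrable lborel (\<lambda>x. indicator A x + norm (G x) ^ n :: real)" using A i by (auto intro!: integrable_real_indicator)
  show "AE x in lborel. norm (G x) \<le> norm (indicator A x + norm (G x) ^ n)"
  proof (rule AE_I2)
    fix x
    have "t \<le> 1 + t ^ n" if "t \<ge> 0" for t :: real
      using that self_le_power[of t n] n by (cases "t \<le> 1") (auto simp: add_increasing2)
    then show "norm (G x) \<le> norm (indicator A x + norm (G x) ^ n)"
      using z[of x] by (cases "x \<in> A") auto
  qed
qed simp

lemma weak_partial_diff:
  fixes u v g h :: "'a::euclidean_space \<Rightarrow> 'b::euclidean_space"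
  assumes m: "u \<in> borel_measurable borel" "v \<in> borel_measurable borel" "g \<in> borel_measurable borel" "h \<in> borel_measurable borel"
    and A: "A \<in> sets borel"
    and i: "integrable lborel (\<lambda>x. indicator A x *\<^sub>R u x)" "integrable lborel (\<lambda>x. indicator A x *\<^sub>R v x)"
       "integrable lborel (\<lambda>x. indicator A x *\<^sub>R g x)" "integrable lborel (\<lambda>x. indicator A x *\<^sub>R h x)"
    and w: "weak_partial A j u g" "weak_partial A j v h"
  shows "weak_partial A j (\<lambda>x. u x - v x) (\<lambda>x. g x - h x)"
proof -
  note [measurable] = m A
  have int: "integrable lborel (\<lambda>x. \<psi> x *\<^sub>R f x)" if "integrable lborel (\<lambda>x. indicator A x *\<^sub>R f x)" "\<psi> \<in> borel_measurable borel" "\<And>x. \<bar>\<psi> x\<bar> \<le> C" "\<And>x. x \<notin> A \<Longrightarrow> \<psi> x = 0" "f \<in> borel_measurable borel"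
    for f :: "'a \<Rightarrow> 'b" and \<psi> C
  proof (rule Bochner_Integration.integrable_bound)
    show "integrable lborel (\<lambda>x. C *\<^sub>R (indicator A x *\<^sub>R f x))" by (intro integrable_scaleR_right that(1))
    show "AE x in lborel. norm (\<psi> x *\<^sub>R f x) \<le> norm (C *\<^sub>R indicator A x *\<^sub>R f x)"
    proof (rule AE_I2)
      fix x
      have "\<bar>\<psi> x\<bar> \<le> \<bar>C\<bar>" using that(3)[of x] by linarith
      then show "norm (\<psi> x *\<^sub>R f x) \<le> norm (C *\<^sub>R indicator A x *\<^sub>R f x)" using that(4)[of x]
        by (cases "x \<in> A") (auto intro!: mult_right_mono)
    qed
  qed (use that in auto)
  have md: "(\<lambda>x. u x - v x) \<in> borel_measurable borel" "(\<lambda>x. g x - h x) \<in> borel_measurable borel" by measurable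
  show ?thesis
    unfolding weak_partial_lborel_iff[OF md]
  proof (intro allI impI)
    fix \<phi> assume t: "test_fun A \<phi>"
    obtain B where B: "B > 0" "\<And>x v. norm (frechet_derivative \<phi> (at x) v) \<le> B * norm v" "\<And>x. \<bar>\<phi> x\<bar> \<le> B"
      using test_fun_bounds[OF t] by metis
    have a: "integrable lborel (\<lambda>x. frechet_derivative \<phi> (at x) j *\<^sub>R f x)" if "integrable lborel (\<lambda>x. indicator A x *\<^sub>R f x)" "f \<in> borel_measurable borel" for f :: "'a \<Rightarrow> 'b"
      by (rule int[OF that(1) _ _ _ that(2), where C="B * norm j"]) (use B(2) test_fun_measurable[OF t] test_funD(7)[OF t] in auto)
    have b: "integrable lborel (\<lambda>x. \<phi> x *\<^sub>R f x)" if "integrable lborel (\<lambda>x. indicator A x *\<^sub>R f x)" "f \<in> borel_measurable borel" for f :: "'a \<Rightarrow> 'b"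
      by (rule int[OF that(1) _ _ _ that(2), where C=B]) (use B(3) test_fun_measurable[OF t] test_funD(6)[OF t] in auto)
    show "(LBINT x. frechet_derivative \<phi> (at x) j *\<^sub>R (u x - v x)) = - (LBINT x. \<phi> x *\<^sub>R (g x - h x))"
      using w t a[OF i(1) m(1)] a[OF i(2) m(2)] b[OF i(3) m(3)] b[OF i(4) m(4)]
      unfolding weak_partial_lborel_iff[OF m(1,3)] weak_partial_lborel_iff[OF m(2,4)] by (simp add: scaleR_diff_right)
  qed
qed

section \<open>The wobbly sphere\<close>

text \<open>For a unit vector \<open>p\<close> this is the complement of the closed ray from the
  origin through \<open>p\<close>, by the equality case of the Cauchy-Schwarz inequality.\<close>

definition offray :: "'a::euclidean_space \<Rightarrow> 'a set" where
  "offray p = {x. x \<bullet> p < norm x}"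

text \<open>Near the ray this is about theta^2 / 16. The divisor 8 forces
  \<open>ht p x \<le> 1 / 4\<close>, hence \<open>lg p x \<ge> 4 / 3\<close> off the ray, so that
  the amplitude \<open>1 / lg p x\<close> is at most 3/4 and the radius of the perturbed sphere
  stays at least 1/4.\<close>

definition ht :: "'a::euclidean_space \<Rightarrow> 'a \<Rightarrow> real" where
  "ht p x = (1 - (x \<bullet> p) / norm x) / 8"

definition lg :: "'a::euclidean_space \<Rightarrow> 'a \<Rightarrow> real" where
  "lg p x = - ln (ht p x)"

text \<open>On the ray through \<open>p\<close> the convention \<open>ln 0 = 0\<close> makes the oscillating factor
  \<open>sin L / L\<close> equal to \<open>0\<close>, which is its limit there.\<close>

definition wob :: "'a::euclidean_space \<Rightarrow> 'a \<Rightarrow> real" where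
  "wob p x = sin (lg p x) / lg p x"

text \<open>Homogeneous of degree 0, hence equal to its own radial extension, and a positive
  multiple of \<open>x\<close> for \<open>x \<noteq> 0\<close>. The same function thus parametrizes
  the surface by the sphere and retracts the punctured space onto it.\<close>

definition wsph :: "'a::euclidean_space \<Rightarrow> 'a \<Rightarrow> 'a" where
  "wsph p x = (1 + wob p x) *\<^sub>R (x /\<^sub>R norm x)"

text \<open>Splitting off the difference of the inverse norms, the norm of \<open>w\<close> cancels,
  so a lower bound on the norm of \<open>u\<close> alone is enough.\<close>

lemma normalize_diff_le:
  fixes u w :: "'a::real_normed_vector"
  assumes "norm u \<ge> m" "m > 0"
  shows "norm (u /\<^sub>R norm u - w /\<^sub>R norm w) \<le> 2 / m * norm (u - w)"
proof (cases "w = 0")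
  case True
  have "norm u > 0" using assms by linarith
  then have "norm (u /\<^sub>R norm u) = 1" by simp
  also have "\<dots> \<le> 2 / m * norm u" using assms by (simp add: divide_simps)
  finally show ?thesis using True by simp
next
  case False
  have u: "norm u > 0" using assms by linarith
  have "inverse (norm u) - inverse (norm w) = (norm w - norm u) / (norm u * norm w)"
    using False u by (simp add: field_simps)
  then have "u /\<^sub>R norm u - w /\<^sub>R norm w = (u - w) /\<^sub>R norm u + ((norm w - norm u) / (norm u * norm w)) *\<^sub>R w"
    by (simp add: algebra_simps flip: scaleR_diff_left)
  also have "norm \<dots> \<le> norm ((u - w) /\<^sub>R norm u) + norm (((norm w - norm u) / (norm u * norm w)) *\<^sub>R w)"
    by (rule norm_triangle_ineq)
  also have "\<dots> = norm (u - w) / norm u + \<bar>norm w - norm u\<bar> / norm u"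
    using False u by (simp add: divide_inverse mult.commute abs_mult)
  also have "\<dots> \<le> norm (u - w) / norm u + norm (u - w) / norm u"
    using norm_triangle_ineq3[of w u] u by (intro add_left_mono divide_right_mono) (auto simp: norm_minus_commute)
  also have "\<dots> = 2 * norm (u - w) / norm u" by simp
  also have "\<dots> \<le> 2 * norm (u - w) / m" using assms u by (intro divide_left_mono) auto
  finally show ?thesis by simp
qed

lemma smooth_open_lipschitz_on_compact_convex:
  fixes f :: "'a::euclidean_space \<Rightarrow> 'b::euclidean_space"
  assumes f: "smooth_open U f" and K: "compact K" "convex K" "K \<subseteq> U"
  obtains L where "L-lipschitz_on K f"
proof -
  let ?D = "\<lambda>x. frechet_derivative f (at x)"
  have "\<exists>C\<ge>0. \<forall>x\<in>K. norm (?D x b) \<le> C" for b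
    using compact_image_bound[OF K(1) continuous_on_subset[OF smooth_open_continuous_derivative[OF f] K(3)]] by metis
  then obtain C where C: "\<And>b. C b \<ge> 0" "\<And>b x. x \<in> K \<Longrightarrow> norm (?D x b) \<le> C b" by metis
  define L where "L = (\<Sum>b\<in>Basis. C b)"
  have L0: "L \<ge> 0" unfolding L_def by (intro sum_nonneg C)
  have der: "(f has_derivative ?D x) (at x)" if "x \<in> K" for x
    using smooth_open_has_derivative[OF f] K(3) that by blast
  have on: "onorm (?D x) \<le> L" if "x \<in> K" for x
  proof (rule onorm_le)
    fix v
    have lin: "linear (?D x)" using has_derivative_linear[OF der[OF that]] .
    have "?D x v = ?D x (\<Sum>b\<in>Basis. (v \<bullet> b) *\<^sub>R b)" by (simp add: euclidean_representation)
    also have "\<dots> = (\<Sum>b\<in>Basis. (v \<bullet> b) *\<^sub>R ?D x b)" by (simp add: linear_sum[OF lin] linear_cmul[OF lin])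
    also have "norm \<dots> \<le> (\<Sum>b\<in>Basis. C b * norm v)"
    proof (rule sum_norm_le)
      fix b :: 'a assume "b \<in> Basis"
      then have "\<bar>v \<bullet> b\<bar> * norm (?D x b) \<le> norm v * C b"
        using C(2)[OF that, of b] by (intro mult_mono) (auto simp: Basis_le_norm)
      then show "norm ((v \<bullet> b) *\<^sub>R ?D x b) \<le> C b * norm v" by (simp add: mult.commute)
    qed
    also have "\<dots> = L * norm v" by (simp add: L_def sum_distrib_right)
    finally show "norm (?D x v) \<le> L * norm v" .
  qed
  have "L-lipschitz_on K f"
  proof (rule lipschitz_onI)
    fix x y assume "x \<in> K" "y \<in> K"
    then show "dist (f x) (f y) \<le> L * dist x y"
      unfolding dist_norm
      by (intro differentiable_bound[OF K(2), of f ?D]) (use der on in \<open>auto intro: has_derivative_at_withinI\<close>)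
  qed (rule L0)
  then show thesis using that by blast
qed

text \<open>With \<open>p\<close> in the basis, the remaining basis vectors index the stereographic
  coordinates and the row of \<open>p\<close> in a determinant is left for the radial
  direction.\<close>

locale pole =
  fixes p :: "'a::euclidean_space"
  assumes p: "p \<in> Basis"
begin

lemma norm_p [simp]: "norm p = 1" and pp [simp]: "p \<bullet> p = 1" and p_nz [simp]: "p \<noteq> 0"
  using p by (auto simp: inner_same_Basis)

lemma inner_p_le: "x \<bullet> p \<le> norm x"
  using Cauchy_Schwarz_ineq2[of x p] by simp

lemma inner_p_ge: "- norm x \<le> x \<bullet> p"
  using Cauchy_Schwarz_ineq2[of x p] by simp

lemma inner_p_eq_norm_iff: "x \<bullet> p = norm x \<longleftrightarrow> x = norm x *\<^sub>R p"
  using norm_cauchy_schwarz_eq[of x p] by (metis mult.commute mult_1 norm_p scaleR_one)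

lemma offray_iff: "x \<in> offray p \<longleftrightarrow> x \<noteq> norm x *\<^sub>R p"
  using inner_p_le[of x] inner_p_eq_norm_iff[of x] by (auto simp: offray_def)

lemma offray_nz: "x \<in> offray p \<Longrightarrow> x \<noteq> 0"
  by (auto simp: offray_def)

lemma open_offray: "open (offray p)"
  unfolding offray_def by (intro open_Collect_less continuous_intros)

lemma ht_nonneg: "x \<noteq> 0 \<Longrightarrow> 0 \<le> ht p x"
  using inner_p_le[of x] by (simp add: ht_def divide_le_eq)

lemma ht_le: "ht p x \<le> 1 / 4"
proof (cases "x = 0")
  case False
  then have "- 1 \<le> (x \<bullet> p) / norm x" using inner_p_ge[of x] by (simp add: le_divide_eq)
  then show ?thesis by (simp add: ht_def)
qed (simp add: ht_def)

lemma ht_pos_iff: "x \<noteq> 0 \<Longrightarrow> 0 < ht p x \<longleftrightarrow> x \<in> offray p"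
  by (simp add: ht_def offray_def divide_less_eq)

lemma ht_eq_0: "x \<noteq> 0 \<Longrightarrow> x \<notin> offray p \<Longrightarrow> ht p x = 0"
  using ht_pos_iff[of x] ht_nonneg[of x] by auto

lemma lg_ge: "x \<in> offray p \<Longrightarrow> 4 / 3 \<le> lg p x"
proof -
  assume "x \<in> offray p"
  then have "0 < ht p x" using ht_pos_iff offray_nz by blast
  then have "ln (ht p x) \<le> ln (1 / 4)" using ht_le[of x] by (subst ln_le_cancel_iff) auto
  also have "ln (1 / 4 :: real) = - (2 * ln 2)"
    using ln_realpow[of 2 2] by (simp add: ln_div)
  finally show ?thesis using ln2_ge_two_thirds by (simp add: lg_def)
qed

lemma wob_eq_0: "x \<noteq> 0 \<Longrightarrow> x \<notin> offray p \<Longrightarrow> wob p x = 0"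
  by (simp add: wob_def lg_def ht_eq_0)

lemma abs_wob_le: "x \<in> offray p \<Longrightarrow> \<bar>wob p x\<bar> \<le> 1 / lg p x"
  using lg_ge[of x] by (auto simp: wob_def abs_mult intro!: divide_right_mono)

lemma wob_bounds: "x \<noteq> 0 \<Longrightarrow> \<bar>wob p x\<bar> \<le> 3 / 4"
proof (cases "x \<in> offray p")
  case True
  have "1 / lg p x \<le> 3 / 4" using lg_ge[OF True] by (simp add: divide_simps)
  then show ?thesis using abs_wob_le[OF True] by simp
qed (simp add: wob_eq_0)

lemma ht_scaleR: "c > 0 \<Longrightarrow> ht p (c *\<^sub>R x) = ht p x"
  by (simp add: ht_def)

lemma wob_scaleR: "c > 0 \<Longrightarrow> wob p (c *\<^sub>R x) = wob p x"
  by (simp add: wob_def lg_def ht_scaleR)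

lemma wsph_scaleR: "c > 0 \<Longrightarrow> wsph p (c *\<^sub>R x) = wsph p x"
  by (simp add: wsph_def wob_scaleR)

lemma norm_wsph: "x \<noteq> 0 \<Longrightarrow> norm (wsph p x) = 1 + wob p x"
  using wob_bounds[of x] by (simp add: wsph_def)

lemma norm_wsph_bounds: "x \<noteq> 0 \<Longrightarrow> 1 / 4 \<le> norm (wsph p x) \<and> norm (wsph p x) \<le> 2"
  using wob_bounds[of x] by (auto simp: norm_wsph)

lemma wsph_pos_multiple: "x \<noteq> 0 \<Longrightarrow> \<exists>c>0. wsph p x = c *\<^sub>R x"
proof (intro exI conjI)
  assume "x \<noteq> 0"
  then show "0 < (1 + wob p x) / norm x" using wob_bounds[of x] by (intro divide_pos_pos) auto
qed (simp add: wsph_def divide_inverse)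

lemma normalize_wsph: "x \<noteq> 0 \<Longrightarrow> wsph p x /\<^sub>R norm (wsph p x) = x /\<^sub>R norm x"
  using wsph_pos_multiple[of x] by auto

lemma wsph_idem: "x \<noteq> 0 \<Longrightarrow> wsph p (wsph p x) = wsph p x"
  using wsph_pos_multiple[of x] wsph_scaleR by metis

lemma wsph_p: "wsph p p = p"
  using wob_eq_0[of p] by (simp add: wsph_def offray_def)

lemma offray_scaleR: "c > 0 \<Longrightarrow> c *\<^sub>R x \<in> offray p \<longleftrightarrow> x \<in> offray p"
  by (simp add: offray_def)

lemma wsph_offray_iff: "x \<noteq> 0 \<Longrightarrow> wsph p x \<in> offray p \<longleftrightarrow> x \<in> offray p"
  using wsph_pos_multiple[of x] offray_scaleR by metis

lemma smooth_ht: "smooth_open (offray p) (ht p)"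
proof -
  have n: "smooth_open (offray p) (\<lambda>x. norm x)"
    using smooth_open_norm[OF open_offray] offray_nz by blast
  have i: "smooth_open (- {0}) (\<lambda>x::real. inverse x)" by (rule smooth_open_inverse) (auto simp: open_Compl)
  have "smooth_open (offray p) (\<lambda>x. (1 - (x \<bullet> p) * inverse (norm x)) * (1/8))"
    by (intro smooth_open_mult smooth_open_diff smooth_open_const open_offray smooth_open_inner smooth_open_id
       smooth_open_compose[OF i n]) (auto dest: offray_nz)
  then show ?thesis by (rule smooth_open_cong) (simp only: ht_def divide_inverse mult_1)
qed

lemma smooth_lg: "smooth_open (offray p) (lg p)"
proof -
  have "smooth_open (offray p) (\<lambda>x. - ln (ht p x))"
    by (intro smooth_open_minus smooth_open_compose[OF smooth_open_ln smooth_ht])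
       (use ht_pos_iff offray_nz in auto)
  then show ?thesis by (rule smooth_open_cong) (simp add: lg_def)
qed

lemma smooth_wob: "smooth_open (offray p) (wob p)"
proof -
  have i: "smooth_open {0<..} (\<lambda>x::real. inverse x)" by (rule smooth_open_inverse) auto
  have "smooth_open (offray p) (\<lambda>x. sin (lg p x) * inverse (lg p x))"
    by (intro smooth_open_mult smooth_open_compose[OF smooth_open_sin smooth_lg] smooth_open_compose[OF i smooth_lg])
       (use lg_ge in force)+
  then show ?thesis by (rule smooth_open_cong) (simp add: wob_def divide_inverse)
qed

lemma smooth_normalize: "smooth_open (- {0}) (\<lambda>x::'a. x /\<^sub>R norm x)"
proof -
  have o: "open (- {0::'a})" by (simp add: open_Compl)
  have n: "smooth_open (- {0}) (\<lambda>x::'a. norm x)" by (rule smooth_open_norm[OF o]) simp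
  have i: "smooth_open (- {0}) (\<lambda>x::real. inverse x)" by (rule smooth_open_inverse) (auto simp: open_Compl)
  show ?thesis
    by (intro smooth_open_scaleR smooth_open_id o smooth_open_compose[OF i n]) auto
qed

lemma smooth_wsph: "smooth_open (offray p) (wsph p)"
proof -
  have "smooth_open (offray p) (\<lambda>x. (1 + wob p x) *\<^sub>R (x /\<^sub>R norm x))"
    by (intro smooth_open_scaleR smooth_open_add smooth_open_const open_offray smooth_wob
        smooth_open_subset[OF smooth_normalize]) (auto dest: offray_nz)
  then show ?thesis by (rule smooth_open_cong) (simp add: wsph_def)
qed

lemma continuous_on_ht: "continuous_on (- {0}) (ht p)"
proof -
  have "continuous_on (- {0}) (\<lambda>x. (1 - (x \<bullet> p) / norm x) / 8)" by (intro continuous_intros) auto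
  then show ?thesis by (simp add: ht_def[abs_def])
qed

lemma continuous_on_wob: "continuous_on (- {0}) (wob p)"
proof (rule continuous_at_imp_continuous_on, rule ballI)
  fix x :: 'a assume x: "x \<in> - {0}"
  show "isCont (wob p) x"
  proof (cases "x \<in> offray p")
    case True
    then show ?thesis
      using smooth_open_continuous[OF smooth_wob] open_offray by (simp add: continuous_on_eq_continuous_at)
  next
    case False
    have w0: "wob p x = 0" "ht p x = 0" using wob_eq_0 ht_eq_0 x False by auto
    show ?thesis
      unfolding isCont_def w0
    proof (rule tendstoI)
      fix e :: real assume e: "e > 0"
      have "isCont (ht p) x"
        using continuous_on_ht x by (simp add: continuous_on_eq_continuous_at open_Compl)
      \<comment> \<open>Below this threshold \<open>lg p y\<close> exceeds \<open>1 / e\<close>, so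
        the bound \<open>1 / lg p y\<close> on the oscillation is smaller than
        \<open>e\<close>.\<close>
      then have "eventually (\<lambda>y. ht p y < exp (- 1 / e)) (at x)"
        unfolding isCont_def w0 by (rule order_tendstoD) simp
      moreover have "eventually (\<lambda>y. y \<noteq> 0) (at x)"
        using x by (intro eventually_neq_at_within)
      ultimately show "eventually (\<lambda>y. dist (wob p y) 0 < e) (at x)"
      proof eventually_elim
        case (elim y)
        show ?case
        proof (cases "y \<in> offray p")
          case True
          then have "ln (ht p y) < - 1 / e"
            using elim ht_pos_iff[of y] ln_less_cancel_iff[of "ht p y" "exp (- 1 / e)"] by simp
          then have "lg p y > 1 / e" by (simp add: lg_def)
          then have "1 / lg p y < e" using e lg_ge[OF True] by (simp add: divide_simps mult.commute)
          then show ?thesis using abs_wob_le[OF True] by simp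
        qed (use elim e wob_eq_0 in simp)
      qed
    qed
  qed
qed

lemma continuous_on_wsph: "continuous_on (- {0}) (wsph p)"
proof -
  have "continuous_on (- {0}) (\<lambda>x. (1 + wob p x) *\<^sub>R (x /\<^sub>R norm x))"
    by (intro continuous_intros continuous_on_wob) auto
  then show ?thesis by (simp add: wsph_def[abs_def])
qed

section \<open>The surface and its comparison with the round sphere\<close>

definition Y :: "'a set" where "Y = wsph p ` sphere 0 1"

lemma compact_Y: "compact Y"
  unfolding Y_def by (intro compact_continuous_image continuous_on_subset[OF continuous_on_wsph]) auto

lemma p_in_Y: "p \<in> Y"
  unfolding Y_def using wsph_p by (metis image_eqI mem_sphere_0 norm_p)

lemma Y_nz: "y \<in> Y \<Longrightarrow> y \<noteq> 0"
  using norm_wsph_bounds unfolding Y_def by (metis imageE mem_sphere_0 norm_zero not_le zero_less_divide_1_iff zero_less_numeral zero_neq_one)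

lemma norm_Y: "y \<in> Y \<Longrightarrow> 1 / 4 \<le> norm y \<and> norm y \<le> 2"
  using norm_wsph_bounds unfolding Y_def by (metis imageE mem_sphere_0 norm_zero zero_neq_one)

lemma wsph_Y: "y \<in> Y \<Longrightarrow> wsph p y = y"
  unfolding Y_def by (metis imageE mem_sphere_0 norm_zero wsph_idem zero_neq_one)

lemma wsph_in_Y: "x \<noteq> 0 \<Longrightarrow> wsph p x \<in> Y"
  using wsph_scaleR[of "inverse (norm x)" x] unfolding Y_def by (intro image_eqI[of _ _ "x /\<^sub>R norm x"]) auto

lemma Y_offray_iff: "y \<in> Y \<Longrightarrow> y \<in> offray p \<longleftrightarrow> y \<noteq> p"
proof -
  assume y: "y \<in> Y"
  show ?thesis
  proof
    assume "y \<in> offray p" then show "y \<noteq> p" by (auto simp: offray_def)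
  next
    assume n: "y \<noteq> p"
    show "y \<in> offray p"
    proof (rule ccontr)
      assume "y \<notin> offray p"
      then have "y = norm y *\<^sub>R p" by (simp add: offray_iff)
      then have "wsph p y = p" using wsph_scaleR[of "norm y" p] wsph_p Y_nz[OF y] by simp
      then show False using n wsph_Y[OF y] by simp
    qed
  qed
qed

lemma norm_Y_eq: "y \<in> Y \<Longrightarrow> norm y = 1 + wob p y"
  using wsph_Y norm_wsph[OF Y_nz] by metis

lemma homeomorphism_Y: "homeomorphism Y (sphere 0 1) (\<lambda>y. y /\<^sub>R norm y) (wsph p)"
proof (rule homeomorphismI)
  show "continuous_on Y (\<lambda>y. y /\<^sub>R norm y)" by (intro continuous_intros) (use Y_nz in auto)
  show "continuous_on (sphere 0 1) (wsph p)" by (rule continuous_on_subset[OF continuous_on_wsph]) auto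
  show "(\<lambda>y. y /\<^sub>R norm y) ` Y \<subseteq> sphere 0 1" using Y_nz by auto
  show "wsph p ` sphere 0 1 \<subseteq> Y" by (simp add: Y_def)
  show "wsph p (y /\<^sub>R norm y) = y" if "y \<in> Y" for y
    using wsph_scaleR[of "inverse (norm y)" y] Y_nz[OF that] wsph_Y[OF that] by simp
  show "wsph p x /\<^sub>R norm (wsph p x) = x" if "x \<in> sphere 0 1" for x
    using normalize_wsph[of x] that by (metis inverse_1 mem_sphere_0 norm_zero scaleR_one zero_neq_one)
qed

lemma normalize_lipschitz_Y: "8-lipschitz_on Y (\<lambda>y. y /\<^sub>R norm y)"
proof (rule lipschitz_onI)
  fix x y assume "x \<in> Y" "y \<in> Y"
  then show "dist (x /\<^sub>R norm x) (y /\<^sub>R norm y) \<le> 8 * dist x y"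
    using normalize_diff_le[of "1/4" x y] norm_Y[of x] by (simp add: dist_norm)
qed simp

lemma normalize_image_Y: "(\<lambda>y. y /\<^sub>R norm y) ` (Y - {p}) = sphere 0 1 - {p}"
proof -
  have inj: "inj_on (\<lambda>y. y /\<^sub>R norm y) Y"
    by (rule inj_on_inverseI[of _ "wsph p"]) (use homeomorphism_apply1[OF homeomorphism_Y] in blast)
  have "(\<lambda>y. y /\<^sub>R norm y) ` Y = sphere 0 1" using homeomorphism_Y by (simp add: homeomorphism_def)
  then show ?thesis using inj_on_image_set_diff[OF inj, of Y "{p}"] p_in_Y by simp
qed

text \<open>Both directions extend smoothly to open sets: normalization to the complement of the
  origin, its inverse \<open>wsph p\<close> to the complement of the ray, which meets the sphere
  only in \<open>p\<close>.\<close>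

lemma diffeomorphism_Y: "diffeomorphism_sets (Y - {p}) (sphere 0 1 - {p}) (\<lambda>y. y /\<^sub>R norm y)"
  unfolding diffeomorphism_sets_def
proof (intro exI[of _ "wsph p"] conjI)
  have "wsph p ` (sphere 0 1 - {p}) = Y - {p}"
  proof -
    have inj: "inj_on (wsph p) (sphere 0 1)"
      by (rule inj_on_inverseI[of _ "\<lambda>y. y /\<^sub>R norm y"]) (use homeomorphism_apply2[OF homeomorphism_Y] in blast)
    show ?thesis using inj_on_image_set_diff[OF inj, of "sphere 0 1" "{p}"] wsph_p by (simp add: Y_def)
  qed
  then show "homeomorphism (Y - {p}) (sphere 0 1 - {p}) (\<lambda>y. y /\<^sub>R norm y) (wsph p)"
    using homeomorphism_of_subsets[OF homeomorphism_Y, of "Y - {p}" "sphere 0 1 - {p}"] normalize_image_Y by auto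
  show "smooth_on_set (Y - {p}) (\<lambda>y. y /\<^sub>R norm y)"
    unfolding smooth_on_set_def
    by (intro ballI exI[of _ "- {0}"] exI[of _ "\<lambda>y. y /\<^sub>R norm y"]) (use smooth_normalize Y_nz in auto)
  have "x \<in> offray p" if "x \<in> sphere 0 1 - {p}" for x using that by (auto simp: offray_iff)
  then show "smooth_on_set (sphere 0 1 - {p}) (wsph p)"
    unfolding smooth_on_set_def using smooth_wsph by blast
qed

end

section \<open>Lipschitz maps into the wobbly sphere\<close>

context pole begin

text \<open>The values of L at which \<open>sin L\<close> is alternately 1 and -1; the offset
  \<open>J\<close> discards the first of them.\<close>

definition osc_level :: "nat \<Rightarrow> nat \<Rightarrow> real" where
  "osc_level J j = pi / 2 + pi * real (J + j)"

lemma osc_level_pos: "osc_level J j > 0"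
  by (simp add: osc_level_def add_pos_nonneg)

lemma sin_osc_level: "sin (osc_level J j) = (-1) ^ (J + j)"
  by (simp add: osc_level_def sin_add mult.commute[of pi] cos_npi sin_npi del: of_nat_add)

lemma osc_level_mono: "osc_level J j < osc_level J (Suc j)"
  by (simp add: osc_level_def)

text \<open>Comparison with the harmonic series:
  \<open>osc_level J j \<le> pi * (J + 2) * (j + 1)\<close>.\<close>

lemma sum_inverse_osc_level_unbounded: "\<exists>N. (\<Sum>j<N. 1 / osc_level J j) > C"
proof (rule ccontr)
  assume "\<not> ?thesis"
  then have bd: "(\<Sum>j<N. 1 / osc_level J j) \<le> C" for N by (simp add: not_less)
  have s: "summable (\<lambda>j. 1 / osc_level J j)"
    by (rule summableI_nonneg_bounded[OF _ bd]) (simp add: osc_level_pos less_imp_le)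
  define K where "K = pi * real (J + 2)"
  have K: "K > 0" by (simp add: K_def)
  have "summable (\<lambda>j. K * (1 / osc_level J j))" using s by (rule summable_mult)
  then have "summable (\<lambda>j. inverse (real (Suc j)))"
  proof (rule summable_comparison_test[rotated], intro exI allI impI)
    fix j
    have "osc_level J j \<le> pi + pi * real (J + j)" by (simp add: osc_level_def)
    also have "\<dots> = pi * real (J + j + 1)" by (simp add: algebra_simps)
    also have "\<dots> \<le> pi * (real (J + 2) * real (Suc j))" by (intro mult_left_mono) (auto simp: algebra_simps)
    finally have "osc_level J j \<le> K * real (Suc j)" by (simp add: K_def)
    then show "norm (inverse (real (Suc j))) \<le> K * (1 / osc_level J j)"
      using osc_level_pos[of J j] by (simp add: divide_simps)
  qed
  then have "summable (\<lambda>j. inverse (real j))" by (subst (asm) summable_Suc_iff)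
  then show False using not_summable_harmonic[where 'a=real] by simp
qed

text \<open>A path in \<open>Y\<close> approaching \<open>p\<close> has to pass through all extrema of \<open>sin L / L\<close>, whose total
  variation diverges.\<close>

lemma lipschitz_path_stays_off_p:
  assumes C: "C \<ge> 0" and t0: "t0 > 0"
  obtains \<tau> where "\<tau> > 0"
    "\<And>\<gamma>. C-lipschitz_on {0..1} \<gamma> \<Longrightarrow> \<gamma> ` {0..1::real} \<subseteq> Y \<Longrightarrow> ht p (\<gamma> 0) \<ge> t0 \<Longrightarrow> ht p (\<gamma> 1) \<ge> \<tau>"
proof -
  \<comment> \<open>This offset puts the first extremum strictly between the start of the path and
    \<open>p\<close>: the corresponding value \<open>T 0\<close> of \<open>ht\<close> is below
    \<open>t0\<close>.\<close>
  obtain J :: nat where J: "real J > - ln t0" using reals_Archimedean2 by blast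
  define lev where "lev = osc_level J"
  define T where "T = (\<lambda>j. exp (- lev j))"
  have T_mono: "T (Suc j) < T j" for j using osc_level_mono[of J j] by (simp add: T_def lev_def)
  have "lev 0 > - ln t0"
  proof -
    have "real J \<le> pi * real J" using mult_right_mono[of 1 pi "real J"] pi_gt3 by simp
    also have "\<dots> < lev 0" by (simp add: lev_def osc_level_def)
    finally show ?thesis using J by linarith
  qed
  then have "exp (- lev 0) < exp (ln t0)" by (subst exp_less_cancel_iff) linarith
  then have T0: "T 0 < t0" using t0 by (simp add: T_def)
  obtain N where N: "(\<Sum>j<N. 1 / lev j) > C" using sum_inverse_osc_level_unbounded unfolding lev_def by blast
  show thesis
  proof (rule that[of "T N"])
    show "T N > 0" by (simp add: T_def)
    fix \<gamma> :: "real \<Rightarrow> 'a" assume lip: "C-lipschitz_on {0..1} \<gamma>" and Y: "\<gamma> ` {0..1::real} \<subseteq> Y" and h0: "ht p (\<gamma> 0) \<ge> t0"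
    have cont: "continuous_on {0..1} (\<lambda>s. ht p (\<gamma> s))"
      by (rule continuous_on_compose2[OF continuous_on_ht lipschitz_on_continuous_on[OF lip]]) (use Y Y_nz in blast)
    have nrm: "norm (\<gamma> s) = 1 + sin (lev j) / lev j" if "s \<in> {0..1}" "ht p (\<gamma> s) = T j" for s j
    proof -
      have "\<gamma> s \<in> Y" using Y that by blast
      then show ?thesis using that(2) by (simp add: norm_Y_eq wob_def lg_def T_def)
    qed
    \<comment> \<open>The levels \<open>T k\<close> decrease to 0, so by the intermediate value
      theorem a path ending below \<open>T k\<close> meets them successively at increasing times.
      Between two of them \<open>C\<close> times the elapsed time is at least
      \<open>1 / lev k\<close>, and the total time is 1.\<close>
    have step: "\<exists>s\<in>{0..1}. ht p (\<gamma> s) = T k \<and> (\<Sum>j<k. 1 / lev j) \<le> C * s" if "ht p (\<gamma> 1) < T k" for k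
      using that
    proof (induction k)
      case 0
      have "continuous_on {0..1} (\<lambda>s. - ht p (\<gamma> s))" by (intro continuous_intros cont)
      then obtain s where "0 \<le> s" "s \<le> 1" "- ht p (\<gamma> s) = - T 0"
        using IVT'[of "\<lambda>s. - ht p (\<gamma> s)" 0 "- T 0" 1] h0 T0 0 by auto
      then show ?case using C by (intro bexI[of _ s]) auto
    next
      case (Suc k)
      then have "ht p (\<gamma> 1) < T k" using T_mono[of k] by linarith
      then obtain s where s: "s \<in> {0..1}" "ht p (\<gamma> s) = T k" "(\<Sum>j<k. 1 / lev j) \<le> C * s" using Suc.IH by blast
      have "continuous_on {s..1} (\<lambda>s. - ht p (\<gamma> s))"
        by (intro continuous_intros continuous_on_subset[OF cont]) (use s in auto)
      then obtain s' where s': "s \<le> s'" "s' \<le> 1" "- ht p (\<gamma> s') = - T (Suc k)"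
        using IVT'[of "\<lambda>s. - ht p (\<gamma> s)" s "- T (Suc k)" 1] s Suc.prems T_mono[of k] by auto
      have s'1: "s' \<in> {0..1}" "ht p (\<gamma> s') = T (Suc k)" using s s' by auto
      have "\<bar>norm (\<gamma> s) - norm (\<gamma> s')\<bar> \<le> C * (s' - s)"
        using lipschitz_onD[OF lip s(1) s'1(1)] norm_triangle_ineq3[of "\<gamma> s" "\<gamma> s'"] s' by (simp add: dist_norm dist_real_def)
      \<comment> \<open>At consecutive extrema the sines have opposite signs, so the two deviations
        of the norm from 1 add up.\<close>
      moreover have "\<bar>norm (\<gamma> s) - norm (\<gamma> s')\<bar> = 1 / lev k + 1 / lev (Suc k)"
      proof -
        have "norm (\<gamma> s) - norm (\<gamma> s') = (-1) ^ (J + k) * (1 / lev k + 1 / lev (Suc k))"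
          using nrm[OF s(1,2)] nrm[OF s'1] by (simp add: lev_def sin_osc_level algebra_simps)
        moreover have "1 / lev k + 1 / lev (Suc k) \<ge> 0"
          using osc_level_pos[of J k] osc_level_pos[of J "Suc k"] by (simp add: lev_def)
        ultimately show ?thesis by (simp add: abs_mult power_abs)
      qed
      moreover have "1 / lev (Suc k) > 0" using osc_level_pos[of J "Suc k"] by (simp add: lev_def)
      moreover have "C * (s' - s) = C * s' - C * s" by (simp add: algebra_simps)
      ultimately have "(\<Sum>j<k. 1 / lev j) + 1 / lev k \<le> C * s'" using s(3) by linarith
      then have "(\<Sum>j<Suc k. 1 / lev j) \<le> C * s'" by simp
      then show ?case using s'1 by blast
    qed
    show "ht p (\<gamma> 1) \<ge> T N"
    proof (rule ccontr)
      assume "\<not> ?thesis"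
      then obtain s where "s \<in> {0..1}" "(\<Sum>j<N. 1 / lev j) \<le> C * s" using step[of N] by auto
      moreover have "C * s \<le> C" using \<open>s \<in> {0..1}\<close> C mult_left_mono[of s 1 C] by simp
      ultimately show False using N by linarith
    qed
  qed
qed

lemma ht_Y_pos_iff: "y \<in> Y \<Longrightarrow> 0 < ht p y \<longleftrightarrow> y \<noteq> p"
  using ht_pos_iff[OF Y_nz] Y_offray_iff by blast

text \<open>The normalized chord from \<open>a\<close> to \<open>x\<close> is a Lipschitz path
  unless the points are antipodal, and its image cannot run into \<open>p\<close>. Antipodal points
  are joined through a third point, which exists in dimension at least 2.\<close>

lemma lipschitz_sphere_map_off_p:
  fixes v :: "'a \<Rightarrow> 'a"
  assumes lip: "L-lipschitz_on (sphere 0 1) v" and Y: "v ` sphere 0 1 \<subseteq> Y" and dim: "DIM('a) \<ge> 2"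
    and a: "a \<in> sphere 0 1" "v a \<noteq> p" and x: "x \<in> sphere 0 1"
  shows "v x \<noteq> p"
proof -
  have main: "v x \<noteq> p" if ax: "a \<in> sphere 0 1" "x \<in> sphere 0 1" "v a \<noteq> p" "x \<noteq> - a" for a x
  proof -
    define u where "u = (\<lambda>s. (1 - s) *\<^sub>R a + s *\<^sub>R x)"
    have n: "a \<bullet> a = 1" "x \<bullet> x = 1" using ax by (auto simp: norm_eq_1)
    have "a \<bullet> x \<noteq> -1"
    proof
      assume "a \<bullet> x = -1"
      then have "(a + x) \<bullet> (a + x) = 0" using n by (simp add: inner_add_left inner_add_right inner_commute)
      then show False using ax(4) by (simp add: add_eq_0_iff2)
    qed
    moreover have "a \<bullet> x \<ge> -1" using Cauchy_Schwarz_ineq2[of a x] ax by simp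
    ultimately have c: "1 + a \<bullet> x > 0" by linarith
    \<comment> \<open>The norm of the midpoint of the chord, that is, the distance of the chord from
      the origin.\<close>
    define m where "m = sqrt ((1 + a \<bullet> x) / 2)"
    have m: "m > 0" using c by (simp add: m_def)
    have um: "norm (u s) \<ge> m" if "s \<in> {0..1}" for s
    proof -
      have "(1 - s) * s \<le> 1 / 4"
        using zero_le_power2[of "s - 1/2"] by (simp add: power2_eq_square algebra_simps)
      moreover have "1 - a \<bullet> x \<ge> 0" using Cauchy_Schwarz_ineq2[of a x] ax by simp
      ultimately have "(1 - s) * s * (1 - a \<bullet> x) \<le> 1 / 4 * (1 - a \<bullet> x)" by (rule mult_right_mono)
      moreover have "u s \<bullet> u s = 1 - 2 * ((1 - s) * s * (1 - a \<bullet> x))"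
        using n by (simp add: u_def inner_add_left inner_add_right inner_commute[of x a] algebra_simps)
      ultimately have "(1 + a \<bullet> x) / 2 \<le> u s \<bullet> u s" by (simp add: algebra_simps)
      then show ?thesis unfolding m_def norm_eq_sqrt_inner by (rule real_sqrt_le_mono)
    qed
    define q where "q = (\<lambda>s. u s /\<^sub>R norm (u s))"
    have q: "q s \<in> sphere 0 1" if "s \<in> {0..1}" for s
    proof -
      have "u s \<noteq> 0" using um[OF that] m by auto
      then show ?thesis by (simp add: q_def)
    qed
    have lipq: "(2 / m * norm (x - a))-lipschitz_on {0..1} q"
    proof (rule lipschitz_onI)
      fix s t :: real assume st: "s \<in> {0..1}" "t \<in> {0..1}"
      have "dist (q s) (q t) \<le> 2 / m * norm (u s - u t)"
        unfolding q_def dist_norm by (rule normalize_diff_le[OF um[OF st(1)] m])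
      also have "u s - u t = (s - t) *\<^sub>R (x - a)" by (simp add: u_def algebra_simps)
      finally show "dist (q s) (q t) \<le> 2 / m * norm (x - a) * dist s t" by (simp add: dist_real_def mult_ac)
    qed (use m in simp)
    have L0: "L \<ge> 0" using lip lipschitz_on_nonneg by blast
    let ?C = "L * (2 / m * norm (x - a))"
    have lipg: "?C-lipschitz_on {0..1} (\<lambda>s. v (q s))"
      by (rule lipschitz_on_compose2[OF lipq lipschitz_on_subset[OF lip]]) (use q in auto)
    have "v a \<in> Y" "v x \<in> Y" using Y ax by auto
    then have h0: "ht p (v a) > 0" using ht_Y_pos_iff ax(3) by blast
    have q01: "q 0 = a" "q 1 = x" using ax by (auto simp: q_def u_def)
    have C0: "?C \<ge> 0" using L0 m by simp
    obtain \<tau> where "\<tau> > 0"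
      "\<And>\<gamma>. ?C-lipschitz_on {0..1} \<gamma> \<Longrightarrow> \<gamma> ` {0..1::real} \<subseteq> Y \<Longrightarrow> ht p (\<gamma> 0) \<ge> ht p (v a) \<Longrightarrow> ht p (\<gamma> 1) \<ge> \<tau>"
      using lipschitz_path_stays_off_p[OF C0 h0] by blast
    note \<tau> = this(1) this(2)[OF lipg]
    have "(\<lambda>s. v (q s)) ` {0..1} \<subseteq> Y" using Y q by blast
    then have "ht p (v x) \<ge> \<tau>" using \<tau>(2) q01 by simp
    then show ?thesis using \<tau>(1) ht_Y_pos_iff[OF \<open>v x \<in> Y\<close>] by auto
  qed
  show ?thesis
  proof (cases "x = - a")
    case False
    then show ?thesis using main a x by blast
  next
    case True
    have "\<exists>b\<in>Basis. b \<noteq> a \<and> b \<noteq> - a"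
    proof (rule ccontr)
      assume "\<not> ?thesis"
      then have sub: "Basis \<subseteq> {a, - a}" by auto
      have "\<not> (a \<in> Basis \<and> - a \<in> (Basis::'a set))"
      proof
        assume "a \<in> Basis \<and> - a \<in> (Basis::'a set)"
        then have "a \<bullet> (- a) = (if a = - a then 1 else 0)" "a \<bullet> a = 1" using inner_Basis[of a "- a"] inner_Basis[of a a] by simp_all
        then show False by (simp split: if_splits)
      qed
      then have "Basis \<subseteq> {a} \<or> Basis \<subseteq> {- a}" using sub by blast
      then have "card (Basis::'a set) \<le> 1"
        by (metis card.empty card_insert_le_m1 card_mono card_1_singleton_iff finite.emptyI finite.insertI is_singletonI is_singleton_altdef)
      then show False using dim by simp
    qed
    then obtain b where b: "b \<in> Basis" "b \<noteq> a" "b \<noteq> - a" by blast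
    have bs: "b \<in> sphere 0 1" using b by simp
    have "v b \<noteq> p" using main[OF a(1) bs a(2)] b by blast
    then show ?thesis using main[OF bs x] b True by (metis minus_minus)
  qed
qed

text \<open>Stereographic projection from \<open>p\<close> to the hyperplane orthogonal to
  \<open>p\<close>. Numerator and denominator scale alike, so it factors through normalization and
  makes sense on the whole complement of the ray.\<close>

definition stereo :: "'a \<Rightarrow> 'a" where
  "stereo y = (y - (y \<bullet> p) *\<^sub>R p) /\<^sub>R (norm y - y \<bullet> p)"

definition unstereo :: "'a \<Rightarrow> 'a" where
  "unstereo z = (2 *\<^sub>R z + (z \<bullet> z - 1) *\<^sub>R p) /\<^sub>R (z \<bullet> z + 1)"

lemma stereo_perp: "stereo y \<bullet> p = 0"
  by (simp add: stereo_def inner_diff_left)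

lemma unstereo_stereo: "y \<in> offray p \<Longrightarrow> unstereo (stereo y) = y /\<^sub>R norm y"
proof -
  assume y: "y \<in> offray p"
  define m where "m = norm y - y \<bullet> p"
  define y' where "y' = y - (y \<bullet> p) *\<^sub>R p"
  have m: "m > 0" using y by (simp add: m_def offray_def)
  have ny: "norm y > 0" using offray_nz[OF y] by simp
  have "y' \<bullet> y' = (norm y)\<^sup>2 - (y \<bullet> p)\<^sup>2"
    by (simp add: y'_def inner_diff_left inner_diff_right inner_commute[of p y] power2_norm_eq_inner)
       (simp add: power2_eq_square)
  also have "\<dots> = m * (norm y + y \<bullet> p)" by (simp add: m_def power2_eq_square algebra_simps)
  finally have yy: "y' \<bullet> y' = m * (norm y + y \<bullet> p)" .
  have z: "stereo y = y' /\<^sub>R m" by (simp add: stereo_def y'_def m_def)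
  have zz: "stereo y \<bullet> stereo y = (norm y + y \<bullet> p) / m"
    using m by (simp add: z yy divide_simps)
  have 1: "(norm y + y \<bullet> p) / m + 1 = 2 * norm y / m" using m by (simp add: m_def field_simps)
  have 2: "(norm y + y \<bullet> p) / m - 1 = 2 * (y \<bullet> p) / m" using m by (simp add: m_def field_simps)
  have "unstereo (stereo y) = (2 *\<^sub>R (y' /\<^sub>R m) + (2 * (y \<bullet> p) / m) *\<^sub>R p) /\<^sub>R (2 * norm y / m)"
    unfolding unstereo_def zz 1 2 unfolding z ..
  also have "2 *\<^sub>R (y' /\<^sub>R m) + (2 * (y \<bullet> p) / m) *\<^sub>R p = (2 / m) *\<^sub>R (y' + (y \<bullet> p) *\<^sub>R p)"
    by (simp add: scaleR_add_right divide_inverse mult_ac)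
  also have "y' + (y \<bullet> p) *\<^sub>R p = y" by (simp add: y'_def)
  also have "((2 / m) *\<^sub>R y) /\<^sub>R (2 * norm y / m) = y /\<^sub>R norm y"
  proof -
    have "inverse (2 * norm y / m) * (2 / m) = inverse (norm y)" using m ny by (simp add: field_simps)
    then show ?thesis by simp
  qed
  finally show ?thesis .
qed

lemma unstereo_props:
  assumes "z \<bullet> p = 0"
  shows "norm (unstereo z) = 1" "unstereo z \<in> offray p"
proof -
  have pos: "z \<bullet> z + 1 > 0" using inner_ge_zero[of z] by linarith
  have "(2 *\<^sub>R z + (z \<bullet> z - 1) *\<^sub>R p) \<bullet> (2 *\<^sub>R z + (z \<bullet> z - 1) *\<^sub>R p) = (z \<bullet> z + 1)\<^sup>2"
    using assms by (simp add: inner_add_left inner_add_right inner_commute[of p z] power2_eq_square algebra_simps)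
  then have "norm (2 *\<^sub>R z + (z \<bullet> z - 1) *\<^sub>R p) = z \<bullet> z + 1"
    using pos by (simp add: norm_eq_sqrt_inner)
  then show n: "norm (unstereo z) = 1" using pos by (simp add: unstereo_def)
  have "unstereo z \<bullet> p = (z \<bullet> z - 1) / (z \<bullet> z + 1)" using assms by (simp add: unstereo_def inner_add_left divide_inverse mult.commute)
  then show "unstereo z \<in> offray p" using n pos by (simp add: offray_def)
qed

lemma smooth_unstereo: "smooth_open UNIV unstereo"
proof -
  have i: "smooth_open {0<..} (\<lambda>x::real. inverse x)" by (rule smooth_open_inverse) auto
  have q: "smooth_open UNIV (\<lambda>z::'a. z \<bullet> z + 1)"
    by (intro smooth_open_add smooth_open_inner smooth_open_id smooth_open_const) auto
  have "smooth_open UNIV (\<lambda>z. inverse (z \<bullet> z + 1) *\<^sub>R (2 *\<^sub>R z + (z \<bullet> z - 1) *\<^sub>R p))"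
    by (intro smooth_open_scaleR smooth_open_add smooth_open_diff smooth_open_inner smooth_open_id smooth_open_const
        smooth_open_compose[OF i q]) (auto simp: add_nonneg_pos)
  then show ?thesis by (rule smooth_open_cong) (simp add: unstereo_def)
qed

text \<open>\<open>unstereo\<close> maps the hyperplane off the ray, so the composite is smooth on a
  neighbourhood of the compact convex disc.\<close>

lemma lipschitz_wsph_unstereo:
  obtains L where "L-lipschitz_on {z. z \<bullet> p = 0 \<and> norm z \<le> R} (\<lambda>z. wsph p (unstereo z))"
proof -
  have cu: "continuous_on UNIV unstereo" by (rule smooth_open_continuous[OF smooth_unstereo])
  have o: "open (unstereo -` offray p)" by (rule open_vimage[OF open_offray cu])
  have K: "{z. z \<bullet> p = 0 \<and> norm z \<le> R} = {z. z \<bullet> p = 0} \<inter> cball 0 R" by auto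
  have "closed {z. z \<bullet> p = 0}" by (intro closed_Collect_eq continuous_intros)
  moreover have "convex {z. z \<bullet> p = 0}" using convex_hyperplane[of p 0] by (simp add: inner_commute)
  moreover have "smooth_open (unstereo -` offray p) (\<lambda>z. wsph p (unstereo z))"
    by (rule smooth_open_compose[OF smooth_wsph smooth_open_subset[OF smooth_unstereo]]) (use o in auto)
  ultimately obtain L where "L-lipschitz_on ({z. z \<bullet> p = 0} \<inter> cball 0 R) (\<lambda>z. wsph p (unstereo z))"
    using smooth_open_lipschitz_on_compact_convex[of "unstereo -` offray p" "\<lambda>z. wsph p (unstereo z)" "{z. z \<bullet> p = 0} \<inter> cball 0 R"]
      unstereo_props(2) closed_Int_compact[OF _ compact_cball] convex_Int[OF _ convex_cball]
    by (smt (verit, ccfv_threshold) IntD1 mem_Collect_eq subsetI vimageI)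
  then show thesis using that unfolding K by blast
qed

text \<open>\<open>Y\<close> is not convex, so the quotient is estimated directly: its denominator
  equals \<open>8 * norm y * ht p y\<close> and is at least \<open>2 * \<tau>\<close> on the set
  considered.\<close>

lemma stereo_lipschitz:
  assumes \<tau>: "\<tau> > 0"
  obtains L R where "L-lipschitz_on {y\<in>Y. ht p y \<ge> \<tau>} stereo" "\<And>y. y \<in> Y \<Longrightarrow> ht p y \<ge> \<tau> \<Longrightarrow> norm (stereo y) \<le> R"
proof -
  define m where "m = (\<lambda>y. norm y - y \<bullet> p)"
  define y' where "y' = (\<lambda>y. y - (y \<bullet> p) *\<^sub>R p)"
  have st: "stereo y = y' y /\<^sub>R m y" for y by (simp add: stereo_def y'_def m_def)
  have m: "m y \<ge> 2 * \<tau>" if "y \<in> Y" "ht p y \<ge> \<tau>" for y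
  proof -
    have "m y = 8 * norm y * ht p y" using Y_nz[OF that(1)] by (simp add: m_def ht_def field_simps)
    moreover have "8 * norm y * ht p y \<ge> 8 * (1/4) * \<tau>" using norm_Y[OF that(1)] that(2) \<tau> by (intro mult_mono) auto
    ultimately show ?thesis by simp
  qed
  have inn: "\<bar>x \<bullet> p\<bar> \<le> norm x" for x using Cauchy_Schwarz_ineq2[of x p] by simp
  have y'n: "norm (y' y) \<le> 2 * norm y" for y
    using norm_triangle_ineq4[of y "(y \<bullet> p) *\<^sub>R p"] inn[of y] by (simp add: y'_def)
  have y'd: "norm (y' y - y' x) \<le> 2 * norm (y - x)" for x y
    using y'n[of "y - x"] by (simp add: y'_def inner_diff_left algebra_simps)
  have md: "\<bar>m y - m x\<bar> \<le> 2 * norm (y - x)" for x y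
    using norm_triangle_ineq3[of y x] inn[of "y - x"] by (simp add: m_def inner_diff_left)
  let ?L = "2 / (2 * \<tau>) + 8 / (2 * \<tau> * (2 * \<tau>))"
  show thesis
  proof (rule that)
    show "?L-lipschitz_on {y\<in>Y. ht p y \<ge> \<tau>} stereo"
    proof (rule lipschitz_onI)
      fix x y assume "x \<in> {y\<in>Y. ht p y \<ge> \<tau>}" "y \<in> {y\<in>Y. ht p y \<ge> \<tau>}"
      then have mm: "m x \<ge> 2 * \<tau>" "m y \<ge> 2 * \<tau>" and Y: "y \<in> Y" using m by auto
      have pos: "m x > 0" "m y > 0" using mm \<tau> by linarith+
      have "inverse (m x) - inverse (m y) = (m y - m x) / (m x * m y)" using pos by (simp add: field_simps)
      then have "stereo x - stereo y = (y' x - y' y) /\<^sub>R m x + ((m y - m x) / (m x * m y)) *\<^sub>R y' y"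
        by (simp add: st algebra_simps flip: scaleR_diff_left)
      then have "norm (stereo x - stereo y) \<le> norm ((y' x - y' y) /\<^sub>R m x) + norm (((m y - m x) / (m x * m y)) *\<^sub>R y' y)"
        using norm_triangle_ineq by metis
      also have "\<dots> = norm (y' x - y' y) / m x + \<bar>m y - m x\<bar> * norm (y' y) / (m x * m y)"
        using pos by (simp add: abs_mult divide_inverse mult_ac)
      also have "\<dots> \<le> (2 * norm (x - y)) / (2 * \<tau>) + (2 * norm (x - y)) * 4 / (2 * \<tau> * (2 * \<tau>))"
      proof (intro add_mono frac_le mult_mono)
        show "norm (y' y) \<le> 4" using y'n[of y] norm_Y[OF Y] by linarith
        show "\<bar>m y - m x\<bar> \<le> 2 * norm (x - y)" using md[of y x] by (simp add: norm_minus_commute)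
      qed (use y'd mm pos \<tau> in auto)
      also have "\<dots> = ?L * norm (x - y)" by (simp add: distrib_right)
      finally show "dist (stereo x) (stereo y) \<le> ?L * dist x y" by (simp add: dist_norm)
    qed (use \<tau> in simp)
    show "norm (stereo y) \<le> 4 / (2 * \<tau>)" if "y \<in> Y" "ht p y \<ge> \<tau>" for y
    proof -
      have "norm (stereo y) = norm (y' y) / m y" using m[OF that] \<tau> by (simp add: st divide_inverse mult.commute)
      also have "\<dots> \<le> 4 / (2 * \<tau>)"
        using m[OF that] \<tau> y'n[of y] norm_Y[OF that(1)] by (intro frac_le) auto
      finally show ?thesis .
    qed
  qed
qed

end

section \<open>Lipschitz homotopy groups\<close>

lemma edist_nonneg: "edist k x y \<ge> 0"
  by (simp add: edist_def sum_nonneg)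

lemma edist_le_sqrt:
  assumes "x \<in> cube k" "y \<in> cube k"
  shows "edist k x y \<le> sqrt (real k)"
proof -
  have "(\<Sum>i<k. (x i - y i)\<^sup>2) \<le> (\<Sum>i<k. 1)"
  proof (rule sum_mono)
    fix i assume "i \<in> {..<k}"
    then have "0 \<le> x i" "x i \<le> 1" "0 \<le> y i" "y i \<le> 1" using assms by (auto simp: cube_def)
    then have "\<bar>x i - y i\<bar> \<le> 1" by linarith
    then show "(x i - y i)\<^sup>2 \<le> 1" by (simp add: abs_square_le_1)
  qed
  then show ?thesis by (simp add: edist_def)
qed

lemma edist_Suc_ge:
  "edist k (x(k := 0)) (y(k := 0)) \<le> edist (Suc k) x y" "\<bar>x k - y k\<bar> \<le> edist (Suc k) x y"
proof -
  have e: "(\<Sum>i<k. ((x(k := 0)) i - (y(k := 0)) i)\<^sup>2) = (\<Sum>i<k. (x i - y i)\<^sup>2)" by (intro sum.cong) auto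
  show "edist k (x(k := 0)) (y(k := 0)) \<le> edist (Suc k) x y"
    unfolding edist_def e by (rule real_sqrt_le_mono) simp
  have "\<bar>x k - y k\<bar> = sqrt ((x k - y k)\<^sup>2)" by simp
  also have "\<dots> \<le> edist (Suc k) x y"
    unfolding edist_def by (rule real_sqrt_le_mono) (simp add: sum_nonneg)
  finally show "\<bar>x k - y k\<bar> \<le> edist (Suc k) x y" .
qed

definition cube_seg :: "(nat \<Rightarrow> real) \<Rightarrow> (nat \<Rightarrow> real) \<Rightarrow> real \<Rightarrow> nat \<Rightarrow> real" where
  "cube_seg x y s = (\<lambda>i. x i + s * (y i - x i))"

lemma cube_seg_in_cube:
  assumes "x \<in> cube k" "y \<in> cube k" "s \<in> {0..1}"
  shows "cube_seg x y s \<in> cube k"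
proof -
  have "0 \<le> cube_seg x y s i \<and> cube_seg x y s i \<le> 1" if "i < k" for i
  proof -
    have b: "0 \<le> x i" "x i \<le> 1" "0 \<le> y i" "y i \<le> 1" using assms that by (auto simp: cube_def)
    have e: "cube_seg x y s i = (1 - s) * x i + s * y i" by (simp add: cube_seg_def algebra_simps)
    have "(1 - s) * x i + s * y i \<le> (1 - s) * 1 + s * 1"
      using b assms(3) by (intro add_mono mult_left_mono) auto
    then show ?thesis using b assms(3) unfolding e by auto
  qed
  moreover have "cube_seg x y s i = 0" if "i \<ge> k" for i using assms that by (auto simp: cube_seg_def cube_def)
  ultimately show ?thesis by (auto simp: cube_def)
qed

lemma edist_cube_seg: "edist k (cube_seg x y s) (cube_seg x y t) = \<bar>s - t\<bar> * edist k x y"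
proof -
  have "(\<Sum>i<k. (cube_seg x y s i - cube_seg x y t i)\<^sup>2) = (\<Sum>i<k. (s - t)\<^sup>2 * (x i - y i)\<^sup>2)"
    by (intro sum.cong) (auto simp: cube_seg_def power2_eq_square algebra_simps)
  also have "\<dots> = (s - t)\<^sup>2 * (\<Sum>i<k. (x i - y i)\<^sup>2)" by (simp add: sum_distrib_left)
  finally show ?thesis by (simp add: edist_def real_sqrt_mult)
qed

context pole begin

text \<open>The bound for paths depends only on the Lipschitz constant and the initial height;
  segments from \<open>a\<close> have length at most \<open>sqrt k\<close>, so one
  \<open>\<tau>\<close> serves all endpoints.\<close>

lemma lip_cube_off_p:
  assumes f: "lip_cube k Y f" and a: "a \<in> cube k" "f a \<noteq> p"
  obtains \<tau> where "\<tau> > 0" "\<And>x. x \<in> cube k \<Longrightarrow> ht p (f x) \<ge> \<tau>"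
proof -
  obtain L where L: "\<And>x y. x \<in> cube k \<Longrightarrow> y \<in> cube k \<Longrightarrow> dist (f x) (f y) \<le> L * edist k x y"
    and Y: "\<And>x. x \<in> cube k \<Longrightarrow> f x \<in> Y"
    using f by (auto simp: lip_cube_def)
  define C where "C = \<bar>L\<bar> * sqrt (real k)"
  have C0: "C \<ge> 0" by (simp add: C_def)
  have h0: "ht p (f a) > 0" using Y[OF a(1)] ht_Y_pos_iff a(2) by blast
  obtain \<tau> where \<tau>: "\<tau> > 0"
    "\<And>\<gamma>. C-lipschitz_on {0..1} \<gamma> \<Longrightarrow> \<gamma> ` {0..1::real} \<subseteq> Y \<Longrightarrow> ht p (\<gamma> 0) \<ge> ht p (f a) \<Longrightarrow> ht p (\<gamma> 1) \<ge> \<tau>"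
    using lipschitz_path_stays_off_p[OF C0 h0] by blast
  have "ht p (f x) \<ge> \<tau>" if x: "x \<in> cube k" for x
  proof -
    let ?\<gamma> = "\<lambda>s. f (cube_seg a x s)"
    have "C-lipschitz_on {0..1} ?\<gamma>"
    proof (rule lipschitz_onI)
      fix s t :: real assume st: "s \<in> {0..1}" "t \<in> {0..1}"
      have "dist (?\<gamma> s) (?\<gamma> t) \<le> L * edist k (cube_seg a x s) (cube_seg a x t)"
        by (intro L cube_seg_in_cube a x st)
      also have "\<dots> \<le> \<bar>L\<bar> * (\<bar>s - t\<bar> * edist k a x)"
        unfolding edist_cube_seg by (intro mult_right_mono) (auto simp: edist_nonneg)
      also have "\<dots> \<le> \<bar>L\<bar> * (\<bar>s - t\<bar> * sqrt (real k))"
        by (intro mult_left_mono edist_le_sqrt a x) auto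
      finally show "dist (?\<gamma> s) (?\<gamma> t) \<le> C * dist s t" by (simp add: C_def dist_real_def mult_ac)
    qed (rule C0)
    moreover have "?\<gamma> ` {0..1} \<subseteq> Y" using cube_seg_in_cube[OF a(1) x] Y by blast
    moreover have "?\<gamma> 0 = f a" "?\<gamma> 1 = f x" by (simp_all add: cube_seg_def)
    ultimately show ?thesis using \<tau>(2)[of ?\<gamma>] by simp
  qed
  with \<tau>(1) that show thesis by blast
qed

text \<open>Either \<open>f\<close> is constantly \<open>p\<close>, or it keeps a definite distance
  from \<open>p\<close>. In the second case the straight-line homotopy in stereographic coordinates
  contracts \<open>f\<close> to the base point; it is stationary wherever \<open>f\<close> already
  has the value \<open>y0\<close>.\<close>

lemma lip_pi_trivial_Y:
  assumes k: "k \<ge> 1" and y0: "y0 \<in> Y"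
  shows "lip_pi_trivial k Y y0"
  unfolding lip_pi_trivial_def
proof (intro allI impI, elim conjE)
  fix f assume f: "lip_cube k Y f" and fb: "\<forall>x\<in>cube_boundary k. f x = y0"
  \<comment> \<open>The corner of the cube lies on the boundary because \<open>k \<ge> 1\<close>, so
    \<open>y0\<close> is a value of \<open>f\<close> and shares its distance from
    \<open>p\<close>.\<close>
  define x0 where "x0 = (\<lambda>i::nat. 0::real)"
  have x0: "x0 \<in> cube k" "x0 \<in> cube_boundary k" using k by (auto simp: x0_def cube_def cube_boundary_def intro!: exI[of _ "0::nat"])
  have fo: "f x0 = y0" using fb x0 by blast
  obtain L where L: "\<And>x y. x \<in> cube k \<Longrightarrow> y \<in> cube k \<Longrightarrow> dist (f x) (f y) \<le> L * edist k x y"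
    and fY: "\<And>x. x \<in> cube k \<Longrightarrow> f x \<in> Y"
    using f by (auto simp: lip_cube_def)
  have xk0: "x k = 0" if "x \<in> cube k" for x using that by (simp add: cube_def)
  have upd: "x(k := 0) = x" if "x \<in> cube k" for x using xk0[OF that] by auto
  have cS: "x(k := 0) \<in> cube k \<and> x k \<in> {0..1}" if "x \<in> cube (Suc k)" for x
    using that by (auto simp: cube_def less_Suc_eq)
  show "\<exists>H. lip_cube (Suc k) Y H \<and> (\<forall>x\<in>cube k. H x = f x) \<and> (\<forall>x\<in>cube k. H (x(k := 1)) = y0) \<and>
      (\<forall>x\<in>cube_boundary k. \<forall>t\<in>{0..1}. H (x(k := t)) = y0)"
  proof (cases "\<exists>a\<in>cube k. f a \<noteq> p")
    case False
    then have "\<And>x. x \<in> cube k \<Longrightarrow> f x = p" by blast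
    moreover have "y0 = p" using False x0 fo by auto
    ultimately show ?thesis using y0
      by (intro exI[of _ "\<lambda>_. p"]) (auto simp: lip_cube_def intro: exI[of _ 0])
  next
    case True
    then obtain \<tau> where \<tau>: "\<tau> > 0" "\<And>x. x \<in> cube k \<Longrightarrow> ht p (f x) \<ge> \<tau>" using lip_cube_off_p[OF f] by metis
    obtain LF R where LF: "LF-lipschitz_on {y\<in>Y. ht p y \<ge> \<tau>} stereo"
      and R: "\<And>y. y \<in> Y \<Longrightarrow> ht p y \<ge> \<tau> \<Longrightarrow> norm (stereo y) \<le> R" using stereo_lipschitz[OF \<tau>(1)] by blast
    obtain LG where LG: "LG-lipschitz_on {z. z \<bullet> p = 0 \<and> norm z \<le> R} (\<lambda>z. wsph p (unstereo z))"
      using lipschitz_wsph_unstereo by blast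
    have n: "LF \<ge> 0" "LG \<ge> 0" using LF LG lipschitz_on_nonneg by blast+
    \<comment> \<open>Coordinate \<open>k\<close> is the time and \<open>x(k := 0)\<close> the point
      of the original cube.\<close>
    define z where "z = (\<lambda>x. (1 - x k) *\<^sub>R stereo (f (x(k := 0))) + x k *\<^sub>R stereo y0)"
    define H where "H = (\<lambda>x. wsph p (unstereo (z x)))"
    have zp: "z x \<bullet> p = 0" for x by (simp add: z_def inner_add_left stereo_perp)
    have fR: "norm (stereo (f x)) \<le> R" if "x \<in> cube k" for x using R[OF fY[OF that] \<tau>(2)[OF that]] .
    have yR: "norm (stereo y0) \<le> R" using fR[OF x0(1)] fo by simp
    have R0: "R \<ge> 0" using yR norm_ge_zero order_trans by blast
    have zR: "norm (z x) \<le> R" if "x \<in> cube (Suc k)" for x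
    proof -
      have "norm (z x) \<le> (1 - x k) * norm (stereo (f (x(k := 0)))) + x k * norm (stereo y0)"
        using norm_triangle_ineq[of "(1 - x k) *\<^sub>R stereo (f (x(k := 0)))" "x k *\<^sub>R stereo y0"] cS[OF that] by (simp add: z_def)
      also have "\<dots> \<le> (1 - x k) * R + x k * R"
        using cS[OF that] fR[of "x(k := 0)"] yR by (intro add_mono mult_left_mono) auto
      finally show ?thesis by (simp add: algebra_simps)
    qed
    have inv: "wsph p (unstereo (stereo y)) = y" if "y \<in> Y" "ht p y \<ge> \<tau>" for y
    proof -
      have "y \<in> offray p" using ht_pos_iff[OF Y_nz[OF that(1)]] that(2) \<tau>(1) by linarith
      then show ?thesis using wsph_scaleR[of "inverse (norm y)" y] Y_nz[OF that(1)] wsph_Y[OF that(1)] by (simp add: unstereo_stereo)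
    qed
    have invf: "wsph p (unstereo (stereo (f x))) = f x" if "x \<in> cube k" for x using inv fY \<tau>(2) that by blast
    have invy: "wsph p (unstereo (stereo y0)) = y0" using invf[OF x0(1)] fo by simp
    have HY: "H x \<in> Y" for x
      unfolding H_def using unstereo_props(1)[OF zp[of x]] by (intro wsph_in_Y) auto
    have zlip: "norm (z x - z y) \<le> (LF * \<bar>L\<bar> + 2 * R) * edist (Suc k) x y" if "x \<in> cube (Suc k)" "y \<in> cube (Suc k)" for x y
    proof -
      let ?x = "x(k := 0)" and ?y = "y(k := 0)"
      have c: "?x \<in> cube k" "?y \<in> cube k" "x k \<in> {0..1}" using cS that by auto
      have "z x - z y = (1 - x k) *\<^sub>R (stereo (f ?x) - stereo (f ?y)) + (x k - y k) *\<^sub>R (stereo y0 - stereo (f ?y))"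
        by (simp add: z_def algebra_simps)
      then have "norm (z x - z y) \<le> norm ((1 - x k) *\<^sub>R (stereo (f ?x) - stereo (f ?y))) + norm ((x k - y k) *\<^sub>R (stereo y0 - stereo (f ?y)))"
        using norm_triangle_ineq by metis
      also have "\<dots> \<le> 1 * (LF * (\<bar>L\<bar> * edist (Suc k) x y)) + edist (Suc k) x y * (R + R)"
      proof (rule add_mono)
        have "norm (stereo (f ?x) - stereo (f ?y)) \<le> LF * dist (f ?x) (f ?y)"
          using lipschitz_onD[OF LF, of "f ?x" "f ?y"] fY \<tau>(2) c by (simp add: dist_norm)
        also have "\<dots> \<le> LF * (\<bar>L\<bar> * edist (Suc k) x y)"
        proof (rule mult_left_mono[OF _ n(1)])
          have "dist (f ?x) (f ?y) \<le> L * edist k ?x ?y" using L c by blast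
          also have "\<dots> \<le> \<bar>L\<bar> * edist (Suc k) x y"
            using edist_Suc_ge(1)[of k x y] edist_nonneg by (intro mult_mono) auto
          finally show "dist (f ?x) (f ?y) \<le> \<bar>L\<bar> * edist (Suc k) x y" .
        qed
        finally have b: "norm (stereo (f ?x) - stereo (f ?y)) \<le> LF * (\<bar>L\<bar> * edist (Suc k) x y)" .
        show "norm ((1 - x k) *\<^sub>R (stereo (f ?x) - stereo (f ?y))) \<le> 1 * (LF * (\<bar>L\<bar> * edist (Suc k) x y))"
          unfolding norm_scaleR by (rule mult_mono[OF _ b]) (use c in auto)
        show "norm ((x k - y k) *\<^sub>R (stereo y0 - stereo (f ?y))) \<le> edist (Suc k) x y * (R + R)"
          unfolding norm_scaleR
        proof (rule mult_mono)
          show "\<bar>x k - y k\<bar> \<le> edist (Suc k) x y" by (rule edist_Suc_ge(2))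
          show "norm (stereo y0 - stereo (f ?y)) \<le> R + R"
            using norm_triangle_ineq4[of "stereo y0" "stereo (f ?y)"] yR fR[OF c(2)] by linarith
        qed (auto simp: edist_nonneg)
      qed
      also have "\<dots> = (LF * \<bar>L\<bar> + 2 * R) * edist (Suc k) x y" by (simp add: algebra_simps)
      finally show ?thesis .
    qed
    show ?thesis
    proof (intro exI[of _ H] conjI ballI)
      show "lip_cube (Suc k) Y H"
        unfolding lip_cube_def
      proof (intro conjI ballI exI[of _ "LG * (LF * \<bar>L\<bar> + 2 * R)"])
        fix x y assume xy: "x \<in> cube (Suc k)" "y \<in> cube (Suc k)"
        have "dist (H x) (H y) \<le> LG * norm (z x - z y)"
          unfolding H_def dist_norm[symmetric] by (rule lipschitz_onD[OF LG]) (use zp zR xy in auto)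
        also have "\<dots> \<le> LG * ((LF * \<bar>L\<bar> + 2 * R) * edist (Suc k) x y)" by (intro mult_left_mono zlip xy n)
        finally show "dist (H x) (H y) \<le> LG * (LF * \<bar>L\<bar> + 2 * R) * edist (Suc k) x y" by (simp add: mult_ac)
      qed (rule HY)
      show "H x = f x" if "x \<in> cube k" for x using that invf xk0[OF that] upd[OF that] by (simp add: H_def z_def)
      show "H (x(k := 1)) = y0" if "x \<in> cube k" for x using invy by (simp add: H_def z_def)
      fix x and t :: real assume x: "x \<in> cube_boundary k" and t: "t \<in> {0..1}"
      then have "x \<in> cube k" "f x = y0" using fb by (auto simp: cube_boundary_def)
      then have "z (x(k := t)) = stereo y0" using upd[of x] by (simp add: z_def algebra_simps)
      then show "H (x(k := t)) = y0" using invy by (simp add: H_def)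
    qed
  qed
qed

end

section \<open>A volume form away from the ray\<close>

definition tent :: "real \<Rightarrow> real" where
  "tent s = max 0 (s + 1) - 2 * max 0 s + max 0 (s - 1)"

definition ramp :: "real \<Rightarrow> real" where
  "ramp s = ((max 0 (s + 1))\<^sup>2 - 2 * (max 0 s)\<^sup>2 + (max 0 (s - 1))\<^sup>2) / 2"

lemma DERIV_max_0_power2: "((\<lambda>s::real. (max 0 s)\<^sup>2) has_real_derivative 2 * max 0 s) (at s)"
proof -
  consider "s < 0" | "s = 0" | "s > 0" by linarith
  then show ?thesis
  proof cases
    case 1
    have "((\<lambda>s::real. 0) has_real_derivative 0) (at s)" by simp
    then have "((\<lambda>s::real. (max 0 s)\<^sup>2) has_real_derivative 0) (at s)"
      by (rule DERIV_cong_ev[THEN iffD1, rotated 3])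
         (use 1 eventually_nhds_in_open[of "{..<0}" s] in \<open>auto simp: max_def elim!: eventually_mono\<close>)
    then show ?thesis using 1 by simp
  next
    case 3
    have "((\<lambda>s::real. s\<^sup>2) has_real_derivative 2 * s) (at s)" by (auto intro!: derivative_eq_intros)
    then have "((\<lambda>s::real. (max 0 s)\<^sup>2) has_real_derivative 2 * s) (at s)"
      by (rule DERIV_cong_ev[THEN iffD1, rotated 3])
         (use 3 eventually_nhds_in_open[of "{0<..}" s] in \<open>auto simp: max_def elim!: eventually_mono\<close>)
    then show ?thesis using 3 by simp
  next
    case 2
    have "((\<lambda>h::real. (max 0 h)\<^sup>2 / h) \<longlongrightarrow> 0) (at 0)"
    proof (rule Lim_null_comparison)
      show "eventually (\<lambda>h::real. norm ((max 0 h)\<^sup>2 / h) \<le> \<bar>h\<bar>) (at 0)"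
        by (intro always_eventually allI) (auto simp: max_def power2_eq_square)
      show "((\<lambda>h::real. \<bar>h\<bar>) \<longlongrightarrow> 0) (at 0)" by (intro tendsto_eq_intros) auto
    qed
    then show ?thesis using 2 by (simp add: DERIV_def)
  qed
qed

lemma DERIV_ramp: "(ramp has_real_derivative tent s) (at s)"
proof -
  have shift: "((\<lambda>s. (max 0 (s + c))\<^sup>2) has_real_derivative 2 * max 0 (s + c)) (at s)" for c :: real
    using DERIV_shift[of "\<lambda>s. (max 0 s)\<^sup>2" "2 * max 0 (s + c)" s c] DERIV_max_0_power2 by simp
  have "((\<lambda>s. ((max 0 (s + 1))\<^sup>2 - 2 * (max 0 (s + 0))\<^sup>2 + (max 0 (s + - 1))\<^sup>2) / 2) has_real_derivative
      (2 * max 0 (s + 1) - 2 * (2 * max 0 (s + 0)) + 2 * max 0 (s + - 1)) / 2) (at s)"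
    by (intro DERIV_cdivide DERIV_add DERIV_diff DERIV_cmult shift)
  then show ?thesis by (simp add: ramp_def[abs_def] tent_def diff_divide_distrib add_divide_distrib)
qed

lemma continuous_on_tent [continuous_intros]: "continuous_on S f \<Longrightarrow> continuous_on S (\<lambda>x. tent (f x))"
  unfolding tent_def by (intro continuous_intros)

lemma continuous_on_ramp [continuous_intros]: "continuous_on S f \<Longrightarrow> continuous_on S (\<lambda>x. ramp (f x))"
  unfolding ramp_def by (intro continuous_intros) auto

lemma tent_eq_0: "\<bar>s\<bar> \<ge> 1 \<Longrightarrow> tent s = 0"
  by (auto simp: tent_def max_def)

lemma tent_pos: "\<bar>s\<bar> < 1 \<Longrightarrow> tent s > 0"
  by (auto simp: tent_def max_def)

lemma tent_bounds: "0 \<le> tent s" "tent s \<le> 1"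
  by (auto simp: tent_def max_def)

lemma ramp_simps: "s \<le> -1 \<Longrightarrow> ramp s = 0" "s \<ge> 1 \<Longrightarrow> ramp s = 1"
  by (auto simp: ramp_def max_def power2_eq_square algebra_simps)

text \<open>The determinant of a matrix of scalars given by rows, which allows one row to be an
  arbitrary covector.\<close>

definition rowdet :: "('a::euclidean_space \<Rightarrow> 'a \<Rightarrow> real) \<Rightarrow> real" where
  "rowdet r = (\<Sum>\<sigma>\<in>{\<sigma>. \<sigma> permutes (UNIV::'a bidx set)}. of_int (sign \<sigma>) * (\<Prod>k\<in>UNIV. r (bvec k) (bvec (\<sigma> k))))"

lemma detf_eq_rowdet: "detf c = rowdet (\<lambda>i j. c j \<bullet> i)"
  by (simp add: detf_leibniz rowdet_def)

lemma rowdet_cong: "(\<And>i j. i \<in> Basis \<Longrightarrow> j \<in> Basis \<Longrightarrow> r i j = r' i j) \<Longrightarrow> rowdet r = rowdet r'"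
  by (simp add: rowdet_def)

lemma rowdet_scale_rows:
  "rowdet (\<lambda>i j. t i * r i j) = (\<Prod>i\<in>Basis. t i) * rowdet (r :: 'a::euclidean_space \<Rightarrow> 'a \<Rightarrow> real)"
  by (simp add: rowdet_def prod.distrib prod_bvec sum_distrib_left mult_ac)

lemma rowdet_zero_row:
  fixes r :: "'a::euclidean_space \<Rightarrow> 'a \<Rightarrow> real"
  assumes "i \<in> Basis" "\<And>j. j \<in> Basis \<Longrightarrow> r i j = 0"
  shows "rowdet r = 0"
proof -
  obtain k where k: "bvec k = i" using assms(1) bij_bvec[where 'a='a] by (metis bij_betw_imp_surj_on imageE)
  have "(\<Prod>k\<in>UNIV. r (bvec k) (bvec (\<sigma> k))) = 0" for \<sigma> :: "'a bidx \<Rightarrow> 'a bidx"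
  proof (rule prod_zero)
    have "r (bvec k) (bvec (\<sigma> k)) = 0" unfolding k by (rule assms(2)) simp
    then show "\<exists>a\<in>UNIV. r (bvec a) (bvec (\<sigma> a)) = 0" by blast
  qed simp
  then show ?thesis by (simp only: rowdet_def mult_zero_right sum.neutral_const)
qed

lemma tendsto_rowdet:
  fixes r :: "'c \<Rightarrow> 'a::euclidean_space \<Rightarrow> 'a \<Rightarrow> real"
  assumes "\<And>i j. i \<in> Basis \<Longrightarrow> j \<in> Basis \<Longrightarrow> ((\<lambda>x. r x i j) \<longlongrightarrow> r' i j) F"
  shows "((\<lambda>x. rowdet (r x)) \<longlongrightarrow> rowdet r') F"
  unfolding rowdet_def by (intro tendsto_sum tendsto_mult tendsto_const tendsto_prod assms) auto

lemma rowdet_bound: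
  fixes r :: "'a::euclidean_space \<Rightarrow> 'a \<Rightarrow> real"
  assumes "\<And>i j. i \<in> Basis \<Longrightarrow> j \<in> Basis \<Longrightarrow> \<bar>r i j\<bar> \<le> c i"
  shows "\<bar>rowdet r\<bar> \<le> fact DIM('a) * (\<Prod>i\<in>Basis. c i)"
proof -
  have "\<bar>rowdet r\<bar> \<le> (\<Sum>\<sigma>\<in>{\<sigma>. \<sigma> permutes (UNIV::'a bidx set)}. \<bar>of_int (sign \<sigma>) * (\<Prod>k\<in>UNIV. r (bvec k) (bvec (\<sigma> k)))\<bar>)"
    unfolding rowdet_def by (rule sum_abs)
  also have "\<dots> \<le> (\<Sum>\<sigma>\<in>{\<sigma>. \<sigma> permutes (UNIV::'a bidx set)}. (\<Prod>i\<in>Basis. c i))"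
  proof (rule sum_mono)
    fix \<sigma> :: "'a bidx \<Rightarrow> 'a bidx"
    have "\<bar>of_int (sign \<sigma>) * (\<Prod>k\<in>UNIV. r (bvec k) (bvec (\<sigma> k)))\<bar> = (\<Prod>k\<in>UNIV. \<bar>r (bvec k) (bvec (\<sigma> k))\<bar>)"
      by (simp add: abs_mult abs_prod sign_def)
    also have "\<dots> \<le> (\<Prod>k\<in>UNIV. c (bvec k))" by (rule prod_mono) (use assms in auto)
    finally show "\<bar>of_int (sign \<sigma>) * (\<Prod>k\<in>UNIV. r (bvec k) (bvec (\<sigma> k)))\<bar> \<le> (\<Prod>i\<in>Basis. c i)"
      by (simp add: prod_bvec)
  qed
  also have "\<dots> = fact DIM('a) * (\<Prod>i\<in>Basis. c i)"
    by (simp add: card_permutations[OF refl] card_bidx)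
  finally show ?thesis .
qed

lemma detf_nonzero:
  fixes M :: "'a::euclidean_space \<Rightarrow> 'a"
  assumes lin: "linear M" and inj: "\<And>v. M v = 0 \<Longrightarrow> v = 0"
  shows "detf M \<noteq> 0"
proof -
  define N where "N = (\<lambda>w. coordv (M (uncoordv w)))"
  have linN: "linear N"
    unfolding N_def using linear_compose[OF linear_compose[OF linear_uncoordv lin] linear_coordv] by (simp add: o_def)
  have "w = 0" if "N w = 0" for w
  proof -
    have "norm (M (uncoordv w)) = 0" using that by (metis N_def norm_coordv norm_zero)
    then have "norm (uncoordv w) = 0" using inj[of "uncoordv w"] by simp
    then show ?thesis by simp
  qed
  then have "inj N" using linear_injective_0[OF linN] by blast
  then have "det (matrix N) \<noteq> 0" using det_nz_iff_inj[OF linN] by blast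
  moreover have "uncoordv (axis j 1) = bvec j" for j :: "'a bidx"
    by (subst euclidean_eq_iff) (simp add: ball_Basis_bvec uncoordv_inner axis_def inner_bvec)
  then have "det (matrix N) = detf M"
    by (simp add: matrix_def detf_def N_def) (simp add: coordv_def)
  ultimately show ?thesis by simp
qed

text \<open>The factor \<open>\<psi>\<close> is controlled only on \<open>U\<close>; since
  \<open>\<eta>\<close> lives on a closed subset of \<open>U\<close>, the product extends by zero
  across the boundary of \<open>U\<close>.\<close>

lemma cutoff_product_C1:
  fixes \<psi> :: "'a::euclidean_space \<Rightarrow> real"
  assumes U: "open U" and Z: "closed Z" "Z \<subseteq> U"
    and \<eta>: "\<And>x. (\<eta> has_derivative \<eta>' x) (at x)" "\<And>v. continuous_on UNIV (\<lambda>x. \<eta>' x v)"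
      "\<And>x. x \<notin> Z \<Longrightarrow> \<eta> x = 0" "\<And>x v. x \<notin> Z \<Longrightarrow> \<eta>' x v = 0"
    and \<psi>: "\<And>x. x \<in> U \<Longrightarrow> (\<psi> has_derivative \<psi>' x) (at x)" "\<And>v. continuous_on U (\<lambda>x. \<psi>' x v)"
  shows "((\<lambda>x. \<eta> x * \<psi> x) has_derivative (\<lambda>v. \<eta>' x v * \<psi> x + \<eta> x * \<psi>' x v)) (at x)"
    "continuous_on UNIV (\<lambda>x. \<eta>' x v * \<psi> x + \<eta> x * \<psi>' x v)"
proof -
  show "((\<lambda>x. \<eta> x * \<psi> x) has_derivative (\<lambda>v. \<eta>' x v * \<psi> x + \<eta> x * \<psi>' x v)) (at x)"
  proof (cases "x \<in> U")
    case True
    show ?thesis by (auto intro!: derivative_eq_intros \<eta>(1) \<psi>(1)[OF True])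
  next
    case False
    then have x: "x \<in> - Z" using Z by auto
    have "((\<lambda>x. \<eta> x * \<psi> x) has_derivative (\<lambda>v. 0)) (at x)"
      by (rule has_derivative_transform_within_open[of "\<lambda>_. 0" _ _ _ "- Z"]) (use x Z \<eta>(3) in \<open>auto simp: open_Compl\<close>)
    then show ?thesis using x \<eta>(3,4) by simp
  qed
  have cp: "continuous_on U \<psi>"
    using \<psi>(1) by (meson continuous_at_imp_continuous_on has_derivative_continuous)
  have cx: "continuous_on UNIV \<eta>"
    using \<eta>(1) by (meson continuous_at_imp_continuous_on has_derivative_continuous)
  have "continuous_on U (\<lambda>x. \<eta>' x v * \<psi> x + \<eta> x * \<psi>' x v)"
    by (intro continuous_intros cp \<psi>(2) continuous_on_subset[OF cx] continuous_on_subset[OF \<eta>(2)]) auto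
  moreover have "continuous_on (- Z) (\<lambda>x. \<eta>' x v * \<psi> x + \<eta> x * \<psi>' x v)"
    using continuous_on_cong[of "-Z" "-Z" "\<lambda>x. \<eta>' x v * \<psi> x + \<eta> x * \<psi>' x v" "\<lambda>x. 0"] \<eta>(3,4) by simp
  moreover have "open (- Z)" "U \<union> - Z = UNIV" using Z by (auto simp: open_Compl)
  ultimately show "continuous_on UNIV (\<lambda>x. \<eta>' x v * \<psi> x + \<eta> x * \<psi>' x v)"
    using continuous_on_open_Un[OF U, of "- Z"] by metis
qed

text \<open>A step in the squared norm, up around \<open>c\<close> and down around \<open>d\<close>,
  each transition of half-width 1/10. The factor 20 is 10 times the 2 from differentiating
  \<open>x \<bullet> x\<close>.\<close>

lemma radial_step_C1:
  fixes c d :: real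
  defines "f \<equiv> \<lambda>x::'a::euclidean_space. ramp (10 * (x \<bullet> x - c)) - ramp (10 * (x \<bullet> x - d))"
    and "f' \<equiv> \<lambda>x v. (tent (10 * (x \<bullet> x - c)) - tent (10 * (x \<bullet> x - d))) * (20 * (x \<bullet> v))"
  shows "(f has_derivative f' x) (at x)" "continuous_on UNIV (\<lambda>x. f' x v)"
proof -
  have "((\<lambda>x. ramp (10 * (x \<bullet> x - e))) has_derivative (\<lambda>v. tent (10 * (x \<bullet> x - e)) * (20 * (x \<bullet> v)))) (at x)" for e
  proof -
    have "((\<lambda>x. 10 * (x \<bullet> x - e)) has_derivative (\<lambda>v. 20 * (x \<bullet> v))) (at x)"
      by (auto intro!: derivative_eq_intros simp: inner_commute)
    from has_derivative_compose[OF this DERIV_ramp[unfolded has_field_derivative_def]]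
    show ?thesis by (simp add: mult.commute)
  qed
  then show "(f has_derivative f' x) (at x)"
    unfolding f_def f'_def left_diff_distrib by (intro has_derivative_diff)
  show "continuous_on UNIV (\<lambda>x. f' x v)" unfolding f'_def by (intro continuous_intros)
qed

context pole begin

section \<open>The stereographic form, its bounds and its continuity\<close>

definition dstereo :: "'a \<Rightarrow> 'a \<Rightarrow> 'a" where
  "dstereo y v = frechet_derivative stereo (at y) v"

lemma smooth_stereo: "smooth_open (offray p) stereo"
proof -
  have n: "smooth_open (offray p) (\<lambda>x. norm x - x \<bullet> p)"
    by (intro smooth_open_diff smooth_open_inner smooth_open_id smooth_open_const open_offray smooth_open_norm) (auto simp: offray_def)
  have i: "smooth_open {0<..} (\<lambda>x::real. inverse x)" by (rule smooth_open_inverse) auto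
  have "smooth_open (offray p) (\<lambda>y. inverse (norm y - y \<bullet> p) *\<^sub>R (y - (y \<bullet> p) *\<^sub>R p))"
    by (intro smooth_open_scaleR smooth_open_diff smooth_open_inner smooth_open_id smooth_open_const open_offray
        smooth_open_compose[OF i n]) (auto simp: offray_def)
  then show ?thesis by (rule smooth_open_cong) (simp add: stereo_def)
qed

lemma stereo_has_derivative: "y \<in> offray p \<Longrightarrow> (stereo has_derivative dstereo y) (at y)"
  unfolding dstereo_def[abs_def] by (rule smooth_open_has_derivative[OF smooth_stereo])

lemma linear_dstereo: "y \<in> offray p \<Longrightarrow> linear (dstereo y)"
  by (rule has_derivative_linear[OF stereo_has_derivative])

lemma continuous_on_dstereo: "continuous_on (offray p) (\<lambda>y. dstereo y v)"
  unfolding dstereo_def by (rule smooth_open_continuous_derivative[OF smooth_stereo])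

lemma dstereo_expand: "y \<in> offray p \<Longrightarrow> dstereo y v = (\<Sum>b\<in>Basis. (v \<bullet> b) *\<^sub>R dstereo y b)"
proof -
  assume "y \<in> offray p"
  note lin = linear_dstereo[OF this]
  have "dstereo y (\<Sum>b\<in>Basis. (v \<bullet> b) *\<^sub>R b) = (\<Sum>b\<in>Basis. (v \<bullet> b) *\<^sub>R dstereo y b)"
    by (simp add: linear_sum[OF lin] linear_cmul[OF lin])
  then show ?thesis by (simp add: euclidean_representation)
qed

definition bump :: "'a \<Rightarrow> real" where
  "bump y = (\<Prod>i\<in>Basis - {p}. tent (stereo y \<bullet> i))"

text \<open>\<open>stereo\<close> is orthogonal to \<open>p\<close>, so the row of \<open>p\<close>
  would be zero; it is the place where the covector is inserted.\<close>

definition drows :: "'a \<Rightarrow> ('a \<Rightarrow> 'a) \<Rightarrow> ('a \<Rightarrow> real) \<Rightarrow> 'a \<Rightarrow> 'a \<Rightarrow> real" where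
  "drows y a b i j = (if i = p then b j else dstereo y (a j) \<bullet> i)"

text \<open>The \<open>n\<close>-form \<open>bump * dz\<^sub>1 \<and> \<dots> \<and> dz\<^sub>n\<close> in stereographic coordinates \<open>z\<close>, evaluated on the
  images \<open>a j\<close> of the basis vectors and wedged with the covector \<open>b\<close>.\<close>

definition dform :: "'a \<Rightarrow> ('a \<Rightarrow> 'a) \<Rightarrow> ('a \<Rightarrow> real) \<Rightarrow> real" where
  "dform y a b = (if y \<in> offray p then bump y * rowdet (drows y a b) else 0)"

text \<open>A compact set off the ray that carries the support of \<open>bump\<close> for the norms
  that occur. The last condition is the bound \<open>DIM('a)\<close> on the square of
  \<open>stereo y\<close>, with the denominator cleared. Points of \<open>Y\<close> have norm
  between 1/4 and 2, so the range from 1/10 to 3 leaves room for mollification.\<close>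

definition dcore :: "'a set" where
  "dcore = {y. 1 / 10 \<le> norm y \<and> norm y \<le> 3 \<and> 2 * norm y \<le> (real DIM('a) + 1) * (norm y - y \<bullet> p)}"

lemma compact_dcore: "compact dcore"
proof -
  have "closed dcore"
    unfolding dcore_def by (intro closed_Collect_conj closed_Collect_le continuous_intros)
  moreover have "bounded dcore" by (rule boundedI[of _ 3]) (auto simp: dcore_def)
  ultimately show ?thesis by (simp add: compact_eq_bounded_closed)
qed

lemma dcore_offray: "dcore \<subseteq> offray p"
proof
  fix y assume y: "y \<in> dcore"
  then have "0 < 2 * norm y" "2 * norm y \<le> (real DIM('a) + 1) * (norm y - y \<bullet> p)" by (auto simp: dcore_def)
  then have "0 < (real DIM('a) + 1) * (norm y - y \<bullet> p)" by linarith
  then have "0 < norm y - y \<bullet> p" by (simp add: zero_less_mult_iff)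
  then show "y \<in> offray p" by (simp add: offray_def)
qed

lemma norm_stereo_square: "y \<in> offray p \<Longrightarrow> stereo y \<bullet> stereo y = (norm y + y \<bullet> p) / (norm y - y \<bullet> p)"
proof -
  assume "y \<in> offray p"
  then have m: "norm y - y \<bullet> p > 0" by (simp add: offray_def)
  have "(y - (y \<bullet> p) *\<^sub>R p) \<bullet> (y - (y \<bullet> p) *\<^sub>R p) = y \<bullet> y - (y \<bullet> p)\<^sup>2"
    by (simp add: inner_diff_left inner_diff_right inner_commute[of p y] power2_eq_square)
  also have "\<dots> = (norm y - y \<bullet> p) * (norm y + y \<bullet> p)"
    by (simp add: dot_square_norm power2_eq_square algebra_simps)
  finally show ?thesis using m by (simp add: stereo_def divide_simps)
qed

lemma bump_support:
  assumes "y \<in> offray p" "bump y \<noteq> 0" "1 / 10 \<le> norm y" "norm y \<le> 3"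
  shows "y \<in> dcore"
proof -
  have m: "norm y - y \<bullet> p > 0" using assms(1) by (simp add: offray_def)
  have t: "\<bar>stereo y \<bullet> i\<bar> \<le> 1" if "i \<in> Basis" for i
  proof (cases "i = p")
    case False
    then have "tent (stereo y \<bullet> i) \<noteq> 0" using assms(2) that by (auto simp: bump_def)
    then show ?thesis using tent_eq_0[of "stereo y \<bullet> i"] by linarith
  qed (simp add: stereo_perp)
  have "stereo y \<bullet> stereo y = (\<Sum>i\<in>Basis. (stereo y \<bullet> i)\<^sup>2)" by (subst euclidean_inner) (simp add: power2_eq_square)
  also have "\<dots> \<le> (\<Sum>i\<in>(Basis::'a set). 1)" by (intro sum_mono) (use t in \<open>simp add: abs_square_le_1\<close>)
  finally have "(norm y + y \<bullet> p) / (norm y - y \<bullet> p) \<le> real DIM('a)" using norm_stereo_square[OF assms(1)] by simp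
  then have "norm y + y \<bullet> p \<le> real DIM('a) * (norm y - y \<bullet> p)" using m by (simp add: divide_le_eq)
  then show ?thesis using assms by (simp add: dcore_def algebra_simps)
qed

lemma abs_bump_le: "0 \<le> bump y" "bump y \<le> 1"
  unfolding bump_def by (auto intro!: prod_nonneg prod_le_1 tent_bounds)

text \<open>One row is the covector, the other \<open>DIM('a) - 1\<close> rows are linear in the
  images, and the derivative of \<open>stereo\<close> is bounded on the compact support. The
  exponent is exactly the Sobolev exponent, which makes the form integrable along Sobolev
  maps.\<close>

lemma dform_bound:
  obtains C where "C \<ge> 0" "\<And>y a b M \<beta>. 1 / 10 \<le> norm y \<Longrightarrow> norm y \<le> 3 \<Longrightarrow> (\<And>j. j \<in> Basis \<Longrightarrow> norm (a j) \<le> M) \<Longrightarrow>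
     (\<And>j. j \<in> Basis \<Longrightarrow> \<bar>b j\<bar> \<le> \<beta>) \<Longrightarrow> \<bar>dform y a b\<bar> \<le> C * \<beta> * M ^ (DIM('a) - 1)"
proof -
  have "\<exists>C\<ge>0. \<forall>y\<in>dcore. norm (dstereo y b) \<le> C" for b
    using compact_image_bound[OF compact_dcore continuous_on_subset[OF continuous_on_dstereo dcore_offray]] by metis
  then obtain c where c: "\<And>b. c b \<ge> 0" "\<And>b y. y \<in> dcore \<Longrightarrow> norm (dstereo y b) \<le> c b" by metis
  define K where "K = (\<Sum>b\<in>(Basis::'a set). c b)"
  have K0: "K \<ge> 0" unfolding K_def by (intro sum_nonneg c)
  have K: "norm (dstereo y v) \<le> K * norm v" if "y \<in> dcore" for y v
  proof -
    have "norm (dstereo y v) \<le> (\<Sum>b\<in>Basis. c b * norm v)"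
      unfolding dstereo_expand[OF subsetD[OF dcore_offray that], of v]
    proof (rule sum_norm_le)
      fix b :: 'a assume "b \<in> Basis"
      then have "\<bar>v \<bullet> b\<bar> * norm (dstereo y b) \<le> norm v * c b"
        using c(2)[OF that, of b] by (intro mult_mono) (auto simp: Basis_le_norm)
      then show "norm ((v \<bullet> b) *\<^sub>R dstereo y b) \<le> c b * norm v" by (simp add: mult.commute)
    qed
    then show ?thesis by (simp add: K_def sum_distrib_right)
  qed
  show thesis
  proof (rule that[of "fact DIM('a) * K ^ (DIM('a) - 1)"])
    show "0 \<le> fact DIM('a) * K ^ (DIM('a) - 1)" using K0 by simp
    fix y :: 'a and a :: "'a \<Rightarrow> 'a" and b :: "'a \<Rightarrow> real" and M \<beta> :: real
    assume y: "1 / 10 \<le> norm y" "norm y \<le> 3" and a: "\<And>j. j \<in> Basis \<Longrightarrow> norm (a j) \<le> M" and b: "\<And>j. j \<in> Basis \<Longrightarrow> \<bar>b j\<bar> \<le> \<beta>"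
    have M0: "M \<ge> 0" "\<beta> \<ge> 0" using a[OF p] b[OF p] norm_ge_zero[of "a p"] abs_ge_zero[of "b p"] by linarith+
    show "\<bar>dform y a b\<bar> \<le> fact DIM('a) * K ^ (DIM('a) - 1) * \<beta> * M ^ (DIM('a) - 1)"
    proof (cases "y \<in> offray p \<and> bump y \<noteq> 0")
      case True
      then have yc: "y \<in> dcore" using bump_support y by blast
      have "\<bar>rowdet (drows y a b)\<bar> \<le> fact DIM('a) * (\<Prod>i\<in>Basis. if i = p then \<beta> else K * M)"
      proof (rule rowdet_bound)
        fix i j :: 'a assume ij: "i \<in> Basis" "j \<in> Basis"
        have "\<bar>dstereo y (a j) \<bullet> i\<bar> \<le> norm (dstereo y (a j))" using ij by (simp add: Basis_le_norm)
        also have "\<dots> \<le> K * M" using K[OF yc, of "a j"] a[OF ij(2)] K0 mult_left_mono by (meson order_trans)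
        finally show "\<bar>drows y a b i j\<bar> \<le> (if i = p then \<beta> else K * M)" using b[OF ij(2)] by (simp add: drows_def)
      qed
      also have "(\<Prod>i\<in>Basis. if i = p then \<beta> else K * M) = \<beta> * (K * M) ^ (DIM('a) - 1)"
      proof -
        have "(\<Prod>i\<in>Basis - {p}. if i = p then \<beta> else K * M) = (\<Prod>i\<in>Basis - {p}. K * M)" by (rule prod.cong) auto
        also have "\<dots> = (K * M) ^ (DIM('a) - 1)" using p by (simp add: card_Diff_singleton)
        finally show ?thesis by (subst prod.remove[OF finite_Basis p]) simp
      qed
      finally have "\<bar>rowdet (drows y a b)\<bar> \<le> fact DIM('a) * (\<beta> * (K * M) ^ (DIM('a) - 1))" .
      moreover have "\<bar>dform y a b\<bar> \<le> 1 * \<bar>rowdet (drows y a b)\<bar>"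
        using True abs_bump_le[of y] by (simp only: dform_def abs_mult if_True) (intro mult_right_mono, auto)
      ultimately show ?thesis by (simp add: power_mult_distrib mult_ac)
    next
      case False
      then have "dform y a b = 0" by (auto simp: dform_def)
      then show ?thesis using M0 K0 by simp
    qed
  qed
qed

text \<open>Off the ray all ingredients are continuous. A limit on the ray lies outside the closed
  set \<open>dcore\<close>, so the form vanishes along the sequence from some index on.\<close>

lemma tendsto_dform:
  assumes y: "y \<longlonglongrightarrow> y0" and a: "\<And>j. j \<in> Basis \<Longrightarrow> (\<lambda>k. a k j) \<longlonglongrightarrow> a0 j"
    and bd: "\<And>k::nat. 1 / 10 \<le> norm (y k) \<and> norm (y k) \<le> 3"
  shows "(\<lambda>k. dform (y k) (a k) b) \<longlonglongrightarrow> dform y0 a0 b"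
proof (cases "y0 \<in> offray p")
  case True
  have ev: "eventually (\<lambda>k. y k \<in> offray p) sequentially"
    using topological_tendstoD[OF y open_offray True] .
  have ct: "((\<lambda>k. f (y k)) \<longlongrightarrow> f y0) sequentially" if "continuous_on (offray p) f" for f :: "'a \<Rightarrow> 'a"
    using that True open_offray y by (metis continuous_on_eq_continuous_at isCont_tendsto_compose)
  have s: "(\<lambda>k. stereo (y k)) \<longlonglongrightarrow> stereo y0" by (rule ct[OF smooth_open_continuous[OF smooth_stereo]])
  have "isCont tent t" for t using continuous_on_tent[OF continuous_on_id, of UNIV] by (simp add: continuous_on_eq_continuous_at)
  then have q: "(\<lambda>k. bump (y k)) \<longlonglongrightarrow> bump y0"
    unfolding bump_def by (intro tendsto_prod isCont_tendsto_compose[of _ tent] tendsto_inner s tendsto_const)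
  have d: "(\<lambda>k. \<Sum>b\<in>Basis. (a k j \<bullet> b) *\<^sub>R dstereo (y k) b) \<longlonglongrightarrow> (\<Sum>b\<in>Basis. (a0 j \<bullet> b) *\<^sub>R dstereo y0 b)" if "j \<in> Basis" for j
    by (intro tendsto_sum tendsto_scaleR tendsto_inner a that tendsto_const ct[OF continuous_on_dstereo])
  have d': "(\<lambda>k. dstereo (y k) (a k j)) \<longlonglongrightarrow> dstereo y0 (a0 j)" if "j \<in> Basis" for j
  proof -
    have "(\<lambda>k. dstereo (y k) (a k j)) \<longlonglongrightarrow> (\<Sum>b\<in>Basis. (a0 j \<bullet> b) *\<^sub>R dstereo y0 b)"
      by (rule Lim_transform_eventually[OF d[OF that]])
         (use ev in eventually_elim, rule dstereo_expand[symmetric])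
    then show ?thesis using dstereo_expand[OF True] by metis
  qed
  have "(\<lambda>k. bump (y k) * rowdet (drows (y k) (a k) b)) \<longlonglongrightarrow> bump y0 * rowdet (drows y0 a0 b)"
  proof (intro tendsto_mult q tendsto_rowdet)
    fix i j :: 'a assume "i \<in> Basis" "j \<in> Basis"
    then show "(\<lambda>k. drows (y k) (a k) b i j) \<longlonglongrightarrow> drows y0 a0 b i j"
      unfolding drows_def by (cases "i = p") (auto intro!: tendsto_inner d')
  qed
  then have "(\<lambda>k. dform (y k) (a k) b) \<longlonglongrightarrow> bump y0 * rowdet (drows y0 a0 b)"
    by (rule Lim_transform_eventually) (use ev in eventually_elim, simp add: dform_def)
  then show ?thesis using True by (simp add: dform_def)
next
  case False
  then have "y0 \<in> - dcore" using dcore_offray by blast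
  then have "eventually (\<lambda>k. y k \<in> - dcore) sequentially"
    using compact_imp_closed[OF compact_dcore] by (intro topological_tendstoD[OF y]) (auto simp: open_Compl)
  then have "eventually (\<lambda>k. dform (y k) (a k) b = 0) sequentially"
    by eventually_elim (use bump_support bd in \<open>auto simp: dform_def\<close>)
  then show ?thesis using False by (simp add: dform_def tendsto_eventually)
qed

text \<open>The differential of \<open>ramp (10 * (x \<bullet> x - 1))\<close>. Wedging with it
  spreads the integral over the unit sphere to the shell of squared norms between 9/10 and
  11/10.\<close>

definition radial_covector :: "'a \<Rightarrow> 'a \<Rightarrow> real" where
  "radial_covector x j = tent (10 * (x \<bullet> x - 1)) * (20 * (x \<bullet> j))"


lemma sum_scaleR_inner_Basis: "i \<in> Basis \<Longrightarrow> (\<Sum>k\<in>Basis. f k *\<^sub>R k) \<bullet> i = f (i::'a)"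
  by (simp add: inner_sum_left inner_Basis if_distrib sum.delta' cong: if_cong)

lemma bump_eq_prod: "bump y = (\<Prod>i\<in>Basis. if i = p then 1 else tent (stereo y \<bullet> i))"
proof -
  have "(\<Prod>i\<in>Basis - {p}. if i = p then 1 else tent (stereo y \<bullet> i)) = bump y"
    unfolding bump_def by (rule prod.cong) auto
  then show ?thesis by (subst prod.remove[OF finite_Basis p]) simp
qed

text \<open>The form is exact off the ray: it is \<open>d(ramp z\<^sub>1) \<and> \<dots> \<and> d(ramp z\<^sub>n)\<close>, so after cutting
  off the potentials \<open>ramp z\<^sub>i\<close> the integrand becomes the Jacobian of a compactly supported map.\<close>

lemma integral_dform_C1_zero:
  fixes V :: "'a \<Rightarrow> 'a"
  assumes dim: "DIM('a) \<ge> 2"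
    and V: "\<And>x. (V has_derivative V' x) (at x)" "\<And>v. continuous_on UNIV (\<lambda>x. V' x v)"
    and off: "\<And>x. 6 / 10 \<le> x \<bullet> x \<Longrightarrow> x \<bullet> x \<le> 14 / 10 \<Longrightarrow> V x \<in> offray p"
  shows "(LBINT x. dform (V x) (V' x) (radial_covector x)) = 0"
    and "integrable lborel (\<lambda>x. dform (V x) (V' x) (radial_covector x))"
proof -
  \<comment> \<open>Cutoff for the potentials: 1 for squared norms in [8/10, 12/10], 0 outside
    [6/10, 14/10]. It must be constant where the radial covector lives.\<close>
  define \<eta> where "\<eta> = (\<lambda>x::'a. ramp (10 * (x \<bullet> x - 7 / 10)) - ramp (10 * (x \<bullet> x - 13 / 10)))"
  define \<eta>' where "\<eta>' = (\<lambda>x v::'a. (tent (10 * (x \<bullet> x - 7 / 10)) - tent (10 * (x \<bullet> x - 13 / 10))) * (20 * (x \<bullet> v)))"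
  \<comment> \<open>The radial potential, brought back to 0 around 17/10 to have compact support;
    there \<open>\<eta>\<close> is already 0, so the descent adds nothing to the Jacobian.\<close>
  define H where "H = (\<lambda>x::'a. ramp (10 * (x \<bullet> x - 1)) - ramp (10 * (x \<bullet> x - 17 / 10)))"
  define H' where "H' = (\<lambda>x v::'a. (tent (10 * (x \<bullet> x - 1)) - tent (10 * (x \<bullet> x - 17 / 10))) * (20 * (x \<bullet> v)))"
  have \<eta>d: "(\<eta> has_derivative \<eta>' x) (at x)" "continuous_on UNIV (\<lambda>x. \<eta>' x v)" for x v
    unfolding \<eta>_def \<eta>'_def by (rule radial_step_C1)+
  have Hd: "(H has_derivative H' x) (at x)" "continuous_on UNIV (\<lambda>x. H' x v)" for x v
    unfolding H_def H'_def by (rule radial_step_C1)+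
  have \<eta>0: "\<eta> x = 0 \<and> \<eta>' x v = 0" if "x \<bullet> x \<le> 6 / 10 \<or> x \<bullet> x \<ge> 14 / 10" for x v
    using that by (auto simp: \<eta>_def \<eta>'_def ramp_simps tent_eq_0)
  have \<eta>1: "\<eta> x = 1 \<and> \<eta>' x v = 0" if "8 / 10 \<le> x \<bullet> x" "x \<bullet> x \<le> 12 / 10" for x v
    using that by (auto simp: \<eta>_def \<eta>'_def ramp_simps tent_eq_0)
  have cV: "continuous_on UNIV V"
    using V(1) by (meson continuous_at_imp_continuous_on has_derivative_continuous)
  define U where "U = V -` offray p"
  define Z where "Z = {x::'a. 6 / 10 \<le> x \<bullet> x \<and> x \<bullet> x \<le> 14 / 10}"
  have U: "open U" unfolding U_def by (rule open_vimage[OF open_offray cV])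
  have Z: "closed Z" unfolding Z_def by (intro closed_Collect_conj closed_Collect_le continuous_intros)
  have ZU: "Z \<subseteq> U" using off by (auto simp: Z_def U_def)
  define \<psi> where "\<psi> = (\<lambda>i x. ramp (stereo (V x) \<bullet> i))"
  define \<psi>' where "\<psi>' = (\<lambda>i x v. tent (stereo (V x) \<bullet> i) * (dstereo (V x) (V' x v) \<bullet> i))"
  have s: "((\<lambda>x. stereo (V x)) has_derivative (\<lambda>v. dstereo (V x) (V' x v))) (at x)" if "x \<in> U" for x
    by (rule has_derivative_compose[OF V(1) stereo_has_derivative]) (use that in \<open>simp add: U_def\<close>)
  have \<psi>d: "(\<psi> i has_derivative \<psi>' i x) (at x)" if "x \<in> U" for i x
  proof -
    have "((\<lambda>x. stereo (V x) \<bullet> i) has_derivative (\<lambda>v. dstereo (V x) (V' x v) \<bullet> i)) (at x)"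
      by (rule has_derivative_inner_left[OF s[OF that]])
    from has_derivative_compose[OF this DERIV_ramp[unfolded has_field_derivative_def]]
    show ?thesis by (simp add: \<psi>_def \<psi>'_def)
  qed
  have cs: "continuous_on U (\<lambda>x. stereo (V x))"
    by (rule continuous_on_compose2[OF smooth_open_continuous[OF smooth_stereo] continuous_on_subset[OF cV]]) (auto simp: U_def)
  have cd: "continuous_on U (\<lambda>x. dstereo (V x) (V' x v))" for v
  proof -
    have "continuous_on U (\<lambda>x. \<Sum>b\<in>Basis. (V' x v \<bullet> b) *\<^sub>R dstereo (V x) b)"
    proof (intro continuous_on_sum continuous_on_scaleR continuous_on_inner continuous_on_const)
      show "continuous_on U (\<lambda>x. V' x v)" by (rule continuous_on_subset[OF V(2)]) simp
      show "continuous_on U (\<lambda>x. dstereo (V x) b)" for b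
        by (rule continuous_on_compose2[OF continuous_on_dstereo continuous_on_subset[OF cV]]) (auto simp: U_def)
    qed
    then show ?thesis
      by (rule continuous_on_eq) (simp add: U_def dstereo_expand[of _ "V' _ v"])
  qed
  have \<psi>c: "continuous_on U (\<lambda>x. \<psi>' i x v)" for i v
    unfolding \<psi>'_def by (intro continuous_intros cs cd)
  have \<eta>Z: "\<eta> x = 0" "\<eta>' x v = 0" if "x \<notin> Z" for x v
    using \<eta>0[of x v] that by (auto simp: Z_def)
  define r where "r = (\<lambda>x i v. if i = p then H' x v else \<eta>' x v * \<psi> i x + \<eta> x * \<psi>' i x v)"
  define W where "W = (\<lambda>x. \<Sum>i\<in>Basis. (if i = p then H x else \<eta> x * \<psi> i x) *\<^sub>R i)"
  define W' where "W' = (\<lambda>x v. \<Sum>i\<in>Basis. r x i v *\<^sub>R i)"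
  have rd: "((\<lambda>x. if i = p then H x else \<eta> x * \<psi> i x) has_derivative r x i) (at x)"
    and rc: "continuous_on UNIV (\<lambda>x. r x i v)" for x i v
  proof -
    have a: "((\<lambda>x. \<eta> x * \<psi> i x) has_derivative (\<lambda>v. \<eta>' x v * \<psi> i x + \<eta> x * \<psi>' i x v)) (at x)"
      by (rule cutoff_product_C1(1)[OF U Z ZU \<eta>d \<eta>Z \<psi>d \<psi>c])
    have b: "continuous_on UNIV (\<lambda>x. \<eta>' x v * \<psi> i x + \<eta> x * \<psi>' i x v)"
      by (rule cutoff_product_C1(2)[OF U Z ZU \<eta>d \<eta>Z \<psi>d \<psi>c])
    show "((\<lambda>x. if i = p then H x else \<eta> x * \<psi> i x) has_derivative r x i) (at x)"
      using a Hd(1) by (cases "i = p") (simp_all add: r_def[abs_def])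
    show "continuous_on UNIV (\<lambda>x. r x i v)"
      using b Hd(2) by (cases "i = p") (simp_all add: r_def)
  qed
  have Wd: "(W has_derivative W' x) (at x)" for x
    unfolding W_def W'_def by (intro has_derivative_sum has_derivative_scaleR_left rd)
  have Wc: "continuous_on UNIV (\<lambda>x. W' x v)" for v
    unfolding W'_def by (intro continuous_intros rc)
  have Ws: "W x = 0" if "norm x > 2" for x
  proof -
    have "x \<bullet> x \<ge> 4" using that power_strict_mono[of 2 "norm x" 2] by (simp flip: power2_norm_eq_inner)
    then have "H x = 0" "\<eta> x = 0" using \<eta>0[of x] by (auto simp: H_def ramp_simps)
    then show ?thesis unfolding W_def by (intro sum.neutral ballI) simp
  qed
  \<comment> \<open>A row other than that of \<open>p\<close>; it vanishes wherever
    \<open>\<eta>\<close> does.\<close>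
  obtain e where e: "e \<in> Basis" "e \<noteq> p"
  proof -
    have "\<not> Basis \<subseteq> {p}" using dim card_mono[of "{p}" "Basis::'a set"] by auto
    then show ?thesis using that by blast
  qed
  \<comment> \<open>Inside the support of the covector the cutoffs are inactive and the Jacobian is
    the form. Elsewhere both sides are 0: the row of \<open>p\<close> vanishes for squared norm
    below 14/10, the row of \<open>e\<close> from there on.\<close>
  have eq: "detf (W' x) = dform (V x) (V' x) (radial_covector x)" for x
  proof -
    have dW: "detf (W' x) = rowdet (\<lambda>i j. r x i j)"
      unfolding detf_eq_rowdet W'_def by (rule rowdet_cong) (simp add: sum_scaleR_inner_Basis)
    show ?thesis
    proof (cases "9 / 10 < x \<bullet> x \<and> x \<bullet> x < 11 / 10")
      case True
      then have off': "V x \<in> offray p" using off by auto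
      have "H' x v = radial_covector x v" for v using True by (simp add: H'_def radial_covector_def tent_eq_0)
      moreover have "\<eta> x = 1" "\<eta>' x v = 0" for v using \<eta>1[of x v] True by auto
      ultimately have "rowdet (\<lambda>i j. r x i j) = rowdet (\<lambda>i j. (if i = p then 1 else tent (stereo (V x) \<bullet> i)) * drows (V x) (V' x) (radial_covector x) i j)"
        by (intro rowdet_cong) (simp add: r_def \<psi>'_def drows_def)
      then show ?thesis using off' unfolding dW rowdet_scale_rows bump_eq_prod[symmetric] by (simp add: dform_def)
    next
      case False
      then have "tent (10 * (x \<bullet> x - 1)) = 0" by (intro tent_eq_0) auto
      then have rc0: "radial_covector x j = 0" for j by (simp add: radial_covector_def)
      have "rowdet (drows (V x) (V' x) (radial_covector x)) = 0"
        by (rule rowdet_zero_row[OF p]) (simp add: drows_def rc0)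
      then have "dform (V x) (V' x) (radial_covector x) = 0" by (simp add: dform_def)
      moreover have "rowdet (\<lambda>i j. r x i j) = 0"
      proof (cases "x \<bullet> x \<ge> 14 / 10")
        case True
        then have "r x e j = 0" for j using \<eta>0[of x j] e by (simp add: r_def)
        then show ?thesis by (intro rowdet_zero_row[OF e(1)])
      next
        case F: False
        have "tent (10 * (x \<bullet> x - 17 / 10)) = 0" using F by (intro tent_eq_0) auto
        then have "r x p j = 0" for j using \<open>tent (10 * (x \<bullet> x - 1)) = 0\<close> by (simp add: r_def H'_def)
        then show ?thesis by (intro rowdet_zero_row[OF p])
      qed
      ultimately show ?thesis by (simp add: dW)
    qed
  qed
  have "(LBINT x. detf (W' x)) = 0"
    by (rule integral_detf_compact_support[OF Wd Wc Ws])
  then show "(LBINT x. dform (V x) (V' x) (radial_covector x)) = 0" by (simp add: eq)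
  have cW: "continuous_on UNIV (\<lambda>x. detf (W' x))"
    unfolding detf_leibniz by (intro continuous_intros Wc)
  have W0: "detf (W' x) = 0" if "norm x > 2" for x
  proof -
    obtain B where "\<And>x v. norm x > 2 \<Longrightarrow> W' x v = 0"
      using compact_support_C1_bounded[OF Wd Wc Ws] by metis
    then show ?thesis using that unfolding detf_eq_rowdet by (intro rowdet_zero_row[OF p]) simp
  qed
  obtain B where B: "\<And>x. x \<in> cball 0 2 \<Longrightarrow> norm (detf (W' x)) \<le> B"
    using compact_image_bound[OF compact_cball continuous_on_subset[OF cW subset_UNIV]] by metis
  have "norm (detf (W' x)) \<le> \<bar>B\<bar>" for x
    using B[of x] W0[of x] by (cases "norm x > 2") auto
  then have "integrable lborel (\<lambda>x. detf (W' x))"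
    by (rule integrable_bounded_support[OF borel_measurable_continuous_onI[OF cW] _ W0])
  then show "integrable lborel (\<lambda>x. dform (V x) (V' x) (radial_covector x))" by (simp add: eq)
qed

section \<open>The degree integral of the perturbed sphere\<close>

definition dwsph :: "'a \<Rightarrow> 'a \<Rightarrow> 'a" where
  "dwsph x v = (if x \<in> offray p then frechet_derivative (wsph p) (at x) v else 0)"

lemma wsph_has_derivative: "x \<in> offray p \<Longrightarrow> (wsph p has_derivative dwsph x) (at x)"
  using smooth_open_has_derivative[OF smooth_wsph] by (simp add: dwsph_def[abs_def])

lemma continuous_on_dwsph: "continuous_on (offray p) (\<lambda>x. dwsph x v)"
  using smooth_open_continuous_derivative[OF smooth_wsph]
  by (rule continuous_on_eq) (simp add: dwsph_def)

lemma stereo_scaleR: "c > 0 \<Longrightarrow> stereo (c *\<^sub>R y) = stereo y"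
proof -
  assume c: "c > 0"
  have "stereo (c *\<^sub>R y) = (c *\<^sub>R (y - (y \<bullet> p) *\<^sub>R p)) /\<^sub>R (c * (norm y - y \<bullet> p))"
    using c by (simp add: stereo_def algebra_simps)
  also have "\<dots> = (inverse (c * (norm y - y \<bullet> p)) * c) *\<^sub>R (y - (y \<bullet> p) *\<^sub>R p)" by (simp only: scaleR_scaleR)
  also have "inverse (c * (norm y - y \<bullet> p)) * c = inverse (norm y - y \<bullet> p)" using c by simp
  finally show ?thesis by (simp add: stereo_def)
qed

lemma stereo_wsph: "x \<noteq> 0 \<Longrightarrow> stereo (wsph p x) = stereo x"
  using wsph_pos_multiple[of x] stereo_scaleR by metis

text \<open>Stereographic coordinates do not see the radial perturbation: differentiate
  \<open>stereo (wsph p x) = stereo x\<close>.\<close>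

lemma dstereo_dwsph:
  assumes "x \<in> offray p"
  shows "dstereo (wsph p x) (dwsph x v) = dstereo x v"
proof -
  have w: "wsph p x \<in> offray p" using wsph_offray_iff offray_nz assms by blast
  have "((\<lambda>x. stereo (wsph p x)) has_derivative (\<lambda>v. dstereo (wsph p x) (dwsph x v))) (at x)"
    by (rule has_derivative_compose[OF wsph_has_derivative[OF assms] stereo_has_derivative[OF w]])
  then have "(stereo has_derivative (\<lambda>v. dstereo (wsph p x) (dwsph x v))) (at x)"
    by (rule has_derivative_transform_within_open[OF _ open_offray assms]) (use stereo_wsph offray_nz in auto)
  then have "(\<lambda>v. dstereo (wsph p x) (dwsph x v)) = dstereo x"
    using has_derivative_unique stereo_has_derivative[OF assms] by blast
  then show ?thesis by (rule fun_cong)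
qed

definition dnormalize :: "'a \<Rightarrow> 'a \<Rightarrow> 'a" where
  "dnormalize x v = v /\<^sub>R norm x - ((x \<bullet> v) / norm x ^ 3) *\<^sub>R x"

lemma normalize_has_derivative:
  assumes nx: "x \<noteq> 0"
  shows "((\<lambda>x. x /\<^sub>R norm x) has_derivative dnormalize x) (at x)"
proof -
  have n: "(norm has_derivative (\<lambda>v. inverse (norm x) * (v \<bullet> x))) (at x)"
    using GDERIV_norm[OF nx] by (simp add: gderiv_def sgn_div_norm)
  have "((\<lambda>x. x /\<^sub>R norm x) has_derivative (\<lambda>v. v /\<^sub>R norm x - ((x \<bullet> v) / norm x ^ 3) *\<^sub>R x)) (at x)"
    by (rule derivative_eq_intros n | rule nx | simp add: nx)+
       (use nx in \<open>auto simp: fun_eq_iff power3_eq_cube inner_commute divide_inverse algebra_simps\<close>)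
  then show ?thesis by (simp add: dnormalize_def[abs_def])
qed

text \<open>\<open>unstereo\<close> after \<open>stereo\<close> is normalization, so the kernel of
  \<open>dstereo x\<close> lies in that of \<open>dnormalize x\<close>, which is the radial
  line.\<close>

lemma dstereo_kernel:
  assumes x: "x \<in> offray p" and d: "dstereo x v = 0" and o: "x \<bullet> v = 0"
  shows "v = 0"
proof -
  let ?U = "\<lambda>z. frechet_derivative unstereo (at z)"
  have u: "(unstereo has_derivative ?U (stereo x)) (at (stereo x))"
    by (rule smooth_open_has_derivative[OF smooth_unstereo]) simp
  have "((\<lambda>x. unstereo (stereo x)) has_derivative (\<lambda>v. ?U (stereo x) (dstereo x v))) (at x)"
    by (rule has_derivative_compose[OF stereo_has_derivative[OF x] u])
  then have 1: "((\<lambda>x. x /\<^sub>R norm x) has_derivative (\<lambda>v. ?U (stereo x) (dstereo x v))) (at x)"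
    by (rule has_derivative_transform_within_open[OF _ open_offray x]) (use unstereo_stereo in auto)
  have nx: "x \<noteq> 0" using offray_nz[OF x] .
  have "dnormalize x v = ?U (stereo x) (dstereo x v)"
    using has_derivative_unique[OF 1 normalize_has_derivative[OF nx]] by (metis (no_types, lifting))
  also have "\<dots> = 0" using d linear_0[OF has_derivative_linear[OF u]] by simp
  finally show ?thesis using o nx by (simp add: dnormalize_def)
qed

lemma dform_wsph:
  assumes x: "x \<in> offray p"
  shows "dform (wsph p x) (dwsph x) (radial_covector x) =
    bump x * (20 * tent (10 * (x \<bullet> x - 1))) * rowdet (drows x (\<lambda>j. j) (\<lambda>j. x \<bullet> j))"
proof -
  have w: "wsph p x \<in> offray p" using wsph_offray_iff offray_nz x by blast
  have b: "bump (wsph p x) = bump x" using stereo_wsph[OF offray_nz[OF x]] by (simp add: bump_def)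
  have "rowdet (drows (wsph p x) (dwsph x) (radial_covector x)) =
      rowdet (\<lambda>i j. (if i = p then 20 * tent (10 * (x \<bullet> x - 1)) else 1) * drows x (\<lambda>j. j) (\<lambda>j. x \<bullet> j) i j)"
    by (rule rowdet_cong) (simp add: drows_def dstereo_dwsph[OF x] radial_covector_def)
  also have "\<dots> = (20 * tent (10 * (x \<bullet> x - 1))) * rowdet (drows x (\<lambda>j. j) (\<lambda>j. x \<bullet> j))"
    unfolding rowdet_scale_rows using p by (simp add: prod.delta)
  finally show ?thesis using w b by (simp add: dform_def)
qed

text \<open>The matrix represents the map from \<open>v\<close> to the stereographic components of
  \<open>dstereo x v\<close> together with \<open>x \<bullet> v\<close>. A vector killed by the
  former is radial, and the latter detects the radial direction.\<close>

lemma rowdet_identity_nonzero: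
  assumes x: "x \<in> offray p"
  shows "rowdet (drows x (\<lambda>j. j) (\<lambda>j. x \<bullet> j)) \<noteq> 0"
proof -
  define M where "M = (\<lambda>v. \<Sum>i\<in>Basis. (if i = p then x \<bullet> v else dstereo x v \<bullet> i) *\<^sub>R i)"
  note lin = linear_dstereo[OF x]
  have Mi: "M v \<bullet> i = (if i = p then x \<bullet> v else dstereo x v \<bullet> i)" if "i \<in> Basis" for v i
    unfolding M_def by (rule sum_scaleR_inner_Basis[OF that])
  have "linear M"
  proof (rule linearI)
    show "M (u + v) = M u + M v" for u v
      by (rule euclidean_eqI) (auto simp: Mi inner_add_left inner_add_right linear_add[OF lin])
    show "M (c *\<^sub>R v) = c *\<^sub>R M v" for c v
      by (rule euclidean_eqI) (auto simp: Mi linear_cmul[OF lin])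
  qed
  moreover have "v = 0" if "M v = 0" for v
  proof (rule dstereo_kernel[OF x])
    have z: "(if i = p then x \<bullet> v else dstereo x v \<bullet> i) = 0" if "i \<in> Basis" for i
      using Mi[OF that, of v] \<open>M v = 0\<close> by simp
    show "x \<bullet> v = 0" using z[OF p] by simp
    have "dstereo x v \<bullet> p = 0"
    proof -
      have "((\<lambda>y. stereo y \<bullet> p) has_derivative (\<lambda>v. dstereo x v \<bullet> p)) (at x)"
        by (rule has_derivative_inner_left[OF stereo_has_derivative[OF x]])
      moreover have "((\<lambda>y. stereo y \<bullet> p) has_derivative (\<lambda>v. 0)) (at x)" by (simp add: stereo_perp)
      ultimately show ?thesis using has_derivative_unique by (metis (no_types, lifting))
    qed
    then have "dstereo x v \<bullet> i = 0 \<bullet> i" if "i \<in> Basis" for i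
      using z[OF that] by (cases "i = p") auto
    then show "dstereo x v = 0" by (rule euclidean_eqI)
  qed
  ultimately have "detf M \<noteq> 0" by (rule detf_nonzero)
  moreover have "detf M = rowdet (drows x (\<lambda>j. j) (\<lambda>j. x \<bullet> j))"
    unfolding detf_eq_rowdet by (rule rowdet_cong) (simp add: Mi drows_def)
  ultimately show ?thesis by simp
qed

lemma minus_p_offray: "- p \<in> offray p"
  by (simp add: offray_def)

lemma connected_offray: "connected (offray p)"
proof (rule starlike_imp_connected)
  have "closed_segment (- p) x \<subseteq> offray p" if x: "x \<in> offray p" for x
  proof
    fix y assume "y \<in> closed_segment (- p) x"
    then obtain s where s: "0 \<le> s" "s \<le> 1" "y = (1 - s) *\<^sub>R (- p) + s *\<^sub>R x" by (auto simp: closed_segment_def)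
    show "y \<in> offray p"
    proof (cases "s = 0")
      case True
      then show ?thesis using s minus_p_offray by simp
    next
      case False
      have "s * norm x = norm (s *\<^sub>R x)" using s by simp
      also have "s *\<^sub>R x = y + (1 - s) *\<^sub>R p" using s by simp
      also have "norm (y + (1 - s) *\<^sub>R p) \<le> norm y + (1 - s)"
        using norm_triangle_ineq[of y "(1 - s) *\<^sub>R p"] s by simp
      finally have "norm y \<ge> s * norm x - (1 - s)" by simp
      moreover have "y \<bullet> p = s * (x \<bullet> p) - (1 - s)"
        unfolding s(3) by (simp add: inner_diff_left inner_add_left algebra_simps)
      moreover have "s * (x \<bullet> p) < s * norm x" using x False s by (simp add: offray_def)
      ultimately show ?thesis by (simp add: offray_def)
    qed
  qed
  then show "starlike (offray p)" unfolding starlike_def using minus_p_offray by blast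
qed

text \<open>A continuous function without zeros has one sign on a connected set; the complement of
  the ray is star-shaped about \<open>- p\<close>.\<close>

lemma rowdet_identity_sign:
  obtains \<sigma> :: real where "\<sigma> = 1 \<or> \<sigma> = -1" "\<And>x. x \<in> offray p \<Longrightarrow> \<sigma> * rowdet (drows x (\<lambda>j. j) (\<lambda>j. x \<bullet> j)) > 0"
proof -
  let ?D = "\<lambda>x. rowdet (drows x (\<lambda>j. j) (\<lambda>j. x \<bullet> j))"
  have "continuous_on (offray p) (\<lambda>x. drows x (\<lambda>j. j) (\<lambda>j. x \<bullet> j) i j)" for i j
    unfolding drows_def by (cases "i = p") (auto intro!: continuous_intros continuous_on_dstereo)
  then have c: "continuous_on (offray p) ?D"
    unfolding rowdet_def by (intro continuous_intros)
  have "connected (?D ` offray p)" by (rule connected_continuous_image[OF c connected_offray])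
  then have iv: "is_interval (?D ` offray p)" by (simp add: is_interval_connected_1)
  have nz: "0 \<notin> ?D ` offray p" using rowdet_identity_nonzero by auto
  show thesis
  proof (cases "\<exists>x\<in>offray p. ?D x > 0")
    case True
    then obtain x where x: "x \<in> offray p" "?D x > 0" by blast
    have "?D y > 0" if "y \<in> offray p" for y
    proof (rule ccontr)
      assume "\<not> ?thesis"
      then have "0 \<in> ?D ` offray p" using x that iv unfolding is_interval_1 by (meson imageI less_imp_le not_less)
      then show False using nz by blast
    qed
    then show ?thesis using that[of 1] by simp
  next
    case False
    then have "?D y < 0" if "y \<in> offray p" for y
      using that rowdet_identity_nonzero[OF that] by (meson linorder_neqE_linordered_idom)
    then show ?thesis using that[of "-1"] by simp
  qed
qed

text \<open>The integrand has a constant sign and is nonzero on an open set around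
  \<open>- p\<close>, the point with stereographic coordinates 0. Orientation is therefore
  irrelevant, and no degree has to be computed.\<close>

lemma integral_dform_wsph_nonzero:
  assumes int: "integrable lborel (\<lambda>x. dform (wsph p x) (dwsph x) (radial_covector x))"
  shows "(LBINT x. dform (wsph p x) (dwsph x) (radial_covector x)) \<noteq> 0"
proof
  let ?J = "\<lambda>x. dform (wsph p x) (dwsph x) (radial_covector x)"
  assume z: "integral\<^sup>L lborel ?J = 0"
  obtain \<sigma> :: real where \<sigma>: "\<sigma> = 1 \<or> \<sigma> = -1" "\<And>x. x \<in> offray p \<Longrightarrow> \<sigma> * rowdet (drows x (\<lambda>j. j) (\<lambda>j. x \<bullet> j)) > 0"
    using rowdet_identity_sign by blast
  have J: "\<sigma> * ?J x = bump x * (20 * tent (10 * (x \<bullet> x - 1))) * (\<sigma> * rowdet (drows x (\<lambda>j. j) (\<lambda>j. x \<bullet> j)))" if "x \<in> offray p" for x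
    using dform_wsph[OF that] by (simp add: mult_ac)
  have "wsph p x \<notin> offray p" if "x \<notin> offray p" for x
    using that wsph_offray_iff[of x] by (cases "x = 0") (auto simp: wsph_def offray_def)
  then have J0: "?J x = 0" if "x \<notin> offray p" for x using that by (simp add: dform_def)
  have nn: "\<sigma> * ?J x \<ge> 0" for x
  proof (cases "x \<in> offray p")
    case True
    show ?thesis unfolding J[OF True]
      by (rule mult_nonneg_nonneg[OF _ less_imp_le[OF \<sigma>(2)[OF True]]]) (use abs_bump_le(1)[of x] tent_bounds(1) in auto)
  qed (simp add: J0)
  have "AE x in lborel. \<sigma> * ?J x = 0"
    by (subst integral_nonneg_eq_0_iff_AE[symmetric]) (use int nn z in auto)
  moreover define G where "G = {x \<in> offray p. (\<forall>i\<in>Basis - {p}. \<bar>stereo x \<bullet> i\<bar> < 1) \<and> \<bar>10 * (x \<bullet> x - 1)\<bar> < 1}"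
  have pos: "\<sigma> * ?J x > 0" if "x \<in> G" for x
  proof -
    have x: "x \<in> offray p" using that by (simp add: G_def)
    have "bump x > 0" unfolding bump_def by (rule prod_pos) (use that tent_pos in \<open>auto simp: G_def\<close>)
    then show ?thesis unfolding J[OF x] using \<sigma>(2)[OF x] tent_pos[of "10 * (x \<bullet> x - 1)"] that by (auto simp: G_def)
  qed
  ultimately have "AE x in lborel. x \<notin> G" by (elim eventually_mono) (use pos in force)
  have "open G"
  proof -
    have "open (offray p \<inter> stereo -` {z. \<forall>i\<in>Basis - {p}. \<bar>z \<bullet> i\<bar> < 1})"
    proof (rule continuous_open_preimage[OF smooth_open_continuous[OF smooth_stereo] open_offray])
      have "{z. \<forall>i\<in>Basis - {p}. \<bar>z \<bullet> i\<bar> < 1} = (\<Inter>i\<in>Basis - {p}. {z. \<bar>z \<bullet> i\<bar> < 1})" by auto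
      then show "open {z::'a. \<forall>i\<in>Basis - {p}. \<bar>z \<bullet> i\<bar> < 1}"
        by (simp only:) (intro open_INT ballI open_Collect_less continuous_intros, simp)
    qed
    moreover have "open {x::'a. \<bar>10 * (x \<bullet> x - 1)\<bar> < 1}" by (intro open_Collect_less continuous_intros)
    ultimately have "open (offray p \<inter> stereo -` {z. \<forall>i\<in>Basis - {p}. \<bar>z \<bullet> i\<bar> < 1} \<inter> {x. \<bar>10 * (x \<bullet> x - 1)\<bar> < 1})"
      by (rule open_Int)
    also have "offray p \<inter> stereo -` {z. \<forall>i\<in>Basis - {p}. \<bar>z \<bullet> i\<bar> < 1} \<inter> {x. \<bar>10 * (x \<bullet> x - 1)\<bar> < 1} = G"
      by (auto simp: G_def)
    finally show ?thesis .
  qed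
  have "- p \<in> G" using minus_p_offray by (simp add: G_def stereo_def)
  have [measurable]: "G \<in> sets borel" using \<open>open G\<close> by simp
  have "G \<in> null_sets lborel" using \<open>AE x in lborel. x \<notin> G\<close> by (simp add: AE_iff_null_sets)
  then have "negligible G" by (simp add: negligible_iff_null_sets null_sets_completionI)
  then show False using open_not_negligible[OF \<open>open G\<close>] \<open>- p \<in> G\<close> by auto
qed

end

section \<open>Energy estimates and truncations\<close>

context pole begin

lemma continuous_on_dnormalize: "continuous_on (- {0}) (\<lambda>x. dnormalize x v)"
  unfolding dnormalize_def by (intro continuous_intros) auto

lemma norm_dnormalize_le: "x \<noteq> 0 \<Longrightarrow> norm (dnormalize x v) \<le> 2 * norm v / norm x"
proof -
  assume x: "x \<noteq> 0"
  have "norm (dnormalize x v) \<le> norm (v /\<^sub>R norm x) + norm (((x \<bullet> v) / norm x ^ 3) *\<^sub>R x)"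
    unfolding dnormalize_def by (rule norm_triangle_ineq4)
  also have "norm (((x \<bullet> v) / norm x ^ 3) *\<^sub>R x) = \<bar>x \<bullet> v\<bar> / (norm x)\<^sup>2"
    using x by (simp add: power3_eq_cube power2_eq_square)
  also have "\<dots> \<le> (norm x * norm v) / (norm x)\<^sup>2"
    by (intro divide_right_mono Cauchy_Schwarz_ineq2) simp
  also have "\<dots> = norm v / norm x" using x by (simp add: power2_eq_square)
  finally have "norm (dnormalize x v) \<le> norm (v /\<^sub>R norm x) + norm v / norm x" by simp
  moreover have "norm (v /\<^sub>R norm x) = norm v / norm x" by (simp add: divide_inverse mult.commute)
  moreover have "2 * norm v / norm x = norm v / norm x + norm v / norm x"
    by (simp only: mult_2 add_divide_distrib)
  ultimately show ?thesis by simp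
qed

text \<open>In terms of the angle: sin^2 theta is at most 2 (1 - cos theta).\<close>

lemma perp_square_le:
  assumes "x \<noteq> 0"
  shows "(norm x)\<^sup>2 - (x \<bullet> p)\<^sup>2 \<le> 16 * ht p x * (norm x)\<^sup>2"
proof -
  define c where "c = (x \<bullet> p) / norm x"
  have xp: "x \<bullet> p = c * norm x" using assms by (simp add: c_def)
  have h: "1 - c = 8 * ht p x" by (simp add: c_def ht_def)
  have "c \<le> 1" using inner_p_le[of x] assms by (simp add: c_def divide_le_eq)
  then have "(1 - c) * (1 + c) \<le> (1 - c) * 2" by (intro mult_left_mono) auto
  moreover have "(1 - c) * (1 + c) = 1 - c\<^sup>2" by (simp add: power2_eq_square algebra_simps)
  moreover have "(1 - c) * 2 = 16 * ht p x" using h by simp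
  ultimately have "1 - c\<^sup>2 \<le> 16 * ht p x" by linarith
  then have "(1 - c\<^sup>2) * (norm x)\<^sup>2 \<le> 16 * ht p x * (norm x)\<^sup>2" by (intro mult_right_mono) auto
  then show ?thesis unfolding xp by (simp add: power_mult_distrib algebra_simps)
qed

text \<open>\<open>dnormalize x\<close> is symmetric, so it may be applied to \<open>p\<close>
  instead, where its norm is sin theta divided by \<open>norm x\<close>. This gain of order
  \<open>sqrt (ht p x)\<close> halves the singularity of the derivative of
  \<open>lg\<close>.\<close>

lemma dnormalize_inner_p_le:
  assumes x: "x \<noteq> 0"
  shows "\<bar>dnormalize x v \<bullet> p\<bar> \<le> norm v * (4 * sqrt (ht p x) / norm x)"
proof -
  have "dnormalize x v \<bullet> p = v \<bullet> dnormalize x p"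
    by (simp add: dnormalize_def inner_diff_left inner_diff_right inner_commute)
  then have "\<bar>dnormalize x v \<bullet> p\<bar> \<le> norm v * norm (dnormalize x p)" using Cauchy_Schwarz_ineq2 by metis
  also have "norm (dnormalize x p) \<le> 4 * sqrt (ht p x) / norm x"
  proof (rule power2_le_imp_le)
    have "(norm (dnormalize x p))\<^sup>2 = ((norm x)\<^sup>2 - (x \<bullet> p)\<^sup>2) / norm x ^ 4"
    proof -
      have "(norm (dnormalize x p))\<^sup>2 = 1 / (norm x)\<^sup>2 - 2 * ((x \<bullet> p) / norm x ^ 3) * ((x \<bullet> p) / norm x) + ((x \<bullet> p) / norm x ^ 3)\<^sup>2 * (norm x)\<^sup>2"
      proof -
        define a k where "a = 1 / norm x" and "k = (x \<bullet> p) / norm x ^ 3"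
        have d: "dnormalize x p = a *\<^sub>R p - k *\<^sub>R x" by (simp add: dnormalize_def a_def k_def inverse_eq_divide)
        have "(norm (dnormalize x p))\<^sup>2 = a * a - 2 * k * (x \<bullet> p) * a + k\<^sup>2 * (norm x)\<^sup>2"
          unfolding d power2_norm_eq_inner
          by (simp add: inner_diff_left inner_diff_right inner_commute[of p x] power2_eq_square algebra_simps)
        then show ?thesis by (simp add: a_def k_def power2_eq_square)
      qed
      also have "\<dots> = ((norm x)\<^sup>2 - (x \<bullet> p)\<^sup>2) / norm x ^ 4"
        using x by (simp add: field_simps power2_eq_square power3_eq_cube power4_eq_xxxx)
      finally show ?thesis .
    qed
    also have "\<dots> \<le> (16 * ht p x * (norm x)\<^sup>2) / norm x ^ 4" by (intro divide_right_mono perp_square_le x) simp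
    also have "\<dots> = (4 * sqrt (ht p x) / norm x)\<^sup>2"
      using x ht_nonneg[OF x] by (simp add: power_divide power_mult_distrib) (simp add: field_simps power2_eq_square power4_eq_xxxx)
    finally show "(norm (dnormalize x p))\<^sup>2 \<le> (4 * sqrt (ht p x) / norm x)\<^sup>2" .
    show "0 \<le> 4 * sqrt (ht p x) / norm x" using ht_nonneg[OF x] by simp
  qed
  finally show ?thesis by (simp add: mult_left_mono)
qed

definition dlg :: "'a \<Rightarrow> 'a \<Rightarrow> real" where
  "dlg x v = (dnormalize x v \<bullet> p) / (8 * ht p x)"

lemma lg_has_derivative:
  assumes x: "x \<in> offray p"
  shows "(lg p has_derivative dlg x) (at x)"
proof -
  have nx: "x \<noteq> 0" using offray_nz[OF x] .
  have h: "ht p x > 0" using ht_pos_iff[OF nx] x by blast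
  have gen: "((\<lambda>x. (1 - f x) / 8) has_derivative (\<lambda>v. - f' v / 8)) (at x)"
    if "(f has_derivative f') (at x)" for f :: "'a \<Rightarrow> real" and f'
    by (auto intro!: derivative_eq_intros that)
  have "(\<lambda>x. (1 - (x /\<^sub>R norm x) \<bullet> p) / 8) = ht p"
    by (rule ext) (simp add: ht_def divide_inverse[of "_ \<bullet> p"] mult.commute)
  then have dh: "(ht p has_derivative (\<lambda>v. - (dnormalize x v \<bullet> p) / 8)) (at x)"
    using gen[OF has_derivative_inner_left[OF normalize_has_derivative[OF nx], of p]] by (simp only:)
  have l: "(ln has_derivative (\<lambda>h. inverse (ht p x) * h)) (at (ht p x))"
    using DERIV_ln[OF h] by (simp add: has_field_derivative_def)
  have "((\<lambda>x. - ln (ht p x)) has_derivative (\<lambda>v. - (inverse (ht p x) * (- (dnormalize x v \<bullet> p) / 8)))) (at x)"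
    by (rule has_derivative_minus[OF has_derivative_compose[OF dh l]])
  moreover have "(\<lambda>v. - (inverse (ht p x) * (- (dnormalize x v \<bullet> p) / 8))) = dlg x"
    using h by (intro ext) (simp add: dlg_def field_simps)
  ultimately show ?thesis by (simp add: lg_def[abs_def])
qed

text \<open>Comparable to 1/(theta L), the size of the derivative of the oscillation. On the ray the
  conventions \<open>sqrt 0 = 0\<close> and division by 0 give the value 0.\<close>

definition sing :: "'a \<Rightarrow> real" where
  "sing x = 1 / (sqrt (ht p x) * lg p x)"

lemma abs_dlg_le:
  assumes x: "x \<in> offray p" and r: "norm x \<ge> 1 / 2"
  shows "\<bar>dlg x v\<bar> \<le> norm v / sqrt (ht p x)"
proof -
  have nx: "x \<noteq> 0" using offray_nz[OF x] .
  have h: "ht p x > 0" using ht_pos_iff[OF nx] x by blast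
  have "\<bar>dlg x v\<bar> = \<bar>dnormalize x v \<bullet> p\<bar> / (8 * ht p x)" using h by (simp add: dlg_def)
  also have "\<dots> \<le> (norm v * (4 * sqrt (ht p x) / norm x)) / (8 * ht p x)"
    using h by (intro divide_right_mono dnormalize_inner_p_le nx) auto
  also have "\<dots> \<le> (norm v * (4 * sqrt (ht p x) / (1 / 2))) / (8 * ht p x)"
    using h r by (intro divide_right_mono mult_left_mono divide_left_mono) auto
  also have "\<dots> = norm v * (sqrt (ht p x) / ht p x)" by simp
  also have "sqrt (ht p x) / ht p x = 1 / sqrt (ht p x)" using h by (simp add: field_simps)
  finally show ?thesis by simp
qed

lemma continuous_on_dlg: "continuous_on (offray p) (\<lambda>x. dlg x v)"
  unfolding dlg_def
  by (intro continuous_intros continuous_on_subset[OF continuous_on_dnormalize] continuous_on_subset[OF continuous_on_ht])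
     (use offray_nz ht_pos_iff in force)+

text \<open>A general profile in place of \<open>sin L / L\<close>, so that the oscillation and all
  its truncations share one derivative formula and one bound.\<close>

definition gwsph :: "(real \<Rightarrow> real) \<Rightarrow> 'a \<Rightarrow> 'a" where
  "gwsph G x = (1 + G (lg p x)) *\<^sub>R (x /\<^sub>R norm x)"

definition dgwsph :: "(real \<Rightarrow> real) \<Rightarrow> (real \<Rightarrow> real) \<Rightarrow> 'a \<Rightarrow> 'a \<Rightarrow> 'a" where
  "dgwsph G G' x v = (G' (lg p x) * dlg x v) *\<^sub>R (x /\<^sub>R norm x) + (1 + G (lg p x)) *\<^sub>R dnormalize x v"

lemma gwsph_has_derivative:
  assumes x: "x \<in> offray p" and G: "(G has_real_derivative G' (lg p x)) (at (lg p x))"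
  shows "(gwsph G has_derivative dgwsph G G' x) (at x)"
proof -
  have "((\<lambda>x. G (lg p x)) has_derivative (\<lambda>v. G' (lg p x) * dlg x v)) (at x)"
    by (rule has_derivative_compose[OF lg_has_derivative[OF x] G[unfolded has_field_derivative_def]])
  then have "((\<lambda>x. 1 + G (lg p x)) has_derivative (\<lambda>v. G' (lg p x) * dlg x v)) (at x)"
    by (auto intro!: derivative_eq_intros)
  from has_derivative_scaleR[OF this normalize_has_derivative[OF offray_nz[OF x]]]
  show ?thesis by (simp add: gwsph_def[abs_def] dgwsph_def[abs_def] add.commute)
qed

lemma norm_dgwsph_le:
  assumes x: "x \<in> offray p" and r: "norm x \<ge> 1 / 2" and G: "\<bar>G' (lg p x)\<bar> \<le> 3 / lg p x" "\<bar>1 + G (lg p x)\<bar> \<le> 2"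
  shows "norm (dgwsph G G' x v) \<le> (8 + 3 * sing x) * norm v"
proof -
  have nx: "x \<noteq> 0" using offray_nz[OF x] .
  have L: "lg p x > 0" using lg_ge[OF x] by linarith
  have h: "ht p x > 0" using ht_pos_iff[OF nx] x by blast
  have "norm (dgwsph G G' x v) \<le> norm ((G' (lg p x) * dlg x v) *\<^sub>R (x /\<^sub>R norm x)) + norm ((1 + G (lg p x)) *\<^sub>R dnormalize x v)"
    unfolding dgwsph_def by (rule norm_triangle_ineq)
  also have "\<dots> = \<bar>G' (lg p x)\<bar> * \<bar>dlg x v\<bar> + \<bar>1 + G (lg p x)\<bar> * norm (dnormalize x v)"
    using nx by (simp add: abs_mult)
  also have "\<dots> \<le> (3 / lg p x) * (norm v / sqrt (ht p x)) + 2 * (4 * norm v)"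
  proof (intro add_mono mult_mono)
    have "norm (dnormalize x v) \<le> 2 * norm v / norm x" by (rule norm_dnormalize_le[OF nx])
    also have "\<dots> \<le> 2 * norm v / (1 / 2)" using r by (intro divide_left_mono) auto
    finally show "norm (dnormalize x v) \<le> 4 * norm v" by simp
  qed (use G abs_dlg_le[OF x r] L h in auto)
  also have "\<dots> = (8 + 3 * sing x) * norm v" by (simp add: sing_def algebra_simps)
  finally show ?thesis .
qed

section \<open>The oscillating profile and its truncations\<close>

definition oscG :: "real \<Rightarrow> real" where "oscG L = sin L / L"
definition oscG' :: "real \<Rightarrow> real" where "oscG' L = cos L / L - sin L / L\<^sup>2"

lemma oscG_deriv: "L > 0 \<Longrightarrow> (oscG has_real_derivative oscG' L) (at L)"
  unfolding oscG_def[abs_def] oscG'_def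
  by (auto intro!: derivative_eq_intros simp: field_simps power2_eq_square)

lemma abs_oscG_le: "L > 0 \<Longrightarrow> \<bar>oscG L\<bar> \<le> 1 / L"
  unfolding oscG_def by (simp add: divide_right_mono)

lemma abs_oscG'_le: "L \<ge> 1 \<Longrightarrow> \<bar>oscG' L\<bar> \<le> 2 / L"
proof -
  assume L: "L \<ge> 1"
  have "\<bar>oscG' L\<bar> \<le> \<bar>cos L / L\<bar> + \<bar>sin L / L\<^sup>2\<bar>" unfolding oscG'_def by (rule abs_triangle_ineq4)
  also have "\<dots> \<le> 1 / L + 1 / L\<^sup>2" using L by (intro add_mono) (auto intro!: divide_right_mono)
  also have "1 / L\<^sup>2 \<le> 1 / L" using L by (simp add: power2_eq_square divide_simps)
  finally show ?thesis by simp
qed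

text \<open>The profile is unchanged up to L = m + 1 and 0 from L = 3 (m + 1) on. A transition of
  slope at most 1/(m + 1) keeps the derivative below 3/L uniformly in \<open>m\<close>.\<close>

definition truncG :: "nat \<Rightarrow> real \<Rightarrow> real" where
  "truncG m L = oscG L * (1 - ramp (L / real (Suc m) - 2))"
definition truncG' :: "nat \<Rightarrow> real \<Rightarrow> real" where
  "truncG' m L = oscG' L * (1 - ramp (L / real (Suc m) - 2)) - oscG L * (tent (L / real (Suc m) - 2) / real (Suc m))"

lemma ramp_bounds: "0 \<le> ramp s" "ramp s \<le> 1"
proof -
  have mono: "ramp a \<le> ramp b" if "a \<le> b" for a b
    by (rule DERIV_nonneg_imp_nondecreasing[OF that]) (use DERIV_ramp tent_bounds in blast)
  show "0 \<le> ramp s" using mono[of "min s (-1)" s] ramp_simps(1)[of "min s (-1)"] by simp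
  show "ramp s \<le> 1" using mono[of s "max s 1"] ramp_simps(2)[of "max s 1"] by simp
qed

lemma truncG_deriv: "L > 0 \<Longrightarrow> (truncG m has_real_derivative truncG' m L) (at L)"
proof -
  assume L: "L > 0"
  have "((\<lambda>L. L / real (Suc m) - 2) has_real_derivative 1 / real (Suc m)) (at L)"
    by (auto intro!: derivative_eq_intros)
  from DERIV_chain2[OF DERIV_ramp this]
  have "((\<lambda>L. 1 - ramp (L / real (Suc m) - 2)) has_real_derivative - (tent (L / real (Suc m) - 2) * (1 / real (Suc m)))) (at L)"
    by (auto intro!: derivative_eq_intros)
  from DERIV_mult[OF oscG_deriv[OF L] this]
  show ?thesis unfolding truncG_def[abs_def]
    by (rule DERIV_cong) (simp add: truncG'_def)
qed

lemma abs_truncG_le: "L > 0 \<Longrightarrow> \<bar>truncG m L\<bar> \<le> 1 / L"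
proof -
  assume L: "L > 0"
  have "\<bar>oscG L\<bar> * \<bar>1 - ramp (L / real (Suc m) - 2)\<bar> \<le> (1 / L) * 1"
    using ramp_bounds L by (intro mult_mono abs_oscG_le) auto
  then show ?thesis by (simp add: truncG_def abs_mult)
qed

lemma abs_truncG'_le: "L \<ge> 1 \<Longrightarrow> \<bar>truncG' m L\<bar> \<le> 3 / L"
proof -
  assume L: "L \<ge> 1"
  have "\<bar>truncG' m L\<bar> \<le> \<bar>oscG' L\<bar> * \<bar>1 - ramp (L / real (Suc m) - 2)\<bar> + \<bar>oscG L\<bar> * \<bar>tent (L / real (Suc m) - 2) / real (Suc m)\<bar>"
    unfolding truncG'_def using abs_triangle_ineq4 by (simp only: abs_mult[symmetric])
  also have "\<dots> \<le> (2 / L) * 1 + (1 / L) * 1"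
  proof (intro add_mono mult_mono abs_oscG'_le abs_oscG_le)
    have "tent (L / real (Suc m) - 2) / real (Suc m) \<le> 1 / 1" using tent_bounds by (intro frac_le) auto
    then show "\<bar>tent (L / real (Suc m) - 2) / real (Suc m)\<bar> \<le> 1" using tent_bounds by simp
  qed (use ramp_bounds L in auto)
  finally show ?thesis by simp
qed

lemma truncG_far: "L \<ge> 3 * real (Suc m) \<Longrightarrow> truncG m L = 0 \<and> truncG' m L = 0"
proof -
  assume "L \<ge> 3 * real (Suc m)"
  then have "L / real (Suc m) \<ge> 3" by (simp add: le_divide_eq del: of_nat_Suc)
  then show ?thesis by (simp add: truncG_def truncG'_def ramp_simps tent_eq_0)
qed

lemma truncG_near: "0 < L \<Longrightarrow> L \<le> real (Suc m) \<Longrightarrow> truncG m L = oscG L \<and> truncG' m L = oscG' L"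
proof -
  assume "0 < L" "L \<le> real (Suc m)"
  then have le: "L / real (Suc m) - 2 \<le> -1" by (simp add: divide_le_eq del: of_nat_Suc)
  then have "tent (L / real (Suc m) - 2) = 0" by (intro tent_eq_0) linarith
  then show ?thesis using ramp_simps(1)[OF le] by (simp add: truncG_def truncG'_def del: of_nat_Suc)
qed

lemma gwsph_oscG: "gwsph oscG = wsph p"
  by (simp add: gwsph_def[abs_def] wsph_def[abs_def] oscG_def wob_def)

lemma dwsph_eq: "x \<in> offray p \<Longrightarrow> dwsph x = dgwsph oscG oscG' x"
proof -
  assume x: "x \<in> offray p"
  have "(wsph p has_derivative dgwsph oscG oscG' x) (at x)"
    using gwsph_has_derivative[OF x, where G=oscG and G'=oscG', OF oscG_deriv] lg_ge[OF x] by (simp add: gwsph_oscG)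
  then show ?thesis using has_derivative_unique[OF wsph_has_derivative[OF x]] by blast
qed

lemma norm_dwsph_le: "norm x \<ge> 1 / 2 \<Longrightarrow> norm (dwsph x v) \<le> (8 + 3 * sing x) * norm v"
proof (cases "x \<in> offray p")
  case True
  assume r: "norm x \<ge> 1 / 2"
  have L: "lg p x \<ge> 4 / 3" by (rule lg_ge[OF True])
  have "\<bar>oscG' (lg p x)\<bar> \<le> 2 / lg p x" using L by (intro abs_oscG'_le) auto
  also have "\<dots> \<le> 3 / lg p x" using L by (intro divide_right_mono) auto
  finally have 1: "\<bar>oscG' (lg p x)\<bar> \<le> 3 / lg p x" .
  have "\<bar>oscG (lg p x)\<bar> \<le> 1 / lg p x" using L by (intro abs_oscG_le) auto
  also have "\<dots> \<le> 1" using L by simp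
  finally have "\<bar>1 + oscG (lg p x)\<bar> \<le> 2" by linarith
  then show ?thesis unfolding dwsph_eq[OF True] by (rule norm_dgwsph_le[where G'=oscG', OF True r 1])
next
  case False
  assume r: "norm x \<ge> 1 / 2"
  then have "x \<noteq> 0" by auto
  then have "ht p x = 0" using ht_eq_0 False by blast
  then show ?thesis using False by (simp add: dwsph_def sing_def)
qed

definition twsph :: "nat \<Rightarrow> 'a \<Rightarrow> 'a" where "twsph m = gwsph (truncG m)"
definition dtwsph :: "nat \<Rightarrow> 'a \<Rightarrow> 'a \<Rightarrow> 'a" where
  "dtwsph m x v = (if x \<in> offray p then dgwsph (truncG m) (truncG' m) x v else dnormalize x v)"

text \<open>For \<open>ht\<close> below this threshold \<open>lg\<close> exceeds
  \<open>3 * (m + 1)\<close>, where the truncated profile is 0. Around the ray the truncated map is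
  thus plain normalization, and it is C1 across the ray.\<close>

lemma near_ray:
  defines "N m \<equiv> {x. x \<noteq> 0 \<and> ht p x < exp (- 3 * real (Suc m))}"
  shows "open (N m)" "x \<in> N m \<Longrightarrow> twsph m x = x /\<^sub>R norm x" "x \<in> N m \<Longrightarrow> dtwsph m x v = dnormalize x v"
    "offray p \<union> N m = - {0}"
proof -
  have "open (- {0} \<inter> ht p -` {..<exp (- 3 * real (Suc m))})"
    by (rule continuous_open_preimage[OF continuous_on_ht]) (auto simp: open_Compl)
  also have "- {0} \<inter> ht p -` {..<exp (- 3 * real (Suc m))} = N m" by (auto simp: N_def)
  finally show "open (N m)" .
  have far: "truncG m (lg p x) = 0 \<and> (x \<in> offray p \<longrightarrow> truncG' m (lg p x) = 0)" if "x \<in> N m" for x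
  proof (cases "x \<in> offray p")
    case True
    then have h: "ht p x > 0" using ht_pos_iff offray_nz by blast
    then have "ln (ht p x) < - 3 * real (Suc m)"
      using that ln_less_cancel_iff[of "ht p x" "exp (- 3 * real (Suc m))"] by (simp add: N_def del: of_nat_Suc)
    then have "lg p x \<ge> 3 * real (Suc m)" by (simp add: lg_def del: of_nat_Suc)
    then show ?thesis using truncG_far by blast
  next
    case False
    \<comment> \<open>On the ray the convention \<open>ln 0 = 0\<close> gives
      \<open>lg p x = 0\<close>, far from the cutoff; the profile is 0 there because
      \<open>sin 0 / 0 = 0\<close>.\<close>
    then have "lg p x = 0" using that ht_eq_0[of x] by (simp add: N_def lg_def)
    then show ?thesis using False by (simp add: truncG_def oscG_def)
  qed
  show "twsph m x = x /\<^sub>R norm x" if "x \<in> N m" using far[OF that] by (simp add: twsph_def gwsph_def)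
  show "dtwsph m x v = dnormalize x v" if "x \<in> N m" using far[OF that] by (simp add: dtwsph_def dgwsph_def)
  show "offray p \<union> N m = - {0}" using offray_nz ht_eq_0 by (auto simp: N_def)
qed

lemma twsph_has_derivative:
  assumes "x \<noteq> 0"
  shows "(twsph m has_derivative dtwsph m x) (at x)"
proof (cases "x \<in> offray p")
  case True
  then show ?thesis
    using gwsph_has_derivative[OF True, where G="truncG m" and G'="truncG' m", OF truncG_deriv] lg_ge[OF True] by (simp add: twsph_def dtwsph_def[abs_def])
next
  case False
  let ?N = "{x. x \<noteq> 0 \<and> ht p x < exp (- 3 * real (Suc m))}"
  have x: "x \<in> ?N" using near_ray(4)[of m] assms False by blast
  have "(twsph m has_derivative dnormalize x) (at x)"
    by (rule has_derivative_transform_within_open[OF normalize_has_derivative[OF assms] near_ray(1)[of m] x])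
       (rule near_ray(2)[symmetric])
  moreover have "dtwsph m x = dnormalize x" using False by (simp add: dtwsph_def[abs_def])
  ultimately show ?thesis by simp
qed

lemma continuous_on_lg: "continuous_on (offray p) (lg p)"
  by (rule smooth_open_continuous[OF smooth_lg])

lemma continuous_on_dtwsph: "continuous_on (- {0}) (\<lambda>x. dtwsph m x v)"
proof -
  let ?N = "{x. x \<noteq> 0 \<and> ht p x < exp (- 3 * real (Suc m))}"
  have nz: "lg p x \<noteq> 0" if "x \<in> offray p" for x using lg_ge[OF that] by linarith
  have "continuous_on (offray p) (\<lambda>x. truncG m (lg p x))" "continuous_on (offray p) (\<lambda>x. truncG' m (lg p x))"
    unfolding truncG_def truncG'_def oscG_def oscG'_def
    by (intro continuous_intros continuous_on_lg; use nz in simp)+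
  then have "continuous_on (offray p) (\<lambda>x. dgwsph (truncG m) (truncG' m) x v)"
    unfolding dgwsph_def
    by (intro continuous_intros continuous_on_dlg continuous_on_subset[OF continuous_on_dnormalize]) (use offray_nz in auto)
  then have "continuous_on (offray p) (\<lambda>x. dtwsph m x v)" by (rule continuous_on_eq) (simp add: dtwsph_def)
  moreover have "continuous_on ?N (\<lambda>x. dtwsph m x v)"
    by (rule continuous_on_eq[OF continuous_on_subset[OF continuous_on_dnormalize]]) (auto simp: near_ray(3))
  ultimately have "continuous_on (offray p \<union> ?N) (\<lambda>x. dtwsph m x v)"
    by (rule continuous_on_open_Un[OF open_offray near_ray(1)[of m]])
  then show ?thesis by (simp only: near_ray(4)[of m])
qed

lemma norm_dtwsph_le:
  assumes r: "norm x \<ge> 1 / 2"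
  shows "norm (dtwsph m x v) \<le> (8 + 3 * sing x) * norm v"
proof (cases "x \<in> offray p")
  case True
  have L: "lg p x \<ge> 4 / 3" by (rule lg_ge[OF True])
  have 1: "\<bar>truncG' m (lg p x)\<bar> \<le> 3 / lg p x" using L by (intro abs_truncG'_le) auto
  have "\<bar>truncG m (lg p x)\<bar> \<le> 1 / lg p x" using L by (intro abs_truncG_le) auto
  also have "\<dots> \<le> 1" using L by simp
  finally have "\<bar>1 + truncG m (lg p x)\<bar> \<le> 2" by linarith
  moreover have "dtwsph m x v = dgwsph (truncG m) (truncG' m) x v" using True by (simp add: dtwsph_def)
  ultimately show ?thesis using norm_dgwsph_le[where G="truncG m" and G'="truncG' m", OF True r 1] by simp
next
  case False
  have nx: "x \<noteq> 0" using r by auto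
  then have "ht p x = 0" using ht_eq_0 False by blast
  then have "sing x = 0" by (simp add: sing_def)
  have "2 * norm v / norm x \<le> 2 * norm v / (1 / 2)"
    using r nx by (intro divide_left_mono) auto
  then have "norm (dnormalize x v) \<le> 4 * norm v" using norm_dnormalize_le[OF nx, of v] by simp
  then have "norm (dnormalize x v) \<le> 8 * norm v" using norm_ge_zero[of v] by linarith
  then show ?thesis using False \<open>sing x = 0\<close> by (simp add: dtwsph_def)
qed

lemma norm_twsph_le: "norm (twsph m x) \<le> 2"
proof (cases "x \<in> offray p")
  case True
  have L: "lg p x \<ge> 4 / 3" by (rule lg_ge[OF True])
  have "\<bar>truncG m (lg p x)\<bar> \<le> 1 / lg p x" using L by (intro abs_truncG_le) auto
  also have "\<dots> \<le> 1" using L by simp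
  finally have "\<bar>1 + truncG m (lg p x)\<bar> \<le> 2" by linarith
  then show ?thesis using offray_nz[OF True] unfolding twsph_def gwsph_def norm_scaleR by simp
next
  case False
  then have "twsph m x = x /\<^sub>R norm x" if "x \<noteq> 0" using near_ray(2)[where m=m] near_ray(4)[where m=m] that by blast
  then show ?thesis by (cases "x = 0") (auto simp: twsph_def gwsph_def)
qed

lemma offray_AE:
  assumes dim: "DIM('a) \<ge> 2"
  shows "AE x in lborel. x \<in> offray p"
proof -
  obtain e where e: "e \<in> Basis" "e \<noteq> p"
  proof -
    have "\<not> Basis \<subseteq> {p}" using dim card_mono[of "{p}" "Basis::'a set"] by auto
    then show ?thesis using that by blast
  qed
  have "AE x in lborel. x \<bullet> e \<noteq> 0" by (rule AE_lborel_inner_neq[OF e(1)])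
  then show ?thesis
  proof eventually_elim
    case (elim x)
    show ?case
    proof (rule ccontr)
      assume "x \<notin> offray p"
      then have "x = norm x *\<^sub>R p" by (simp add: offray_iff)
      then have "x \<bullet> e = norm x * (p \<bullet> e)" by (metis inner_scaleR_left)
      then show False using elim e p by (simp add: inner_not_same_Basis)
    qed
  qed
qed

section \<open>Integrability of the singular weight\<close>

lemma sing_nonneg: "sing x \<ge> 0"
proof (cases "x \<in> offray p")
  case True
  then show ?thesis using lg_ge[OF True] ht_nonneg[OF offray_nz[OF True]] by (simp add: sing_def)
next
  case False
  show ?thesis
  proof (cases "x = 0")
    case True
    then show ?thesis by (simp add: sing_def ht_def lg_def ln_div)
  next
    case nx: False
    have "ht p x = 0" using ht_eq_0[OF nx False] .
    then show ?thesis by (simp add: sing_def)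
  qed
qed

lemma sing_measurable [measurable]: "sing \<in> borel_measurable borel"
  unfolding sing_def[abs_def] lg_def ht_def by measurable

text \<open>On the dyadic shell \<open>ht \<sim> 4\<^sup>-\<^sup>j\<close>, contained in a tube of radius \<open>\<sim> 2\<^sup>-\<^sup>j\<close>, the integrand is at
  most \<open>(2\<^sup>j / j)\<^sup>n\<close>.\<close>

lemma sing_power_integrable:
  assumes n: "n = DIM('a) - 1" "n \<ge> 2"
  shows "integrable lborel (\<lambda>x. indicator annulus x * sing x ^ n)"
proof -
  \<comment> \<open>Half side lengths of a box around the tube \<open>ht \<le> 4^-j\<close>: the
    norm is below 2 along \<open>p\<close>, and across the distance is at most the square root of
    \<open>16 * 4^-j * 4\<close>.\<close>
  define w where "w = (\<lambda>(j::nat) i. if i = p then 2 else 8 / 2 ^ j :: real)"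
  have w0: "w j i \<ge> 0" for j i by (simp add: w_def)
  define Q where "Q = (\<lambda>j::nat. cbox (- (\<Sum>i\<in>Basis. w j i *\<^sub>R i)) (\<Sum>i\<in>Basis. w j i *\<^sub>R i) :: 'a set)"
  \<comment> \<open>On the j-th shell \<open>sqrt (ht p x)\<close> is at least
    \<open>2^-(j+1)\<close> and \<open>lg p x\<close> at least \<open>j * ln 4\<close>, hence at
    least \<open>j\<close>.\<close>
  define c where "c = (\<lambda>j::nat. (2 ^ Suc j / real j) ^ n)"
  have inQ: "x \<in> Q j" if "x \<in> annulus" "ht p x \<le> (1 / 4) ^ j" for x j
  proof -
    have nx: "x \<noteq> 0" "norm x < 2" using that by (auto simp: annulus_def)
    have "\<bar>x \<bullet> i\<bar> \<le> w j i" if i: "i \<in> Basis" for i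
    proof (cases "i = p")
      case True
      then show ?thesis using Basis_le_norm[OF i, of x] nx by (simp add: w_def)
    next
      case False
      have "(x \<bullet> i)\<^sup>2 + (x \<bullet> p)\<^sup>2 \<le> (norm x)\<^sup>2"
      proof -
        have "(\<Sum>k\<in>{i, p}. (x \<bullet> k)\<^sup>2) \<le> (\<Sum>k\<in>Basis. (x \<bullet> k)\<^sup>2)" by (rule sum_mono2) (use i p in auto)
        then show ?thesis using False by (simp add: power2_norm_eq_inner euclidean_inner[of x x]) (simp add: power2_eq_square)
      qed
      then have "(x \<bullet> i)\<^sup>2 \<le> 16 * ht p x * (norm x)\<^sup>2" using perp_square_le[OF nx(1)] by linarith
      also have "\<dots> \<le> 16 * (1 / 4) ^ j * 2\<^sup>2"
        using nx \<open>ht p x \<le> (1 / 4) ^ j\<close> ht_nonneg[OF nx(1)] by (intro mult_mono power_mono) auto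
      also have "\<dots> = (8 / 2 ^ j)\<^sup>2" by (simp add: power_divide power2_eq_square flip: power_mult_distrib)
      finally have "\<bar>x \<bullet> i\<bar> \<le> \<bar>8 / 2 ^ j\<bar>" by (simp only: abs_le_square_iff)
      then show ?thesis using False by (simp add: w_def)
    qed
    then have "- w j i \<le> x \<bullet> i \<and> x \<bullet> i \<le> w j i" if "i \<in> Basis" for i using that by (simp add: abs_le_iff) force
    then show ?thesis unfolding Q_def mem_box by (simp add: sum_scaleR_inner_Basis)
  qed
  have eQ: "emeasure lborel (Q j) = ennreal (4 * (16 / 2 ^ j) ^ n)" for j
  proof -
    have "- w j b \<le> w j b" for b using w0[of j b] by linarith
    then have "emeasure lborel (Q j) = ennreal (\<Prod>i\<in>Basis. ((\<Sum>i\<in>Basis. w j i *\<^sub>R i) - (- (\<Sum>i\<in>Basis. w j i *\<^sub>R i))) \<bullet> i)"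
      unfolding Q_def by (subst emeasure_lborel_cbox) (auto simp: sum_scaleR_inner_Basis)
    also have "(\<Prod>i\<in>Basis. ((\<Sum>i\<in>Basis. w j i *\<^sub>R i) - (- (\<Sum>i\<in>Basis. w j i *\<^sub>R i))) \<bullet> i) = (\<Prod>i\<in>Basis. 2 * w j i)"
      by (intro prod.cong refl) (simp add: sum_scaleR_inner_Basis inner_diff_left inner_add_left)
    also have "(\<Prod>i\<in>Basis. 2 * w j i) = 4 * (16 / 2 ^ j :: real) ^ n"
    proof -
      have "(\<Prod>i\<in>Basis - {p}. 2 * w j i) = (\<Prod>i\<in>Basis - {p}. 16 / 2 ^ j :: real)" by (rule prod.cong) (auto simp: w_def)
      also have "\<dots> = (16 / 2 ^ j) ^ n" using p by (simp add: card_Diff_singleton n)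
      finally show ?thesis by (subst prod.remove[OF finite_Basis p]) (simp add: w_def)
    qed
    finally show ?thesis .
  qed
  have pt: "ennreal (indicator annulus x * sing x ^ n) \<le> (\<Sum>j. ennreal (c (Suc j)) * indicator (Q (Suc j)) x)" for x
  proof (cases "x \<in> annulus \<and> x \<in> offray p")
    case True
    have h: "ht p x > 0" using True ht_pos_iff offray_nz by blast
    obtain j0 where j0: "(1 / 4) ^ j0 < ht p x" using real_arch_pow_inv[OF h, of "1/4"] by auto
    \<comment> \<open>The index with \<open>4^-(j+1) < ht p x \<le> 4^-j\<close>. It is at least 1
      because \<open>ht p x \<le> 1 / 4\<close>, which keeps the division by \<open>j\<close>
      harmless.\<close>
    define j where "j = (LEAST j. (1 / 4) ^ Suc j < ht p x)"
    have "(1 / 4) ^ Suc j0 < ht p x"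
      by (rule le_less_trans[OF _ j0]) (simp add: mult_left_le_one_le)
    then have j: "(1 / 4) ^ Suc j < ht p x" unfolding j_def by (rule LeastI)
    have jpos: "j \<noteq> 0" using j ht_le[of x] by (intro notI) simp
    then obtain k where k: "j = Suc k" by (cases j) auto
    have "\<not> (1 / 4) ^ Suc k < ht p x"
      by (rule not_less_Least) (unfold j_def[symmetric], simp add: k)
    then have hle: "ht p x \<le> (1 / 4) ^ j" unfolding k by (simp only: not_less)
    have "sqrt ((1 / 4) ^ Suc j) \<le> sqrt (ht p x)" using j by (intro real_sqrt_le_mono) simp
    also have "sqrt ((1 / 4) ^ Suc j) = (1 / 2 :: real) ^ Suc j"
      by (simp only: real_sqrt_power) (simp add: real_sqrt_divide)
    finally have s: "(1 / 2) ^ Suc j \<le> sqrt (ht p x)" .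
    have "ln (ht p x) \<le> ln ((1 / 4) ^ j)" using h hle by (subst ln_le_cancel_iff) auto
    also have "\<dots> = - (real j * ln 4)" by (simp add: ln_realpow ln_div)
    finally have "lg p x \<ge> real j * ln 4" by (simp add: lg_def)
    moreover have "ln 4 \<ge> (1::real)"
    proof -
      have "ln (4::real) = 2 * ln 2" using ln_realpow[of "2::real" 2] by simp
      then show ?thesis using ln2_ge_two_thirds by simp
    qed
    ultimately have L: "lg p x \<ge> real j" using mult_left_mono[of 1 "ln 4" "real j"] by simp
    have "sing x \<le> 1 / ((1 / 2) ^ Suc j * real j)"
      unfolding sing_def using s L jpos h by (intro divide_left_mono mult_mono mult_pos_pos) auto
    also have "\<dots> = 2 ^ Suc j / real j" by (simp add: power_one_over divide_simps)
    finally have "sing x ^ n \<le> c j" unfolding c_def by (intro power_mono sing_nonneg)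
    then have "ennreal (indicator annulus x * sing x ^ n) \<le> ennreal (c (Suc k)) * indicator (Q (Suc k)) x"
      using inQ[OF _ hle] True by (simp add: k ennreal_leI)
    also have "\<dots> \<le> (\<Sum>j. ennreal (c (Suc j)) * indicator (Q (Suc j)) x)"
    proof -
      have "f k \<le> suminf f" for f :: "nat \<Rightarrow> ennreal" using sum_le_suminf[of f "{k}"] by simp
      then show ?thesis .
    qed
    finally show ?thesis .
  next
    case False
    have "sing x = 0" if "x \<in> annulus"
    proof -
      have "ht p x = 0" using False that by (intro ht_eq_0) (auto simp: annulus_def)
      then show ?thesis by (simp add: sing_def)
    qed
    then have "indicator annulus x * sing x ^ n = 0"
      using n(2) by (cases "x \<in> annulus") auto
    then show ?thesis by (simp only: ennreal_0 zero_le)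
  qed
  have "(\<integral>\<^sup>+x. ennreal (indicator annulus x * sing x ^ n) \<partial>lborel) \<le> (\<integral>\<^sup>+x. (\<Sum>j. ennreal (c (Suc j)) * indicator (Q (Suc j)) x) \<partial>lborel)"
    by (rule nn_integral_mono) (rule pt)
  also have "\<dots> = (\<Sum>j. \<integral>\<^sup>+x. ennreal (c (Suc j)) * indicator (Q (Suc j)) x \<partial>lborel)"
    by (rule nn_integral_suminf) (simp add: Q_def)
  also have "\<dots> = (\<Sum>j. ennreal (c (Suc j) * (4 * (16 / 2 ^ Suc j) ^ n)))"
  proof (rule suminf_cong)
    fix j
    have "Q (Suc j) \<in> sets lborel" by (simp add: Q_def)
    then show "(\<integral>\<^sup>+x. ennreal (c (Suc j)) * indicator (Q (Suc j)) x \<partial>lborel) = ennreal (c (Suc j) * (4 * (16 / 2 ^ Suc j) ^ n))"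
      by (subst nn_integral_cmult_indicator) (auto simp: eQ ennreal_mult c_def simp del: power_Suc of_nat_Suc)
  qed
  \<comment> \<open>The powers of 2 from the weight and from the cross-section of the tube cancel
    exactly; what remains is the inverse n-th power of the index, summable because
    \<open>n \<ge> 2\<close>.\<close>
  also have "\<dots> = (\<Sum>j. ennreal (4 * 32 ^ n * (1 / real (Suc j)) ^ n))"
  proof -
    have "c (Suc j) * (4 * (16 / 2 ^ Suc j) ^ n) = 4 * 32 ^ n * (1 / real (Suc j)) ^ n" for j
      unfolding c_def by (simp add: power_mult_distrib[symmetric] mult.left_commute[of _ 4] del: of_nat_Suc)
    then show ?thesis by (simp only:)
  qed
  also have "\<dots> < \<infinity>"
  proof -
    have "summable (\<lambda>j. inverse (real (Suc j) ^ 2))"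
      using inverse_power_summable[of 2, where 'a=real] by (subst summable_Suc_iff) simp
    then have "summable (\<lambda>j. 4 * 32 ^ n * inverse (real (Suc j) ^ 2))" by (rule summable_mult)
    then have "summable (\<lambda>j. 4 * 32 ^ n * (1 / real (Suc j)) ^ n)"
    proof (rule summable_comparison_test[rotated], intro exI allI impI)
      fix j :: nat
      have "(1 / real (Suc j)) ^ n \<le> (1 / real (Suc j)) ^ 2"
        by (rule power_decreasing) (use n in auto)
      then have "4 * 32 ^ n * (1 / real (Suc j)) ^ n \<le> 4 * 32 ^ n * inverse (real (Suc j) ^ 2)"
        by (intro mult_left_mono) (auto simp: power_divide inverse_eq_divide)
      then show "norm (4 * 32 ^ n * (1 / real (Suc j)) ^ n) \<le> 4 * 32 ^ n * inverse (real (Suc j) ^ 2)"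
        by (simp del: of_nat_Suc)
    qed
    then have "(\<Sum>j. ennreal (4 * 32 ^ n * (1 / real (Suc j)) ^ n)) = ennreal (\<Sum>j. 4 * 32 ^ n * (1 / real (Suc j)) ^ n)"
      by (intro suminf_ennreal2) auto
    then show ?thesis by simp
  qed
  finally have fin: "(\<integral>\<^sup>+x. ennreal (indicator annulus x * sing x ^ n) \<partial>lborel) < \<infinity>" .
  have [measurable]: "(annulus :: 'a set) \<in> sets borel"
    unfolding annulus_def by measurable
  show ?thesis
  proof (rule integrableI_bounded)
    show "(\<integral>\<^sup>+x. ennreal (norm (indicator annulus x * sing x ^ n)) \<partial>lborel) < \<infinity>"
      using fin sing_nonneg by simp
  qed measurable
qed

end

section \<open>The wobbly sphere as a Sobolev map\<close>

lemma open_annulus: "open (annulus :: 'a::euclidean_space set)"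
  unfolding annulus_def by (intro open_Collect_conj open_Collect_less continuous_intros)

lemma annulus_sets [measurable]: "(annulus :: 'a::euclidean_space set) \<in> sets borel"
  by (rule borel_open[OF open_annulus])

lemma bounded_annulus: "bounded (annulus :: 'a::euclidean_space set)"
  by (rule boundedI[of _ 2]) (auto simp: annulus_def)

lemma emeasure_annulus_finite: "emeasure lborel (annulus :: 'a::euclidean_space set) < \<infinity>"
  by (rule bounded_emeasure_finite[OF bounded_annulus annulus_sets])

lemma power_add_le_two:
  fixes a b :: real
  assumes "a \<ge> 0" "b \<ge> 0"
  shows "(a + b) ^ n \<le> 2 ^ n * (a ^ n + b ^ n)"
proof -
  have "(a + b) ^ n \<le> (2 * max a b) ^ n" using assms by (intro power_mono) auto
  also have "\<dots> = 2 ^ n * max a b ^ n" by (simp add: power_mult_distrib)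
  also have "\<dots> \<le> 2 ^ n * (a ^ n + b ^ n)"
    using assms by (intro mult_left_mono) (auto simp: max_def)
  finally show ?thesis .
qed

lemma integrable_indicator_power_bound:
  fixes f :: "'a::euclidean_space \<Rightarrow> 'b::euclidean_space"
  assumes [measurable]: "f \<in> borel_measurable borel" "A \<in> sets borel" and A: "emeasure lborel A < \<infinity>"
    and b: "AE x in lborel. x \<in> A \<longrightarrow> norm (f x) \<le> C"
  shows "integrable lborel (\<lambda>x. indicator A x * norm (f x) ^ n)" "integrable lborel (\<lambda>x. indicator A x *\<^sub>R f x)"
proof -
  have i: "integrable lborel (\<lambda>x. \<bar>C\<bar> ^ n * indicator A x :: real)" "integrable lborel (\<lambda>x. \<bar>C\<bar> * indicator A x :: real)"
    using A by (auto intro!: integrable_real_indicator)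
  show "integrable lborel (\<lambda>x. indicator A x * norm (f x) ^ n)"
  proof (rule Bochner_Integration.integrable_bound[OF i(1)])
    show "AE x in lborel. norm (indicator A x * norm (f x) ^ n) \<le> norm (\<bar>C\<bar> ^ n * indicator A x :: real)"
      using b
    proof eventually_elim
      case (elim x)
      then show ?case by (cases "x \<in> A") (auto intro!: power_mono)
    qed
  qed measurable
  show "integrable lborel (\<lambda>x. indicator A x *\<^sub>R f x)"
  proof (rule Bochner_Integration.integrable_bound[OF i(2)])
    show "AE x in lborel. norm (indicator A x *\<^sub>R f x) \<le> norm (\<bar>C\<bar> * indicator A x :: real)"
      using b by eventually_elim (auto simp: indicator_def)
  qed measurable
qed

lemma radial_ext_lipschitz:
  fixes v :: "'a::euclidean_space \<Rightarrow> 'a"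
  assumes lip: "L-lipschitz_on (sphere 0 1) v" and x: "norm x \<ge> 1 / 2" and y: "y \<noteq> 0"
  shows "norm (radial_ext v y - radial_ext v x) \<le> 4 * L * norm (y - x)"
proof -
  have L: "L \<ge> 0" using lip lipschitz_on_nonneg by blast
  have "x \<noteq> 0" using x by auto
  have "norm (radial_ext v y - radial_ext v x) \<le> L * norm (y /\<^sub>R norm y - x /\<^sub>R norm x)"
    unfolding radial_ext_def dist_norm[symmetric] by (rule lipschitz_onD[OF lip]) (use \<open>x \<noteq> 0\<close> y in auto)
  also have "norm (y /\<^sub>R norm y - x /\<^sub>R norm x) \<le> 2 / (1 / 2) * norm (y - x)"
    using normalize_diff_le[OF x, of y] by (simp add: norm_minus_commute)
  finally show ?thesis using L by (simp add: mult_left_mono)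
qed

lemma radial_ext_continuous_measurable:
  fixes v :: "'a::euclidean_space \<Rightarrow> 'a"
  assumes "continuous_on (sphere 0 1) v"
  shows "continuous_on (- {0}) (radial_ext v)" "radial_ext v \<in> borel_measurable borel"
proof -
  have "continuous_on (- {0}) (\<lambda>x::'a. x /\<^sub>R norm x)" by (intro continuous_intros) auto
  then have "continuous_on (- {0}) (\<lambda>x. v (x /\<^sub>R norm x))"
  proof (rule continuous_on_compose2[OF assms], intro image_subsetI)
    fix x :: 'a assume "x \<in> - {0}"
    then have "norm x \<noteq> 0" by simp
    then show "x /\<^sub>R norm x \<in> sphere 0 1" by simp
  qed
  then show c: "continuous_on (- {0}) (radial_ext v)" by (simp add: radial_ext_def[abs_def])
  show "radial_ext v \<in> borel_measurable borel"
    by (rule borel_measurable_continuous_countable_exceptions[OF _ c]) simp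
qed

lemma W1p_of_borel:
  fixes u :: "'a::euclidean_space \<Rightarrow> 'b::euclidean_space"
  assumes "u \<in> borel_measurable borel" "A \<in> sets borel" "n \<ge> 1" "integrable lborel (\<lambda>x. indicator A x * norm (u x) ^ n)"
    and "\<And>i. i \<in> Basis \<Longrightarrow> \<exists>g. g \<in> borel_measurable borel \<and> integrable lborel (\<lambda>x. indicator A x * norm (g x) ^ n) \<and> weak_partial A i u g"
  shows "u \<in> W1p A (real n)"
  using assms Lp_space_nat_iff(1)[of _ A n] unfolding W1p_def by blast

context pole begin

lemma radial_ext_wsph: "radial_ext (wsph p) = wsph p"
proof
  fix x
  show "radial_ext (wsph p) x = wsph p x"
    using wsph_scaleR[of "inverse (norm x)" x] by (cases "x = 0") (auto simp: radial_ext_def)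
qed

lemma wsph_measurable [measurable]: "wsph p \<in> borel_measurable borel"
  by (rule borel_measurable_continuous_countable_exceptions[OF _ continuous_on_wsph]) simp

lemma dwsph_measurable [measurable]: "(\<lambda>x. dwsph x i) \<in> borel_measurable borel"
proof -
  have "(\<lambda>x. indicator (offray p) x *\<^sub>R dwsph x i) \<in> borel_measurable borel"
    by (rule borel_measurable_continuous_on_indicator[OF _ continuous_on_dwsph]) (simp add: open_offray)
  moreover have "(\<lambda>x. indicator (offray p) x *\<^sub>R dwsph x i) = (\<lambda>x. dwsph x i)"
    by (auto simp: fun_eq_iff dwsph_def indicator_def)
  ultimately show ?thesis by simp
qed

lemma twsph_measurable [measurable]: "twsph m \<in> borel_measurable borel"
proof (rule borel_measurable_continuous_countable_exceptions[of "{0}"])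
  show "continuous_on (- {0}) (twsph m)"
    by (intro continuous_at_imp_continuous_on ballI has_derivative_continuous[OF twsph_has_derivative]) auto
qed simp

lemma dtwsph_measurable [measurable]: "(\<lambda>x. dtwsph m x i) \<in> borel_measurable borel"
  by (rule borel_measurable_continuous_countable_exceptions[OF _ continuous_on_dtwsph]) simp

lemma norm_wsph_le: "norm (wsph p x) \<le> 2"
  using norm_wsph_bounds[of x] by (cases "x = 0") (auto simp: wsph_def)

lemma bound_power_integrable:
  assumes n: "n = DIM('a) - 1" "n \<ge> 2"
  shows "integrable lborel (\<lambda>x. indicator annulus x * (8 + 3 * sing x) ^ n)"
    "integrable lborel (\<lambda>x. indicator annulus x * (8 + 3 * sing x))"
proof -
  have nn: "8 + 3 * sing x \<ge> 8" for x using sing_nonneg[of x] by simp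
  have i: "integrable lborel (\<lambda>x. 2 ^ n * (8 ^ n * indicator annulus x + 3 ^ n * (indicator annulus x * sing x ^ n)))"
    by (intro integrable_mult_right Bochner_Integration.integrable_add integrable_real_indicator sing_power_integrable[OF n])
       (use annulus_sets emeasure_annulus_finite in auto)
  show a: "integrable lborel (\<lambda>x. indicator annulus x * (8 + 3 * sing x) ^ n)"
  proof (rule Bochner_Integration.integrable_bound[OF i])
    show "AE x in lborel. norm (indicator annulus x * (8 + 3 * sing x) ^ n) \<le> norm (2 ^ n * (8 ^ n * indicator annulus x + 3 ^ n * (indicator annulus x * sing x ^ n)))"
    proof (rule AE_I2)
      fix x
      have "(8 + 3 * sing x) ^ n \<le> 2 ^ n * (8 ^ n + (3 * sing x) ^ n)" using sing_nonneg by (intro power_add_le_two) auto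
      then show "norm (indicator annulus x * (8 + 3 * sing x) ^ n) \<le> norm (2 ^ n * (8 ^ n * indicator annulus x + 3 ^ n * (indicator annulus x * sing x ^ n)))"
        using sing_nonneg[of x] by (cases "x \<in> annulus") (auto simp: power_mult_distrib)
    qed
  qed measurable
  show "integrable lborel (\<lambda>x. indicator annulus x * (8 + 3 * sing x))"
  proof (rule Bochner_Integration.integrable_bound[OF a])
    show "AE x in lborel. norm (indicator annulus x * (8 + 3 * sing x)) \<le> norm (indicator annulus x * (8 + 3 * sing x) ^ n)"
    proof (rule AE_I2)
      fix x
      have "8 + 3 * sing x \<le> (8 + 3 * sing x) ^ n" using nn[of x] n by (intro self_le_power) auto
      then show "norm (indicator annulus x * (8 + 3 * sing x)) \<le> norm (indicator annulus x * (8 + 3 * sing x) ^ n)"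
        using nn[of x] by (cases "x \<in> annulus") auto
    qed
  qed measurable
qed

lemma annulus_norm: "x \<in> annulus \<Longrightarrow> norm x \<ge> 1 / 2"
  by (simp add: annulus_def)

lemma weak_partial_twsph:
  assumes n: "DIM('a) \<ge> 3" and i: "i \<in> Basis"
  shows "weak_partial annulus i (twsph m) (\<lambda>x. dtwsph m x i)"
proof (rule weak_partial_C1[OF open_annulus])
  have nz: "x \<noteq> 0" if "x \<in> annulus" for x :: 'a using that by (auto simp: annulus_def)
  show "(twsph m has_derivative dtwsph m x) (at x)" if "x \<in> annulus" for x by (rule twsph_has_derivative[OF nz[OF that]])
  show "continuous_on annulus (\<lambda>x. dtwsph m x v)" for v
    by (rule continuous_on_subset[OF continuous_on_dtwsph]) (use nz in auto)
  fix \<phi> :: "'a \<Rightarrow> real" assume t: "test_fun annulus \<phi>"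
  note [measurable] = test_fun_measurable[OF t]
  obtain B where B: "B > 0" "\<And>x v. norm (frechet_derivative \<phi> (at x) v) \<le> B * norm v" "\<And>x. \<bar>\<phi> x\<bar> \<le> B"
    using test_fun_bounds[OF t] by metis
  have ib: "integrable lborel (\<lambda>x. B * (indicator annulus x * (8 + 3 * sing x)))"
    using bound_power_integrable(2)[OF refl] n by simp
  show "integrable lborel (\<lambda>x. \<phi> x *\<^sub>R dtwsph m x i)"
  proof (rule Bochner_Integration.integrable_bound[OF ib])
    show "AE x in lborel. norm (\<phi> x *\<^sub>R dtwsph m x i) \<le> norm (B * (indicator annulus x * (8 + 3 * sing x)))"
    proof (rule AE_I2)
      fix x
      show "norm (\<phi> x *\<^sub>R dtwsph m x i) \<le> norm (B * (indicator annulus x * (8 + 3 * sing x)))"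
      proof (cases "x \<in> annulus")
        case True
        have "\<bar>\<phi> x\<bar> * norm (dtwsph m x i) \<le> B * ((8 + 3 * sing x) * norm i)"
          by (intro mult_mono B(3) norm_dtwsph_le annulus_norm True) (use B(1) in auto)
        then show ?thesis using True i B(1) sing_nonneg[of x] by simp
      qed (use test_funD(6)[OF t] in simp)
    qed
  qed measurable
  have ia: "integrable lborel (\<lambda>x. (2 * B) * indicator annulus x :: real)"
    using emeasure_annulus_finite by (auto intro!: integrable_real_indicator)
  show "integrable lborel (\<lambda>x. frechet_derivative \<phi> (at x) i *\<^sub>R twsph m x)"
  proof (rule Bochner_Integration.integrable_bound[OF ia])
    show "AE x in lborel. norm (frechet_derivative \<phi> (at x) i *\<^sub>R twsph m x) \<le> norm (2 * B * indicator annulus x :: real)"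
    proof (rule AE_I2)
      fix x
      show "norm (frechet_derivative \<phi> (at x) i *\<^sub>R twsph m x) \<le> norm (2 * B * indicator annulus x :: real)"
      proof (cases "x \<in> annulus")
        case True
        have "\<bar>frechet_derivative \<phi> (at x) i\<bar> * norm (twsph m x) \<le> (B * norm i) * 2"
          using B(2)[of x i] by (intro mult_mono norm_twsph_le) (use B(1) in auto)
        then show ?thesis using True i B(1) by simp
      qed (use test_funD(7)[OF t] in simp)
    qed
  qed measurable
qed measurable

text \<open>\<open>lg p x\<close> is a finite number off the ray, and the truncation leaves the
  profile alone up to L = m + 1.\<close>

lemma truncation_eventually:
  assumes x: "x \<in> offray p"
  shows "eventually (\<lambda>m. twsph m x = wsph p x \<and> (\<forall>v. dtwsph m x v = dwsph x v)) sequentially"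
proof -
  obtain k :: nat where k: "real k > lg p x" using reals_Archimedean2 by blast
  have L: "0 < lg p x" using lg_ge[OF x] by linarith
  have "twsph m x = wsph p x \<and> (\<forall>v. dtwsph m x v = dwsph x v)" if "m \<ge> k" for m
  proof -
    have "lg p x \<le> real (Suc m)" using k that by linarith
    then have "truncG m (lg p x) = oscG (lg p x)" "truncG' m (lg p x) = oscG' (lg p x)" using truncG_near[OF L] by blast+
    then show ?thesis using x
      by (simp add: twsph_def gwsph_oscG[symmetric] gwsph_def dtwsph_def dgwsph_def dwsph_eq)
  qed
  then show ?thesis by (auto simp: eventually_sequentially)
qed

text \<open>The ray carries no distributional derivative: the truncations are C1 and their
  derivatives are dominated by the integrable function \<open>8 + 3 * sing x\<close>.\<close>

lemma weak_partial_wsph: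
  assumes n: "DIM('a) \<ge> 3" and i: "i \<in> Basis"
  shows "weak_partial annulus i (wsph p) (\<lambda>x. dwsph x i)"
proof (rule weak_partial_limit[where u=twsph and g="\<lambda>m x. dtwsph m x i" and M="\<lambda>x. 8 + 3 * sing x"])
  have AE: "AE x in lborel. x \<in> offray p" using n by (intro offray_AE) simp
  show "AE x in lborel. x \<in> annulus \<longrightarrow> (\<lambda>m. twsph m x) \<longlonglongrightarrow> wsph p x"
    using AE by eventually_elim (intro impI tendsto_eventually eventually_mono[OF truncation_eventually], auto)
  show "AE x in lborel. x \<in> annulus \<longrightarrow> (\<lambda>m. dtwsph m x i) \<longlonglongrightarrow> dwsph x i"
    using AE by eventually_elim (intro impI tendsto_eventually eventually_mono[OF truncation_eventually], auto)
  show "integrable lborel (\<lambda>x. indicator annulus x * (8 + 3 * sing x))"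
    using bound_power_integrable(2)[OF refl] n by simp
  show "AE x in lborel. x \<in> annulus \<longrightarrow> norm (twsph m x) \<le> 8 + 3 * sing x" for m
    using norm_twsph_le[of m] sing_nonneg by (intro AE_I2) (smt (verit))
  show "AE x in lborel. x \<in> annulus \<longrightarrow> norm (dtwsph m x i) \<le> 8 + 3 * sing x" for m
  proof (intro AE_I2 impI)
    fix x :: 'a assume "x \<in> annulus"
    then show "norm (dtwsph m x i) \<le> 8 + 3 * sing x" using norm_dtwsph_le[OF annulus_norm, of x m i] i by simp
  qed
qed (use weak_partial_twsph[OF n i] in measurable)

lemma dwsph_power_integrable:
  assumes n: "n = DIM('a) - 1" "n \<ge> 2" and i: "i \<in> Basis"
  shows "integrable lborel (\<lambda>x. indicator annulus x * norm (dwsph x i) ^ n)"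
    "integrable lborel (\<lambda>x. indicator annulus x *\<^sub>R dwsph x i)"
proof -
  have b: "norm (dwsph x i) \<le> 8 + 3 * sing x" if "x \<in> annulus" for x
    using norm_dwsph_le[OF annulus_norm[OF that], of i] i by simp
  show "integrable lborel (\<lambda>x. indicator annulus x * norm (dwsph x i) ^ n)"
    by (rule Bochner_Integration.integrable_bound[OF bound_power_integrable(1)[OF n]], measurable)
       (use b sing_nonneg in \<open>auto simp: indicator_def intro!: power_mono\<close>)
  show "integrable lborel (\<lambda>x. indicator annulus x *\<^sub>R dwsph x i)"
    by (rule Bochner_Integration.integrable_bound[OF bound_power_integrable(2)[OF n]], measurable)
       (use b in \<open>auto simp: indicator_def intro: order_trans[OF _ abs_ge_self]\<close>)
qed

lemma wsph_in_W1n: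
  assumes n: "DIM('a) \<ge> 3"
  shows "wsph p \<in> W1n_sphere_into Y"
proof -
  define N where "N = DIM('a) - 1"
  have N: "N = DIM('a) - 1" "N \<ge> 2" using n by (auto simp: N_def)
  have "wsph p \<in> W1p annulus (real N)"
  proof (rule W1p_of_borel)
    show "integrable lborel (\<lambda>x. indicator annulus x * norm (wsph p x) ^ N)"
      by (rule integrable_indicator_power_bound(1)[OF _ _ emeasure_annulus_finite, where C=2]) (use norm_wsph_le in auto)
    show "\<exists>g. g \<in> borel_measurable borel \<and> integrable lborel (\<lambda>x. indicator annulus x * norm (g x) ^ N) \<and> weak_partial annulus i (wsph p) g"
      if i: "i \<in> Basis" for i :: 'a
      using dwsph_power_integrable(1)[OF N i] weak_partial_wsph[OF n i] dwsph_measurable[of i] by blast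
  qed (use N in auto)
  moreover have "AE x in lebesgue. x \<in> annulus \<longrightarrow> radial_ext (wsph p) x \<in> Y"
    unfolding radial_ext_wsph by (intro AE_I2 impI wsph_in_Y) (auto simp: annulus_def)
  ultimately show ?thesis
    by (simp add: W1n_sphere_into_def W1n_sphere_def sph_dim_def radial_ext_wsph N_def)
qed

end

section \<open>Smooth approximation of Lipschitz maps\<close>

lemma power_add4_le:
  fixes a b c d :: real
  assumes "a \<ge> 0" "b \<ge> 0" "c \<ge> 0" "d \<ge> 0"
  shows "(a + b + c + d) ^ n \<le> 4 ^ n * (a ^ n + b ^ n + c ^ n + d ^ n)"
proof -
  define m where "m = max (max a b) (max c d)"
  have "(a + b + c + d) ^ n \<le> (4 * m) ^ n" using assms by (intro power_mono) (auto simp: m_def)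
  also have "\<dots> = 4 ^ n * m ^ n" by (simp add: power_mult_distrib)
  also have "m ^ n \<le> a ^ n + b ^ n + c ^ n + d ^ n"
    using assms by (auto simp: m_def max_def)
  finally show ?thesis by (simp add: mult_left_mono)
qed

text \<open>The squared norms on which \<open>integral_dform_C1_zero\<close> requires values off the
  ray. Balls of radius 1/20 around its points stay in the annulus.\<close>

definition shell :: "'a::euclidean_space set" where
  "shell = {x. 6 / 10 \<le> x \<bullet> x \<and> x \<bullet> x \<le> 14 / 10}"

lemma closed_shell: "closed (shell :: 'a::euclidean_space set)"
  unfolding shell_def by (intro closed_Collect_conj closed_Collect_le continuous_intros)

lemma shell_norm: "x \<in> shell \<Longrightarrow> 6 / 10 \<le> norm x \<and> norm x \<le> 14 / 10"
proof
  assume x: "x \<in> shell"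
  then have n: "6 / 10 \<le> norm x * norm x" "norm x * norm x \<le> 14 / 10"
    by (auto simp: shell_def dot_square_norm power2_eq_square)
  show "6 / 10 \<le> norm x"
  proof (rule ccontr)
    assume "\<not> ?thesis"
    then have "norm x * norm x \<le> (6 / 10) * (6 / 10)" by (intro mult_mono) auto
    then show False using n by simp
  qed
  show "norm x \<le> 14 / 10"
  proof (rule ccontr)
    assume "\<not> ?thesis"
    then have "(14 / 10) * (14 / 10) \<le> norm x * norm x" by (intro mult_mono) auto
    then show False using n by simp
  qed
qed

lemma cball_shell_annulus:
  assumes "x \<in> shell" "\<epsilon> \<le> 1 / 20" "norm (x - y) \<le> \<epsilon>"
  shows "y \<in> annulus" "norm y \<ge> 55 / 100" "norm y \<le> 145 / 100"
proof -
  have "norm y \<le> norm x + norm (x - y)" "norm x \<le> norm y + norm (x - y)"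
    using norm_triangle_ineq4[of x "x - y"] norm_triangle_sub[of x y] by auto
  then show "y \<in> annulus" "norm y \<ge> 55 / 100" "norm y \<le> 145 / 100"
    using shell_norm[OF assms(1)] assms(2,3) by (auto simp: annulus_def)
qed

lemma shell_subset_annulus: "x \<in> shell \<Longrightarrow> x \<in> annulus"
  using cball_shell_annulus(1)[of x "1/20" x] by simp

lemma shell_sets [measurable]: "(shell :: 'a::euclidean_space set) \<in> sets borel"
  using closed_shell by (rule borel_closed)

context pole begin

lemma truncation_power_limit:
  assumes n: "n = DIM('a) - 1" "n \<ge> 2" and i: "i \<in> Basis"
  shows "integrable lborel (\<lambda>x. indicator annulus x * norm (dwsph x i - dtwsph m x i) ^ n)"
    "(\<lambda>m. (LBINT x. indicator annulus x * norm (dwsph x i - dtwsph m x i) ^ n)) \<longlonglongrightarrow> 0"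
proof -
  have dim: "DIM('a) \<ge> 2" using n by auto
  let ?B = "\<lambda>x. 2 ^ n * (indicator annulus x * (8 + 3 * sing x) ^ n)"
  have iB: "integrable lborel ?B" using bound_power_integrable(1)[OF n] by (rule integrable_mult_right)
  have b: "norm (indicator annulus x * norm (dwsph x i - dtwsph m x i) ^ n) \<le> ?B x" for x m
  proof (cases "x \<in> annulus")
    case True
    have "norm (dwsph x i - dtwsph m x i) \<le> norm (dwsph x i) + norm (dtwsph m x i)" by (rule norm_triangle_ineq4)
    also have "\<dots> \<le> (8 + 3 * sing x) + (8 + 3 * sing x)"
      using norm_dwsph_le[OF annulus_norm[OF True], of i] norm_dtwsph_le[OF annulus_norm[OF True], of m i] i by (intro add_mono) auto
    finally have "norm (dwsph x i - dtwsph m x i) ^ n \<le> (2 * (8 + 3 * sing x)) ^ n" by (intro power_mono) auto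
    also have "\<dots> = 2 ^ n * (8 + 3 * sing x) ^ n" by (rule power_mult_distrib)
    finally show ?thesis using True by simp
  qed simp
  show "integrable lborel (\<lambda>x. indicator annulus x * norm (dwsph x i - dtwsph m x i) ^ n)"
    by (rule Bochner_Integration.integrable_bound[OF iB], measurable)
       (intro AE_I2 order_trans[OF b] , simp)
  have "(\<lambda>m. (LBINT x. indicator annulus x * norm (dwsph x i - dtwsph m x i) ^ n)) \<longlonglongrightarrow> integral\<^sup>L lborel (\<lambda>x::'a. 0 :: real)"
  proof (rule integral_dominated_convergence[OF _ _ iB])
    show "AE x in lborel. (\<lambda>m. indicator annulus x * norm (dwsph x i - dtwsph m x i) ^ n) \<longlonglongrightarrow> 0"
      using offray_AE[OF dim]
    proof eventually_elim
      case (elim x)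
      show ?case
        by (rule tendsto_eventually, rule eventually_mono[OF truncation_eventually[OF elim]]) (use n in auto)
    qed
    show "AE x in lborel. norm (indicator annulus x * norm (dwsph x i - dtwsph m x i) ^ n) \<le> ?B x" for m
      using b by (intro AE_I2)
  qed measurable
  then show "(\<lambda>m. (LBINT x. indicator annulus x * norm (dwsph x i - dtwsph m x i) ^ n)) \<longlonglongrightarrow> 0" by simp
qed

lemma lipschitz_radial_ext_weak_partial:
  fixes v :: "'a \<Rightarrow> 'a"
  assumes v: "L-lipschitz_on (sphere 0 1) v" "v ` sphere 0 1 \<subseteq> Y"
  obtains M g where "radial_ext v \<in> borel_measurable borel" "\<And>x. norm (radial_ext v x) \<le> M"
    "g \<in> borel_measurable borel" "AE x in lborel. norm (g x) \<le> \<bar>4 * L\<bar> * norm i" "weak_partial annulus i (radial_ext v) g"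
proof -
  have c: "continuous_on (sphere 0 1) v" by (rule lipschitz_on_continuous_on[OF v(1)])
  note m = radial_ext_continuous_measurable[OF c]
  \<comment> \<open>At the origin the radial extension takes the value \<open>v 0\<close>, about
    which the hypotheses say nothing.\<close>
  have M: "norm (radial_ext v x) \<le> max 2 (norm (v 0))" for x
  proof (cases "x = 0")
    case False
    then have "radial_ext v x \<in> Y" using v(2) by (auto simp: radial_ext_def)
    then show ?thesis using norm_Y by fastforce
  qed (simp add: radial_ext_def)
  have l: "norm (radial_ext v (x + h) - radial_ext v x) \<le> (4 * L) * norm h" if "x \<in> annulus" "norm h < 1 / 4" for x h
  proof -
    have "x + h \<noteq> 0"
    proof
      assume "x + h = 0"
      then have "norm x = norm h" by (metis add_eq_0_iff2 norm_minus_cancel)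
      then show False using that by (simp add: annulus_def)
    qed
    then show ?thesis using radial_ext_lipschitz[OF v(1) annulus_norm[OF that(1)], of "x + h"] by simp
  qed
  obtain g where "g \<in> borel_measurable borel" "AE x in lborel. norm (g x) \<le> \<bar>4 * L\<bar> * norm i" "weak_partial annulus i (radial_ext v) g"
    by (rule lipschitz_weak_partial[OF open_annulus bounded_annulus m(2) M, of "1/4" "4 * L" i]) (use l in auto)
  then show thesis using that m(2) M by blast
qed

text \<open>Mollifying the given Lipschitz map close to \<open>wsph p\<close>: the derivative is compared with that
  of a truncation, for which mollification converges uniformly.\<close>

lemma smooth_approximation:
  fixes v :: "'a \<Rightarrow> 'a"
  assumes n: "n = DIM('a) - 1" "n \<ge> 2"
    and v: "L-lipschitz_on (sphere 0 1) v" "v ` sphere 0 1 \<subseteq> Y"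
    and \<eta>: "0 < \<eta>" "\<eta> \<le> 1" and close: "W1n_sphere_dist (wsph p) v < \<eta>"
  obtains V V' where "\<And>x. (V has_derivative V' x) (at x)" "\<And>h. continuous_on UNIV (\<lambda>x. V' x h)"
     "\<And>x. x \<in> shell \<Longrightarrow> norm (V x - radial_ext v x) \<le> \<eta> / 10"
     "\<And>i. i \<in> Basis \<Longrightarrow> integrable lborel (\<lambda>x. indicator shell x * norm (V' x i - dwsph x i) ^ n)"
     "\<And>i. i \<in> Basis \<Longrightarrow> (LBINT x. indicator shell x * norm (V' x i - dwsph x i) ^ n) \<le> 4 ^ n * (3 + measure lborel (annulus::'a set)) * \<eta>"
     "integrable lborel (\<lambda>x. indicator shell x * norm (wsph p x - radial_ext v x) ^ n)"
     "(LBINT x. indicator shell x * norm (wsph p x - radial_ext v x) ^ n) \<le> \<eta>"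
     "(LBINT x. dform (V x) (V' x) (radial_covector x)) = 0"
     "integrable lborel (\<lambda>x. dform (V x) (V' x) (radial_covector x))"
proof -
  have dim: "DIM('a) \<ge> 2" "DIM('a) \<ge> 3" and n1: "n \<ge> 1" using n by auto
  have L0: "L \<ge> 0" using v(1) lipschitz_on_nonneg by blast
  have cv: "continuous_on (sphere 0 1) v" by (rule lipschitz_on_continuous_on[OF v(1)])
  define vr where "vr = radial_ext v"
  have vr_cont: "continuous_on (- {0}) vr" and mvr[measurable]: "vr \<in> borel_measurable borel"
    unfolding vr_def by (rule radial_ext_continuous_measurable[OF cv])+
  have vrY: "vr x \<in> Y" if "x \<noteq> 0" for x using v(2) that by (auto simp: vr_def radial_ext_def)
  define M where "M = max 2 (norm (v 0))"
  have vrM: "norm (vr x) \<le> M" for x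
    using norm_Y[OF vrY[of x]] by (cases "x = 0") (auto simp: M_def vr_def radial_ext_def)
  have fin: "emeasure lborel (annulus::'a set) < \<infinity>" by (rule emeasure_annulus_finite)
  define w where "w = (\<lambda>x. wsph p x - vr x)"
  have mw[measurable]: "w \<in> borel_measurable borel" unfolding w_def by measurable
  have wM: "norm (w x) \<le> 2 + M" for x
    unfolding w_def using norm_triangle_ineq4[of "wsph p x" "vr x"] norm_wsph_le[of x] vrM[of x] by linarith
  have iw: "integrable lborel (\<lambda>x. indicator annulus x * norm (w x) ^ n)" "integrable lborel (\<lambda>x. indicator annulus x *\<^sub>R w x)"
    using integrable_indicator_power_bound(1)[OF _ annulus_sets fin, of w "2 + M" n]
      integrable_indicator_power_bound(2)[OF _ annulus_sets fin, of w "2 + M"] wM by auto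
  have iws: "integrable lborel (\<lambda>x. indicator annulus x *\<^sub>R wsph p x)"
    using integrable_indicator_power_bound(2)[OF _ annulus_sets fin, of "wsph p" 2] norm_wsph_le by auto
  have ivr: "integrable lborel (\<lambda>x. indicator annulus x *\<^sub>R vr x)"
    using integrable_indicator_power_bound(2)[OF _ annulus_sets fin, of vr M] vrM by auto
  \<comment> \<open>Membership is needed to read off smallness from the norm: only then does the
    \<open>SOME\<close> in \<open>W1p_norm\<close> denote weak derivatives of the
    difference.\<close>
  have wW: "w \<in> W1p annulus (real n)"
  proof (rule W1p_of_borel[OF _ annulus_sets n1 iw(1)])
    fix i :: 'a assume i: "i \<in> Basis"
    obtain g where g[measurable]: "g \<in> borel_measurable borel" and gb: "AE x in lborel. norm (g x) \<le> \<bar>4 * L\<bar> * norm i"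
      and gw: "weak_partial annulus i vr g"
      unfolding vr_def by (rule lipschitz_radial_ext_weak_partial[OF v, of i])
    have gb': "AE x in lborel. x \<in> annulus \<longrightarrow> norm (g x) \<le> \<bar>4 * L\<bar>" using gb by eventually_elim (use i in simp)
    note ig = integrable_indicator_power_bound(1)[OF g annulus_sets fin gb', of n] integrable_indicator_power_bound(2)[OF g annulus_sets fin gb']
    have "weak_partial annulus i w (\<lambda>x. dwsph x i - g x)"
      unfolding w_def by (rule weak_partial_diff[OF wsph_measurable mvr dwsph_measurable g annulus_sets iws ivr
          dwsph_power_integrable(2)[OF n i] ig(2) weak_partial_wsph[OF dim(2) i] gw])
    moreover have "integrable lborel (\<lambda>x. indicator annulus x * norm (dwsph x i - g x) ^ n)"
    proof (rule Bochner_Integration.integrable_bound)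
      show "integrable lborel (\<lambda>x. 2 ^ n * (indicator annulus x * norm (dwsph x i) ^ n + indicator annulus x * norm (g x) ^ n))"
        by (intro integrable_mult_right Bochner_Integration.integrable_add dwsph_power_integrable(1)[OF n i] ig(1))
      show "AE x in lborel. norm (indicator annulus x * norm (dwsph x i - g x) ^ n) \<le> norm (2 ^ n * (indicator annulus x * norm (dwsph x i) ^ n + indicator annulus x * norm (g x) ^ n))"
      proof (rule AE_I2)
        fix x
        have "norm (dwsph x i - g x) ^ n \<le> (norm (dwsph x i) + norm (g x)) ^ n" by (intro power_mono norm_triangle_ineq4) auto
        also have "\<dots> \<le> 2 ^ n * (norm (dwsph x i) ^ n + norm (g x) ^ n)" by (rule power_add_le_two) auto
        finally show "norm (indicator annulus x * norm (dwsph x i - g x) ^ n) \<le> norm (2 ^ n * (indicator annulus x * norm (dwsph x i) ^ n + indicator annulus x * norm (g x) ^ n))"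
          by (cases "x \<in> annulus") auto
      qed
    qed measurable
    moreover have "(\<lambda>x. dwsph x i - g x) \<in> borel_measurable borel" by measurable
    ultimately show "\<exists>g. g \<in> borel_measurable borel \<and> integrable lborel (\<lambda>x. indicator annulus x * norm (g x) ^ n) \<and> weak_partial annulus i w g"
      by blast
  qed measurable
  have wd: "W1p_norm annulus (real n) w < \<eta>"
    using close by (simp add: W1n_sphere_dist_def sph_dim_def n radial_ext_wsph w_def vr_def)
  obtain G where Gm: "\<And>i. i \<in> Basis \<Longrightarrow> G i \<in> borel_measurable borel" and Gz: "\<And>i x. x \<notin> annulus \<Longrightarrow> G i x = 0"
     and Gw: "\<And>i. i \<in> Basis \<Longrightarrow> weak_partial annulus i w (G i)"
     and Gi: "\<And>i. i \<in> Basis \<Longrightarrow> integrable lborel (\<lambda>x. norm (G i x) ^ n)"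
     and Gs: "\<And>i. i \<in> Basis \<Longrightarrow> (LBINT x. norm (G i x) ^ n) < \<eta> ^ n"
     and ws: "(LBINT x. indicator annulus x * norm (w x) ^ n) < \<eta> ^ n"
  proof (rule W1p_norm_lessD[OF annulus_sets n1 wW mw wd], goal_cases)
    case (1 G)
    show thesis by (rule that[of G]; rule 1; assumption)
  qed
  have \<eta>n: "\<eta> ^ n \<le> \<eta>" using \<eta> n1 power_decreasing[of 1 n \<eta>] by simp
  have Gint: "integrable lborel (G i)" if "i \<in> Basis" for i
    by (rule integrable_of_power_integrable[OF Gm[OF that] annulus_sets fin Gz Gi[OF that] n1])
  have ind: "(\<lambda>x. indicator annulus x *\<^sub>R G i x) = G i" for i
    using Gz by (auto simp: fun_eq_iff indicator_def)
  \<comment> \<open>The weak derivative of the Lipschitz map is rewritten as that of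
    \<open>wsph p\<close> minus the small \<open>G\<close>, so that its Lipschitz constant, over
    which there is no control, disappears from the estimates.\<close>
  have vrw: "weak_partial annulus i vr (\<lambda>x. dwsph x i - G i x)" if i: "i \<in> Basis" for i
  proof -
    have "weak_partial annulus i (\<lambda>x. wsph p x - w x) (\<lambda>x. dwsph x i - G i x)"
      by (rule weak_partial_diff[OF wsph_measurable mw dwsph_measurable Gm[OF i] annulus_sets iws iw(2)
          dwsph_power_integrable(2)[OF n i] _ weak_partial_wsph[OF dim(2) i] Gw[OF i]]) (unfold ind, rule Gint[OF i])
    then show ?thesis by (simp add: w_def)
  qed
  have "\<exists>m. \<forall>i\<in>Basis. (LBINT x. indicator annulus x * norm (dwsph x i - dtwsph m x i) ^ n) < \<eta>"
  proof -
    have "eventually (\<lambda>m. \<forall>i\<in>Basis. (LBINT x. indicator annulus x * norm (dwsph x i - dtwsph m x i) ^ n) < \<eta>) sequentially"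
      by (subst eventually_ball_finite_distrib) (use order_tendstoD(2)[OF truncation_power_limit(2)[OF n] \<eta>(1)] in auto)
    then show ?thesis by (auto simp: eventually_sequentially)
  qed
  then obtain m where m: "\<And>i. i \<in> Basis \<Longrightarrow> (LBINT x. indicator annulus x * norm (dwsph x i - dtwsph m x i) ^ n) < \<eta>" by blast
  define K where "K = v ` sphere 0 1"
  have K: "compact K" unfolding K_def by (intro compact_continuous_image cv compact_sphere)
  have vrK: "vr x \<in> K" if "x \<noteq> 0" for x using that by (auto simp: vr_def radial_ext_def K_def)
  \<comment> \<open>If \<open>v\<close> omits \<open>p\<close>, its compact image has a
    neighbourhood of positive width off the ray, so sufficiently close maps stay off the
    ray.\<close>
  have "\<exists>\<delta>>0. (p \<notin> K \<longrightarrow> (\<forall>x\<in>K. \<forall>y. dist x y < \<delta> \<longrightarrow> y \<in> offray p))"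
  proof (cases "p \<in> K")
    case False
    then have sub: "K \<subseteq> offray p" using v(2) Y_offray_iff unfolding K_def by blast
    then obtain \<delta> where "\<delta> > 0" "(\<Union>x\<in>K. ball x \<delta>) \<subseteq> offray p"
      using compact_subset_open_imp_ball_epsilon_subset[OF K open_offray] by blast
    then show ?thesis by (intro exI[of _ \<delta>]) (auto simp: subset_iff)
  qed (auto intro: exI[of _ 1])
  then obtain \<delta> where \<delta>: "\<delta> > 0" "p \<notin> K \<Longrightarrow> x \<in> K \<Longrightarrow> dist x y < \<delta> \<Longrightarrow> y \<in> offray p" for x y by blast
  \<comment> \<open>\<open>\<eta> / 10\<close> keeps the norm of the mollified map in the range of
    \<open>dform_bound\<close>; \<open>\<delta> / 2\<close> keeps the map off the ray.\<close>
  define e1 where "e1 = min (\<eta> / 10) (\<delta> / 2)"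
  have e1: "e1 > 0" "e1 \<le> \<eta> / 10" "e1 < \<delta>" using \<eta> \<delta>(1) by (auto simp: e1_def)
  define S2 where "S2 = {y::'a. 55 / 100 \<le> norm y \<and> norm y \<le> 145 / 100}"
  have cS2: "compact S2"
  proof -
    have "closed S2" unfolding S2_def by (intro closed_Collect_conj closed_Collect_le continuous_intros)
    moreover have "bounded S2" by (rule boundedI[of _ "145/100"]) (auto simp: S2_def)
    ultimately show ?thesis by (simp add: compact_eq_bounded_closed)
  qed
  have S2nz: "S2 \<subseteq> - {0}" by (auto simp: S2_def)
  have uc: "\<exists>d>0. \<forall>x\<in>S2. \<forall>y\<in>S2. dist y x < d \<longrightarrow> norm (f y - f x) < e"
    if "continuous_on (- {0}) f" "e > 0" for f :: "'a \<Rightarrow> 'a" and e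
    using compact_uniformly_continuous[OF continuous_on_subset[OF that(1) S2nz] cS2] that(2)
    unfolding uniformly_continuous_on_def dist_norm by blast
  obtain d0 where d0: "d0 > 0" "\<And>x y. x \<in> S2 \<Longrightarrow> y \<in> S2 \<Longrightarrow> dist y x < d0 \<Longrightarrow> norm (vr y - vr x) < e1"
    using uc[OF vr_cont e1(1)] by blast
  have "\<exists>d>0. \<forall>x\<in>S2. \<forall>y\<in>S2. dist y x < d \<longrightarrow> norm (dtwsph m y i - dtwsph m x i) < \<eta>" for i
    using uc[OF continuous_on_dtwsph \<eta>(1)] by blast
  then obtain d where d: "\<And>i. d i > 0" "\<And>i x y. x \<in> S2 \<Longrightarrow> y \<in> S2 \<Longrightarrow> dist y x < d i \<Longrightarrow> norm (dtwsph m y i - dtwsph m x i) < \<eta>"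
    by metis
  \<comment> \<open>Small enough for balls around the shell to lie in the annulus, and for
    \<open>vr\<close> and the truncated derivatives to vary little on such balls.\<close>
  define \<epsilon> where "\<epsilon> = min (1 / 20) (min d0 (Min (d ` Basis)))"
  have \<epsilon>: "\<epsilon> > 0" "\<epsilon> \<le> 1 / 20" "\<epsilon> \<le> d0" "\<And>i. i \<in> Basis \<Longrightarrow> \<epsilon> \<le> d i"
    using d0(1) d(1) by (auto simp: \<epsilon>_def min_le_iff_disj)
  obtain \<rho> :: "'a \<Rightarrow> real" where \<rho>: "smooth_open UNIV \<rho>" "\<And>x. \<rho> x \<ge> 0" "\<And>x. norm x \<ge> \<epsilon> \<Longrightarrow> \<rho> x = 0"
      "integrable lborel \<rho>" "integral\<^sup>L lborel \<rho> = 1"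
    using mollifier_exists[OF \<epsilon>(1)] by blast
  have t: "test_fun UNIV \<rho>"
  proof -
    \<comment> \<open>Reflecting the reflected kernel about the origin returns \<open>\<rho>\<close>
      itself.\<close>
    have "test_fun UNIV (\<lambda>y. (\<lambda>z. \<rho> (- z)) (0 - y))"
      by (rule test_fun_reflect_translate(1)[where \<epsilon>=\<epsilon>])
         (use \<rho>(3) in \<open>auto intro!: smooth_open_compose[OF \<rho>(1)] smooth_open_minus smooth_open_id\<close>)
    then show ?thesis by simp
  qed
  have c\<rho>: "continuous_on UNIV \<rho>" by (rule smooth_open_continuous[OF \<rho>(1)])
  obtain B where B: "\<And>z. \<bar>\<rho> z\<bar> \<le> B" using test_fun_bounds[OF t] by metis
  have mr: "\<rho> \<in> borel_measurable borel" by (rule test_fun_measurable(1)[OF t])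
  have refl: "integrable lborel (\<lambda>y. \<rho> (x - y)) \<and> (LBINT y. \<rho> (x - y)) = 1" for x
  proof -
    have "distr lborel borel (\<lambda>y. x - y) = lborel"
      using lborel_affine[of "-1" x] by (simp add: density_1)
    then have "integrable (distr lborel borel (\<lambda>y. x - y)) \<rho>" "integral\<^sup>L (distr lborel borel (\<lambda>y. x - y)) \<rho> = 1"
      using \<rho> by simp_all
    then show ?thesis using mr by (simp add: integrable_distr_eq integral_distr)
  qed
  define V where "V = convol \<rho> (\<lambda>y. indicator annulus y *\<^sub>R vr y)"
  define V' where "V' = (\<lambda>x h. convol (\<lambda>z. frechet_derivative \<rho> (at z) h) (\<lambda>y. indicator annulus y *\<^sub>R vr y) x)"
  have Vd: "(V has_derivative V' x) (at x)" for x
    unfolding V_def V'_def by (rule convol_has_derivative[OF t ivr])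
  have Vc: "continuous_on UNIV (\<lambda>x. V' x h)" for h
  proof -
    obtain B' where B': "\<And>x v. norm (frechet_derivative \<rho> (at x) v) \<le> B' * norm v" using test_fun_bounds[OF t] by metis
    have "continuous_on UNIV (convol (\<lambda>z. frechet_derivative \<rho> (at z) h) (\<lambda>y. indicator annulus y *\<^sub>R vr y))"
      by (rule continuous_on_convol[OF test_funD(2)[OF t] _ ivr, of h "B' * norm h"]) (use B'[of _ h] in simp)
    then show ?thesis by (simp add: V'_def)
  qed
  have S2x: "x \<in> S2" "y \<in> S2" "y \<in> annulus" if "x \<in> shell" "norm (x - y) < \<epsilon>" for x y
    using cball_shell_annulus[OF that(1) \<epsilon>(2), of x] cball_shell_annulus[OF that(1) \<epsilon>(2), of y] that(2) \<epsilon>(1) by (auto simp: S2_def)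
  have near: "norm (V x - a) \<le> c" if "x \<in> shell" "\<And>y. y \<in> annulus \<Longrightarrow> y \<in> S2 \<Longrightarrow> norm (x - y) < \<epsilon> \<Longrightarrow> norm (vr y - a) \<le> c" for x a c
    unfolding V_def
    by (rule convol_near[where \<epsilon>=\<epsilon>, OF c\<rho> \<rho>(2) B _ _ \<rho>(3) ivr]) (use refl[of x] that S2x[OF that(1)] in auto)
  have Vnear: "norm (V x - vr x) \<le> e1" if "x \<in> shell" for x
  proof (rule near[OF that])
    fix y assume y: "y \<in> annulus" "y \<in> S2" "norm (x - y) < \<epsilon>"
    have "x \<in> S2" using S2x(1)[OF that, of x] \<epsilon>(1) by simp
    then show "norm (vr y - vr x) \<le> e1"
      using d0(2)[of x y] y \<epsilon>(3) by (simp add: dist_norm norm_minus_commute)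
  qed
  have shell_nz: "x \<noteq> 0" if "x \<in> shell" for x :: 'a using shell_norm[OF that] by auto
  \<comment> \<open>If \<open>v\<close> omits \<open>p\<close>, the mollified map avoids the ray on
    the shell and the Jacobian identity applies. Otherwise \<open>v\<close> is constantly
    \<open>p\<close>, so is its mollification on the shell, and the form vanishes on the
    ray.\<close>
  have dform_zero: "(LBINT x. dform (V x) (V' x) (radial_covector x)) = 0 \<and> integrable lborel (\<lambda>x. dform (V x) (V' x) (radial_covector x))"
  proof (cases "p \<in> K")
    case False
    have "V x \<in> offray p" if "x \<in> shell" for x
      using \<delta>(2)[OF False vrK[OF shell_nz[OF that]], of "V x"] Vnear[OF that] e1 by (simp add: dist_norm norm_minus_commute)
    then have "\<And>x. 6 / 10 \<le> x \<bullet> x \<Longrightarrow> x \<bullet> x \<le> 14 / 10 \<Longrightarrow> V x \<in> offray p" by (simp add: shell_def)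
    then show ?thesis using integral_dform_C1_zero[OF dim(1) Vd Vc] by blast
  next
    case True
    then obtain a where a: "a \<in> sphere 0 1" "v a = p" unfolding K_def by auto
    have vp: "v x = p" if "x \<in> sphere 0 1" for x
      using lipschitz_sphere_map_off_p[OF v dim(1) that _ a(1)] a(2) by blast
    have "V x = p" if "x \<in> shell" for x
    proof -
      have "norm (V x - p) \<le> 0"
      proof (rule near[OF that])
        fix y :: 'a assume "y \<in> annulus"
        then have "norm y \<noteq> 0" by (auto simp: annulus_def)
        then have "vr y = p" using vp[of "y /\<^sub>R norm y"] by (simp add: vr_def radial_ext_def)
        then show "norm (vr y - p) \<le> 0" by simp
      qed
      then show ?thesis by simp
    qed
    then have 1: "dform (V x) (V' x) (radial_covector x) = 0" if "x \<in> shell" for x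
      using that by (simp add: dform_def offray_def)
    have "dform (V x) (V' x) (radial_covector x) = 0" if "x \<notin> shell" for x
    proof -
      have "tent (10 * (x \<bullet> x - 1)) = 0" using that by (intro tent_eq_0) (auto simp: shell_def)
      then have "rowdet (drows (V x) (V' x) (radial_covector x)) = 0"
        by (intro rowdet_zero_row[OF p]) (simp add: drows_def radial_covector_def)
      then show ?thesis by (simp add: dform_def)
    qed
    with 1 have "(\<lambda>x. dform (V x) (V' x) (radial_covector x)) = (\<lambda>x. 0)" by blast
    then show ?thesis by simp
  qed
  have ishell: "indicator shell x * c \<le> (indicator annulus x * c :: real)" "0 \<le> indicator shell x * c" if "c \<ge> 0" for x :: 'a and c
    using that shell_subset_annulus[of x] by (auto simp: indicator_def)
  have iw': "integrable lborel (\<lambda>x. indicator shell x * norm (w x) ^ n)"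
    by (rule Bochner_Integration.integrable_bound[OF iw(1)], measurable) (use ishell in auto)
  have "(LBINT x. indicator shell x * norm (w x) ^ n) \<le> (LBINT x. indicator annulus x * norm (w x) ^ n)"
    by (rule integral_mono[OF iw' iw(1)]) (use ishell in auto)
  then have ws': "(LBINT x. indicator shell x * norm (w x) ^ n) \<le> \<eta>" using ws \<eta>n by linarith
  have deriv: "integrable lborel (\<lambda>x. indicator shell x * norm (V' x i - dwsph x i) ^ n) \<and>
     (LBINT x. indicator shell x * norm (V' x i - dwsph x i) ^ n) \<le> 4 ^ n * (3 + measure lborel (annulus::'a set)) * \<eta>"
    if i: "i \<in> Basis" for i
  proof -
    note [measurable] = Gm[OF i]
    \<comment> \<open>The derivative of the mollified map is the mollification of
      \<open>f1 + f2 - G i\<close>. Here \<open>f1\<close> and \<open>G i\<close> are small in the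
      n-th mean, which mollification does not increase, and the continuous \<open>f2\<close> is
      nearly reproduced pointwise.\<close>
    define f1 where "f1 = (\<lambda>y. indicator annulus y *\<^sub>R (dwsph y i - dtwsph m y i))"
    define f2 where "f2 = (\<lambda>y. indicator annulus y *\<^sub>R dtwsph m y i)"
    have [measurable]: "f1 \<in> borel_measurable borel" "f2 \<in> borel_measurable borel" unfolding f1_def f2_def by measurable
    have nf1: "norm (f1 x) ^ n = indicator annulus x * norm (dwsph x i - dtwsph m x i) ^ n" for x
      using n1 by (cases "x \<in> annulus") (auto simp: f1_def)
    have if1n: "integrable lborel (\<lambda>x. norm (f1 x) ^ n)" unfolding nf1 by (rule truncation_power_limit(1)[OF n i])
    have if1: "integrable lborel f1"
      by (rule integrable_of_power_integrable[OF _ annulus_sets fin _ if1n n1]) (auto simp: f1_def)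
    have if2: "integrable lborel f2"
      by (rule Bochner_Integration.integrable_bound[OF bound_power_integrable(2)[OF n]], measurable)
         (use norm_dtwsph_le[OF annulus_norm, of _ m i] i in \<open>auto simp: f2_def indicator_def intro: order_trans[OF _ abs_ge_self]\<close>)
    have V'eq: "V' x i = convol \<rho> f1 x + convol \<rho> f2 x - convol \<rho> (G i) x" if x: "x \<in> shell" for x
    proof -
      have cb: "cball x \<epsilon> \<subseteq> annulus" using cball_shell_annulus(1)[OF x \<epsilon>(2)] by (auto simp: dist_norm)
      have "V' x i = convol \<rho> (\<lambda>y. indicator annulus y *\<^sub>R (dwsph y i - G i y)) x"
        unfolding V'_def by (rule convol_weak_partial[where \<epsilon>=\<epsilon>, OF \<rho>(1,3) cb _ _ vrw[OF i]]) measurable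
      also have "(\<lambda>y. indicator annulus y *\<^sub>R (dwsph y i - G i y)) = (\<lambda>y. f1 y + f2 y - G i y)"
        using Gz by (auto simp: fun_eq_iff f1_def f2_def indicator_def)
      also have "convol \<rho> (\<lambda>y. f1 y + f2 y - G i y) x = convol \<rho> f1 x + convol \<rho> f2 x - convol \<rho> (G i) x"
        unfolding convol_def
        using integrable_convol[OF c\<rho> B if1] integrable_convol[OF c\<rho> B if2] integrable_convol[OF c\<rho> B Gint[OF i]]
        by (simp add: scaleR_add_right scaleR_diff_right)
      finally show ?thesis .
    qed
    have near2: "norm (convol \<rho> f2 x - dtwsph m x i) \<le> \<eta>" if x: "x \<in> shell" for x
    proof (rule convol_near[where \<epsilon>=\<epsilon>, OF c\<rho> \<rho>(2) B _ _ \<rho>(3) if2])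
      fix y assume y: "norm (x - y) < \<epsilon>"
      have "x \<in> S2" "y \<in> S2" "y \<in> annulus" using S2x[OF x y] by auto
      then have "norm (dtwsph m y i - dtwsph m x i) < \<eta>"
        using d(2)[of x y i] y \<epsilon>(4)[OF i] by (simp add: dist_norm norm_minus_commute)
      then show "norm (f2 y - dtwsph m x i) \<le> \<eta>" using \<open>y \<in> annulus\<close> by (simp add: f2_def)
    qed (use refl in auto)
    note y1 = convol_power_integral_le[OF c\<rho> \<rho>(2) B \<rho>(4,5) if1 if1n n1]
    note y2 = convol_power_integral_le[OF c\<rho> \<rho>(2) B \<rho>(4,5) Gint[OF i] Gi[OF i] n1]
    \<comment> \<open>Four error terms: mollified \<open>f1\<close>, the pointwise error at most
      \<open>\<eta>\<close>, \<open>f1\<close> itself from replacing the truncation by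
      \<open>dwsph\<close>, and mollified \<open>G i\<close>. Three integrals at most
      \<open>\<eta>\<close> and one constant on the annulus give the factor
      \<open>3 + measure lborel annulus\<close>.\<close>
    let ?R = "\<lambda>x. 4 ^ n * (norm (convol \<rho> f1 x) ^ n + \<eta> * indicator annulus x + norm (f1 x) ^ n + norm (convol \<rho> (G i) x) ^ n)"
    have iR: "integrable lborel ?R"
      by (intro integrable_mult_right Bochner_Integration.integrable_add y1(1) y2(1) if1n integrable_real_indicator fin) auto
    have pt: "indicator shell x * norm (V' x i - dwsph x i) ^ n \<le> ?R x" for x
    proof (cases "x \<in> shell")
      case True
      have xa: "x \<in> annulus" by (rule shell_subset_annulus[OF True])
      have "V' x i - dwsph x i = convol \<rho> f1 x + (convol \<rho> f2 x - dtwsph m x i) - f1 x - convol \<rho> (G i) x"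
        unfolding V'eq[OF True] using xa by (simp add: f1_def)
      then have "norm (V' x i - dwsph x i) \<le> norm (convol \<rho> f1 x) + norm (convol \<rho> f2 x - dtwsph m x i) + norm (f1 x) + norm (convol \<rho> (G i) x)"
        using norm_triangle_ineq4[of "convol \<rho> f1 x + (convol \<rho> f2 x - dtwsph m x i) - f1 x" "convol \<rho> (G i) x"]
          norm_triangle_ineq4[of "convol \<rho> f1 x + (convol \<rho> f2 x - dtwsph m x i)" "f1 x"]
          norm_triangle_ineq[of "convol \<rho> f1 x" "convol \<rho> f2 x - dtwsph m x i"] by simp
      also have "\<dots> \<le> norm (convol \<rho> f1 x) + \<eta> + norm (f1 x) + norm (convol \<rho> (G i) x)" using near2[OF True] by simp
      finally have "norm (V' x i - dwsph x i) ^ n \<le> (norm (convol \<rho> f1 x) + \<eta> + norm (f1 x) + norm (convol \<rho> (G i) x)) ^ n" by (intro power_mono) auto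
      also have "\<dots> \<le> 4 ^ n * (norm (convol \<rho> f1 x) ^ n + \<eta> ^ n + norm (f1 x) ^ n + norm (convol \<rho> (G i) x) ^ n)"
        by (rule power_add4_le) (use \<eta> in auto)
      also have "\<dots> \<le> ?R x" using xa \<eta>n by (intro mult_left_mono) auto
      finally show ?thesis using True by simp
    next
      case False
      then show ?thesis using \<eta> by (simp add: add_nonneg_nonneg)
    qed
    have mV: "(\<lambda>x. V' x i) \<in> borel_measurable borel" by (rule borel_measurable_continuous_onI[OF Vc])
    have mL: "(\<lambda>x. indicator shell x * norm (V' x i - dwsph x i) ^ n) \<in> borel_measurable lborel"
      using mV by measurable
    have iL: "integrable lborel (\<lambda>x. indicator shell x * norm (V' x i - dwsph x i) ^ n)"
      by (rule Bochner_Integration.integrable_bound[OF iR mL]) (use pt in \<open>auto intro!: order_trans[OF pt abs_ge_self]\<close>)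
    have "(LBINT x. indicator shell x * norm (V' x i - dwsph x i) ^ n) \<le> integral\<^sup>L lborel ?R"
      by (rule integral_mono[OF iL iR pt])
    also have "integral\<^sup>L lborel ?R = 4 ^ n * ((LBINT x. norm (convol \<rho> f1 x) ^ n) + \<eta> * measure lborel (annulus::'a set)
        + (LBINT x. norm (f1 x) ^ n) + (LBINT x. norm (convol \<rho> (G i) x) ^ n))"
    proof -
      have ia: "integrable lborel (\<lambda>x. \<eta> * indicator (annulus::'a set) x :: real)"
        by (intro integrable_mult_right integrable_real_indicator fin) simp
      show ?thesis using y1(1) y2(1) if1n ia by simp
    qed
    also have "\<dots> \<le> 4 ^ n * (\<eta> + \<eta> * measure lborel (annulus::'a set) + \<eta> + \<eta>)"
    proof (intro mult_left_mono add_mono order_refl)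
      have f1s: "(LBINT x. norm (f1 x) ^ n) \<le> \<eta>" using m[OF i] unfolding nf1 by simp
      then show "(LBINT x. norm (f1 x) ^ n) \<le> \<eta>" .
      show "(LBINT x. norm (convol \<rho> f1 x) ^ n) \<le> \<eta>" using y1(2) f1s by linarith
      show "(LBINT x. norm (convol \<rho> (G i) x) ^ n) \<le> \<eta>" using y2(2) Gs[OF i] \<eta>n by linarith
    qed (use \<eta> in auto)
    also have "\<dots> = 4 ^ n * (3 + measure lborel (annulus::'a set)) * \<eta>" by (simp add: algebra_simps)
    finally show ?thesis using iL by blast
  qed
  show thesis
  proof (rule that[OF Vd Vc])
    show "norm (V x - radial_ext v x) \<le> \<eta> / 10" if "x \<in> shell" for x
      using Vnear[OF that] e1 by (simp add: vr_def)
    show "integrable lborel (\<lambda>x. indicator shell x * norm (wsph p x - radial_ext v x) ^ n)"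
      using iw' by (simp add: w_def vr_def)
    show "(LBINT x. indicator shell x * norm (wsph p x - radial_ext v x) ^ n) \<le> \<eta>"
      using ws' by (simp add: w_def vr_def)
  qed (use deriv dform_zero in auto)
qed

end

section \<open>Failure of density\<close>

lemma sum_power_le:
  fixes f :: "'i \<Rightarrow> real"
  assumes "finite I" "\<And>i. i \<in> I \<Longrightarrow> f i \<ge> 0" "n \<ge> 1"
  shows "(\<Sum>i\<in>I. f i) ^ n \<le> real (card I) ^ n * (\<Sum>i\<in>I. f i ^ n)"
proof (cases "I = {}")
  case False
  define m where "m = Max (f ` I)"
  have m: "f i \<le> m" if "i \<in> I" for i unfolding m_def using assms(1) that by simp
  have "m \<in> f ` I" unfolding m_def by (rule Max_in) (use assms(1) False in auto)
  then obtain k where k: "k \<in> I" "m = f k" by blast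
  have "(\<Sum>i\<in>I. f i) \<le> real (card I) * m" by (rule sum_bounded_above) (use m in simp)
  then have "(\<Sum>i\<in>I. f i) ^ n \<le> (real (card I) * m) ^ n" by (intro power_mono sum_nonneg assms(2))
  also have "\<dots> = real (card I) ^ n * f k ^ n" by (simp add: power_mult_distrib k)
  also have "f k ^ n \<le> (\<Sum>i\<in>I. f i ^ n)"
    by (rule member_le_sum[OF k(1)]) (use assms in auto)
  finally show ?thesis by (simp add: mult_left_mono)
qed (use assms in \<open>auto simp: power_0_left\<close>)

lemma clip_distance_le:
  fixes b j q :: real
  assumes "0 \<le> b" "0 \<le> q" "\<bar>j\<bar> \<le> b + q"
  shows "\<bar>max (- b) (min b j) - j\<bar> \<le> q"
  using assms by (cases "j > b"; cases "j < - b") (auto simp: max_def min_def)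

context pole begin

text \<open>If Lipschitz maps converged to \<open>wsph p\<close>, the Jacobian integrals of their mollifications, which
  vanish, would converge to the one of \<open>wsph p\<close>, which does not. The integrands are clipped at an
  integrable bound so that dominated convergence applies along an a.e. convergent subsequence.\<close>

lemma lipschitz_not_dense:
  assumes dim: "DIM('a) \<ge> 3"
  shows "\<exists>\<epsilon>>0. \<forall>v. (\<exists>L. L-lipschitz_on (sphere 0 1) v) \<and> v ` sphere 0 1 \<subseteq> Y \<longrightarrow> \<not> W1n_sphere_dist (wsph p) v < \<epsilon>"
proof (rule ccontr)
  assume "\<not> ?thesis"
  then have ex: "\<exists>v. (\<exists>L. L-lipschitz_on (sphere 0 1) v) \<and> v ` sphere 0 1 \<subseteq> Y \<and> W1n_sphere_dist (wsph p) v < \<epsilon>" if "\<epsilon> > 0" for \<epsilon>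
    using that by blast
  define n where "n = DIM('a) - 1"
  have n: "n = DIM('a) - 1" "n \<ge> 2" "n \<ge> 1" using dim by (auto simp: n_def)
  define c where "c = 4 ^ n * (3 + measure lborel (annulus::'a set))"
  define e where "e = (\<lambda>k::nat. 1 / real (Suc k))"
  have e: "0 < e k" "e k \<le> 1" for k by (auto simp: e_def)
  \<comment> \<open>Everything known about the k-th approximation in a single predicate, so that
    map, mollification and derivative can be chosen simultaneously for all \<open>k\<close>.\<close>
  define P where "P = (\<lambda>k v V V'. v ` sphere 0 1 \<subseteq> Y \<and>
      (\<forall>x. (V has_derivative V' x) (at x)) \<and> (\<forall>h. continuous_on UNIV (\<lambda>x. V' x h)) \<and>
      (\<forall>x\<in>shell. norm (V x - radial_ext v x) \<le> e k / 10) \<and>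
      (\<forall>i\<in>Basis. integrable lborel (\<lambda>x. indicator shell x * norm (V' x i - dwsph x i) ^ n)) \<and>
      (\<forall>i\<in>Basis. (LBINT x. indicator shell x * norm (V' x i - dwsph x i) ^ n) \<le> c * e k) \<and>
      integrable lborel (\<lambda>x. indicator shell x * norm (wsph p x - radial_ext v x) ^ n) \<and>
      (LBINT x. indicator shell x * norm (wsph p x - radial_ext v x) ^ n) \<le> e k \<and>
      (LBINT x. dform (V x) (V' x) (radial_covector x)) = 0 \<and>
      integrable lborel (\<lambda>x. dform (V x) (V' x) (radial_covector x)))"
  have "\<exists>v V V'. P k v V V'" for k
  proof -
    obtain v L where v: "L-lipschitz_on (sphere 0 1) v" "v ` sphere 0 1 \<subseteq> Y" "W1n_sphere_dist (wsph p) v < e k"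
      using ex[OF e(1)[of k]] by blast
    show ?thesis
    proof (rule smooth_approximation[OF n(1,2) v(1,2) e(1)[of k] e(2)[of k] v(3)], goal_cases)
      case (1 V V')
      have "P k v V V'"
        unfolding P_def by (intro conjI allI ballI; (rule v(2) | (rule 1[folded c_def]; assumption)))
      then show ?case by blast
    qed
  qed
  then obtain v V V' where P: "\<And>k. P k (v k) (V k) (V' k)" by metis
  note P' = P[unfolded P_def]
  have vY: "\<And>k. v k ` sphere 0 1 \<subseteq> Y"
    and Vn: "\<And>k x. x \<in> shell \<Longrightarrow> norm (V k x - radial_ext (v k) x) \<le> e k / 10"
    and Di: "\<And>k i. i \<in> Basis \<Longrightarrow> integrable lborel (\<lambda>x. indicator shell x * norm (V' k x i - dwsph x i) ^ n)"
    and Ds: "\<And>k i. i \<in> Basis \<Longrightarrow> (LBINT x. indicator shell x * norm (V' k x i - dwsph x i) ^ n) \<le> c * e k"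
    and wi: "\<And>k. integrable lborel (\<lambda>x. indicator shell x * norm (wsph p x - radial_ext (v k) x) ^ n)"
    and ws: "\<And>k. (LBINT x. indicator shell x * norm (wsph p x - radial_ext (v k) x) ^ n) \<le> e k"
    and J0: "\<And>k. (LBINT x. dform (V k x) (V' k x) (radial_covector x)) = 0"
    and Ji: "\<And>k. integrable lborel (\<lambda>x. dform (V k x) (V' k x) (radial_covector x))"
    using P' by blast+
  define S where "S = (\<lambda>k x. \<Sum>i\<in>Basis. indicator shell x * norm (V' k x i - dwsph x i) ^ n)"
  \<comment> \<open>One error function for values and derivatives. Its integral tends to 0, so it
    tends to 0 almost everywhere along a subsequence; it also measures how far \<open>Jk\<close> may
    exceed a fixed integrable bound.\<close>
  define f where "f = (\<lambda>k x. indicator shell x * norm (wsph p x - radial_ext (v k) x) ^ n + S k x)"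
  have S0: "S k x \<ge> 0" for k x unfolding S_def by (intro sum_nonneg) simp
  have f0: "f k x \<ge> 0" for k x using S0 by (simp add: f_def)
  have iS: "integrable lborel (S k)" for k unfolding S_def by (intro Bochner_Integration.integrable_sum Di)
  have fi: "integrable lborel (f k)" for k unfolding f_def by (intro Bochner_Integration.integrable_add wi iS)
  have fs: "integral\<^sup>L lborel (f k) \<le> (1 + real DIM('a) * c) * e k" for k
  proof -
    have "integral\<^sup>L lborel (f k) = (LBINT x. indicator shell x * norm (wsph p x - radial_ext (v k) x) ^ n) + integral\<^sup>L lborel (S k)"
      unfolding f_def by (rule Bochner_Integration.integral_add[OF wi iS])
    also have "integral\<^sup>L lborel (S k) = (\<Sum>i\<in>Basis. (LBINT x. indicator shell x * norm (V' k x i - dwsph x i) ^ n))"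
      unfolding S_def by (rule Bochner_Integration.integral_sum[OF Di])
    also have "\<dots> \<le> (\<Sum>i\<in>(Basis::'a set). c * e k)" by (intro sum_mono Ds)
    finally show ?thesis using ws[of k] by (simp add: algebra_simps)
  qed
  have elim: "e \<longlonglongrightarrow> 0" unfolding e_def using LIMSEQ_inverse_real_of_nat by (simp add: inverse_eq_divide)
  have flim: "(\<lambda>k. integral\<^sup>L lborel (f k)) \<longlonglongrightarrow> 0"
  proof (rule tendsto_sandwich[of "\<lambda>_. 0" _ sequentially "\<lambda>k. (1 + real DIM('a) * c) * e k"])
    show "(\<lambda>k. (1 + real DIM('a) * c) * e k) \<longlonglongrightarrow> 0" by (rule tendsto_mult_right_zero[OF elim])
    show "eventually (\<lambda>k. 0 \<le> integral\<^sup>L lborel (f k)) sequentially"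
      using f0 by (intro always_eventually allI Bochner_Integration.integral_nonneg) auto
  qed (use fs in auto)
  have "(\<lambda>k. (LBINT x. norm (f k x))) \<longlonglongrightarrow> 0" using flim f0 by simp
  then obtain r where r: "strict_mono r" "AE x in lborel. (\<lambda>k. f (r k) x) \<longlonglongrightarrow> 0"
    using tendsto_L1_AE_subseq[of lborel f] fi by blast
  have erlim: "(\<lambda>k. e (r k)) \<longlonglongrightarrow> 0" using LIMSEQ_subseq_LIMSEQ[OF elim r(1)] by (simp add: o_def)
  define J where "J = (\<lambda>x. dform (wsph p x) (dwsph x) (radial_covector x))"
  define Jk where "Jk = (\<lambda>k x. dform (V k x) (V' k x) (radial_covector x))"
  have outside: "dform y a (radial_covector x) = 0" if "x \<notin> shell" for x y a
  proof -
    have "tent (10 * (x \<bullet> x - 1)) = 0" using that by (intro tent_eq_0) (auto simp: shell_def)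
    then have "rowdet (drows y a (radial_covector x)) = 0"
      by (intro rowdet_zero_row[OF p]) (simp add: drows_def radial_covector_def)
    then show ?thesis by (simp add: dform_def)
  qed
  have snz: "x \<noteq> 0" if "x \<in> shell" for x :: 'a using shell_norm[OF that] by auto
  have Vb: "1 / 10 \<le> norm (V k x) \<and> norm (V k x) \<le> 3" if "x \<in> shell" for k x
  proof -
    have "radial_ext (v k) x \<in> Y" using vY[of k] snz[OF that] by (auto simp: radial_ext_def)
    then have "1 / 4 \<le> norm (radial_ext (v k) x) \<and> norm (radial_ext (v k) x) \<le> 2" by (rule norm_Y)
    moreover have "norm (V k x - radial_ext (v k) x) \<le> 1 / 10" using Vn[OF that, of k] e(2)[of k] by linarith
    ultimately show ?thesis
      using norm_triangle_ineq3[of "V k x" "radial_ext (v k) x"] by linarith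
  qed
  have wb: "1 / 10 \<le> norm (wsph p x) \<and> norm (wsph p x) \<le> 3" if "x \<in> shell" for x
    using norm_wsph_bounds[OF snz[OF that]] by linarith
  obtain C where C: "C \<ge> 0" "\<And>y a b M \<beta>. 1 / 10 \<le> norm y \<Longrightarrow> norm y \<le> 3 \<Longrightarrow> (\<And>j. j \<in> Basis \<Longrightarrow> norm (a j) \<le> M) \<Longrightarrow>
     (\<And>j. j \<in> Basis \<Longrightarrow> \<bar>b j\<bar> \<le> \<beta>) \<Longrightarrow> \<bar>dform y a b\<bar> \<le> C * \<beta> * M ^ (DIM('a) - 1)"
    using dform_bound by blast
  have rc: "\<bar>radial_covector x j\<bar> \<le> 40" if "x \<in> shell" "j \<in> Basis" for x j
  proof -
    have "\<bar>x \<bullet> j\<bar> \<le> 2" using Basis_le_norm[OF that(2), of x] shell_norm[OF that(1)] by linarith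
    then have "\<bar>tent (10 * (x \<bullet> x - 1))\<bar> * (20 * \<bar>x \<bullet> j\<bar>) \<le> 1 * (20 * 2)"
      using tent_bounds[of "10 * (x \<bullet> x - 1)"] by (intro mult_mono) auto
    then show ?thesis by (simp add: radial_covector_def abs_mult)
  qed
  define D where "D = (\<lambda>x. \<Sum>i\<in>Basis. norm (dwsph x i))"
  \<comment> \<open>The bound from \<open>dform_bound\<close> for the derivative of
    \<open>wsph p\<close> itself; 40 bounds the radial covector on the shell, and
    \<open>2 ^ n\<close> pays for splitting off the error in the derivative.\<close>
  define Bd where "Bd = (\<lambda>x. C * 40 * 2 ^ n * (indicator shell x * D x ^ n))"
  define C' where "C' = C * 40 * 2 ^ n * real DIM('a) ^ n"
  have C'0: "C' \<ge> 0" using C(1) by (simp add: C'_def)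
  have D0: "D x \<ge> 0" for x unfolding D_def by (intro sum_nonneg) simp
  have Bd0: "Bd x \<ge> 0" for x using C(1) D0[of x] by (simp add: Bd_def)
  have gen: "\<bar>dform y a (radial_covector x)\<bar> \<le> Bd x + C' * (\<Sum>i\<in>Basis. norm (a i - dwsph x i) ^ n)"
    if x: "x \<in> shell" and y: "1 / 10 \<le> norm y \<and> norm y \<le> 3" for x y a
  proof -
    define E where "E = (\<Sum>i\<in>Basis. norm (a i - dwsph x i))"
    have E0: "E \<ge> 0" unfolding E_def by (intro sum_nonneg) simp
    have aj: "norm (a j) \<le> D x + E" if j: "j \<in> Basis" for j
    proof -
      have "norm (a j) \<le> norm (dwsph x j) + norm (a j - dwsph x j)" using norm_triangle_sub[of "a j" "dwsph x j"] by simp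
      also have "\<dots> \<le> D x + E" unfolding D_def E_def
        using member_le_sum[OF j, of "\<lambda>i. norm (dwsph x i)"] member_le_sum[OF j, of "\<lambda>i. norm (a i - dwsph x i)"] by (intro add_mono) auto
      finally show ?thesis .
    qed
    have "\<bar>dform y a (radial_covector x)\<bar> \<le> C * 40 * (D x + E) ^ n"
      unfolding n(1) by (rule C(2)) (use y aj rc[OF x] in auto)
    also have "\<dots> \<le> C * 40 * (2 ^ n * (D x ^ n + E ^ n))"
      using power_add_le_two[OF D0 E0] C(1) by (intro mult_left_mono) auto
    also have "\<dots> \<le> C * 40 * (2 ^ n * (D x ^ n + real DIM('a) ^ n * (\<Sum>i\<in>Basis. norm (a i - dwsph x i) ^ n)))"
      unfolding E_def using sum_power_le[of "Basis::'a set" "\<lambda>i. norm (a i - dwsph x i)" n] n C(1)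
      by (intro mult_left_mono add_left_mono) auto
    also have "\<dots> = Bd x + C' * (\<Sum>i\<in>Basis. norm (a i - dwsph x i) ^ n)"
      using x by (simp add: Bd_def C'_def algebra_simps)
    finally show ?thesis .
  qed
  have Jk_bound: "\<bar>Jk k x\<bar> \<le> Bd x + C' * f k x" for k x
  proof (cases "x \<in> shell")
    case True
    have "(\<Sum>i\<in>Basis. norm (V' k x i - dwsph x i) ^ n) = S k x" using True by (simp add: S_def)
    also have "\<dots> \<le> f k x" by (simp add: f_def)
    finally have "C' * (\<Sum>i\<in>Basis. norm (V' k x i - dwsph x i) ^ n) \<le> C' * f k x" using C'0 by (rule mult_left_mono)
    then show ?thesis using gen[OF True Vb[OF True, of k], of "V' k x"] unfolding Jk_def by linarith
  next
    case False
    have "C' * f k x \<ge> 0" using C'0 f0 by simp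
    then show ?thesis using outside[OF False] Bd0[of x] by (simp add: Jk_def)
  qed
  have J_bound: "\<bar>J x\<bar> \<le> Bd x" for x
  proof (cases "x \<in> shell")
    case True
    have "(\<Sum>i\<in>Basis. norm (dwsph x i - dwsph x i) ^ n) = 0" using n(3) by (simp add: power_0_left)
    then show ?thesis using gen[OF True wb[OF True], of "dwsph x"] unfolding J_def by (simp only: mult_zero_right add_0_right)
  qed (use outside Bd0 in \<open>simp add: J_def\<close>)
  have [measurable]: "D \<in> borel_measurable borel" unfolding D_def by measurable
  have Bdm[measurable]: "Bd \<in> borel_measurable borel" unfolding Bd_def by measurable
  have iBd: "integrable lborel Bd"
  proof (rule Bochner_Integration.integrable_bound)
    show "integrable lborel (\<lambda>x. C' * (\<Sum>i\<in>Basis. indicator annulus x * norm (dwsph x i) ^ n))"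
      by (intro integrable_mult_right Bochner_Integration.integrable_sum dwsph_power_integrable(1)[OF n(1,2)])
    show "AE x in lborel. norm (Bd x) \<le> norm (C' * (\<Sum>i\<in>Basis. indicator annulus x * norm (dwsph x i) ^ n))"
    proof (rule AE_I2)
      fix x
      show "norm (Bd x) \<le> norm (C' * (\<Sum>i\<in>Basis. indicator annulus x * norm (dwsph x i) ^ n))"
      proof (cases "x \<in> shell")
        case True
        have "D x ^ n \<le> real DIM('a) ^ n * (\<Sum>i\<in>Basis. norm (dwsph x i) ^ n)"
          unfolding D_def using n by (intro sum_power_le) auto
        then have "C * 40 * 2 ^ n * D x ^ n \<le> C * 40 * 2 ^ n * (real DIM('a) ^ n * (\<Sum>i\<in>Basis. norm (dwsph x i) ^ n))"
          using C(1) by (intro mult_left_mono) auto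
        then have "Bd x \<le> C' * (\<Sum>i\<in>Basis. indicator annulus x * norm (dwsph x i) ^ n)"
          using True shell_subset_annulus[OF True] by (simp add: Bd_def C'_def mult.assoc)
        then show ?thesis using Bd0[of x] by simp
      qed (simp add: Bd_def)
    qed
  qed simp
  \<comment> \<open>The formula for the form along \<open>wsph p\<close> presents \<open>J\<close>
    as a function continuous on the open complement of the ray and 0 elsewhere.\<close>
  have Jm[measurable]: "J \<in> borel_measurable borel"
  proof -
    let ?g = "\<lambda>x. bump x * (20 * tent (10 * (x \<bullet> x - 1))) * rowdet (drows x (\<lambda>j. j) (\<lambda>j. x \<bullet> j))"
    have "continuous_on (offray p) (\<lambda>x. drows x (\<lambda>j. j) (\<lambda>j. x \<bullet> j) i j)" for i j
      unfolding drows_def by (cases "i = p") (auto intro!: continuous_intros continuous_on_dstereo)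
    then have "continuous_on (offray p) ?g"
      unfolding rowdet_def bump_def
      by (intro continuous_intros smooth_open_continuous[OF smooth_stereo])
    then have m: "(\<lambda>x. indicator (offray p) x *\<^sub>R ?g x) \<in> borel_measurable borel"
      by (intro borel_measurable_continuous_on_indicator) (simp add: open_offray)
    have "J x = indicator (offray p) x *\<^sub>R ?g x" for x
    proof (cases "x \<in> offray p")
      case False
      then have "wsph p x \<notin> offray p"
        using wsph_offray_iff[of x] by (cases "x = 0") (auto simp: wsph_def offray_def)
      then show ?thesis using False by (simp add: J_def dform_def)
    qed (simp add: J_def dform_wsph)
    then have "J = (\<lambda>x. indicator (offray p) x *\<^sub>R ?g x)" by blast
    then show ?thesis using m by simp
  qed
  have iJ: "integrable lborel J"
    by (rule Bochner_Integration.integrable_bound[OF iBd]) (use J_bound Bd0 in auto)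
  have Jk_lim: "AE x in lborel. (\<lambda>k. Jk (r k) x) \<longlonglongrightarrow> J x"
    using r(2)
  proof eventually_elim
    case (elim x)
    show ?case
    proof (cases "x \<in> shell")
      case True
      \<comment> \<open>The error controls n-th powers; the continuous n-th root turns this into
        convergence of the norms themselves.\<close>
      have pz: "(\<lambda>k. a k) \<longlonglongrightarrow> 0" if "\<And>k. 0 \<le> a k ^ n \<and> a k ^ n \<le> f (r k) x" "\<And>k. a k \<ge> 0" for a :: "nat \<Rightarrow> real"
      proof -
        have "(\<lambda>k. a k ^ n) \<longlonglongrightarrow> 0"
          by (rule tendsto_sandwich[OF _ _ tendsto_const elim]) (use that in auto)
        then have "(\<lambda>k. root n (a k ^ n)) \<longlonglongrightarrow> root n 0" by (rule tendsto_real_root)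
        then show ?thesis using that(2) n by (simp add: real_root_power_cancel)
      qed
      have "(\<lambda>k. norm (wsph p x - radial_ext (v (r k)) x)) \<longlonglongrightarrow> 0"
        by (rule pz) (use True S0 in \<open>auto simp: f_def\<close>)
      moreover have "(\<lambda>k. norm (V (r k) x - radial_ext (v (r k)) x)) \<longlonglongrightarrow> 0"
      proof (rule tendsto_sandwich[OF _ _ tendsto_const])
        show "(\<lambda>k. e (r k) / 10) \<longlonglongrightarrow> 0" using tendsto_divide[OF erlim tendsto_const, of 10] by simp
      qed (use Vn[OF True] in auto)
      ultimately have "(\<lambda>k. norm (V (r k) x - radial_ext (v (r k)) x) + norm (wsph p x - radial_ext (v (r k)) x)) \<longlonglongrightarrow> 0"
        using tendsto_add by fastforce
      then have "(\<lambda>k. V (r k) x - wsph p x) \<longlonglongrightarrow> 0"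
      proof (rule Lim_null_comparison[rotated])
        show "eventually (\<lambda>k. norm (V (r k) x - wsph p x) \<le> norm (V (r k) x - radial_ext (v (r k)) x) + norm (wsph p x - radial_ext (v (r k)) x)) sequentially"
        proof (intro always_eventually allI)
          fix k
          show "norm (V (r k) x - wsph p x) \<le> norm (V (r k) x - radial_ext (v (r k)) x) + norm (wsph p x - radial_ext (v (r k)) x)"
            using norm_triangle_ineq4[of "V (r k) x - radial_ext (v (r k)) x" "wsph p x - radial_ext (v (r k)) x"] by simp
        qed
      qed
      then have Vl: "(\<lambda>k. V (r k) x) \<longlonglongrightarrow> wsph p x" by (simp add: LIM_zero_iff)
      have Vl': "(\<lambda>k. V' (r k) x j) \<longlonglongrightarrow> dwsph x j" if j: "j \<in> Basis" for j
      proof -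
        have "norm (V' (r k) x j - dwsph x j) ^ n \<le> S (r k) x" for k
          unfolding S_def using True member_le_sum[OF j, of "\<lambda>i. norm (V' (r k) x i - dwsph x i) ^ n"] by simp
        moreover have "S (r k) x \<le> f (r k) x" for k by (simp add: f_def)
        ultimately have "norm (V' (r k) x j - dwsph x j) ^ n \<le> f (r k) x" for k using order_trans by blast
        then have "(\<lambda>k. norm (V' (r k) x j - dwsph x j)) \<longlonglongrightarrow> 0" by (intro pz) auto
        then have "(\<lambda>k. V' (r k) x j - dwsph x j) \<longlonglongrightarrow> 0" by (rule tendsto_norm_zero_cancel)
        then show ?thesis by (simp add: LIM_zero_iff)
      qed
      show ?thesis unfolding Jk_def J_def by (rule tendsto_dform[OF Vl Vl' Vb[OF True]])
    next
      case False
      then show ?thesis by (simp add: Jk_def J_def outside)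
    qed
  qed
  \<comment> \<open>The excess of \<open>Jk\<close> over \<open>Bd\<close> is small only in the mean
    and has no common majorant, so \<open>Jk\<close> is clipped at \<open>Bd\<close>. The limit
    \<open>J\<close> respects this bound, so clipping does not change the limit.\<close>
  define T where "T = (\<lambda>k x. max (- Bd x) (min (Bd x) (Jk k x)))"
  have iJk: "integrable lborel (Jk k)" for k unfolding Jk_def by (rule Ji)
  have [measurable]: "Jk k \<in> borel_measurable borel" for k using borel_measurable_integrable[OF iJk[of k]] by simp
  have Tm: "T k \<in> borel_measurable borel" for k unfolding T_def by measurable
  have T_le: "\<bar>T k x\<bar> \<le> Bd x" for k x using Bd0[of x] by (auto simp: T_def)
  have iT: "integrable lborel (T k)" for k
    by (rule Bochner_Integration.integrable_bound[OF iBd]) (use Tm T_le Bd0 in auto)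
  have T_diff: "\<bar>T k x - Jk k x\<bar> \<le> C' * f k x" for k x
    unfolding T_def by (rule clip_distance_le[OF Bd0 mult_nonneg_nonneg[OF C'0 f0] Jk_bound])
  have "(\<lambda>k. integral\<^sup>L lborel (T (r k))) \<longlonglongrightarrow> integral\<^sup>L lborel J"
  proof (rule integral_dominated_convergence[OF _ _ iBd])
    show "AE x in lborel. (\<lambda>k. T (r k) x) \<longlonglongrightarrow> J x"
      using Jk_lim
    proof eventually_elim
      case (elim x)
      have "(\<lambda>k. T (r k) x) \<longlonglongrightarrow> max (- Bd x) (min (Bd x) (J x))"
        unfolding T_def by (intro tendsto_max tendsto_min tendsto_const elim)
      moreover have "max (- Bd x) (min (Bd x) (J x)) = J x" using J_bound[of x] by (auto simp: max_def min_def)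
      ultimately show ?case by simp
    qed
    show "AE x in lborel. norm (T (r k) x) \<le> Bd x" for k using T_le by simp
  qed (use Tm in auto)
  moreover have "(\<lambda>k. integral\<^sup>L lborel (T (r k))) \<longlonglongrightarrow> 0"
  proof (rule Lim_null_comparison)
    \<comment> \<open>As \<open>Jk k\<close> has integral 0, the integral of the clipped function
      equals that of the clipping error, which is at most \<open>C' * f k\<close> pointwise.\<close>
    have "norm (integral\<^sup>L lborel (T k)) \<le> C' * integral\<^sup>L lborel (f k)" for k
    proof -
      have "integral\<^sup>L lborel (Jk k) = 0" unfolding Jk_def by (rule J0)
      then have "integral\<^sup>L lborel (T k) = (LBINT x. T k x - Jk k x)" using iT iJk by simp
      then have "norm (integral\<^sup>L lborel (T k)) \<le> (LBINT x. norm (T k x - Jk k x))"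
        by (simp only: integral_norm_bound)
      also have "\<dots> \<le> (LBINT x. C' * f k x)"
      proof (rule integral_mono)
        show "integrable lborel (\<lambda>x. norm (T k x - Jk k x))" using iT iJk by auto
        show "integrable lborel (\<lambda>x. C' * f k x)" using fi by simp
      qed (use T_diff in simp)
      finally show ?thesis by simp
    qed
    then show "eventually (\<lambda>k. norm (integral\<^sup>L lborel (T (r k))) \<le> C' * integral\<^sup>L lborel (f (r k))) sequentially" by simp
    have "(\<lambda>k. integral\<^sup>L lborel (f (r k))) \<longlonglongrightarrow> 0" using LIMSEQ_subseq_LIMSEQ[OF flim r(1)] by (simp add: o_def)
    then show "(\<lambda>k. C' * integral\<^sup>L lborel (f (r k))) \<longlonglongrightarrow> 0" by (rule tendsto_mult_right_zero)
  qed
  ultimately have "integral\<^sup>L lborel J = 0" by (rule LIMSEQ_unique)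
  then show False using integral_dform_wsph_nonzero iJ unfolding J_def by blast
qed

end

theorem theorem1p11:
  assumes "DIM('a::euclidean_space) \<ge> 3"
  shows "\<exists>(Y::'a set) p.
     compact Y \<and> p \<in> Y \<and> p \<in> sphere 0 1 \<and>
     Y homeomorphic sphere (0::'a) 1 \<and>
     (\<exists>\<Phi> \<Psi> C. homeomorphism Y (sphere 0 1) \<Phi> \<Psi> \<and> C-lipschitz_on Y \<Phi> \<and>
        \<Phi> ` (Y - {p}) = sphere 0 1 - {p} \<and>
        diffeomorphism_sets (Y - {p}) (sphere 0 1 - {p}) \<Phi>) \<and>
     (\<forall>k\<ge>1. \<forall>y0\<in>Y. lip_pi_trivial k Y y0) \<and>
     \<not> (\<forall>u\<in>W1n_sphere_into Y. \<forall>\<epsilon>>0. \<exists>v.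
           (\<exists>L. L-lipschitz_on (sphere 0 1) v) \<and> v ` sphere 0 1 \<subseteq> Y \<and>
           W1n_sphere_dist u v < \<epsilon>)"
proof -
  obtain p :: 'a where p: "p \<in> Basis" using nonempty_Basis by blast
  interpret pole p by unfold_locales (rule p)
  show ?thesis
  proof (intro exI[of _ Y] exI[of _ p] conjI allI impI ballI)
    show "compact Y" by (rule compact_Y)
    show "p \<in> Y" by (rule p_in_Y)
    show "p \<in> sphere 0 1" by simp
    show "Y homeomorphic sphere (0::'a) 1" unfolding homeomorphic_def by (intro exI) (rule homeomorphism_Y)
    show "\<exists>\<Phi> \<Psi> C. homeomorphism Y (sphere 0 1) \<Phi> \<Psi> \<and> C-lipschitz_on Y \<Phi> \<and>
        \<Phi> ` (Y - {p}) = sphere 0 1 - {p} \<and> diffeomorphism_sets (Y - {p}) (sphere 0 1 - {p}) \<Phi>"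
      using homeomorphism_Y normalize_lipschitz_Y normalize_image_Y diffeomorphism_Y by blast
    show "lip_pi_trivial k Y y0" if "k \<ge> 1" "y0 \<in> Y" for k y0 using lip_pi_trivial_Y that by blast
    show "\<not> (\<forall>u\<in>W1n_sphere_into Y. \<forall>\<epsilon>>0. \<exists>v. (\<exists>L. L-lipschitz_on (sphere 0 1) v) \<and> v ` sphere 0 1 \<subseteq> Y \<and> W1n_sphere_dist u v < \<epsilon>)"
      using lipschitz_not_dense[OF assms] wsph_in_W1n[OF assms] by blast
  qed
qed

end
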